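(* Let $0<s<1$ and let $\Omega\subset\mathbb R^n$ be a nonempty bounded open set with Lipschitz continuous boundary, $\Omega_e:=\mathbb R^n\setminus\Omega$. Let $\theta,\theta'\in\Lambda_1$ be such that $\theta-\theta'\in L^\infty(\Omega_e)$ and $\theta-\theta'\ne0$ a.e. in $\Omega_e$. Let $q\in C(\overline\Omega)$ satisfy $q\ge q_0>0$ in $\Omega$ for some constant $q_0$, let $f\in L^2(\Omega_e)$, and let $u\in W_\theta$ be the unique $L^1$-weak solution of the Robin problem $$(-\Delta)^su+qu=0\ \text{ in }\Omega,\qquad\mathcal N_su+\theta u=f\ \text{ in }\Omega_e.$$ Let $Rf:=R^{q,1}_{\theta,\theta'}f=f+(\theta'-\theta)u|_{\Omega_e}$. Suppose that either (i) $0<s<1/2$, or (ii) $1/2\le s<1$, the Robin-to-Robin data $(f,Rf)$ are of $H^s$ regularity in a neighborhood of $\Omega$, and $\frac1{\theta'-\theta}$ is bounded and Lipschitz continuous near $\partial\Omega$. Then $u|_\Omega$ can be reconstructed from (i.e. is determined by) the knowledge of the pair $(f,Rf)$, and $$q(x)=-\frac{(-\Delta)^su(x)}{u(x)},\qquad\forall x\in\Omega.$$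
   Context: $(-\Delta)^su(x)=C_{n,s}\,\mathrm{P.V.}\int_{\mathbb R^n}\frac{u(x)-u(y)}{|x-y|^{n+2s}}dy$, $C_{n,s}=\frac{s2^{2s}\Gamma((2s+n)/2)}{\pi^{n/2}\Gamma(1-s)}$. Nonlocal normal derivative: $\mathcal N_su(x)=C_{n,s}\int_\Omega\frac{u(x)-u(y)}{|x-y|^{n+2s}}dy$ for $x\in\Omega_e$. Energy form: $$\mathcal E(u,v)=\frac{C_{n,s}}2\iint_{(\mathbb R^n\times\mathbb R^n)\setminus\Omega_e^2}\frac{(u(x)-u(y))(v(x)-v(y))}{|x-y|^{n+2s}}dy\,dx.$$ $\Lambda_1$ is the set of $\theta\in L^1_{\rm loc}(\Omega_e)$ for which there is a constant $a>0$ with $\theta-a\in L^1(\Omega_e)$ and $\theta-a>0$ a.e. in $\Omega_e$. For $\theta\in\Lambda_1$, $W_\theta$ is the space of measurable $u:\mathbb R^n\to\mathbb R$ with $\|u\|_{W_\theta}^2:=\mathcal E(u,u)+\|u\|_{L^2(\Omega)}^2+\int_{\Omega_e}|\theta|u^2dx<\infty$. An $L^1$-weak solution of the Robin problem is $u\in W_\theta$ with $\mathcal E(u,v)+(qu,v)_{L^2(\Omega)}+\int_{\Omega_e}\theta uv\,dx=(f,v)_{L^2(\Omega_e)}$ for all $v\in W_\theta$. The $L^1$-Robin-to-Robin map is $R^{q,1}_{\theta,\theta'}:L^2(\Omega_e)\to L^2(\Omega_e)$, $f=\mathcal N_su+\theta u\mapsto\mathcal N_su+\theta'u=f+(\theta'-\theta)u$.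 Condition (ii) means: there is an open set $\Omega_0$ with $\overline\Omega\subset\Omega_0$ such that $f,Rf\in H^s(\Omega_0\setminus\overline\Omega)$ and $\frac1{\theta'-\theta}$ is bounded and Lipschitz continuous on $\Omega_0\setminus\Omega$. "Determined by $(f,Rf)$" means: with $n,s,\Omega,\theta,\theta'$ fixed and known and $q$ unknown, $u|_\Omega$ is a function of the pair $(f,Rf)$.
   Formalization: The formula for q is asserted, for the representative of u continuous in Ω, where u(x)≠0; if f is not a.e. zero, such points accumulate at every x in Ω and q(x) is the limit of the quotient along them. As printed it is 0/0 at zeros of u, e.g. everywhere when f=0. *)

theory Defs
  imports "HOL-Analysis.Analysis"
begin

text \<open>
  Euclidean space of dimension $n$ is an arbitrary type of class \<open>euclidean_space\<close>, with
  $n$ = \<open>DIM('a)\<close>, and the exterior of \<open>\<Omega>\<close> is the set \<open>- \<Omega>\<close>. Elements of function spaces over a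
  set are total functions of which only the values on that set, up to null sets, matter.
\<close>

definition frac_const :: "nat \<Rightarrow> real \<Rightarrow> real" where
  "frac_const n s =
     s * 2 powr (2 * s) * Gamma ((2 * s + real n) / 2) / (pi powr (real n / 2) * Gamma (1 - s))"

text \<open>The principal value exists at \<open>x\<close> and equals \<open>l\<close>. The integrability clause excludes the
  default value of divergent Bochner integrals.\<close>

definition has_frac_laplacian :: "real \<Rightarrow> ('a::euclidean_space \<Rightarrow> real) \<Rightarrow> 'a \<Rightarrow> real \<Rightarrow> bool" where
  "has_frac_laplacian s u x l \<longleftrightarrow>
     (\<forall>\<epsilon>>0. set_integrable lebesgue (- ball x \<epsilon>)
        (\<lambda>y. (u x - u y) / norm (x - y) powr (real DIM('a) + 2 * s))) \<and>
     ((\<lambda>\<epsilon>. frac_const DIM('a) s *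
        (LINT y:- ball x \<epsilon>|lebesgue. (u x - u y) / norm (x - y) powr (real DIM('a) + 2 * s)))
      \<longlongrightarrow> l) (at_right 0)"

definition frac_laplacian :: "real \<Rightarrow> ('a::euclidean_space \<Rightarrow> real) \<Rightarrow> 'a \<Rightarrow> real" where
  "frac_laplacian s u x = (THE l. has_frac_laplacian s u x l)"

text \<open>Near each boundary point, in suitable orthonormal coordinates with last axis \<open>e\<close>, the set
  lies on one side of the graph of a Lipschitz function of the remaining coordinates.\<close>

definition lipschitz_boundary :: "'a::euclidean_space set \<Rightarrow> bool" where
  "lipschitz_boundary \<Omega> \<longleftrightarrow>
     (\<forall>p\<in>frontier \<Omega>. \<exists>e \<gamma> L r. norm e = 1 \<and> 0 < r \<and> L-lipschitz_on {y. y \<bullet> e = 0} \<gamma> \<and>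
        \<Omega> \<inter> ball p r = {x \<in> ball p r. x \<bullet> e < \<gamma> (x - (x \<bullet> e) *\<^sub>R e)})"

definition L2_on :: "'a::euclidean_space set \<Rightarrow> ('a \<Rightarrow> real) \<Rightarrow> bool" where
  "L2_on A f \<longleftrightarrow> set_borel_measurable lebesgue A f \<and> set_integrable lebesgue A (\<lambda>x. (f x)\<^sup>2)"

definition Linfty_on :: "'a::euclidean_space set \<Rightarrow> ('a \<Rightarrow> real) \<Rightarrow> bool" where
  "Linfty_on A f \<longleftrightarrow>
     set_borel_measurable lebesgue A f \<and> (\<exists>B. AE x in lebesgue. x \<in> A \<longrightarrow> \<bar>f x\<bar> \<le> B)"

text \<open>Sobolev--Slobodeckij space on an open set. Restrictions of functions in $H^s$ of the whole
  space belong to it; on bounded Lipschitz sets the two notions coincide.\<close>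

definition Hs_on :: "real \<Rightarrow> 'a::euclidean_space set \<Rightarrow> ('a \<Rightarrow> real) \<Rightarrow> bool" where
  "Hs_on s U f \<longleftrightarrow> L2_on U f \<and>
     (\<integral>\<^sup>+z\<in>U \<times> U. ennreal ((f (fst z) - f (snd z))\<^sup>2
         / norm (fst z - snd z) powr (real DIM('a) + 2 * s)) \<partial>(lebesgue \<Otimes>\<^sub>M lebesgue)) < \<infinity>"

definition Lambda1 :: "'a::euclidean_space set \<Rightarrow> ('a \<Rightarrow> real) set" where
  "Lambda1 \<Omega> = {\<theta>. (\<forall>K. compact K \<and> K \<subseteq> - \<Omega> \<longrightarrow> set_integrable lebesgue K \<theta>) \<and>
     (\<exists>a>0. set_integrable lebesgue (- \<Omega>) (\<lambda>x. \<theta> x - a) \<and>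
            (AE x in lebesgue. x \<in> - \<Omega> \<longrightarrow> \<theta> x - a > 0))}"

text \<open>The bilinear form as a real Bochner integral, to be used only on the space \<open>W_space\<close> below,
  where the integral converges absolutely. Finiteness of the norm is expressed with
  \<open>ennreal\<close>-valued integrals instead.\<close>

definition energy :: "real \<Rightarrow> 'a::euclidean_space set \<Rightarrow> ('a \<Rightarrow> real) \<Rightarrow> ('a \<Rightarrow> real) \<Rightarrow> real" where
  "energy s \<Omega> u v = frac_const DIM('a) s / 2 *
     (LINT z:- ((- \<Omega>) \<times> (- \<Omega>))|(lebesgue \<Otimes>\<^sub>M lebesgue).
        (u (fst z) - u (snd z)) * (v (fst z) - v (snd z))
          / norm (fst z - snd z) powr (real DIM('a) + 2 * s))"

definition W_norm_sq ::
  "real \<Rightarrow> 'a::euclidean_space set \<Rightarrow> ('a \<Rightarrow> real) \<Rightarrow> ('a \<Rightarrow> real) \<Rightarrow> ennreal" where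
  "W_norm_sq s \<Omega> \<theta> u =
     ennreal (frac_const DIM('a) s / 2) *
       (\<integral>\<^sup>+z\<in>- ((- \<Omega>) \<times> (- \<Omega>)). ennreal ((u (fst z) - u (snd z))\<^sup>2
          / norm (fst z - snd z) powr (real DIM('a) + 2 * s)) \<partial>(lebesgue \<Otimes>\<^sub>M lebesgue))
     + (\<integral>\<^sup>+x\<in>\<Omega>. ennreal ((u x)\<^sup>2) \<partial>lebesgue)
     + (\<integral>\<^sup>+x\<in>- \<Omega>. ennreal (\<bar>\<theta> x\<bar> * (u x)\<^sup>2) \<partial>lebesgue)"

definition W_space ::
  "real \<Rightarrow> 'a::euclidean_space set \<Rightarrow> ('a \<Rightarrow> real) \<Rightarrow> ('a \<Rightarrow> real) set" where
  "W_space s \<Omega> \<theta> = {u \<in> borel_measurable lebesgue. W_norm_sq s \<Omega> \<theta> u < \<infinity>}"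

definition robin_solution ::
  "real \<Rightarrow> 'a::euclidean_space set \<Rightarrow> ('a \<Rightarrow> real) \<Rightarrow> ('a \<Rightarrow> real) \<Rightarrow> ('a \<Rightarrow> real)
    \<Rightarrow> ('a \<Rightarrow> real) \<Rightarrow> bool" where
  "robin_solution s \<Omega> \<theta> q f u \<longleftrightarrow> u \<in> W_space s \<Omega> \<theta> \<and>
     (\<forall>v\<in>W_space s \<Omega> \<theta>.
        energy s \<Omega> u v + (LINT x:\<Omega>|lebesgue. q x * u x * v x)
          + (LINT x:- \<Omega>|lebesgue. \<theta> x * u x * v x)
        = (LINT x:- \<Omega>|lebesgue. f x * v x))"

text \<open>The choice is harmless: under the coercivity assumptions on \<open>\<theta>\<close> and \<open>q\<close> the weak solution
  is unique up to null sets.\<close>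

definition robin_to_robin ::
  "real \<Rightarrow> 'a::euclidean_space set \<Rightarrow> ('a \<Rightarrow> real) \<Rightarrow> ('a \<Rightarrow> real) \<Rightarrow> ('a \<Rightarrow> real)
    \<Rightarrow> ('a \<Rightarrow> real) \<Rightarrow> 'a \<Rightarrow> real" where
  "robin_to_robin s \<Omega> \<theta> \<theta>' q f =
     (\<lambda>x. f x + (\<theta>' x - \<theta> x) * (SOME u. robin_solution s \<Omega> \<theta> q f u) x)"

text \<open>Since \<open>\<theta>\<close> and \<open>\<theta>'\<close> are given up to null sets, \<open>1 / (\<theta>' - \<theta>)\<close> is bounded and Lipschitz if
  some representative \<open>h\<close> of it is.\<close>

definition regular_data ::
  "real \<Rightarrow> 'a::euclidean_space set \<Rightarrow> ('a \<Rightarrow> real) \<Rightarrow> ('a \<Rightarrow> real) \<Rightarrow> ('a \<Rightarrow> real)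
    \<Rightarrow> ('a \<Rightarrow> real) \<Rightarrow> bool" where
  "regular_data s \<Omega> \<theta> \<theta>' f g \<longleftrightarrow>
     (\<exists>\<Omega>\<^sub>0. open \<Omega>\<^sub>0 \<and> closure \<Omega> \<subseteq> \<Omega>\<^sub>0 \<and>
        Hs_on s (\<Omega>\<^sub>0 - closure \<Omega>) f \<and> Hs_on s (\<Omega>\<^sub>0 - closure \<Omega>) g \<and>
        (\<exists>h L. bounded (h ` (\<Omega>\<^sub>0 - \<Omega>)) \<and> L-lipschitz_on (\<Omega>\<^sub>0 - \<Omega>) h \<and>
           (AE x in lebesgue. x \<in> \<Omega>\<^sub>0 - \<Omega> \<longrightarrow> h x = 1 / (\<theta>' x - \<theta> x))))"

text \<open>The formula \<open>q = - (-\<Delta>)\<^sup>s u / u\<close> at every point of \<open>\<Omega>\<close>, for a representative \<open>w\<close> of \<open>u\<close> that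
  is continuous in \<open>\<Omega>\<close>. The principal value is required to exist everywhere in \<open>\<Omega>\<close> and the
  quotient is literal where \<open>w\<close> does not vanish. At a zero of \<open>w\<close> the quotient has the form 0/0
  and can only be understood as the limit along nearby points with \<open>w \<noteq> 0\<close>; such points have to
  exist, which presupposes \<open>f \<noteq> 0\<close> (otherwise \<open>u = 0\<close> and the quotient is nowhere defined).\<close>

definition potential_formula ::
  "real \<Rightarrow> 'a::euclidean_space set \<Rightarrow> ('a \<Rightarrow> real) \<Rightarrow> ('a \<Rightarrow> real) \<Rightarrow> ('a \<Rightarrow> real) \<Rightarrow> bool" where
  "potential_formula s \<Omega> q f u \<longleftrightarrow>
     (\<exists>w. continuous_on \<Omega> w \<and> (AE x in lebesgue. w x = u x) \<and>
        (\<forall>x\<in>\<Omega>. (\<exists>l. has_frac_laplacian s w x l) \<and>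
                (w x \<noteq> 0 \<longrightarrow> q x = - frac_laplacian s w x / w x)) \<and>
        (\<not> (AE x in lebesgue. x \<in> - \<Omega> \<longrightarrow> f x = 0) \<longrightarrow>
           (\<forall>x\<in>\<Omega>. x islimpt {y \<in> \<Omega>. w y \<noteq> 0} \<and>
              ((\<lambda>y. - frac_laplacian s w y / w y) \<longlongrightarrow> q x) (at x within {y \<in> \<Omega>. w y \<noteq> 0}))))"

end

theory Submission
  imports Defs
begin

text \<open>
  Write \<open>K z = \<bar>z\<bar>\<^sup>-\<^sup>n\<^sup>-\<^sup>2\<^sup>s\<close>. Testing the weak equation with all translates and dilates of one bump function turns
  it into identities for \<open>u\<close> against the explicit, decaying fractional Laplacian of the bump. By Kato's
  inequality a smoothed \<open>\<bar>u\<bar>\<close> is a subsolution, and integrating the identities over the scale bounds it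
  locally. The same integration shows that averages of \<open>u\<close> converge locally uniformly, to a continuous
  representative \<open>w\<close>, and that the second differences of \<open>w\<close> at step \<open>z\<close> are \<open>o (\<bar>z\<bar>\<^sup>2\<^sup>s)\<close>. As the averaging kernel
  agrees with a multiple of \<open>K\<close> up to a faster decaying term, the principal value exists and equals \<open>- q w\<close>.

  Outside the domain the data determine \<open>u = (Rf - f) / (\<theta>' - \<theta>)\<close>. The difference \<open>d\<close> of two solutions with the
  same data vanishes there and is tested to zero by bumps in an exterior ball, so \<open>\<integral> d y K (x - y) dy = 0\<close>
  for \<open>x\<close> in that ball. Differentiating in \<open>x\<close> and approximating by polynomials in \<open>(x - y) / \<bar>x - y\<bar>\<^sup>2\<close> forces
  \<open>d = 0\<close>. By the same unique continuation \<open>w\<close> vanishes on no ball unless \<open>f = 0\<close>.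
\<close>

subsection \<open>Lebesgue measure: affine maps, reflections, polar coordinates\<close>

text \<open>The potential is merely continuous, so the right-hand side of the equation has no
  Hoelder modulus and no Schauder estimate makes the principal value converge absolutely. Even
  second differences of size o (|z|^(2s)) do not suffice alone: against K they may diverge
  logarithmically. Convergence comes from a comparison. For the averages the limit of the relevant
  quotient is read off the weak equation, and the truncated K differs from the rescaled averaging
  kernel by a term with one more power of decay; against that term o (|z|^(2s)) is enough.

  The averaging kernel is built for this purpose. Its derivative in the scale is, up to sign, the
  rescaled fractional Laplacian of the bump, which is what the weak equation evaluates. That
  function has integral zero, so the integrals over large and over small scales are opposite: one
  bounds the kernel near the origin, the other gives its decay.

  Kato's inequality has to come before all this because q u is at first only square integrable,
  while the estimates in the scale need it locally bounded.\<close>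

lemma nn_integral_lborel_affine:
 fixes f :: "'a::euclidean_space \<Rightarrow> ennreal"
 assumes [measurable]: "f \<in> borel_measurable borel" and c: "c \<noteq> 0"
 shows "(\<integral>\<^sup>+x. f x \<partial>lborel) = ennreal (\<bar>c\<bar> ^ DIM('a)) * (\<integral>\<^sup>+x. f (t + c *\<^sub>R x) \<partial>lborel)"
 by (subst lborel_affine[OF c, of t])
  (simp add: nn_integral_density nn_integral_distr nn_integral_cmult)

lemma integrable_lborel_affine_iff:
 fixes f :: "'a::euclidean_space \<Rightarrow> real"
 assumes [measurable]: "f \<in> borel_measurable borel" and c: "c \<noteq> 0"
 shows "integrable lborel (\<lambda>x. f (t + c *\<^sub>R x)) \<longleftrightarrow> integrable lborel f"
 using c by (subst (2) lborel_affine[OF c, of t])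
  (simp add: integrable_density integrable_distr_eq)

lemma integral_lborel_affine:
 fixes f :: "'a::euclidean_space \<Rightarrow> real"
 assumes [measurable]: "f \<in> borel_measurable borel" and c: "c \<noteq> 0"
 shows "(LBINT x. f x) = \<bar>c\<bar> ^ DIM('a) * (LBINT x. f (t + c *\<^sub>R x))"
 by (subst lborel_affine[OF c, of t])
  (simp add: integral_density integral_distr)

lemma nn_integral_shift:
 fixes f :: "'a::euclidean_space \<Rightarrow> ennreal"
 assumes "f \<in> borel_measurable borel"
 shows "(\<integral>\<^sup>+x. f (x + t) \<partial>lborel) = (\<integral>\<^sup>+x. f x \<partial>lborel)"
  and "(\<integral>\<^sup>+x. f (x - t) \<partial>lborel) = (\<integral>\<^sup>+x. f x \<partial>lborel)"
  and "(\<integral>\<^sup>+x. f (t - x) \<partial>lborel) = (\<integral>\<^sup>+x. f x \<partial>lborel)"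
 using nn_integral_lborel_affine[OF assms, of 1 t] nn_integral_lborel_affine[OF assms, of 1 "-t"]
  nn_integral_lborel_affine[OF assms, of "-1" t]
 by (simp_all add: add.commute)

lemma integrable_shift:
 fixes f :: "'a::euclidean_space \<Rightarrow> real"
 assumes "f \<in> borel_measurable borel"
 shows "integrable lborel (\<lambda>x. f (x + t)) \<longleftrightarrow> integrable lborel f"
  and "integrable lborel (\<lambda>x. f (x - t)) \<longleftrightarrow> integrable lborel f"
  and "integrable lborel (\<lambda>x. f (t - x)) \<longleftrightarrow> integrable lborel f"
 using integrable_lborel_affine_iff[OF assms, of 1 t] integrable_lborel_affine_iff[OF assms, of 1 "-t"]
  integrable_lborel_affine_iff[OF assms, of "-1" t]
 by (simp_all add: add.commute)

lemma integral_shift: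
 fixes f :: "'a::euclidean_space \<Rightarrow> real"
 assumes "f \<in> borel_measurable borel"
 shows "(LBINT x. f (x + t)) = (LBINT x. f x)"
  and "(LBINT x. f (x - t)) = (LBINT x. f x)"
  and "(LBINT x. f (t - x)) = (LBINT x. f x)"
 using integral_lborel_affine[OF assms, of 1 t] integral_lborel_affine[OF assms, of 1 "-t"]
  integral_lborel_affine[OF assms, of "-1" t]
 by (simp_all add: add.commute)

lemma integral_scale:
 fixes f :: "'a::euclidean_space \<Rightarrow> real"
 assumes "f \<in> borel_measurable borel" "0 < l"
 shows "(LBINT x. f ((x - a) /\<^sub>R l)) = l ^ DIM('a) * (LBINT x. f x)"
proof -
 have [measurable]: "f \<in> borel_measurable borel" by fact
 show ?thesis
  using integral_lborel_affine[of "\<lambda>x. f ((x - a) /\<^sub>R l)" l a] assms(2) by simp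
qed

lemma integrable_scale:
 fixes f :: "'a::euclidean_space \<Rightarrow> real"
 assumes "f \<in> borel_measurable borel" "0 < l"
 shows "integrable lborel (\<lambda>x. f ((x - a) /\<^sub>R l)) \<longleftrightarrow> integrable lborel f"
proof -
 have [measurable]: "f \<in> borel_measurable borel" by fact
 show ?thesis
  using integrable_lborel_affine_iff[of "\<lambda>x. f ((x - a) /\<^sub>R l)" l a] assms(2) by simp
qed

text \<open>Uniqueness of Haar measure: integrate \<open>1\<^sub>A (x + y) 1\<^sub>D (y)\<close>, with \<open>D\<close> the unit ball,
 against the two translation invariant measures.\<close>

lemma lborel_distr_isometry:
 fixes T :: "'a::euclidean_space \<Rightarrow> 'a"
 assumes lin: "linear T" and iso: "\<And>x. norm (T x) = norm x" and inv: "\<And>x. T (T x) = x"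
 shows "distr lborel borel T = lborel"
proof (rule measure_eqI)
 show "sets (distr lborel borel T) = sets lborel" by simp
 fix A :: "'a set" assume "A \<in> sets (distr lborel borel T)"
 then have A[measurable]: "A \<in> sets borel" by simp
 have T[measurable]: "T \<in> borel_measurable borel"
  using linear_continuous_on[of T UNIV] lin linear_linear
  by (intro borel_measurable_continuous_onI) (auto simp: linear_conv_bounded_linear)
 define D :: "'a set" where "D = ball 0 1"
 have D[measurable]: "D \<in> sets borel" by (simp add: D_def)
 let ?i = "\<lambda>x y. (indicator A (T x + y) * indicator D y :: ennreal)"
 have emD: "emeasure lborel D \<noteq> 0" "emeasure lborel D \<noteq> \<infinity>"
  unfolding D_def by (auto simp: emeasure_lborel_ball_finite less_top[symmetric] emeasure_ball unit_ball_vol_pos[THEN less_imp_neq, symmetric])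
 have "(\<integral>\<^sup>+y. \<integral>\<^sup>+x. ?i x y \<partial>lborel \<partial>lborel) = (\<integral>\<^sup>+x. \<integral>\<^sup>+y. ?i x y \<partial>lborel \<partial>lborel)"
  by (rule lborel_pair.Fubini') measurable
 moreover have "(\<integral>\<^sup>+x. ?i x y \<partial>lborel) = emeasure (distr lborel borel T) A * indicator D y" for y
 proof -
  have *: "T x + y = T (x + T y)" for x
   using lin by (simp add: linear_add inv)
  have "(\<integral>\<^sup>+x. ?i x y \<partial>lborel) = (\<integral>\<^sup>+x. indicator A (T (x + T y)) \<partial>lborel) * indicator D y"
   by (simp add: nn_integral_multc *)
  also have "(\<integral>\<^sup>+x. indicator A (T (x + T y)) \<partial>lborel) = (\<integral>\<^sup>+x. indicator A (T x) \<partial>lborel)"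
   by (rule nn_integral_shift(1)) measurable
  also have "\<dots> = (\<integral>\<^sup>+x. indicator A x \<partial>distr lborel borel T)"
   by (simp add: nn_integral_distr del: nn_integral_indicator)
  also have "\<dots> = emeasure (distr lborel borel T) A"
   by simp
  finally show ?thesis .
 qed
 moreover have "(\<integral>\<^sup>+y. ?i x y \<partial>lborel) = (\<integral>\<^sup>+y. indicator A y * indicator D (y - T x) \<partial>lborel)" for x
  using nn_integral_shift(2)[of "\<lambda>y. ?i x y" "T x"] by simp
 moreover have "(\<integral>\<^sup>+x. \<integral>\<^sup>+y. indicator A y * indicator D (y - T x) \<partial>lborel \<partial>lborel)
  = (\<integral>\<^sup>+y. \<integral>\<^sup>+x. indicator A y * indicator D (y - T x) \<partial>lborel \<partial>lborel)"
  by (rule lborel_pair.Fubini'[symmetric]) measurable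
 moreover have "(\<integral>\<^sup>+x. indicator A y * indicator D (y - T x) \<partial>lborel) = indicator A y * emeasure lborel D" for y
 proof -
  have "indicator D (y - T x) = (indicator D (T y - x) :: ennreal)" for x
  proof -
   have "T (T y - x) = y - T x" using lin by (simp add: linear_diff inv)
   then show ?thesis using iso[of "T y - x"] by (simp add: D_def indicator_def)
  qed
  then have "(\<integral>\<^sup>+x. indicator A y * indicator D (y - T x) \<partial>lborel)
   = indicator A y * (\<integral>\<^sup>+x. indicator D (T y - x) \<partial>lborel)"
   by (simp add: nn_integral_cmult)
  also have "(\<integral>\<^sup>+x. indicator D (T y - x) \<partial>lborel) = (\<integral>\<^sup>+x. indicator D x \<partial>lborel)"
   by (rule nn_integral_shift(3)) measurable
  finally show ?thesis by simp
 qed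
 ultimately have "emeasure (distr lborel borel T) A * emeasure lborel D
   = emeasure lborel A * emeasure lborel D"
  by (simp add: nn_integral_cmult nn_integral_multc)
 then show "emeasure (distr lborel borel T) A = emeasure lborel A"
  using emD by (simp add: mult.commute[of _ "emeasure lborel D"] ennreal_mult_cancel_left)
qed

text \<open>The reflection in the hyperplane orthogonal to x - y exchanges x and y. Being an
  involution, it preserves Lebesgue measure by \<open>lborel_distr_isometry\<close>; no general
  theory of orthogonal maps is involved. This is the source of all radial symmetry below.\<close>

lemma exists_isometry_between:
 fixes x y :: "'a::euclidean_space"
 assumes "norm x = norm y"
 obtains T where "linear T" "\<And>z. norm (T z) = norm z" "\<And>z. T (T z) = z" "T x = y"
  "distr lborel borel T = lborel"
proof (cases "x = y")
 case True
 show ?thesis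
  by (rule that[of "\<lambda>x. x"]) (auto simp: True linear_id[unfolded id_def] distr_id2)
next
 case False
 define v where "v = x - y"
 define T where "T z = z - (2 * (z \<bullet> v) / (v \<bullet> v)) *\<^sub>R v" for z
 have v: "v \<bullet> v \<noteq> 0" using False by (simp add: v_def)
 have lin: "linear T"
  by (rule linearI) (auto simp: T_def algebra_simps inner_add_left add_divide_distrib
    scaleR_add_left[symmetric] simp del: scaleR_add_left)
 have *: "T z \<bullet> T z = z \<bullet> z" for z
  using v by (simp add: T_def inner_diff_left inner_diff_right inner_commute field_simps)
 then have n: "norm (T z) = norm z" for z by (simp add: norm_eq_sqrt_inner)
 \<comment> \<open>Equal norms make the coefficient of v in \<open>T x\<close> equal to 1, so
   \<open>T x\<close> is x - v = y.\<close>
 have vv: "v \<bullet> v = 2 * (x \<bullet> v)"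
  using assms unfolding v_def by (simp add: norm_eq_sqrt_inner inner_diff_left inner_diff_right inner_commute)
 have inv: "T (T z) = z" for z
 proof -
  have "T z \<bullet> v = - (z \<bullet> v)" using v by (simp add: T_def inner_diff_left)
  then show ?thesis by (simp add: T_def[of "T z"]) (simp add: T_def)
 qed
 have "T x = y" using v unfolding T_def vv by (simp add: v_def)
 with lborel_distr_isometry[OF lin n inv] show ?thesis
  using that lin n inv by blast
qed

text \<open>Multiply by \<open>1 = \<integral> \<bar>y\<bar> t\<^sup>-\<^sup>2 1{\<bar>y\<bar> \<le> t} dt\<close> and substitute \<open>y = t z\<close>.\<close>

lemma nn_integral_rays:
 fixes F :: "'a::euclidean_space \<Rightarrow> ennreal"
 assumes [measurable]: "F \<in> borel_measurable borel"
 shows "(\<integral>\<^sup>+y. F y \<partial>lborel) = (\<integral>\<^sup>+z. ennreal (norm z) * indicator {..1} (norm z) *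
  (\<integral>\<^sup>+t. ennreal (t ^ (DIM('a) - 1)) * F (t *\<^sub>R z) * indicator {0<..} t \<partial>lborel) \<partial>lborel)"
proof -
 let ?k = "\<lambda>(y::'a) t::real. ennreal (norm y / t\<^sup>2) * indicator {0..} (t - norm y) * indicator {0<..} t"
 have one: "(\<integral>\<^sup>+t. ?k y t \<partial>lborel) = 1" if "y \<noteq> 0" for y
 proof -
  have "(\<integral>\<^sup>+t. ?k y t \<partial>lborel) = (\<integral>\<^sup>+t. ennreal (norm y / t\<^sup>2) * indicator {norm y..} t \<partial>lborel)"
   using that by (intro nn_integral_cong) (auto simp: indicator_def intro: less_le_trans[of 0 "norm y"])
  also have "\<dots> = ennreal (0 - (- norm y / norm y))"
  proof (rule nn_integral_FTC_atLeast[where F="\<lambda>t. - norm y / t" and T=0])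
   show "((\<lambda>t. - norm y / t) has_real_derivative norm y / t\<^sup>2) (at t)" if "norm y \<le> t" for t
    using that \<open>y \<noteq> 0\<close> by (auto intro!: derivative_eq_intros simp: power2_eq_square)
   show "((\<lambda>t. - norm y / t) \<longlongrightarrow> 0) at_top"
    by (intro tendsto_divide_0[OF tendsto_const] filterlim_at_top_imp_at_infinity filterlim_ident)
  qed auto
  finally show ?thesis using that by simp
 qed
 have "(\<integral>\<^sup>+y. F y \<partial>lborel) = (\<integral>\<^sup>+y. F y * (\<integral>\<^sup>+t. ?k y t \<partial>lborel) \<partial>lborel)"
  using AE_lborel_singleton[of 0] by (intro nn_integral_cong_AE) (auto simp: one)
 also have "\<dots> = (\<integral>\<^sup>+y. \<integral>\<^sup>+t. F y * ?k y t \<partial>lborel \<partial>lborel)"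
  by (simp add: nn_integral_cmult)
 also have "\<dots> = (\<integral>\<^sup>+t. \<integral>\<^sup>+y. F y * ?k y t \<partial>lborel \<partial>lborel)"
  by (rule lborel_pair.Fubini'[symmetric]) measurable
 also have "\<dots> = (\<integral>\<^sup>+t. \<integral>\<^sup>+z. ennreal (norm z) * indicator {..1} (norm z) *
  (ennreal (t ^ (DIM('a) - 1)) * F (t *\<^sub>R z) * indicator {0<..} t) \<partial>lborel \<partial>lborel)"
 proof (rule nn_integral_cong)
  fix t :: real
  show "(\<integral>\<^sup>+y. F y * ?k y t \<partial>lborel) = (\<integral>\<^sup>+z. ennreal (norm z) * indicator {..1} (norm z) *
  (ennreal (t ^ (DIM('a) - 1)) * F (t *\<^sub>R z) * indicator {0<..} t) \<partial>lborel)"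
  proof (cases "0 < t")
   case True
   have "(\<integral>\<^sup>+y. F y * ?k y t \<partial>lborel)
    = (\<integral>\<^sup>+z. ennreal (\<bar>t\<bar> ^ DIM('a)) * (F (t *\<^sub>R z) * ?k (t *\<^sub>R z) t) \<partial>lborel)"
    using True nn_integral_lborel_affine[of "\<lambda>y. F y * ?k y t" t 0] by (simp add: nn_integral_cmult)
   also have "\<dots> = (\<integral>\<^sup>+z. ennreal (norm z) * indicator {..1} (norm z) *
    (ennreal (t ^ (DIM('a) - 1)) * F (t *\<^sub>R z) * indicator {0<..} t) \<partial>lborel)"
   proof (rule nn_integral_cong)
    fix z :: 'a
    have "ennreal (\<bar>t\<bar> ^ DIM('a)) * ennreal (norm (t *\<^sub>R z) / t\<^sup>2) = ennreal (norm z) * ennreal (t ^ (DIM('a) - 1))"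
    proof -
     obtain k where k: "DIM('a) = Suc k" using DIM_positive[where 'a='a] gr0_conv_Suc by auto
     have "t ^ DIM('a) * (norm (t *\<^sub>R z) / t\<^sup>2) = norm z * t ^ (DIM('a) - 1)"
      using True by (simp add: k power2_eq_square)
     then show ?thesis using True by (simp add: ennreal_mult'[symmetric])
    qed
    moreover have "indicator {0..} (t - norm (t *\<^sub>R z)) = (indicator {..1} (norm z) :: ennreal)"
     using True by (auto simp: indicator_def)
    ultimately show "ennreal (\<bar>t\<bar> ^ DIM('a)) * (F (t *\<^sub>R z) * ?k (t *\<^sub>R z) t) =
     ennreal (norm z) * indicator {..1} (norm z) * (ennreal (t ^ (DIM('a) - 1)) * F (t *\<^sub>R z) * indicator {0<..} t)"
     by (simp add: ac_simps)
   qed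
   finally show ?thesis .
  qed simp
 qed
 also have "\<dots> = (\<integral>\<^sup>+z. \<integral>\<^sup>+t. ennreal (norm z) * indicator {..1} (norm z) *
  (ennreal (t ^ (DIM('a) - 1)) * F (t *\<^sub>R z) * indicator {0<..} t) \<partial>lborel \<partial>lborel)"
  by (rule lborel_pair.Fubini') measurable
 also have "\<dots> = (\<integral>\<^sup>+z. ennreal (norm z) * indicator {..1} (norm z) *
  (\<integral>\<^sup>+t. ennreal (t ^ (DIM('a) - 1)) * F (t *\<^sub>R z) * indicator {0<..} t \<partial>lborel) \<partial>lborel)"
  by (simp add: nn_integral_cmult)
 finally show ?thesis .
qed

text \<open>For a radial function the integral along the ray through z depends on z only through the
  factor |z|^(-n), so the double integral of \<open>nn_integral_rays\<close> splits into a product.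
  The constant is the area of the unit sphere, but only its positivity and finiteness
  matter.\<close>

lemma nn_integral_polar:
 obtains S :: real where "0 < S"
  "\<And>f. f \<in> borel_measurable borel \<Longrightarrow> (\<integral>\<^sup>+y. f (norm (y::'a::euclidean_space)) \<partial>lborel)
   = ennreal S * (\<integral>\<^sup>+t. ennreal (t ^ (DIM('a) - 1)) * f t * indicator {0<..} t \<partial>lborel)"
proof -
 let ?n = "DIM('a)"
 define R where "R = (\<integral>\<^sup>+(z::'a). ennreal (norm z) * indicator {..1} (norm z) * ennreal (1 / norm z ^ ?n) \<partial>lborel)"
 have R: "(\<integral>\<^sup>+y. f (norm (y::'a)) \<partial>lborel)
   = R * (\<integral>\<^sup>+t. ennreal (t ^ (?n - 1)) * f t * indicator {0<..} t \<partial>lborel)"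
  if [measurable]: "f \<in> borel_measurable borel" for f :: "real \<Rightarrow> ennreal"
 proof -
  let ?I = "\<integral>\<^sup>+t. ennreal (t ^ (?n - 1)) * f t * indicator {0<..} t \<partial>lborel"
  have inner: "(\<integral>\<^sup>+t. ennreal (t ^ (?n - 1)) * f (norm (t *\<^sub>R z)) * indicator {0<..} t \<partial>lborel)
   = ennreal (1 / norm z ^ ?n) * ?I" if "z \<noteq> 0" for z :: 'a
  proof -
   let ?J = "\<integral>\<^sup>+t. ennreal (t ^ (?n - 1)) * f (norm (t *\<^sub>R z)) * indicator {0<..} t \<partial>lborel"
   have "?I = ennreal \<bar>norm z\<bar> * (\<integral>\<^sup>+t. ennreal ((0 + norm z * t) ^ (?n - 1)) * f (0 + norm z * t) * indicator {0<..} (0 + norm z * t) \<partial>lborel)"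
    using that by (intro nn_integral_real_affine) measurable
   also have "\<dots> = ennreal \<bar>norm z\<bar> * (\<integral>\<^sup>+t. ennreal (norm z ^ (?n - 1)) * (ennreal (t ^ (?n - 1)) * f (norm (t *\<^sub>R z)) * indicator {0<..} t) \<partial>lborel)"
   proof (rule arg_cong2[where f="(*)"], rule refl, rule nn_integral_cong)
    fix t :: real
    show "ennreal ((0 + norm z * t) ^ (?n - 1)) * f (0 + norm z * t) * indicator {0<..} (0 + norm z * t)
     = ennreal (norm z ^ (?n - 1)) * (ennreal (t ^ (?n - 1)) * f (norm (t *\<^sub>R z)) * indicator {0<..} t)"
    proof (cases "0 < t")
     case True
     then show ?thesis using that
      by (simp add: power_mult_distrib ennreal_mult' mult.commute[of t] mult.assoc)
    qed (use that in \<open>simp add: zero_less_mult_iff\<close>)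
   qed
   also have "\<dots> = ennreal \<bar>norm z\<bar> * (ennreal (norm z ^ (?n - 1)) * ?J)"
    by (simp add: nn_integral_cmult)
   also have "\<dots> = ennreal (norm z ^ ?n) * ?J"
    using DIM_positive[where 'a='a] by (simp add: mult.assoc[symmetric] ennreal_mult'[symmetric] power_eq_if)
   finally have "ennreal (1 / norm z ^ ?n) * ?I = ennreal (1 / norm z ^ ?n) * (ennreal (norm z ^ ?n) * ?J)" by simp
   also have "\<dots> = ?J"
    using that by (simp add: mult.assoc[symmetric] ennreal_mult'[symmetric])
   finally show ?thesis by simp
  qed
  have "(\<integral>\<^sup>+y. f (norm (y::'a)) \<partial>lborel) = (\<integral>\<^sup>+(z::'a). ennreal (norm z) * indicator {..1} (norm z) *
    (ennreal (1 / norm z ^ ?n) * ?I) \<partial>lborel)"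
  proof -
   have "(\<integral>\<^sup>+y. f (norm (y::'a)) \<partial>lborel) = (\<integral>\<^sup>+(z::'a). ennreal (norm z) * indicator {..1} (norm z) *
    (\<integral>\<^sup>+t. ennreal (t ^ (?n - 1)) * f (norm (t *\<^sub>R z)) * indicator {0<..} t \<partial>lborel) \<partial>lborel)"
    by (rule nn_integral_rays) measurable
   also have "\<dots> = (\<integral>\<^sup>+(z::'a). ennreal (norm z) * indicator {..1} (norm z) *
    (ennreal (1 / norm z ^ ?n) * ?I) \<partial>lborel)"
    using AE_lborel_singleton[of 0] by (intro nn_integral_cong_AE, eventually_elim) (simp only: inner not_False_eq_True)
   finally show ?thesis .
  qed
  also have "\<dots> = R * ?I"
   unfolding R_def by (subst nn_integral_multc[symmetric]) (measurable, simp add: mult.assoc)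
  finally show ?thesis .
 qed
 \<comment> \<open>The indicator of the unit ball as a test case: its volume is finite and positive,
   and it equals R / n, which forces R to be finite and positive as well.\<close>
 have cb: "emeasure lborel (cball (0::'a) 1) = R * ennreal (1 / real ?n)"
 proof -
  have "emeasure lborel (cball (0::'a) 1) = (\<integral>\<^sup>+y. indicator {..1} (norm (y::'a)) \<partial>lborel)"
   by (subst nn_integral_indicator[of "cball (0::'a) 1" lborel, symmetric])
    (simp, intro nn_integral_cong, simp add: indicator_def)
  also have "\<dots> = R * (\<integral>\<^sup>+t. ennreal (t ^ (?n - 1)) * indicator {..1} t * indicator {0<..} t \<partial>lborel)"
   by (rule R) measurable
  also have "(\<integral>\<^sup>+t. ennreal (t ^ (?n - 1)) * indicator {..1} t * indicator {0<..} t \<partial>lborel)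
   = (\<integral>\<^sup>+t. ennreal (t ^ (?n - 1)) * indicator {0..1} t \<partial>lborel)"
   using AE_lborel_singleton[of "0::real"] by (intro nn_integral_cong_AE) (auto simp: indicator_def)
  also have "\<dots> = ennreal (1 ^ ?n / ?n - 0 ^ ?n / ?n)"
   using DIM_positive[where 'a='a]
   by (intro nn_integral_FTC_Icc) (auto intro!: derivative_eq_intros)
  finally show ?thesis using DIM_positive[where 'a='a] by (simp add: zero_power)
 qed
 have "R * ennreal (1 / real ?n) < \<infinity>" "0 < R * ennreal (1 / real ?n)"
  unfolding cb[symmetric] by (auto simp: emeasure_lborel_cball_finite emeasure_cball)
 then have "R < \<infinity>" "0 < R"
  by (auto simp: ennreal_mult_less_top ennreal_zero_less_mult_iff less_top[symmetric])
 then obtain S where S: "R = ennreal S" "0 < S"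
  by (cases R) (auto simp: ennreal_less_zero_iff)
 show ?thesis by (rule that[OF S(2)]) (use R S in simp)
qed

text \<open>The same fact as an identity of measures, so that it also applies to signed radial
  functions such as \<open>ell\<close>.\<close>

lemma distr_norm_lborel:
 obtains S :: real where "0 < S"
  "distr (lborel :: 'a::euclidean_space measure) borel norm
   = density lborel (\<lambda>t. ennreal (S * t ^ (DIM('a) - 1) * indicator {0<..} t))"
proof -
 obtain S where S: "0 < S"
  "\<And>f. f \<in> borel_measurable borel \<Longrightarrow> (\<integral>\<^sup>+y. f (norm (y::'a)) \<partial>lborel)
   = ennreal S * (\<integral>\<^sup>+t. ennreal (t ^ (DIM('a) - 1)) * f t * indicator {0<..} t \<partial>lborel)"
  using nn_integral_polar by blast
 have "distr (lborel :: 'a measure) borel norm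
   = density lborel (\<lambda>t. ennreal (S * t ^ (DIM('a) - 1) * indicator {0<..} t))"
 proof (rule measure_eqI)
  fix A assume "A \<in> sets (distr (lborel :: 'a measure) borel norm)"
  then have A[measurable]: "A \<in> sets borel" by simp
  have "emeasure (distr (lborel :: 'a measure) borel norm) A = (\<integral>\<^sup>+y. indicator A (norm (y::'a)) \<partial>lborel)"
   by (simp flip: nn_integral_indicator add: nn_integral_distr)
  also have "\<dots> = (\<integral>\<^sup>+t. ennreal S * (ennreal (t ^ (DIM('a) - 1)) * indicator A t * indicator {0<..} t) \<partial>lborel)"
   by (simp add: S(2) nn_integral_cmult)
  also have "\<dots> = (\<integral>\<^sup>+t. ennreal (S * t ^ (DIM('a) - 1) * indicator {0<..} t) * indicator A t \<partial>lborel)"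
   using S(1) by (intro nn_integral_cong) (auto simp: indicator_def ennreal_mult')
  also have "\<dots> = emeasure (density lborel (\<lambda>t. ennreal (S * t ^ (DIM('a) - 1) * indicator {0<..} t))) A"
   by (simp add: emeasure_density)
  finally show "emeasure (distr (lborel :: 'a measure) borel norm) A = \<dots>" .
 qed simp
 with S(1) that show ?thesis by blast
qed

lemma nn_integral_norm_powr:
 obtains S :: real where "0 < S"
  "\<And>q r. real DIM('a) < q \<Longrightarrow> 0 < r \<Longrightarrow>
   (\<integral>\<^sup>+(y::'a::euclidean_space). ennreal (norm y powr (-q) * indicator {r..} (norm y)) \<partial>lborel)
    = ennreal (S * (r powr (real DIM('a) - q) / (q - real DIM('a))))"
  "\<And>q r. q < real DIM('a) \<Longrightarrow> 0 < r \<Longrightarrow>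
   (\<integral>\<^sup>+(y::'a::euclidean_space). ennreal (norm y powr (-q) * indicator {..r} (norm y)) \<partial>lborel)
    = ennreal (S * (r powr (real DIM('a) - q) / (real DIM('a) - q)))"
proof -
 let ?n = "DIM('a)"
 obtain S where S: "0 < S"
  "\<And>f. f \<in> borel_measurable borel \<Longrightarrow> (\<integral>\<^sup>+y. f (norm (y::'a)) \<partial>lborel)
   = ennreal S * (\<integral>\<^sup>+t. ennreal (t ^ (?n - 1)) * f t * indicator {0<..} t \<partial>lborel)"
  using nn_integral_polar by blast
 have pw: "t ^ (?n - 1) * t powr (-q) = t powr (real ?n - q - 1)" if "0 < t" for t q :: real
 proof -
  have "t ^ (?n - 1) = t powr (real ?n - 1)"
   using that DIM_positive[where 'a='a] by (simp add: powr_realpow[symmetric] of_nat_diff)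
  then show ?thesis by (simp add: powr_add[symmetric] algebra_simps)
 qed
 have 1: "(\<integral>\<^sup>+(y::'a). ennreal (norm y powr (-q) * indicator {r..} (norm y)) \<partial>lborel)
    = ennreal (S * (r powr (real ?n - q) / (q - real ?n)))" if q: "real ?n < q" "0 < r" for q r
 proof -
  have "(\<integral>\<^sup>+(y::'a). ennreal (norm y powr (-q) * indicator {r..} (norm y)) \<partial>lborel)
   = ennreal S * (\<integral>\<^sup>+t. ennreal (t ^ (?n - 1)) * ennreal (t powr (-q) * indicator {r..} t) * indicator {0<..} t \<partial>lborel)"
   by (rule S(2)) measurable
  also have "(\<integral>\<^sup>+t. ennreal (t ^ (?n - 1)) * ennreal (t powr (-q) * indicator {r..} t) * indicator {0<..} t \<partial>lborel)
   = (\<integral>\<^sup>+t. ennreal (t powr (real ?n - q - 1)) * indicator {r..} t \<partial>lborel)"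
   using q by (intro nn_integral_cong) (auto simp: indicator_def ennreal_mult'[symmetric] pw pw[unfolded One_nat_def])
  also have "\<dots> = ennreal (-(r powr (real ?n - q - 1 + 1)) / (real ?n - q - 1 + 1))"
   using q by (intro nn_integral_has_integral_lebesgue' has_integral_powr_to_inf) auto
  also have "-(r powr (real ?n - q - 1 + 1)) / (real ?n - q - 1 + 1) = r powr (real ?n - q) / (q - real ?n)"
   using q by (simp add: field_simps)
  finally show ?thesis by (simp only: ennreal_mult'[OF less_imp_le[OF S(1)]])
 qed
 have 2: "(\<integral>\<^sup>+(y::'a). ennreal (norm y powr (-q) * indicator {..r} (norm y)) \<partial>lborel)
    = ennreal (S * (r powr (real ?n - q) / (real ?n - q)))" if q: "q < real ?n" "0 < r" for q r
 proof -
  have "(\<integral>\<^sup>+(y::'a). ennreal (norm y powr (-q) * indicator {..r} (norm y)) \<partial>lborel)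
   = ennreal S * (\<integral>\<^sup>+t. ennreal (t ^ (?n - 1)) * ennreal (t powr (-q) * indicator {..r} t) * indicator {0<..} t \<partial>lborel)"
   by (rule S(2)) measurable
  also have "(\<integral>\<^sup>+t. ennreal (t ^ (?n - 1)) * ennreal (t powr (-q) * indicator {..r} t) * indicator {0<..} t \<partial>lborel)
   = (\<integral>\<^sup>+t. ennreal (t powr (real ?n - q - 1)) * indicator {0..r} t \<partial>lborel)"
  proof (rule nn_integral_cong_AE, rule AE_mp[OF AE_lborel_singleton[of 0]], intro AE_I2 impI)
   fix t :: real assume "t \<noteq> 0"
   then show "ennreal (t ^ (?n - 1)) * ennreal (t powr (-q) * indicator {..r} t) * indicator {0<..} t
    = ennreal (t powr (real ?n - q - 1)) * indicator {0..r} t"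
    using pw[of t q] by (cases "0 < t") (simp_all add: indicator_def ennreal_mult'[symmetric])
  qed
  also have "\<dots> = ennreal (r powr (real ?n - q - 1 + 1) / (real ?n - q - 1 + 1))"
   using q by (intro nn_integral_has_integral_lebesgue' has_integral_powr_from_0) auto
  also have "real ?n - q - 1 + 1 = real ?n - q" by simp
  finally show ?thesis by (simp only: ennreal_mult'[OF less_imp_le[OF S(1)]])
 qed
 show ?thesis using that S(1) 1 2 by blast
qed

lemma integrable_norm_powr_outside:
 assumes "real DIM('a::euclidean_space) < q" "0 < r"
 shows "integrable lborel (\<lambda>y::'a. norm y powr (-q) * indicator {r..} (norm y))"
proof (rule nn_integral_norm_powr[where 'a='a])
 fix S :: real
 assume *: "\<And>q r. real DIM('a) < q \<Longrightarrow> 0 < r \<Longrightarrow>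
   (\<integral>\<^sup>+(y::'a::euclidean_space). ennreal (norm y powr (-q) * indicator {r..} (norm y)) \<partial>lborel)
    = ennreal (S * (r powr (real DIM('a) - q) / (q - real DIM('a))))"
 show ?thesis by (intro integrableI_nonneg) (simp_all add: *[OF assms] del: times_divide_eq_right)
qed

lemma integrable_norm_powr_inside:
 assumes "q < real DIM('a::euclidean_space)" "0 < r"
 shows "integrable lborel (\<lambda>y::'a. norm y powr (-q) * indicator {..r} (norm y))"
proof (rule nn_integral_norm_powr[where 'a='a])
 fix S :: real
 assume *: "\<And>q r. q < real DIM('a) \<Longrightarrow> 0 < r \<Longrightarrow>
   (\<integral>\<^sup>+(y::'a::euclidean_space). ennreal (norm y powr (-q) * indicator {..r} (norm y)) \<partial>lborel)
    = ennreal (S * (r powr (real DIM('a) - q) / (real DIM('a) - q)))"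
 show ?thesis by (intro integrableI_nonneg) (simp_all add: *[OF assms] del: times_divide_eq_right)
qed

section \<open>Polynomially decaying weights and square integrable functions\<close>

definition decay :: "real \<Rightarrow> 'a::euclidean_space \<Rightarrow> real"
 where "decay p y = (1 + norm y) powr (-p)"

lemma decay_pos: "0 < decay p y"
 and decay_measurable [measurable]: "decay p \<in> borel_measurable borel"
proof -
 have "1 + norm y \<noteq> 0" for y :: 'a using norm_ge_zero[of y] by linarith
 then show "0 < decay p y" "decay p \<in> borel_measurable borel" 
  unfolding decay_def by (simp, measurable)
qed

lemma decay_le_1: "0 < p \<Longrightarrow> decay p y \<le> 1"
 unfolding decay_def by (simp add: powr_minus powr_le_one_le ge_one_powr_ge_zero divide_le_eq inverse_le_1_iff)

lemma decay_minus [simp]: "decay p (- y) = decay p y" by (simp add: decay_def)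
lemma integrable_decay:
 assumes "real DIM('a::euclidean_space) < p"
 shows "integrable lborel (decay p :: 'a \<Rightarrow> real)"
proof (rule Bochner_Integration.integrable_bound)
 show "integrable lborel (\<lambda>y::'a. norm y powr (-0) * indicator {..1} (norm y) + norm y powr (-p) * indicator {1..} (norm y))"
  using assms by (intro Bochner_Integration.integrable_add integrable_norm_powr_inside integrable_norm_powr_outside) auto
 show "AE y::'a in lborel. norm (decay p y) \<le> norm (norm y powr (-0) * indicator {..1} (norm y) + norm y powr (-p) * indicator {1..} (norm y))"
 proof (rule AE_mp[OF AE_lborel_singleton[of 0]], intro AE_I2 impI)
  fix y :: 'a assume "y \<noteq> 0"
  then show "norm (decay p y) \<le> norm (norm y powr (-0) * indicator {..1} (norm y) + norm y powr (-p) * indicator {1..} (norm y))"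
  proof (cases "norm y \<le> 1")
   case True
   have "0 < p" using assms of_nat_0_le_iff[of "DIM('a)"] by linarith
   then have "decay p y \<le> 1" by (rule decay_le_1)
   moreover have "0 \<le> norm y powr (-p) * indicator {1..} (norm y)" by simp
   ultimately show ?thesis using True decay_pos[of p y] \<open>y \<noteq> 0\<close> by (simp add: add_increasing2)
  next
   case False
   have "0 < p" using assms of_nat_0_le_iff[of "DIM('a)"] by linarith
   then have "decay p y \<le> norm y powr (-p)"
    unfolding decay_def using \<open>y \<noteq> 0\<close> by (intro powr_mono2') auto
   then show ?thesis using False decay_pos[of p y] by simp
  qed
 qed
qed measurable

text \<open>Borel measurability is required, rather than Lebesgue measurability, so that
  compositions with affine maps and with maps on the product space stay measurable.\<close>

definition square_integrable :: "('a::euclidean_space \<Rightarrow> real) \<Rightarrow> bool"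
 where "square_integrable u \<longleftrightarrow> u \<in> borel_measurable borel \<and> integrable lborel (\<lambda>x. (u x)\<^sup>2)"

lemma square_integrableD:
 assumes "square_integrable u"
 shows "u \<in> borel_measurable borel" "integrable lborel (\<lambda>x. (u x)\<^sup>2)"
 using assms by (auto simp: square_integrable_def)

lemma integrable_square_integrable_mult:
 assumes u: "square_integrable u" and v: "square_integrable v"
 shows "integrable lborel (\<lambda>x. u x * v x)"
proof (rule Bochner_Integration.integrable_bound)
 note [measurable] = square_integrableD(1)[OF u] square_integrableD(1)[OF v]
 show "integrable lborel (\<lambda>x. (u x)\<^sup>2 + (v x)\<^sup>2)"
  using square_integrableD(2)[OF u] square_integrableD(2)[OF v] by simp
 have "\<bar>a * b\<bar> \<le> a\<^sup>2 + b\<^sup>2" for a b :: real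
 proof -
  have "0 \<le> \<bar>a\<bar> * \<bar>b\<bar>" by simp
  then show ?thesis
   using sum_squares_bound[of "\<bar>a\<bar>" "\<bar>b\<bar>"] unfolding abs_mult power2_abs by linarith
 qed
 then show "AE x in lborel. norm (u x * v x) \<le> norm ((u x)\<^sup>2 + (v x)\<^sup>2)" by simp
qed (use assms in \<open>auto simp: square_integrable_def\<close>)

lemma square_integrable_bounded_integrable:
 assumes [measurable]: "f \<in> borel_measurable borel" and h: "integrable lborel h" "\<And>x. \<bar>f x\<bar> \<le> h x" "\<And>x. \<bar>f x\<bar> \<le> B"
 shows "square_integrable f"
 unfolding square_integrable_def
proof (intro conjI assms(1))
 show "integrable lborel (\<lambda>x. (f x)\<^sup>2)"
 proof (rule Bochner_Integration.integrable_bound)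
  show "integrable lborel (\<lambda>x. B * h x)" using h by simp
  show "AE x in lborel. norm ((f x)\<^sup>2) \<le> norm (B * h x)"
  proof (intro AE_I2)
   fix x
   have "\<bar>f x\<bar> * \<bar>f x\<bar> \<le> B * h x"
    using h(2)[of x] h(3)[of x] by (intro mult_mono) auto
   then show "norm ((f x)\<^sup>2) \<le> norm (B * h x)" by (simp add: power2_eq_square)
  qed
 qed measurable
qed

lemma square_integrable_shift:
 "square_integrable f \<Longrightarrow> square_integrable (\<lambda>x. f (x + t))"
 "square_integrable f \<Longrightarrow> square_integrable (\<lambda>x. f (x - t))"
 "square_integrable f \<Longrightarrow> square_integrable (\<lambda>x. f (t - x))"
 using integrable_shift[of "\<lambda>x. (f x)\<^sup>2" t]
 by (auto simp: square_integrable_def)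

lemma square_integrable_decay:
 assumes "real DIM('a::euclidean_space) < p"
 shows "square_integrable (decay p :: 'a \<Rightarrow> real)"
proof (rule square_integrable_bounded_integrable)
 have p: "0 < p" using assms of_nat_0_le_iff[of "DIM('a)"] by linarith
 show "integrable lborel (decay p :: 'a \<Rightarrow> real)" using integrable_decay assms by blast
 show "\<bar>decay p x\<bar> \<le> decay p x" "\<bar>decay p x\<bar> \<le> 1" for x :: 'a
  using decay_pos[of p x] decay_le_1[OF p, of x] by auto
qed measurable

lemma integrable_mult_decay:
 fixes u :: "'a::euclidean_space \<Rightarrow> real"
 assumes "square_integrable u" "real DIM('a) < p"
 shows "integrable lborel (\<lambda>y. \<bar>u y\<bar> * decay p (y - x))"
proof -
 have "integrable lborel (\<lambda>y. \<bar>u y * decay p (y - x)\<bar>)"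
  by (intro integrable_abs integrable_square_integrable_mult assms square_integrable_shift square_integrable_decay)
 then show ?thesis by (simp add: abs_mult decay_pos less_imp_le)
qed

section \<open>Limits and derivatives under the integral, and signs from test functions\<close>

lemma tendsto_integral_dominated:
 fixes f :: "'b::metric_space \<Rightarrow> 'a \<Rightarrow> real"
 assumes "\<And>x. x \<in> S \<Longrightarrow> x \<noteq> a \<Longrightarrow> f x \<in> borel_measurable M" "g \<in> borel_measurable M"
  and B: "integrable M B" "\<And>x. x \<in> S \<Longrightarrow> x \<noteq> a \<Longrightarrow> AE y in M. \<bar>f x y\<bar> \<le> B y"
  and lim: "AE y in M. ((\<lambda>x. f x y) \<longlongrightarrow> g y) (at a within S)"
 shows "((\<lambda>x. \<integral>y. f x y \<partial>M) \<longlongrightarrow> (\<integral>y. g y \<partial>M)) (at a within S)"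
 unfolding tendsto_at_iff_sequentially
proof (intro allI impI)
 fix X :: "nat \<Rightarrow> 'b" assume X: "\<forall>i. X i \<in> S - {a}" "X \<longlonglongrightarrow> a"
 show "((\<lambda>x. \<integral>y. f x y \<partial>M) \<circ> X) \<longlonglongrightarrow> (\<integral>y. g y \<partial>M)"
  unfolding o_def
 proof (rule integral_dominated_convergence[where w=B])
  show "AE y in M. (\<lambda>i. f (X i) y) \<longlonglongrightarrow> g y"
   using lim by eventually_elim (use X in \<open>simp add: tendsto_at_iff_sequentially o_def\<close>)
 qed (use assms X in auto)
qed

text \<open>The difference quotients at 0 integrate to zero, are dominated by B through the mean
  value inequality, and converge to the derivative. This is how an orthogonality relation that holds
  for all nearby points is differentiated.\<close>

lemma integral_derivative_zero:
 fixes F F' :: "real \<Rightarrow> 'a \<Rightarrow> real"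
 assumes d: "0 < d" and int: "\<And>t. \<bar>t\<bar> < d \<Longrightarrow> integrable M (F t)"
  and zero: "\<And>t. \<bar>t\<bar> < d \<Longrightarrow> (\<integral>y. F t y \<partial>M) = 0"
  and der: "\<And>t y. \<bar>t\<bar> < d \<Longrightarrow> ((\<lambda>t. F t y) has_real_derivative F' t y) (at t)"
  and B: "\<And>t y. \<bar>t\<bar> < d \<Longrightarrow> \<bar>F' t y\<bar> \<le> B y" "integrable M B"
  and meas: "F' 0 \<in> borel_measurable M"
 shows "(\<integral>y. F' 0 y \<partial>M) = 0"
proof -
 have [measurable]: "F t \<in> borel_measurable M" if "\<bar>t\<bar> < d" for t using int[OF that] by simp
 have "((\<lambda>t. \<integral>y. (F t y - F 0 y) / t \<partial>M) \<longlongrightarrow> (\<integral>y. F' 0 y \<partial>M)) (at 0 within {-d<..<d})"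
 proof (rule tendsto_integral_dominated[OF _ meas B(2)])
  fix t assume t: "t \<in> {-d<..<d}" "t \<noteq> 0"
  then show "(\<lambda>y. (F t y - F 0 y) / t) \<in> borel_measurable M" using d by (intro borel_measurable_divide borel_measurable_diff) auto
  have "\<bar>(F t y - F 0 y) / t\<bar> \<le> B y" for y
  proof -
   have "norm (F t y - F 0 y) \<le> B y * norm (t - 0)"
    by (rule field_differentiable_bound[where S="{-d<..<d}" and f'="\<lambda>t. F' t y"])
     (use der B t d in \<open>auto intro: has_field_derivative_at_within\<close>)
   then show ?thesis using t by (simp add: field_simps)
  qed
  then show "AE y in M. \<bar>(F t y - F 0 y) / t\<bar> \<le> B y" by simp
 next
  have "((\<lambda>t. (F t y - F 0 y) / t) \<longlongrightarrow> F' 0 y) (at 0)" for y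
   using der[of 0 y] d by (simp add: DERIV_def)
  then show "AE y in M. ((\<lambda>t. (F t y - F 0 y) / t) \<longlongrightarrow> F' 0 y) (at 0 within {-d<..<d})"
   by (intro AE_I2) (metis tendsto_within_subset subset_UNIV)
 qed
 moreover have "eventually (\<lambda>t. (\<integral>y. (F t y - F 0 y) / t \<partial>M) = 0) (at 0 within {-d<..<d})"
  unfolding eventually_at_filter
  by (rule always_eventually) (use int zero d in auto)
 ultimately have "((\<lambda>t. 0) \<longlongrightarrow> (\<integral>y. F' 0 y \<partial>M)) (at 0 within {-d<..<d})"
  by (rule Lim_transform_eventually)
 moreover have "at 0 within {-d<..<d} \<noteq> bot"
  using d at_within_open[of 0 "{-d<..<d}"] by simp
 ultimately show ?thesis using tendsto_unique tendsto_const by metis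
qed

text \<open>By Lindelof countably many of the balls cover the open set, and countably many null sets
  are harmless.\<close>

lemma AE_ball_cover:
 fixes \<Omega> :: "'a::euclidean_space set"
 assumes "open \<Omega>" "\<And>x. x \<in> \<Omega> \<Longrightarrow> \<exists>r>0. AE y in lborel. y \<in> ball x r \<longrightarrow> P y"
 shows "AE y in lborel. y \<in> \<Omega> \<longrightarrow> P y"
proof -
 obtain r where r: "\<And>x. x \<in> \<Omega> \<Longrightarrow> 0 < r x \<and> (AE y in lborel. y \<in> ball x (r x) \<longrightarrow> P y)"
  using assms(2) by metis
 obtain F' where F': "F' \<subseteq> (\<lambda>x. ball x (r x)) ` \<Omega>" "countable F'" "\<Union>F' = \<Union>((\<lambda>x. ball x (r x)) ` \<Omega>)"
  by (rule Lindelof[of "(\<lambda>x. ball x (r x)) ` \<Omega>"]) auto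
 have "AE y in lborel. \<forall>B\<in>F'. y \<in> B \<longrightarrow> P y"
  using F'(2) by (subst AE_ball_countable) (use F'(1) r in auto)
 moreover have "\<Omega> \<subseteq> \<Union>F'" unfolding F'(3) using r by (auto intro!: bexI)
 ultimately show ?thesis by (auto elim!: eventually_mono)
qed

text \<open>Lipschitz cutoffs increase to indicators of bounded open sets, so h has nonpositive
  integral over each of them. Outer regularity carries this to the set where h is positive, which
  must then be null. Lipschitz test functions are all that is needed later, and they have finite
  energy.\<close>

lemma AE_nonpos_of_lipschitz_test:
 fixes h :: "'a::euclidean_space \<Rightarrow> real"
 assumes U: "open U" and h[measurable]: "h \<in> borel_measurable borel"
  and loc: "\<And>R. integrable lborel (\<lambda>x. h x * indicator (ball 0 R) x)"
  and test: "\<And>g L R. L-lipschitz_on UNIV g \<Longrightarrow> (\<And>x. 0 \<le> g x) \<Longrightarrow> (\<And>x. g x \<le> 1) \<Longrightarrow>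
   (\<And>x. g x \<noteq> 0 \<Longrightarrow> x \<in> U \<and> norm x < R) \<Longrightarrow> (LBINT x. h x * g x) \<le> 0"
 shows "AE x in lborel. x \<in> U \<longrightarrow> h x \<le> 0"
proof -
 have main: "AE x in lborel. x \<in> U \<inter> ball 0 R \<longrightarrow> h x \<le> 0" for R
 proof -
  have op: "(LBINT x. h x * indicator V x) \<le> 0" if V: "open V" "V \<subseteq> U \<inter> ball 0 R" for V
  proof (rule LIMSEQ_le_const2)
   have ne: "- V \<noteq> {}" 
    using bounded_subset[OF bounded_ball V(2)[THEN order_trans, OF Int_lower2]] not_bounded_UNIV[where 'a='a] by (metis Compl_empty_eq double_complement)
   \<comment> \<open>Lipschitz with constant j, zero off V, and eventually 1 at each point of V
     because the distance to the closed complement is positive there.\<close>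
   let ?c = "\<lambda>j x. min 1 (real j * infdist x (- V))"
   have lim: "(\<lambda>j. ?c j x) \<longlonglongrightarrow> indicator V x" for x
   proof (cases "x \<in> V")
    case True
    then have "infdist x (- V) \<noteq> 0" using V ne in_closed_iff_infdist_zero[of "- V" x] by (auto simp: closed_Compl)
    then have pos: "0 < infdist x (- V)" by (simp add: infdist_nonneg less_le)
    have "eventually (\<lambda>j. ?c j x = 1) sequentially"
     using eventually_ge_at_top[of "nat \<lceil>1 / infdist x (- V)\<rceil>"]
     by eventually_elim (use pos in \<open>auto simp: min_def field_simps nat_ceiling_le_eq\<close>)
    then show ?thesis using True by (simp add: tendsto_eventually)
   qed simp
   show "(\<lambda>j. \<integral>x. h x * ?c j x \<partial>lborel) \<longlonglongrightarrow> (LBINT x. h x * indicator V x)"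
   proof (rule integral_dominated_convergence[where w="\<lambda>x. \<bar>h x * indicator (ball 0 R) x\<bar>"])
    show "integrable lborel (\<lambda>x. \<bar>h x * indicator (ball 0 R) x\<bar>)" using loc by (rule integrable_abs)
    have "\<bar>h x * ?c j x\<bar> \<le> \<bar>h x * indicator (ball 0 R) x\<bar>" for j x
    proof (cases "x \<in> ball 0 R")
     case True
     have "\<bar>h x\<bar> * \<bar>?c j x\<bar> \<le> \<bar>h x\<bar> * 1" by (intro mult_left_mono) (auto simp: infdist_nonneg)
     then show ?thesis using True by (simp add: abs_mult)
    next
     case False
     then have "x \<in> - V" using V by auto
     then show ?thesis by simp
    qed
    then show "AE x in lborel. norm (h x * ?c j x) \<le> \<bar>h x * indicator (ball 0 R) x\<bar>" for j by simp
    show "AE x in lborel. (\<lambda>j. h x * ?c j x) \<longlonglongrightarrow> h x * indicator V x"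
     by (intro AE_I2 tendsto_mult tendsto_const lim)
    have [measurable]: "V \<in> sets borel" using V by simp
    show "(\<lambda>x. h x * indicator V x) \<in> borel_measurable lborel" by measurable
    show "(\<lambda>x. h x * ?c j x) \<in> borel_measurable lborel" for j
     by (intro borel_measurable_times borel_measurable_min borel_measurable_const)
      (auto intro!: borel_measurable_continuous_onI continuous_on_infdist continuous_on_id)
   qed
   have "(LBINT x. h x * ?c j x) \<le> 0" for j
   proof (rule test[of "real j" _ R])
    show "(real j)-lipschitz_on UNIV (?c j)"
    proof (rule lipschitz_onI)
     fix x y :: 'a
     have "dist (?c j x) (?c j y) \<le> \<bar>real j * infdist x (- V) - real j * infdist y (- V)\<bar>"
      by (auto simp: dist_real_def min_def)
     also have "\<dots> = real j * \<bar>infdist x (- V) - infdist y (- V)\<bar>"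
      by (simp add: abs_mult flip: right_diff_distrib)
     also have "\<dots> \<le> real j * dist x y" by (intro mult_left_mono infdist_triangle_abs) auto
     finally show "dist (?c j x) (?c j y) \<le> real j * dist x y" .
    qed simp
    show "x \<in> U \<and> norm x < R" if "?c j x \<noteq> 0" for x
    proof -
     have "x \<in> V" using that by (cases "x \<in> V") auto
     then show ?thesis using V by auto
    qed
   qed (auto simp: infdist_nonneg)
   then show "\<exists>N. \<forall>j\<ge>N. (LBINT x. h x * ?c j x) \<le> 0" by blast
  qed
  \<comment> \<open>The bad set inside a ball; the aim is that h integrates to zero over it,
    although h is positive on it.\<close>
  define S where "S = {x \<in> U \<inter> ball 0 R. 0 < h x}"
  have US[measurable]: "U \<in> sets borel" using U by simp
  have S[measurable]: "S \<in> sets borel" unfolding S_def by measurable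
  then have Sl: "S \<in> sets lebesgue" by simp
  have "\<exists>T. open T \<and> S \<subseteq> T \<and> emeasure lebesgue (T - S) < ennreal (1 / real (Suc k))" for k
  proof -
   have "0 < 1 / real (Suc k)" by simp
   from sets_lebesgue_outer_open[OF Sl this] show ?thesis by blast
  qed
  then obtain T where T: "\<And>k. open (T k)" "\<And>k. S \<subseteq> T k"
   "\<And>k. emeasure lebesgue (T k - S) < ennreal (1 / real (Suc k))" by metis
  \<comment> \<open>A decreasing sequence of admissible open sets whose intersection exceeds S only
    by a null set. The intersections over i \<le> k provide the monotonicity that dominated
    convergence uses.\<close>
  define V where "V k = (\<Inter>i\<le>k. T i) \<inter> U \<inter> ball 0 R" for k :: nat
  define W where "W = (\<Inter>k. V k)"
  have V: "open (V k)" "V k \<subseteq> U \<inter> ball 0 R" "S \<subseteq> V k" for k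
   using T U unfolding V_def S_def by (auto intro!: open_INT)
  have Vs[measurable]: "V k \<in> sets borel" for k using V by simp
  have W[measurable]: "W \<in> sets borel" unfolding W_def by measurable
  have null: "emeasure lborel (W - S) = 0"
  proof -
   have "emeasure lborel (W - S) \<le> ennreal (1 / real (Suc k))" for k
   proof -
    have "emeasure lborel (W - S) \<le> emeasure lborel (T k - S)"
     using T(1)[of k] by (intro emeasure_mono) (auto simp: W_def V_def)
    also have "\<dots> = emeasure lebesgue (T k - S)" using T(1)[of k] by simp
    finally show ?thesis using T(3)[of k] by simp
   qed
   moreover have "(\<lambda>k. ennreal (1 / real (Suc k))) \<longlonglongrightarrow> ennreal 0"
    by (intro tendsto_ennrealI lim_1_over_n[THEN LIMSEQ_Suc])
   ultimately show ?thesis by (metis LIMSEQ_le_const ennreal_0 le_zero_eq)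
  qed
  have "(LBINT x. h x * indicator W x) \<le> 0"
  proof (rule LIMSEQ_le_const2)
   show "(\<lambda>k. \<integral>x. h x * indicator (V k) x \<partial>lborel) \<longlonglongrightarrow> (LBINT x. h x * indicator W x)"
   proof (rule integral_dominated_convergence[where w="\<lambda>x. \<bar>h x * indicator (ball 0 R) x\<bar>"])
    show "integrable lborel (\<lambda>x. \<bar>h x * indicator (ball 0 R) x\<bar>)" using loc by (rule integrable_abs)
    show "AE x in lborel. norm (h x * indicator (V k) x) \<le> \<bar>h x * indicator (ball 0 R) x\<bar>" for k
     using V(2)[of k] by (intro AE_I2) (auto simp: indicator_def)
    have "decseq V" unfolding V_def decseq_def by (auto; meson atMost_iff order_trans)
    then have "(\<lambda>k. indicator (V k) x) \<longlonglongrightarrow> (indicator W x :: real)" for x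
     unfolding W_def by (rule LIMSEQ_indicator_decseq)
    then show "AE x in lborel. (\<lambda>k. h x * indicator (V k) x) \<longlonglongrightarrow> h x * indicator W x"
     by (intro AE_I2 tendsto_mult tendsto_const)
   qed measurable
   show "\<exists>N. \<forall>k\<ge>N. (LBINT x. h x * indicator (V k) x) \<le> 0" using op V by blast
  qed
  also have "(LBINT x. h x * indicator W x) = (LBINT x. h x * indicator S x)"
  proof (rule integral_cong_AE)
   have "AE x in lborel. x \<notin> W - S" using null by (intro AE_not_in) (auto simp: null_sets_def)
   then show "AE x in lborel. h x * indicator W x = h x * indicator S x"
    by eventually_elim (use V(3) in \<open>auto simp: indicator_def W_def\<close>)
  qed measurable
  finally have le: "(LBINT x. h x * indicator S x) \<le> 0" .
  have int: "integrable lborel (\<lambda>x. h x * indicator S x)"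
   by (rule Bochner_Integration.integrable_bound[OF loc[of R]]) (auto simp: S_def indicator_def)
  have nn: "0 \<le> h x * indicator S x" for x by (auto simp: S_def indicator_def)
  have "(LBINT x. h x * indicator S x) = 0" using le nn by (intro antisym integral_nonneg) auto
  then have "AE x in lborel. h x * indicator S x = 0"
   using integral_nonneg_eq_0_iff_AE[OF int] nn by simp
  then show ?thesis by eventually_elim (auto simp: S_def indicator_def split: if_splits)
 qed
 have "AE x in lborel. \<forall>R::nat. x \<in> U \<inter> ball 0 (real R) \<longrightarrow> h x \<le> 0"
  by (subst AE_all_countable) (use main in blast)
 then show ?thesis
 proof eventually_elim
  fix x assume *: "\<forall>R::nat. x \<in> U \<inter> ball 0 (real R) \<longrightarrow> h x \<le> 0"
  obtain R :: nat where "norm x < real R" using reals_Archimedean2 by blast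
  with * show "x \<in> U \<longrightarrow> h x \<le> 0" by auto
 qed
qed

subsection \<open>Unique continuation for the kernel \<open>\<bar>x - y\<bar>\<^sup>-\<^sup>p\<close>\<close>

text \<open>Homogeneous polynomials, generated by multiplication with linear forms: the rule
  \<open>mult\<close> is the step along which unique continuation raises the degree.\<close>

inductive homog :: "nat \<Rightarrow> ('a::euclidean_space \<Rightarrow> real) \<Rightarrow> bool" where
 one: "homog 0 (\<lambda>_. 1)"
| mult: "homog N f \<Longrightarrow> homog (Suc N) (\<lambda>z. (z \<bullet> e) * f z)"
| add: "homog N f \<Longrightarrow> homog N g \<Longrightarrow> homog N (\<lambda>z. f z + g z)"
| scale: "homog N f \<Longrightarrow> homog N (\<lambda>z. c * f z)"

lemma homog_zero: "homog 0 (\<lambda>_. 0)"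
 using homog.scale[OF homog.one, of 0] by simp

lemma homog_continuous: "homog N f \<Longrightarrow> continuous_on UNIV f"
 by (induction rule: homog.induct) (auto intro!: continuous_intros)

lemma homog_measurable: "homog N f \<Longrightarrow> f \<in> borel_measurable borel"
 by (simp add: homog_continuous borel_measurable_continuous_onI)

lemma homog_scaleR: "homog N f \<Longrightarrow> f (c *\<^sub>R z) = c ^ N * f z"
 by (induction rule: homog.induct) (auto simp: algebra_simps)

lemma homog_bound: "homog N f \<Longrightarrow> \<exists>C\<ge>0. \<forall>z. \<bar>f z\<bar> \<le> C * norm z ^ N"
proof (induction rule: homog.induct)
 case one
 then show ?case by (auto intro!: exI[of _ 1])
next
 case (mult N f e)
 then obtain C where C: "0 \<le> C" "\<And>z. \<bar>f z\<bar> \<le> C * norm z ^ N" by blast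
 have "\<bar>(z \<bullet> e) * f z\<bar> \<le> (norm e * C) * norm z ^ Suc N" for z
 proof -
  have "\<bar>z \<bullet> e\<bar> * \<bar>f z\<bar> \<le> (norm z * norm e) * (C * norm z ^ N)"
   by (intro mult_mono Cauchy_Schwarz_ineq2 C) auto
  then show ?thesis by (simp add: abs_mult ac_simps)
 qed
 then show ?case using C(1) by (intro exI[of _ "norm e * C"]) auto
next
 case (add N f g)
 then obtain C D where C: "0 \<le> C" "\<And>z. \<bar>f z\<bar> \<le> C * norm z ^ N" and D: "0 \<le> D" "\<And>z. \<bar>g z\<bar> \<le> D * norm z ^ N" by blast
 have "\<bar>f z + g z\<bar> \<le> (C + D) * norm z ^ N" for z
  using C(2)[of z] D(2)[of z] by (simp add: distrib_right)
 then show ?case using C D by (intro exI[of _ "C + D"]) auto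
next
 case (scale N f c)
 then obtain C where C: "0 \<le> C" "\<And>z. \<bar>f z\<bar> \<le> C * norm z ^ N" by blast
 have "\<bar>c * f z\<bar> \<le> (\<bar>c\<bar> * C) * norm z ^ N" for z
  using mult_left_mono[OF C(2)[of z], of "\<bar>c\<bar>"] by (simp add: abs_mult ac_simps)
 then show ?case using C by (intro exI[of _ "\<bar>c\<bar> * C"]) auto
qed

text \<open>In degree 0 the truncated N - 1 is 0 again, so the vanishing of D has to be recorded
  separately.\<close>

lemma homog_derivative:
 "homog N f \<Longrightarrow> \<exists>D. homog (N - 1) D \<and> (N = 0 \<longrightarrow> D = (\<lambda>_. 0)) \<and>
  (\<forall>z t. ((\<lambda>t. f (z + t *\<^sub>R e)) has_real_derivative D (z + t *\<^sub>R e)) (at t))"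
proof (induction rule: homog.induct)
 case one
 then show ?case using homog_zero by (intro exI[of _ "\<lambda>_. 0"]) auto
next
 case (mult N f d)
 then obtain D where D: "homog (N - 1) D" "N = 0 \<longrightarrow> D = (\<lambda>_. 0)"
  "\<And>z t. ((\<lambda>t. f (z + t *\<^sub>R e)) has_real_derivative D (z + t *\<^sub>R e)) (at t)" by blast
 have D': "homog N (\<lambda>z. (z \<bullet> d) * D z)"
  using D(1,2) homog.mult[OF D(1), of d] homog_zero by (cases N) auto
 have "homog N (\<lambda>z. (e \<bullet> d) * f z + (z \<bullet> d) * D z)"
  by (intro homog.add homog.scale mult D')
 moreover have "((\<lambda>t. ((z + t *\<^sub>R e) \<bullet> d) * f (z + t *\<^sub>R e)) has_real_derivative
   (e \<bullet> d) * f (z + t *\<^sub>R e) + ((z + t *\<^sub>R e) \<bullet> d) * D (z + t *\<^sub>R e)) (at t)" for z t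
  by (auto intro!: derivative_eq_intros D(3) simp: inner_add_left)
 ultimately show ?case by (intro exI[of _ "\<lambda>z. (e \<bullet> d) * f z + (z \<bullet> d) * D z"]) auto
next
 case (add N f g)
 then obtain D D' where D: "homog (N - 1) D" "N = 0 \<longrightarrow> D = (\<lambda>_. 0)"
  "\<And>z t. ((\<lambda>t. f (z + t *\<^sub>R e)) has_real_derivative D (z + t *\<^sub>R e)) (at t)"
  and D': "homog (N - 1) D'" "N = 0 \<longrightarrow> D' = (\<lambda>_. 0)"
  "\<And>z t. ((\<lambda>t. g (z + t *\<^sub>R e)) has_real_derivative D' (z + t *\<^sub>R e)) (at t)" by blast
 show ?case
  by (rule exI[of _ "\<lambda>z. D z + D' z"])
   (use D D' in \<open>auto intro!: homog.add DERIV_add\<close>)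
next
 case (scale N f c)
 then obtain D where D: "homog (N - 1) D" "N = 0 \<longrightarrow> D = (\<lambda>_. 0)"
  "\<And>z t. ((\<lambda>t. f (z + t *\<^sub>R e)) has_real_derivative D (z + t *\<^sub>R e)) (at t)" by blast
 show ?case
  by (rule exI[of _ "\<lambda>z. c * D z"])
   (use D in \<open>auto intro!: homog.scale DERIV_cmult\<close>)
qed

text \<open>Sums across degrees, as the polynomials supplied by Stone-Weierstrass are not
  homogeneous.\<close>

inductive polysum :: "('a::euclidean_space \<Rightarrow> real) \<Rightarrow> bool" where
 homog: "homog N f \<Longrightarrow> polysum f"
| add: "polysum f \<Longrightarrow> polysum g \<Longrightarrow> polysum (\<lambda>z. f z + g z)"

lemma polysum_scale: "polysum f \<Longrightarrow> polysum (\<lambda>z. c * f z)"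
 by (induction rule: polysum.induct)
  (auto simp: distrib_left intro: polysum.intros homog.scale)

lemma polysum_inner: "polysum f \<Longrightarrow> polysum (\<lambda>z. (z \<bullet> e) * f z)"
 by (induction rule: polysum.induct)
  (auto simp: distrib_left intro: polysum.intros homog.mult)

lemma real_polynomial_function_polysum:
 assumes "real_polynomial_function (g :: 'a::euclidean_space \<Rightarrow> real)"
 shows "polysum g"
proof -
 \<comment> \<open>Strengthened to closure under multiplication by g, which turns the product case
   of the induction into a composition.\<close>
 have "\<forall>h. polysum h \<longrightarrow> polysum (\<lambda>z. g z * h z)"
  using assms
 proof (induction rule: real_polynomial_function.induct)
  case (linear f)
  interpret bounded_linear f by fact
  have f: "f z = z \<bullet> adjoint f 1" for z
   using adjoint_works[OF linear_axioms, of z 1] by simp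
  show ?case by (auto simp: f intro: polysum_inner)
 next
  case (const c)
  then show ?case by (auto intro: polysum_scale)
 next
  case (add f g)
  then show ?case by (auto simp: distrib_right intro: polysum.add)
 next
  case (mult f g)
  then show ?case by (auto simp: mult.assoc)
 qed
 from this[rule_format, OF polysum.homog[OF homog.one]] show ?thesis by simp
qed

lemma has_real_derivative_inner_powr:
 fixes z e :: "'a::real_inner"
 assumes "z + t *\<^sub>R e \<noteq> 0"
 shows "((\<lambda>t. ((z + t *\<^sub>R e) \<bullet> (z + t *\<^sub>R e)) powr (-b)) has_real_derivative
  - 2 * b * ((z + t *\<^sub>R e) \<bullet> e) * ((z + t *\<^sub>R e) \<bullet> (z + t *\<^sub>R e)) powr (- (b + 1))) (at t)"
proof -
 have g: "((\<lambda>t. (z + t *\<^sub>R e) \<bullet> (z + t *\<^sub>R e)) has_real_derivative 2 * ((z + t *\<^sub>R e) \<bullet> e)) (at t)"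
  unfolding has_field_derivative_def
  by (auto intro!: derivative_eq_intros simp: fun_eq_iff algebra_simps inner_commute)
 have "((\<lambda>t. ((z + t *\<^sub>R e) \<bullet> (z + t *\<^sub>R e)) powr (-b)) has_real_derivative
  (-b) * ((z + t *\<^sub>R e) \<bullet> (z + t *\<^sub>R e)) powr (-b - of_nat 1) * (2 * ((z + t *\<^sub>R e) \<bullet> e))) (at t)"
  by (rule DERIV_fun_powr[OF g]) (use assms in simp)
 moreover have "- b - of_nat 1 = - (b + 1)" by simp
 ultimately show ?thesis by (simp only:) (simp add: mult_ac)
qed

context
 fixes u :: "'a::euclidean_space \<Rightarrow> real" and p r \<rho> :: real
 assumes u: "square_integrable u" and p: "real DIM('a) < p"
  and r: "0 < \<rho>" "2 * \<rho> \<le> r" and zero: "\<And>y. norm y < r \<Longrightarrow> u y = 0"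
begin

private lemma um: "u \<in> borel_measurable borel"
 using u by (rule square_integrableD)

text \<open>Where u is nonzero, |y| \<ge> r \<ge> 2 \<rho>, so |x - y| is comparable to 1 + |y|
  uniformly in x. The bound on b says that the kernel decays at least like |x - y|^(-p), and one
  integrable majorant then serves all x near the origin.\<close>

private lemma kernel_bound:
 assumes f: "homog N f" and b: "p + real N \<le> 2 * b"
 obtains C where "0 \<le> C" "\<And>x y. norm x < \<rho> \<Longrightarrow>
  \<bar>u y * (f (x - y) * ((x - y) \<bullet> (x - y)) powr (-b))\<bar> \<le> C * (\<bar>u y\<bar> * decay p y)"
proof -
 have r0: "0 < r" using r by linarith
 obtain C where C: "0 \<le> C" "\<And>z. \<bar>f z\<bar> \<le> C * norm z ^ N"
  using homog_bound[OF f] by blast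
 \<comment> \<open>From |x| < r / 2 \<le> |y| / 2 follows |x - y| \<ge> |y| / 2, and t / (1 + t) is
   increasing, so |y| / 2 \<ge> c (1 + |y|) for |y| \<ge> r.\<close>
 define c where "c = r / (2 * (1 + r))"
 have c: "0 < c" using r0 by (simp add: c_def)
 define k where "k = real N - 2 * b"
 have k: "k \<le> -p" using b by (simp add: k_def)
 have p0: "0 < p" using p of_nat_0_le_iff[of "DIM('a)"] by linarith
 show ?thesis
 proof (rule that[of "C * c powr k"])
  show "0 \<le> C * c powr k" using C by simp
  fix x y :: 'a assume x: "norm x < \<rho>"
  show "\<bar>u y * (f (x - y) * ((x - y) \<bullet> (x - y)) powr (-b))\<bar> \<le> C * c powr k * (\<bar>u y\<bar> * decay p y)"
  proof (cases "norm y < r")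
   case True then show ?thesis by (simp add: zero)
  next
   case False
   have "norm y / 2 \<le> norm (x - y)" using norm_triangle_ineq2[of y x] x False r by (simp add: norm_minus_commute)
   moreover have "c * (1 + norm y) \<le> norm y / 2" using False r0 by (simp add: c_def field_simps)
   ultimately have *: "c * (1 + norm y) \<le> norm (x - y)" by linarith
   have pos: "0 < 1 + norm y" using norm_ge_zero[of y] by linarith
   have pos2: "0 < norm (x - y)" using * c pos mult_pos_pos[OF c pos] by linarith
   have q: "((x - y) \<bullet> (x - y)) powr (-b) = norm (x - y) powr (- 2 * b)"
    using pos2 by (simp add: dot_square_norm powr_power powr_powr flip: powr_numeral)
   have "\<bar>f (x - y)\<bar> * ((x - y) \<bullet> (x - y)) powr (-b) \<le> C * norm (x - y) ^ N * norm (x - y) powr (- 2 * b)"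
    unfolding q by (intro mult_right_mono C) auto
   also have "\<dots> = C * norm (x - y) powr k"
    using pos2 by (simp add: k_def powr_realpow[symmetric] powr_add[symmetric])
   also have "\<dots> \<le> C * (c * (1 + norm y)) powr k"
    using * C c pos k p0 by (intro mult_left_mono powr_mono2') auto
   also have "\<dots> = C * c powr k * (1 + norm y) powr k"
    using c pos by (simp add: powr_mult)
   also have "\<dots> \<le> C * c powr k * decay p y"
    unfolding decay_def using C k norm_ge_zero[of y] by (intro mult_left_mono powr_mono) auto
   finally have "\<bar>u y\<bar> * (\<bar>f (x - y)\<bar> * ((x - y) \<bullet> (x - y)) powr (-b)) \<le> \<bar>u y\<bar> * (C * c powr k * decay p y)"
    by (intro mult_left_mono) auto
   then show ?thesis by (simp add: abs_mult ac_simps)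
  qed
 qed
qed

private lemma dom: "integrable lborel (\<lambda>y. C * (\<bar>u y\<bar> * decay p y))"
 using integrable_mult_decay[OF u p, of 0] by simp

private lemma km: "homog N f \<Longrightarrow> (\<lambda>y. u y * (f (x - y) * ((x - y) \<bullet> (x - y)) powr (-b))) \<in> borel_measurable lborel"
 using homog_measurable[of N f] um by measurable

private lemma kernel_integrable:
 assumes f: "homog N f" and b: "p + real N \<le> 2 * b" and x: "norm x < \<rho>"
 shows "integrable lborel (\<lambda>y. u y * (f (x - y) * ((x - y) \<bullet> (x - y)) powr (-b)))"
proof -
 obtain C where C: "0 \<le> C" "\<And>x y. norm x < \<rho> \<Longrightarrow>
  \<bar>u y * (f (x - y) * ((x - y) \<bullet> (x - y)) powr (-b))\<bar> \<le> C * (\<bar>u y\<bar> * decay p y)"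
  using kernel_bound[OF f b] by blast
 show ?thesis
  by (rule Bochner_Integration.integrable_bound[OF dom[of C] km[OF f]])
   (use C x in \<open>auto intro!: AE_I2 order_trans[OF C(2)]\<close>)
qed

text \<open>The exponent is attached to the inner product of x - y with itself, that is, to the
  square of the norm; one differentiation then raises it by exactly 1.\<close>

private definition vanishes :: "('a \<Rightarrow> real) \<Rightarrow> real \<Rightarrow> bool" where
 "vanishes f b \<longleftrightarrow> (\<forall>x. norm x < \<rho> \<longrightarrow>
  (LBINT y. u y * (f (x - y) * ((x - y) \<bullet> (x - y)) powr (-b))) = 0)"

text \<open>The product rule: the derivative of f(z) (z \<bullet> z)^(-b) in direction e has one
  term with the derivative of f and one term -2 b (z \<bullet> e) f(z) (z \<bullet> z)^(-b-1). Their
  sum integrates to zero against u.\<close>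

private lemma vanishes_derivative:
 assumes f: "homog N f" and D: "homog (N - 1) D"
  "\<And>z t. ((\<lambda>t. f (z + t *\<^sub>R e)) has_real_derivative D (z + t *\<^sub>R e)) (at t)"
  and b: "p + real N \<le> 2 * b" and v: "vanishes f b" and x: "norm x < \<rho>"
 shows "(LBINT y. u y * (D (x - y) * ((x - y) \<bullet> (x - y)) powr (-b)))
  = 2 * b * (LBINT y. u y * (((x - y) \<bullet> e) * f (x - y) * ((x - y) \<bullet> (x - y)) powr (-(b + 1))))"
proof -
 \<comment> \<open>Small enough to keep x + t e in the ball of radius \<rho>; the added 1 covers e =
   0.\<close>
 define d where "d = (\<rho> - norm x) / (norm e + 1)"
 have d0: "0 < d" using x by (auto simp: d_def intro!: divide_pos_pos add_nonneg_pos)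
 have xt: "norm (x + t *\<^sub>R e) < \<rho>" if "\<bar>t\<bar> < d" for t
 proof -
  have "norm (x + t *\<^sub>R e) \<le> norm x + \<bar>t\<bar> * norm e" using norm_triangle_ineq[of x "t *\<^sub>R e"] by simp
  moreover have "\<bar>t\<bar> * (norm e + 1) < \<rho> - norm x"
   using that unfolding d_def by (subst (asm) pos_less_divide_eq) (auto intro: add_nonneg_pos)
  moreover have "\<bar>t\<bar> * norm e \<le> \<bar>t\<bar> * (norm e + 1)" by (intro mult_left_mono) auto
  ultimately show ?thesis by linarith
 qed
 have b1: "p + real (N - 1) \<le> 2 * b" using b by auto
 have b2: "p + real (Suc N) \<le> 2 * (b + 1)" using b by auto
 let ?q = "\<lambda>z::'a. z \<bullet> z"
 note g = homog.mult[OF f, of e]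
 obtain C1 where C1: "0 \<le> C1" "\<And>x y. norm x < \<rho> \<Longrightarrow> \<bar>u y * (D (x - y) * ?q (x - y) powr (-b))\<bar> \<le> C1 * (\<bar>u y\<bar> * decay p y)"
  using kernel_bound[OF D(1) b1] by blast
 obtain C2 where C2: "0 \<le> C2" "\<And>x y. norm x < \<rho> \<Longrightarrow> \<bar>u y * (((x - y) \<bullet> e) * f (x - y) * ?q (x - y) powr (-(b + 1)))\<bar> \<le> C2 * (\<bar>u y\<bar> * decay p y)"
  using kernel_bound[OF g b2] by blast
 define F' where "F' t y = u y * (D (x + t *\<^sub>R e - y) * ?q (x + t *\<^sub>R e - y) powr (-b)) - 2 * b *
  (u y * (((x + t *\<^sub>R e - y) \<bullet> e) * f (x + t *\<^sub>R e - y) * ?q (x + t *\<^sub>R e - y) powr (-(b + 1))))" for t y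
 have "(LBINT y. F' 0 y) = 0"
 proof (rule integral_derivative_zero[OF d0,
   where F="\<lambda>t y. u y * (f (x + t *\<^sub>R e - y) * ?q (x + t *\<^sub>R e - y) powr (-b))" and
   B="\<lambda>y. (C1 + \<bar>2 * b\<bar> * C2) * (\<bar>u y\<bar> * decay p y)"])
  fix t assume t: "\<bar>t\<bar> < d"
  show "integrable lborel (\<lambda>y. u y * (f (x + t *\<^sub>R e - y) * ?q (x + t *\<^sub>R e - y) powr (-b)))"
   by (rule kernel_integrable[OF f b xt[OF t]])
  show "(LBINT y. u y * (f (x + t *\<^sub>R e - y) * ?q (x + t *\<^sub>R e - y) powr (-b))) = 0"
   using v xt[OF t] by (simp add: vanishes_def)
  fix y
  show "((\<lambda>t. u y * (f (x + t *\<^sub>R e - y) * ?q (x + t *\<^sub>R e - y) powr (-b))) has_real_derivative F' t y) (at t)"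
  proof (cases "norm y < r")
   case True
   then show ?thesis by (simp add: F'_def zero)
  next
   case False
   have eq: "x + t *\<^sub>R e - y = (x - y) + t *\<^sub>R e" for t by simp
   have "norm (x + t *\<^sub>R e) < norm y" using xt[OF t] False r by linarith
   then have nz: "(x - y) + t *\<^sub>R e \<noteq> 0" by (auto simp: algebra_simps)
   show ?thesis unfolding F'_def eq
    by (rule DERIV_cong[OF DERIV_cmult[OF DERIV_mult[OF D(2) has_real_derivative_inner_powr[OF nz]]]])
     (simp add: algebra_simps)
  qed
  have "\<bar>F' t y\<bar> \<le> \<bar>u y * (D (x + t *\<^sub>R e - y) * ?q (x + t *\<^sub>R e - y) powr (-b))\<bar> + \<bar>2 * b\<bar> *
  \<bar>u y * (((x + t *\<^sub>R e - y) \<bullet> e) * f (x + t *\<^sub>R e - y) * ?q (x + t *\<^sub>R e - y) powr (-(b + 1)))\<bar>"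
   unfolding F'_def abs_mult[symmetric] by (rule abs_triangle_ineq4)
  also have "\<dots> \<le> C1 * (\<bar>u y\<bar> * decay p y) + \<bar>2 * b\<bar> * (C2 * (\<bar>u y\<bar> * decay p y))"
   by (intro add_mono mult_left_mono C1 C2 xt t) auto
  finally show "\<bar>F' t y\<bar> \<le> (C1 + \<bar>2 * b\<bar> * C2) * (\<bar>u y\<bar> * decay p y)" by (simp add: algebra_simps)
 next
  show "integrable lborel (\<lambda>y. (C1 + \<bar>2 * b\<bar> * C2) * (\<bar>u y\<bar> * decay p y))" by (rule dom)
  show "F' 0 \<in> borel_measurable lborel"
   unfolding F'_def by (intro borel_measurable_diff borel_measurable_times borel_measurable_const km[OF D(1)] km[OF g])
 qed
 then show ?thesis
  unfolding F'_def using kernel_integrable[OF D(1) b1 x] kernel_integrable[OF g b2 x] by simp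
qed

text \<open>The Laplacian of |z|^(-2b) is 2 b (2 b + 2 - n) |z|^(-2b-2), with a nonzero factor
  because 2 b \<ge> p > n. In the proof two derivatives in each basis direction give n I = 2 (b + 1)
  I for the integral I in question.\<close>

private lemma vanishes_Suc_one:
 assumes b: "p \<le> 2 * b" and v: "vanishes (\<lambda>_. 1) b"
 shows "vanishes (\<lambda>_. 1) (b + 1)"
proof -
 have p0: "0 < p" using p of_nat_0_le_iff[of "DIM('a)"] by linarith
 have lin: "homog 1 (\<lambda>z::'a. (z \<bullet> e) * 1)" for e using homog.mult[OF homog.one] by simp
 have 1: "vanishes (\<lambda>z. (z \<bullet> e) * 1) (b + 1)" for e
  unfolding vanishes_def
  using vanishes_derivative[OF homog.one, of "\<lambda>_. 0" e b] homog_zero b p0 v by auto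
 have 2: "(LBINT y. u y * (((x - y) \<bullet> e) * ((x - y) \<bullet> e) * ((x - y) \<bullet> (x - y)) powr (-(b + 1 + 1))))
   = (LBINT y. u y * ((e \<bullet> e) * ((x - y) \<bullet> (x - y)) powr (-(b + 1)))) / (2 * (b + 1))"
  if x: "norm x < \<rho>" for x e
 proof -
  have "(LBINT y. u y * ((e \<bullet> e) * 1 * ((x - y) \<bullet> (x - y)) powr (-(b + 1))))
   = 2 * (b + 1) * (LBINT y. u y * (((x - y) \<bullet> e) * (((x - y) \<bullet> e) * 1) * ((x - y) \<bullet> (x - y)) powr (-(b + 1 + 1))))"
  proof (rule vanishes_derivative[OF lin _ _ _ 1 x, where e=e])
   show "homog (1 - 1) (\<lambda>z. (e \<bullet> e) * 1)" using homog.scale[OF homog.one] by simp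
   show "((\<lambda>t. (z + t *\<^sub>R e) \<bullet> e * 1) has_real_derivative e \<bullet> e * 1) (at t)" for z t
    by (auto intro!: derivative_eq_intros simp: inner_add_left)
  qed (use b in auto)
  then show ?thesis using b p0 by (simp add: field_simps)
 qed
 show ?thesis unfolding vanishes_def
 proof (intro allI impI)
  fix x :: 'a assume x: "norm x < \<rho>"
  let ?I = "\<integral>y. u y * (1 * ((x - y) \<bullet> (x - y)) powr (-(b + 1))) \<partial>lborel"
  have int: "integrable lborel (\<lambda>y. u y * (((x - y) \<bullet> e) * ((x - y) \<bullet> e) * ((x - y) \<bullet> (x - y)) powr (-(b + 1 + 1))))" for e
   using kernel_integrable[OF homog.mult[OF lin[of e], of e] _ x, of "b + 1 + 1"] b by simp
  have "?I = (LBINT y. (\<Sum>e\<in>Basis. u y * (((x - y) \<bullet> e) * ((x - y) \<bullet> e) * ((x - y) \<bullet> (x - y)) powr (-(b + 1 + 1)))))"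
  proof (rule Bochner_Integration.integral_cong[OF refl])
   fix y :: 'a
   have e: "1 + - (b + 1 + 1) = - (b + 1)" by simp
   have "(\<Sum>e\<in>Basis. u y * (((x - y) \<bullet> e) * ((x - y) \<bullet> e) * ((x - y) \<bullet> (x - y)) powr (-(b + 1 + 1))))
    = u y * (((x - y) \<bullet> (x - y)) * ((x - y) \<bullet> (x - y)) powr (-(b + 1 + 1)))"
    by (simp add: euclidean_inner[of "x - y" "x - y"] sum_distrib_left sum_distrib_right)
   also have "((x - y) \<bullet> (x - y)) * ((x - y) \<bullet> (x - y)) powr (-(b + 1 + 1)) = ((x - y) \<bullet> (x - y)) powr (-(b + 1))"
    using powr_mult_base[of "(x - y) \<bullet> (x - y)" "-(b + 1 + 1)"] by (simp only: e inner_ge_zero)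
   finally show "u y * (1 * ((x - y) \<bullet> (x - y)) powr (-(b + 1))) = (\<Sum>e\<in>Basis. u y * (((x - y) \<bullet> e) * ((x - y) \<bullet> e) * ((x - y) \<bullet> (x - y)) powr (-(b + 1 + 1))))"
    by simp
  qed
  also have "\<dots> = (\<Sum>e\<in>Basis. \<integral>y. u y * (((x - y) \<bullet> e) * ((x - y) \<bullet> e) * ((x - y) \<bullet> (x - y)) powr (-(b + 1 + 1))) \<partial>lborel)"
   by (rule Bochner_Integration.integral_sum[OF int])
  also have "\<dots> = (\<Sum>e\<in>(Basis::'a set). ?I / (2 * (b + 1)))"
   by (rule sum.cong[OF refl]) (simp only: 2[OF x] inner_same_Basis)
  also have "\<dots> = real DIM('a) * ?I / (2 * (b + 1))" by simp
  finally have "2 * (b + 1) * ?I = real DIM('a) * ?I" using b p0 by (simp add: field_simps)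
  moreover have "real DIM('a) < 2 * (b + 1)"
   by (rule less_le_trans[OF p order_trans[OF b]]) simp
  then have "2 * (b + 1) \<noteq> real DIM('a)" by simp
  ultimately show "?I = 0" by simp
 qed
qed

text \<open>At x = 0, the relation for degree N with exponent p/2 + N says that v = u |y|^(-p) is
  orthogonal to every homogeneous polynomial in -y / |y|^2. As u vanishes near the origin, this
  inversion maps its support into a bounded ball, where polynomials are uniformly dense.\<close>

lemma unique_continuation_origin:
 assumes ker: "\<And>x. norm x < \<rho> \<Longrightarrow> (LBINT y. u y * norm (x - y) powr (-p)) = 0"
 shows "AE y in lborel. u y = 0"
proof -
 have p0: "0 < p" using p of_nat_0_le_iff[of "DIM('a)"] by linarith
 have np: "norm z powr (-p) = (z \<bullet> z) powr (- (p / 2))" for z :: 'a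
  by (cases "z = 0") (simp_all add: dot_square_norm powr_powr flip: powr_numeral)
 have one: "vanishes (\<lambda>_. 1) (p / 2 + real j)" for j :: nat
 proof (induction j)
  case 0 then show ?case using ker by (simp add: vanishes_def np)
 next
  case (Suc j)
  then show ?case using vanishes_Suc_one[OF _ Suc] by (simp add: algebra_simps)
 qed
 \<comment> \<open>The derivative identity for f at exponent k expresses (z \<bullet> e) f at k + 1
   through f and its derivative at k. The derivative has smaller degree but is not a subterm of f,
   hence the strong induction on the degree around the structural one.\<close>
 have van: "\<forall>j\<ge>N. vanishes f (p / 2 + real j)" if "homog N f" for N f
  using that
 proof (induction N arbitrary: f rule: less_induct)
  case (less N)
  show ?case using less.prems less.IH
  proof (induction rule: homog.induct)
   case one then show ?case using \<open>\<And>j. vanishes (\<lambda>_. 1) (p / 2 + real j)\<close> by simp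
  next
   case (mult N f e)
   show ?case
   proof (intro allI impI)
    fix j assume "Suc N \<le> j"
    then obtain k where k: "j = Suc k" "N \<le> k" by (cases j) auto
    obtain D where D: "homog (N - 1) D" "N = 0 \<longrightarrow> D = (\<lambda>_. 0)"
     "\<And>z t. ((\<lambda>t. f (z + t *\<^sub>R e)) has_real_derivative D (z + t *\<^sub>R e)) (at t)"
     using homog_derivative[OF mult.hyps, of e] by blast
    have vf: "vanishes f (p / 2 + real k)"
     using mult.prems[OF _ mult.hyps] k by auto
    have vD: "vanishes D (p / 2 + real k)"
    proof (cases N)
     case 0 then show ?thesis using D(2) by (simp add: vanishes_def)
    next
     case (Suc N')
     then show ?thesis using mult.prems[of "N - 1" D] D(1) k by auto
    qed
    show "vanishes (\<lambda>z. z \<bullet> e * f z) (p / 2 + real j)"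
     unfolding vanishes_def
    proof (intro allI impI)
     fix x :: 'a assume x: "norm x < \<rho>"
     have "2 * (p / 2 + real k) * (LBINT y. u y * (((x - y) \<bullet> e) * f (x - y) * ((x - y) \<bullet> (x - y)) powr (-(p / 2 + real k + 1)))) = 0"
      using vanishes_derivative[OF mult.hyps D(1,3) _ vf x] vD x k by (simp add: vanishes_def)
     moreover have "0 < p / 2 + real k" using p0 by (simp add: add_pos_nonneg)
     then have "2 * (p / 2 + real k) \<noteq> 0" by simp
     ultimately show "(LBINT y. u y * (((x - y) \<bullet> e) * f (x - y) * ((x - y) \<bullet> (x - y)) powr (-(p / 2 + real j)))) = 0"
      by (simp add: k add.assoc add.commute[of 1])
    qed
   qed
  next
   case (add N f g)
   show ?case
   proof (intro allI impI)
    fix j assume j: "N \<le> j"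
    have b: "p + real N \<le> 2 * (p / 2 + real j)" using j by simp
    have *: "vanishes f (p / 2 + real j)" "vanishes g (p / 2 + real j)" using add j by auto
    show "vanishes (\<lambda>z. f z + g z) (p / 2 + real j)"
     unfolding vanishes_def
    proof (intro allI impI)
     fix x :: 'a assume x: "norm x < \<rho>"
     have "integrable lborel (\<lambda>y. u y * (f (x - y) * ((x - y) \<bullet> (x - y)) powr (-(p / 2 + real j))))"
      "integrable lborel (\<lambda>y. u y * (g (x - y) * ((x - y) \<bullet> (x - y)) powr (-(p / 2 + real j))))"
      using kernel_integrable[OF add.hyps(1) b x] kernel_integrable[OF add.hyps(2) b x] by blast+
     then show "(LBINT y. u y * ((f (x - y) + g (x - y)) * ((x - y) \<bullet> (x - y)) powr (-(p / 2 + real j)))) = 0"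
      using * x by (simp add: vanishes_def distrib_left distrib_right)
    qed
   qed
  next
   case (scale N f c)
   then show ?case by (auto simp: vanishes_def mult.assoc mult.left_commute[of _ c])
  qed
 qed
 have r0: "0 < r" using r by linarith
 define v where "v y = u y * (y \<bullet> y) powr (- (p / 2))" for y
 \<comment> \<open>The inversion carries a minus sign because the kernels are evaluated at 0 - y; it
   is an involution away from the origin.\<close>
 define \<zeta> where "\<zeta> y = - (y /\<^sub>R (y \<bullet> y))" for y :: 'a
 have [measurable]: "u \<in> borel_measurable borel" by (rule um)
 have vm[measurable]: "v \<in> borel_measurable borel" unfolding v_def by measurable
 have zm[measurable]: "\<zeta> \<in> borel_measurable borel" unfolding \<zeta>_def by measurable
 have vint: "integrable lborel v"
  using kernel_integrable[OF homog.one, of "p / 2" 0] r by (simp add: v_def[abs_def])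
 have nz: "norm (\<zeta> y) = 1 / norm y" for y
  by (simp add: \<zeta>_def dot_square_norm power2_eq_square field_simps)
 have supp: "r \<le> norm y \<and> y \<noteq> 0 \<and> \<zeta> y \<in> cball 0 (1 / r)" if "v y \<noteq> 0" for y
 proof -
  have "r \<le> norm y" using that zero[of y] by (auto simp: v_def not_less[symmetric])
  then show ?thesis using r0 by (auto simp: nz frac_le)
 qed
 have vi: "integrable lborel (\<lambda>y. v y * F (\<zeta> y))"
  if [measurable]: "(\<lambda>y. v y * F (\<zeta> y)) \<in> borel_measurable borel" and B: "\<And>z. z \<in> cball 0 (1 / r) \<Longrightarrow> \<bar>F z\<bar> \<le> B" for F B
 proof (rule Bochner_Integration.integrable_bound[OF integrable_mult_right[OF vint, of B]])
  have "\<bar>v y * F (\<zeta> y)\<bar> \<le> \<bar>B * v y\<bar>" for y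
  proof (cases "v y = 0")
   case False
   from supp[OF this] have "\<bar>F (\<zeta> y)\<bar> \<le> \<bar>B\<bar>" using B by force
   then show ?thesis by (simp add: abs_mult mult.commute[of "\<bar>v y\<bar>"] mult_right_mono)
  qed simp
  then show "AE y in lborel. norm (v y * F (\<zeta> y)) \<le> norm (B * v y)" by simp
 qed measurable
 have vhom: "homog N f \<Longrightarrow> (LBINT y. v y * f (\<zeta> y)) = 0" for N f
 proof -
  assume f: "homog N f"
  have "(LBINT y. v y * f (\<zeta> y)) = (LBINT y. u y * (f (0 - y) * ((0 - y) \<bullet> (0 - y)) powr (-(p / 2 + real N))))"
  proof (rule Bochner_Integration.integral_cong[OF refl])
   fix y
   show "v y * f (\<zeta> y) = u y * (f (0 - y) * ((0 - y) \<bullet> (0 - y)) powr (-(p / 2 + real N)))"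
   proof (cases "u y = 0")
    case False
    then have y: "y \<noteq> 0" using zero[of 0] r0 by auto
    have "f (\<zeta> y) = f (inverse (y \<bullet> y) *\<^sub>R (0 - y))" by (simp add: \<zeta>_def)
    also have "\<dots> = inverse (y \<bullet> y) ^ N * f (0 - y)" by (rule homog_scaleR[OF f])
    also have "inverse (y \<bullet> y) ^ N = (y \<bullet> y) powr (- real N)"
     using y by (simp add: powr_minus powr_realpow power_inverse)
    finally show ?thesis using y by (simp add: v_def powr_add[symmetric] algebra_simps)
   qed (simp add: v_def)
  qed
  also have "\<dots> = 0"
  proof -
   have "vanishes f (p / 2 + real N)" using van[OF f] by blast
   then show ?thesis unfolding vanishes_def using r(1) by (metis norm_zero)
  qed
  finally show ?thesis .
 qed
 have vpoly: "(LBINT y. v y * f (\<zeta> y)) = 0 \<and> continuous_on UNIV f" if "polysum f" for f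
  using that
 proof (induction rule: polysum.induct)
  case (homog N f) then show ?case by (simp add: vhom homog_continuous)
 next
  case (add f g)
  have "integrable lborel (\<lambda>y. v y * h (\<zeta> y))" if h: "continuous_on UNIV h" for h
  proof -
   have [measurable]: "h \<in> borel_measurable borel" using h by (rule borel_measurable_continuous_onI)
   have "compact (h ` cball 0 (1 / r))" by (intro compact_continuous_image continuous_on_subset[OF h]) auto
   then have "bounded (h ` cball 0 (1 / r))" by (rule compact_imp_bounded)
   then obtain B where "\<forall>z\<in>cball 0 (1 / r). \<bar>h z\<bar> \<le> B" unfolding bounded_iff by auto
   then show ?thesis by (intro vi[of h B]) auto
  qed
  then show ?case using add by (auto simp: distrib_left intro!: continuous_intros)
 qed
 have vcont: "(LBINT y. v y * F (\<zeta> y)) = 0"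
  if F: "continuous_on (cball 0 (1 / r)) F" and [measurable]: "(\<lambda>y. v y * F (\<zeta> y)) \<in> borel_measurable borel" for F
 proof -
  have bnd: "\<bar>\<integral>y. v y * F (\<zeta> y) \<partial>lborel\<bar> \<le> e * (LBINT y. \<bar>v y\<bar>)" if e: "0 < e" for e
  proof -
   obtain g where g: "real_polynomial_function g" "\<And>z. z \<in> cball 0 (1 / r) \<Longrightarrow> \<bar>F z - g z\<bar> < e"
    using Stone_Weierstrass_real_polynomial_function[OF compact_cball F e] by blast
   note pg = vpoly[OF real_polynomial_function_polysum[OF g(1)]]
   have [measurable]: "g \<in> borel_measurable borel" using pg by (auto intro: borel_measurable_continuous_onI)
   have bF: "\<exists>B. \<forall>z\<in>cball 0 (1/r). \<bar>h z\<bar> \<le> B" if "continuous_on (cball 0 (1 / r)) h" for h :: "'a \<Rightarrow> real"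
    using compact_imp_bounded[OF compact_continuous_image[OF that compact_cball]] unfolding bounded_iff by auto
   obtain B where "\<forall>z\<in>cball 0 (1/r). \<bar>F z\<bar> \<le> B" using bF[OF F] by blast
   then have iF: "integrable lborel (\<lambda>y. v y * F (\<zeta> y))" by (intro vi[of F B]) auto
   obtain B' where "\<forall>z\<in>cball 0 (1/r). \<bar>g z\<bar> \<le> B'" using bF[of g] pg continuous_on_subset by blast
   then have ig: "integrable lborel (\<lambda>y. v y * g (\<zeta> y))" by (intro vi[of g B']) auto
   have "(LBINT y. v y * F (\<zeta> y)) = (LBINT y. v y * F (\<zeta> y) - v y * g (\<zeta> y))"
    using iF ig pg by simp
   also have "\<bar>\<dots>\<bar> \<le> (LBINT y. \<bar>v y * F (\<zeta> y) - v y * g (\<zeta> y)\<bar>)" by (rule integral_abs_bound)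
   also have "\<dots> \<le> (LBINT y. e * \<bar>v y\<bar>)"
   proof (rule integral_mono)
    show "\<bar>v y * F (\<zeta> y) - v y * g (\<zeta> y)\<bar> \<le> e * \<bar>v y\<bar>" for y
    proof (cases "v y = 0")
     case False
     have "\<bar>v y * F (\<zeta> y) - v y * g (\<zeta> y)\<bar> = \<bar>F (\<zeta> y) - g (\<zeta> y)\<bar> * \<bar>v y\<bar>"
      by (simp add: abs_mult[symmetric] algebra_simps)
     also have "\<dots> \<le> e * \<bar>v y\<bar>" 
      by (rule mult_right_mono) (use g(2)[of "\<zeta> y"] supp[OF False] in auto)
     finally show ?thesis .
    qed simp
   qed (use iF ig vint in auto)
   finally show ?thesis by simp
  qed
  define J where "J = \<bar>\<integral>y. v y * F (\<zeta> y) \<partial>lborel\<bar>"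
  define K where "K = (LBINT y. \<bar>v y\<bar>)"
  have K: "0 \<le> K" unfolding K_def by simp
  have "J \<le> 0 + e" if "0 < e" for e
  proof -
   have "J \<le> e / (K + 1) * K" using bnd[of "e / (K + 1)"] that K unfolding J_def K_def by simp
   also have "\<dots> \<le> e" using that K by (simp add: field_simps)
   finally show ?thesis by simp
  qed
  then have "J \<le> 0" by (rule field_le_epsilon)
  then show ?thesis by (simp add: J_def)
 qed
 have test: "(LBINT y. u y * g y) = 0"
  if g: "L-lipschitz_on UNIV g" and sg: "\<And>x. g x \<noteq> 0 \<Longrightarrow> norm x < R" for g :: "'a \<Rightarrow> real" and L R
 proof -
  \<comment> \<open>The test function pulled back by the inversion, with the weight in v undone, so
    that v(y) F(\<zeta> y) = u(y) g(y).\<close>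
  define F where "F z = g (\<zeta> z) * (\<zeta> z \<bullet> \<zeta> z) powr (p / 2)" for z
  have gc: "continuous_on UNIV g" using g by (rule lipschitz_on_continuous_on)
  have [measurable]: "g \<in> borel_measurable borel" using gc by (rule borel_measurable_continuous_onI)
  have Fm: "F \<in> borel_measurable borel" unfolding F_def by measurable
  have zz: "\<zeta> (\<zeta> y) = y" if "y \<noteq> 0" for y
   using that by (simp add: \<zeta>_def field_simps)
  have "isCont F z" for z
  proof (cases "z = 0")
   case False
   have cz: "isCont \<zeta> z" unfolding \<zeta>_def using False by (intro continuous_intros) auto
   have cg: "isCont g x" for x using gc by (simp add: continuous_on_eq_continuous_at)
   have "\<zeta> z \<bullet> \<zeta> z \<noteq> 0" using False by (simp add: \<zeta>_def)
   then have "isCont (\<lambda>z. (\<zeta> z \<bullet> \<zeta> z) powr (p / 2)) z"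
    using cz unfolding isCont_def by (intro tendsto_powr tendsto_inner tendsto_const)
   then show ?thesis unfolding F_def by (intro continuous_mult isCont_o2[OF cz cg])
  next
   \<comment> \<open>Points near 0 are inverted to points outside the bounded support of g, so F
     vanishes near 0 and the singularity of the inversion does no harm.\<close>
   case True
   define R' where "R' = max R 1"
   have "eventually (\<lambda>z. F z = 0) (nhds 0)"
    unfolding eventually_nhds
   proof (intro exI[of _ "ball 0 (1 / R')"] conjI ballI)
    fix z :: 'a assume z: "z \<in> ball 0 (1 / R')"
    show "F z = 0"
    proof (cases "z = 0")
     case False
     have "0 < R'" by (simp add: R'_def)
     then have "R' \<le> 1 / norm z" using z False by (simp add: field_simps)
     then have "\<not> norm (\<zeta> z) < R" unfolding nz R'_def by simp
     then show ?thesis using sg[of "\<zeta> z"] by (auto simp: F_def)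
    qed (simp add: F_def \<zeta>_def)
   qed (auto simp: R'_def)
   then have "((\<lambda>z. F z) \<longlongrightarrow> 0) (nhds 0)" by (rule tendsto_eventually)
   then have "(F \<longlongrightarrow> 0) (at 0)" by (rule filterlim_mono) (auto simp: at_within_def)
   moreover have "F 0 = 0" by (simp add: F_def \<zeta>_def)
   ultimately show ?thesis by (simp add: True isCont_def)
  qed
  then have "continuous_on (cball 0 (1 / r)) F" by (simp add: continuous_at_imp_continuous_on)
  then have "(LBINT y. v y * F (\<zeta> y)) = 0" using Fm by (intro vcont) auto
  also have "(\<lambda>y. v y * F (\<zeta> y)) = (\<lambda>y. u y * g y)"
  proof
   fix y
   show "v y * F (\<zeta> y) = u y * g y"
   proof (cases "u y = 0")
    case False
    then have y: "y \<noteq> 0" using zero[of 0] r0 by auto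
    then show ?thesis by (simp add: F_def zz v_def powr_minus field_simps)
   qed (simp add: v_def)
  qed
  finally show ?thesis .
 qed
 have loc: "integrable lborel (\<lambda>x. u x * indicator (ball 0 R) x)" for R
 proof -
  have "square_integrable (indicator (ball 0 R) :: 'a \<Rightarrow> real)"
   unfolding square_integrable_def
  proof (rule conjI, intro borel_measurable_indicator borel_open open_ball)
   have "(\<lambda>x. (indicator (ball 0 R) x)\<^sup>2) = (indicator (ball (0::'a) R) :: 'a \<Rightarrow> real)"
    by (auto simp: indicator_def)
   then show "integrable lborel (\<lambda>x::'a. (indicator (ball 0 R) x)\<^sup>2 :: real)"
    by (simp only:) (rule integrable_real_indicator[OF _ emeasure_lborel_ball_finite], simp)
  qed
  from integrable_square_integrable_mult[OF u this] show ?thesis .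
 qed
 have "AE x in lborel. x \<in> UNIV \<longrightarrow> u x \<le> 0"
 proof (rule AE_nonpos_of_lipschitz_test[OF open_UNIV um loc])
  fix g :: "'a \<Rightarrow> real" and L R
  assume a: "L-lipschitz_on UNIV g" "\<And>x. g x \<noteq> 0 \<Longrightarrow> x \<in> UNIV \<and> norm x < R"
  have "(LBINT x. u x * g x) = 0" by (rule test[OF a(1)]) (use a(2) in blast)
  then show "(LBINT x. u x * g x) \<le> 0" by simp
 qed
 moreover have "AE x in lborel. x \<in> UNIV \<longrightarrow> - u x \<le> 0"
 proof (rule AE_nonpos_of_lipschitz_test[OF open_UNIV])
  show "integrable lborel (\<lambda>x. - u x * indicator (ball 0 R) x)" for R using loc[of R] by simp
  show "(\<lambda>x. - u x) \<in> borel_measurable borel" using um by simp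
  fix g :: "'a \<Rightarrow> real" and L R
  assume a: "L-lipschitz_on UNIV g" "\<And>x. g x \<noteq> 0 \<Longrightarrow> x \<in> UNIV \<and> norm x < R"
  have "(LBINT x. u x * g x) = 0" by (rule test[OF a(1)]) (use a(2) in blast)
  then show "(LBINT x. - u x * g x) \<le> 0" by simp
 qed
 ultimately show ?thesis by eventually_elim auto
qed

end

subsection \<open>Second differences of a bump function\<close>

definition sdiff :: "('a::real_vector \<Rightarrow> real) \<Rightarrow> 'a \<Rightarrow> 'a \<Rightarrow> real"
 where "sdiff f z y = 2 * f y - f (y + z) - f (y - z)"

text \<open>The exponent is kept as a parameter since each differentiation lowers it by one.\<close>

definition trunc_pow :: "nat \<Rightarrow> 'a::real_inner \<Rightarrow> real"
 where "trunc_pow k z = (max 0 (1 - z \<bullet> z)) ^ k"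

text \<open>A second difference of a second difference costs four derivatives, after which the power
  2 is left. The profile is also radial and radially decreasing, on which the positivity of
  \<open>mass\<close> will rest.\<close>

abbreviation bump :: "'a::real_inner \<Rightarrow> real"
 where "bump \<equiv> trunc_pow 6"

lemma continuous_on_trunc_pow [continuous_intros]:
 "continuous_on S f \<Longrightarrow> continuous_on S (\<lambda>x. trunc_pow k (f x))"
 unfolding trunc_pow_def by (intro continuous_intros)

lemma trunc_pow_measurable [measurable]: "trunc_pow k \<in> borel_measurable (borel :: 'a::euclidean_space measure)"
 by (intro borel_measurable_continuous_onI continuous_intros)

lemma trunc_pow_nonneg: "0 \<le> trunc_pow k z"
 by (simp add: trunc_pow_def)

lemma trunc_pow_le_1: "trunc_pow k z \<le> 1"
 unfolding trunc_pow_def by (intro power_le_one) auto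

lemma trunc_pow_zero: "1 \<le> norm z \<Longrightarrow> 0 < k \<Longrightarrow> trunc_pow k z = 0"
 using power_mono[of 1 "norm z" 2] by (simp add: trunc_pow_def dot_square_norm)

lemma trunc_pow_minus [simp]: "trunc_pow k (- z) = trunc_pow k z"
 by (simp add: trunc_pow_def)

lemma trunc_pow_norm_cong: "norm x = norm y \<Longrightarrow> trunc_pow k x = trunc_pow k y"
 by (simp add: trunc_pow_def dot_square_norm)

lemma trunc_pow_mono: "norm x \<le> norm y \<Longrightarrow> trunc_pow k y \<le> trunc_pow k x"
proof -
 assume "norm x \<le> norm y"
 then have "(norm x)\<^sup>2 \<le> (norm y)\<^sup>2" by (intro power_mono) auto
 then show ?thesis unfolding trunc_pow_def dot_square_norm by (intro power_mono max.mono) auto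
qed

lemma trunc_pow_strict_mono: "norm x < norm y \<Longrightarrow> norm x < 1 \<Longrightarrow> 0 < k \<Longrightarrow> trunc_pow k y < trunc_pow k x"
 unfolding trunc_pow_def dot_square_norm
 using power_strict_mono[of "norm x" "norm y" 2] power_strict_mono[of "norm x" 1 2]
 by (intro power_strict_mono) auto

lemma has_real_derivative_max0_power:
 "((\<lambda>x::real. (max 0 x) ^ Suc (Suc k)) has_real_derivative real (Suc (Suc k)) * (max 0 x) ^ Suc k) (at x)"
proof -
 consider "x < 0" | "x = 0" | "0 < x" by linarith
 then show ?thesis
 proof cases
  case 1
  have "((\<lambda>x::real. 0) has_real_derivative real (Suc (Suc k)) * (max 0 x) ^ Suc k) (at x)"
   using 1 by simp
  then show ?thesis
   by (rule has_field_derivative_transform_within_open[where S="{..<0}"]) (use 1 in auto)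
 next
  case 2
  have "((\<lambda>h. max 0 h ^ Suc (Suc k) / h) \<longlongrightarrow> 0) (at (0::real))"
  proof (rule Lim_null_comparison)
   have "norm (max 0 h ^ Suc (Suc k) / h) \<le> \<bar>h\<bar> ^ Suc k" if "h \<noteq> 0" for h :: real
   proof (cases "0 < h")
    case False
    then have "max 0 h = 0" by simp
    then have "norm (max 0 h ^ Suc (Suc k) / h) = 0" by simp
    also have "0 \<le> \<bar>h\<bar> ^ Suc k" by (rule zero_le_power) simp
    finally show ?thesis .
   qed simp
   then show "eventually (\<lambda>h. norm (max 0 h ^ Suc (Suc k) / h) \<le> \<bar>h\<bar> ^ Suc k) (at (0::real))"
    by (auto simp: eventually_at_filter)
   have "((\<lambda>h. \<bar>h\<bar> ^ Suc k) \<longlongrightarrow> \<bar>0\<bar> ^ Suc k) (at (0::real))" by (intro tendsto_intros)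
   then show "((\<lambda>h. \<bar>h\<bar> ^ Suc k) \<longlongrightarrow> 0) (at (0::real))" by simp
  qed
  then show ?thesis using 2 by (simp add: DERIV_def)
 next
  case 3
  have "((\<lambda>x::real. x ^ Suc (Suc k)) has_real_derivative real (Suc (Suc k)) * (max 0 x) ^ Suc k) (at x)"
   using 3 DERIV_pow[of "Suc (Suc k)" x] by (simp add: max_def)
  then show ?thesis
   by (rule has_field_derivative_transform_within_open[where S="{0<..}"]) (use 3 in auto)
 qed
qed

lemma has_real_derivative_trunc_pow:
 fixes y w :: "'a::real_inner"
 assumes "1 < k"
 shows "((\<lambda>t. trunc_pow k (y + t *\<^sub>R w)) has_real_derivative
  - 2 * real k * ((y + t *\<^sub>R w) \<bullet> w) * trunc_pow (k - 1) (y + t *\<^sub>R w)) (at t)"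
proof -
 obtain j where k: "k = Suc (Suc j)" using assms by (metis One_nat_def less_imp_Suc_add add_Suc_right Suc_eq_plus1 add.commute)
 have g: "((\<lambda>t. 1 - (y + t *\<^sub>R w) \<bullet> (y + t *\<^sub>R w)) has_real_derivative - 2 * ((y + t *\<^sub>R w) \<bullet> w)) (at t)"
  unfolding has_field_derivative_def
  by (auto intro!: derivative_eq_intros simp: fun_eq_iff algebra_simps inner_commute)
 show ?thesis
  unfolding trunc_pow_def k
  by (rule DERIV_cong[OF DERIV_chain2[OF has_real_derivative_max0_power g]]) (simp add: algebra_simps)
qed

text \<open>The mean value theorem for the even function 2 h(0) - h(t) - h(-t) produces h'(-z) -
  h'(z), and the bound on the second derivative controls this over a distance of at most 2.\<close>

lemma second_difference_bound:
 fixes h h' h'' :: "real \<Rightarrow> real"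
 assumes h: "\<And>t. (h has_real_derivative h' t) (at t)" "\<And>t. (h' has_real_derivative h'' t) (at t)"
  and B: "\<And>t. \<bar>h'' t\<bar> \<le> B"
 shows "\<bar>2 * h 0 - h 1 - h (-1)\<bar> \<le> 2 * B"
proof -
 have "\<exists>z. 0 < z \<and> z < 1 \<and> (2 * h 0 - h 1 - h (-1)) - (2 * h 0 - h 0 - h (-0)) = (1 - 0) * (- h' z + h' (- z))"
 proof (rule MVT2)
  show "((\<lambda>t. 2 * h 0 - h t - h (- t)) has_real_derivative - h' t + h' (- t)) (at t)" for t
   by (auto intro!: derivative_eq_intros h(1) DERIV_chain2[OF h(1)])
 qed simp
 then obtain z where z: "0 < z" "z < 1" "2 * h 0 - h 1 - h (-1) = - h' z + h' (- z)" by auto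
 have "norm (h' (- z) - h' z) \<le> B * norm (- z - z)"
  by (rule field_differentiable_bound[where S=UNIV]) (use h(2) B in auto)
 also have "\<dots> \<le> B * 2"
  using z B[of 0] by (intro mult_left_mono) auto
 finally show ?thesis using z(3) by simp
qed

lemma sdiff_bound:
 fixes f :: "'a::real_inner \<Rightarrow> real"
 assumes "\<And>t. ((\<lambda>t. f (y + t *\<^sub>R w)) has_real_derivative h' t) (at t)"
  "\<And>t. (h' has_real_derivative h'' t) (at t)" "\<And>t. \<bar>h'' t\<bar> \<le> B"
 shows "\<bar>sdiff f w y\<bar> \<le> 2 * B"
 using second_difference_bound[of "\<lambda>t. f (y + t *\<^sub>R w)", OF assms] by (simp add: sdiff_def)

lemma trunc_pow_mult_bound:
 fixes z a b :: "'a::real_inner"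
 assumes "0 < k"
 shows "\<bar>(z \<bullet> a) * (z \<bullet> b) * trunc_pow k z\<bar> \<le> norm a * norm b"
  and "\<bar>(z \<bullet> a) * (z \<bullet> b) * ((z \<bullet> c) * (z \<bullet> d)) * trunc_pow k z\<bar> \<le> norm a * norm b * (norm c * norm d)"
proof -
 have 1: "\<bar>z \<bullet> a\<bar> \<le> norm a" if "norm z \<le> 1" for a
  using Cauchy_Schwarz_ineq2[of z a] mult_right_mono[OF that, of "norm a"] by simp
 have 2: "\<bar>trunc_pow k z\<bar> \<le> 1" using trunc_pow_le_1 trunc_pow_nonneg[of k z] by simp
 show "\<bar>(z \<bullet> a) * (z \<bullet> b) * trunc_pow k z\<bar> \<le> norm a * norm b"
 proof (cases "norm z \<le> 1")
  case True
  have "\<bar>z \<bullet> a\<bar> * \<bar>z \<bullet> b\<bar> * \<bar>trunc_pow k z\<bar> \<le> norm a * norm b * 1"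
   by (intro mult_mono 1 2 True) auto
  then show ?thesis by (simp add: abs_mult)
 qed (use assms in \<open>simp add: trunc_pow_zero\<close>)
 show "\<bar>(z \<bullet> a) * (z \<bullet> b) * ((z \<bullet> c) * (z \<bullet> d)) * trunc_pow k z\<bar> \<le> norm a * norm b * (norm c * norm d)"
 proof (cases "norm z \<le> 1")
  case True
  have "\<bar>z \<bullet> a\<bar> * \<bar>z \<bullet> b\<bar> * (\<bar>z \<bullet> c\<bar> * \<bar>z \<bullet> d\<bar>) * \<bar>trunc_pow k z\<bar> \<le> norm a * norm b * (norm c * norm d) * 1"
   by (intro mult_mono 1 2 True) auto
  then show ?thesis by (simp add: abs_mult)
 qed (use assms in \<open>simp add: trunc_pow_zero\<close>)
qed

lemma trunc_pow_second_derivative: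
 fixes y w :: "'a::real_inner"
 assumes k: "2 < k"
 shows "((\<lambda>t. - 2 * real k * ((y + t *\<^sub>R w) \<bullet> w) * trunc_pow (k - 1) (y + t *\<^sub>R w)) has_real_derivative
  - 2 * real k * (w \<bullet> w) * trunc_pow (k - 1) (y + t *\<^sub>R w) +
  4 * real k * real (k - 1) * (((y + t *\<^sub>R w) \<bullet> w) * ((y + t *\<^sub>R w) \<bullet> w) * trunc_pow (k - 2) (y + t *\<^sub>R w))) (at t)"
proof -
 have lin: "((\<lambda>t. - 2 * real k * ((y + t *\<^sub>R w) \<bullet> w)) has_real_derivative - 2 * real k * (w \<bullet> w)) (at t)"
  by (auto intro!: derivative_eq_intros simp: inner_add_left)
 have k1: "1 < k - 1" using k by linarith
 have k2: "k - 1 - 1 = k - 2" by simp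
 show ?thesis
  by (rule DERIV_cong[OF DERIV_mult[OF lin has_real_derivative_trunc_pow[OF k1]]])
   (simp add: k2 algebra_simps numeral_2_eq_2)
qed

lemma sdiff_trunc_pow_bound:
 fixes y w :: "'a::real_inner"
 assumes k: "2 < k"
 shows "\<bar>sdiff (trunc_pow k) w y\<bar> \<le> (4 * real k + 8 * real k * real (k - 1)) * (norm w)\<^sup>2"
proof -
 have "\<bar>sdiff (trunc_pow k) w y\<bar> \<le> 2 * ((2 * real k + 4 * real k * real (k - 1)) * (norm w)\<^sup>2)"
 proof (rule sdiff_bound[OF has_real_derivative_trunc_pow trunc_pow_second_derivative[OF k]])
  fix t :: real
  let ?z = "y + t *\<^sub>R w"
  have "\<bar>- 2 * real k * (w \<bullet> w) * trunc_pow (k - 1) ?z\<bar> \<le> 2 * real k * (norm w)\<^sup>2 * 1"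
   unfolding abs_mult using trunc_pow_le_1[of "k - 1" ?z] trunc_pow_nonneg[of "k - 1" ?z]
   by (intro mult_mono) (auto simp: dot_square_norm)
  moreover have "\<bar>4 * real k * real (k - 1) * ((?z \<bullet> w) * (?z \<bullet> w) * trunc_pow (k - 2) ?z)\<bar>
    \<le> 4 * real k * real (k - 1) * (norm w * norm w)"
   unfolding abs_mult[of "4 * real k * real (k - 1)"] using k
   by (intro mult_mono trunc_pow_mult_bound(1)) auto
  ultimately show "\<bar>- 2 * real k * (w \<bullet> w) * trunc_pow (k - 1) ?z
   + 4 * real k * real (k - 1) * ((?z \<bullet> w) * (?z \<bullet> w) * trunc_pow (k - 2) ?z)\<bar>
   \<le> (2 * real k + 4 * real k * real (k - 1)) * (norm w)\<^sup>2"
   unfolding power2_eq_square by (simp only: distrib_right mult_1_right) linarith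
 qed (use k in auto)
 then show ?thesis by (simp add: algebra_simps)
qed

lemma bump_lipschitz:
 fixes x y :: "'a::real_inner"
 shows "\<bar>bump x - bump y\<bar> \<le> 12 * norm (x - y)"
proof -
 have "norm (bump (y + 1 *\<^sub>R (x - y)) - bump (y + 0 *\<^sub>R (x - y))) \<le> (12 * norm (x - y)) * norm (1 - 0 :: real)"
 proof (rule field_differentiable_bound[where S=UNIV])
  fix t :: real
  let ?z = "y + t *\<^sub>R (x - y)"
  show "((\<lambda>t. bump (y + t *\<^sub>R (x - y))) has_real_derivative - 2 * real 6 * (?z \<bullet> (x - y)) * trunc_pow (6 - 1) ?z) (at t within UNIV)"
   by (rule has_real_derivative_trunc_pow) simp
  have "\<bar>?z \<bullet> (x - y)\<bar> * \<bar>trunc_pow 5 ?z\<bar> \<le> norm (x - y)"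
  proof (cases "norm ?z \<le> 1")
   case True
   have "\<bar>?z \<bullet> (x - y)\<bar> * \<bar>trunc_pow 5 ?z\<bar> \<le> (1 * norm (x - y)) * 1"
    using trunc_pow_le_1[of 5 ?z] trunc_pow_nonneg[of 5 ?z]
    by (intro mult_mono order_trans[OF Cauchy_Schwarz_ineq2 mult_right_mono[OF True]]) auto
   then show ?thesis by simp
  qed (simp add: trunc_pow_zero)
  then show "norm (- 2 * real 6 * (?z \<bullet> (x - y)) * trunc_pow (6 - 1) ?z) \<le> 12 * norm (x - y)"
   by (simp add: abs_mult)
 qed auto
 then show ?thesis by simp
qed

text \<open>The constant is 4 * 6 + 8 * 6 * 5.\<close>

lemma sdiff_bump_bound: "\<bar>sdiff bump w y\<bar> \<le> 264 * (norm w)\<^sup>2"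
 using sdiff_trunc_pow_bound[of 6 w y] by simp

text \<open>Differences in w commute with derivatives in z. Two derivatives along z therefore act on
  the bump first, and the second difference in w of the result, \<open>D\<close>, is estimated by
  two more derivatives.\<close>

lemma sdiff_sdiff_bump_bound:
 fixes w z y :: "'a::real_inner"
 shows "\<bar>sdiff (sdiff bump z) w y\<bar> \<le> 50000 * (norm z)\<^sup>2 * (norm w)\<^sup>2"
proof -
 define N where "N = (norm z)\<^sup>2 * (norm w)\<^sup>2"
 have N0: "0 \<le> N" by (simp add: N_def)
 \<comment> \<open>The second derivative of the bump in direction z; \<open>d\<close> below is the
   first.\<close>
 define D where "D x = - 12 * (z \<bullet> z) * trunc_pow 5 x + 120 * ((x \<bullet> z) * (x \<bullet> z) * trunc_pow 4 x)" for x :: 'a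
 define d where "d x = - 12 * (x \<bullet> z) * trunc_pow 5 x" for x :: 'a
 have d1: "((\<lambda>t. bump (x + t *\<^sub>R z)) has_real_derivative d (x + t *\<^sub>R z)) (at t)" for x t
  using has_real_derivative_trunc_pow[of 6 x z t] by (simp add: d_def)
 have d2: "((\<lambda>t. d (x + t *\<^sub>R z)) has_real_derivative D (x + t *\<^sub>R z)) (at t)" for x t
  using trunc_pow_second_derivative[of 6 x z t] by (simp add: d_def D_def)
 have Q: "\<bar>sdiff (\<lambda>x. (x \<bullet> z) * (x \<bullet> z) * trunc_pow 4 x) w x\<bar> \<le> 2 * (90 * N)" for x
 proof (rule sdiff_bound)
  let ?y = "\<lambda>t. x + t *\<^sub>R w"
  let ?h' = "\<lambda>t. 2 * (w \<bullet> z) * ((?y t \<bullet> z) * trunc_pow 4 (?y t)) - 8 * ((?y t \<bullet> z) * (?y t \<bullet> z) * (?y t \<bullet> w) * trunc_pow 3 (?y t))"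
  let ?h'' = "\<lambda>t. 2 * (w \<bullet> z) * (w \<bullet> z) * trunc_pow 4 (?y t) - 32 * (w \<bullet> z) * ((?y t \<bullet> z) * (?y t \<bullet> w) * trunc_pow 3 (?y t))
   - 8 * (w \<bullet> w) * ((?y t \<bullet> z) * (?y t \<bullet> z) * trunc_pow 3 (?y t))
   + 48 * ((?y t \<bullet> z) * (?y t \<bullet> z) * ((?y t \<bullet> w) * (?y t \<bullet> w)) * trunc_pow 2 (?y t))"
  fix t
  have lin: "((\<lambda>t. ?y t \<bullet> e) has_real_derivative w \<bullet> e) (at t)" for e
   by (auto intro!: derivative_eq_intros simp: inner_add_left)
  note dp = has_real_derivative_trunc_pow[where y=x and w=w and t=t]
  show "((\<lambda>t. (?y t \<bullet> z) * (?y t \<bullet> z) * trunc_pow 4 (?y t)) has_real_derivative ?h' t) (at t)"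
   by (rule DERIV_cong[OF DERIV_mult[OF DERIV_mult[OF lin lin] dp[of 4]]]) (auto simp: algebra_simps)
  show "(?h' has_real_derivative ?h'' t) (at t)"
   by (rule DERIV_cong[OF DERIV_diff[OF DERIV_cmult[OF DERIV_mult[OF lin dp[of 4]]]
      DERIV_cmult[OF DERIV_mult[OF DERIV_mult[OF DERIV_mult[OF lin lin] lin] dp[of 3]]]]])
    (auto simp: algebra_simps)
  have wz: "\<bar>w \<bullet> z\<bar> \<le> norm w * norm z" by (rule Cauchy_Schwarz_ineq2)
  have 1: "\<bar>2 * (w \<bullet> z) * (w \<bullet> z) * trunc_pow 4 (?y t)\<bar> \<le> 2 * (norm w * norm z) * (norm w * norm z) * 1"
   unfolding abs_mult using trunc_pow_le_1[of 4 "?y t"] trunc_pow_nonneg[of 4 "?y t"] wz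
   by (intro mult_mono) auto
  have 2: "\<bar>32 * (w \<bullet> z) * ((?y t \<bullet> z) * (?y t \<bullet> w) * trunc_pow 3 (?y t))\<bar> \<le> 32 * (norm w * norm z) * (norm z * norm w)"
   unfolding abs_mult[of "32 * (w \<bullet> z)"] abs_mult[of 32] using wz
   by (intro mult_mono trunc_pow_mult_bound(1)) auto
  have 3: "\<bar>8 * (w \<bullet> w) * ((?y t \<bullet> z) * (?y t \<bullet> z) * trunc_pow 3 (?y t))\<bar> \<le> 8 * (norm w)\<^sup>2 * (norm z * norm z)"
   unfolding abs_mult[of "8 * (w \<bullet> w)"] abs_mult[of 8]
   by (intro mult_mono trunc_pow_mult_bound(1)) (auto simp: dot_square_norm)
  have 4: "\<bar>48 * ((?y t \<bullet> z) * (?y t \<bullet> z) * ((?y t \<bullet> w) * (?y t \<bullet> w)) * trunc_pow 2 (?y t))\<bar> \<le> 48 * (norm z * norm z * (norm w * norm w))"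
   unfolding abs_mult[of 48]
   by (intro mult_mono trunc_pow_mult_bound(2)) auto
  have e: "norm w * norm z * (norm w * norm z) = N" "norm w * norm z * (norm z * norm w) = N"
   "(norm w)\<^sup>2 * (norm z * norm z) = N" "norm z * norm z * (norm w * norm w) = N"
   by (simp_all add: N_def power2_eq_square)
  have B1: "\<bar>2 * (w \<bullet> z) * (w \<bullet> z) * trunc_pow 4 (?y t)\<bar> \<le> 2 * N" using 1 e(1) by (simp add: mult.assoc)
  have B2: "\<bar>32 * (w \<bullet> z) * ((?y t \<bullet> z) * (?y t \<bullet> w) * trunc_pow 3 (?y t))\<bar> \<le> 32 * N" using 2 e(2) by (simp only: mult.assoc)
  have B3: "\<bar>8 * (w \<bullet> w) * ((?y t \<bullet> z) * (?y t \<bullet> z) * trunc_pow 3 (?y t))\<bar> \<le> 8 * N" using 3 e(3) by (simp only: mult.assoc)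
  have B4: "\<bar>48 * ((?y t \<bullet> z) * (?y t \<bullet> z) * ((?y t \<bullet> w) * (?y t \<bullet> w)) * trunc_pow 2 (?y t))\<bar> \<le> 48 * N" using 4 unfolding e(4) .
  have tri: "\<bar>a - b - c + d\<bar> \<le> \<bar>a\<bar> + \<bar>b\<bar> + \<bar>c\<bar> + \<bar>d\<bar>" for a b c d :: real by linarith
  \<comment> \<open>90 = 2 + 32 + 8 + 48.\<close>
  show "\<bar>?h'' t\<bar> \<le> 90 * N"
   by (rule order_trans[OF tri]) (use B1 B2 B3 B4 in linarith)
 qed
 have P: "\<bar>sdiff (trunc_pow 5) w x\<bar> \<le> 180 * (norm w)\<^sup>2" for x
  using sdiff_trunc_pow_bound[of 5 w x] by simp
 have zP: "\<bar>12 * (z \<bullet> z) * sdiff (trunc_pow 5) w x\<bar> \<le> 2160 * N" for x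
 proof -
  have "\<bar>12 * (z \<bullet> z) * sdiff (trunc_pow 5) w x\<bar> \<le> (12 * (norm z)\<^sup>2) * (180 * (norm w)\<^sup>2)"
   unfolding abs_mult[of "12 * (z \<bullet> z)"] by (intro mult_mono P) (auto simp: dot_square_norm)
  then show ?thesis by (simp add: N_def)
 qed
 have sD: "sdiff D w x = 120 * sdiff (\<lambda>x. (x \<bullet> z) * (x \<bullet> z) * trunc_pow 4 x) w x - 12 * (z \<bullet> z) * sdiff (trunc_pow 5) w x" for x
  unfolding sdiff_def D_def by (simp add: algebra_simps)
 \<comment> \<open>120 * 180 + 2160 = 23760, rounded up.\<close>
 have B: "\<bar>sdiff D w x\<bar> \<le> 25000 * N" for x
  unfolding sD using Q[of x] zP[of x] N0 by linarith
 have sh: "(y + t *\<^sub>R z) + w = (y + w) + t *\<^sub>R z" "(y + t *\<^sub>R z) - w = (y - w) + t *\<^sub>R z" for t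
  by (simp_all add: algebra_simps)
 have "\<bar>sdiff (sdiff bump w) z y\<bar> \<le> 2 * (25000 * N)"
 proof (rule sdiff_bound)
  fix t
  show "((\<lambda>t. sdiff bump w (y + t *\<^sub>R z)) has_real_derivative sdiff d w (y + t *\<^sub>R z)) (at t)"
   unfolding sdiff_def sh by (intro DERIV_diff DERIV_cmult d1)
  show "((\<lambda>t. sdiff d w (y + t *\<^sub>R z)) has_real_derivative sdiff D w (y + t *\<^sub>R z)) (at t)"
   unfolding sdiff_def sh by (intro DERIV_diff DERIV_cmult d2)
  show "\<bar>sdiff D w (y + t *\<^sub>R z)\<bar> \<le> 25000 * N" by (rule B)
 qed
 also have "sdiff (sdiff bump w) z y = sdiff (sdiff bump z) w y"
  by (simp add: sdiff_def algebra_simps)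
 finally show ?thesis by (simp add: N_def)
qed

subsection \<open>The kernel and the fractional Laplacian of the bump\<close>

lemma sdiff_minus [simp]: "sdiff f (- w) y = sdiff f w y"
 by (simp add: sdiff_def)

lemma sdiff_commute: "sdiff (sdiff f z) w y = sdiff (sdiff f w) z y"
 by (simp add: sdiff_def algebra_simps)

lemma sdiff_measurable [measurable (raw)]:
 fixes f :: "'a::euclidean_space \<Rightarrow> real"
 assumes "f \<in> borel_measurable borel" "g \<in> borel_measurable M" "h \<in> borel_measurable M"
 shows "(\<lambda>x. sdiff f (g x) (h x)) \<in> borel_measurable M"
proof -
 have [measurable]: "f \<in> borel_measurable borel" "g \<in> borel_measurable M" "h \<in> borel_measurable M" by fact+
 show ?thesis unfolding sdiff_def by measurable
qed

lemma powr_minus_diff_bound: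
 fixes a b m :: real
 assumes "0 < m" "m \<le> a" "m \<le> b" "0 \<le> p"
 shows "\<bar>a powr (-p) - b powr (-p)\<bar> \<le> p * m powr (- p - 1) * \<bar>a - b\<bar>"
proof -
 have "norm (a powr (-p) - b powr (-p)) \<le> (p * m powr (- p - 1)) * norm (a - b)"
 proof (rule field_differentiable_bound[where S="{m..}" and f'="\<lambda>x. - p * x powr (- p - 1)"])
  fix x assume x: "x \<in> {m..}"
  have "((\<lambda>x. x powr (-p)) has_real_derivative - p * x powr (- p - 1)) (at x)"
   using assms x by (auto intro!: derivative_eq_intros)
  then show "((\<lambda>x. x powr (-p)) has_real_derivative - p * x powr (- p - 1)) (at x within {m..})"
   by (rule has_field_derivative_at_within)
  have "x powr (- p - 1) \<le> m powr (- p - 1)" using assms x by (intro powr_mono2') auto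
  then show "norm (- p * x powr (- p - 1)) \<le> p * m powr (- p - 1)"
   using assms by (simp add: abs_mult mult_left_mono)
 qed (use assms in auto)
 then show ?thesis by simp
qed

locale frac =
 fixes s :: real
 assumes s0: "0 < s" and s1: "s < 1"
begin

text \<open>At the origin \<open>powr\<close> returns 0, so the diagonal contributes nothing to any
  integral below.\<close>

definition kern :: "'a::euclidean_space \<Rightarrow> real" where
 "kern z = norm z powr (- (real DIM('a) + 2 * s))"

text \<open>A bounded and integrable stand-in for \<open>kern\<close>, comparable to it away from
  the origin; the natural majorant of \<open>ell\<close> and of the averaging kernel.\<close>

abbreviation wt :: "'a::euclidean_space \<Rightarrow> real" where
 "wt \<equiv> decay (real DIM('a) + 2 * s)"

lemma dim_less: "real DIM('a::euclidean_space) < real DIM('a) + 2 * s"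
 using s0 by simp

lemma exponent_pos: "0 < real DIM('a::euclidean_space) + 2 * s"
 using s0 by (simp add: add_nonneg_pos)

lemma kern_measurable [measurable]: "kern \<in> borel_measurable borel"
 unfolding kern_def by measurable

lemma kern_nonneg: "0 \<le> kern z" by (simp add: kern_def)

lemma kern_minus [simp]: "kern (- z) = kern z" by (simp add: kern_def)

lemma kern_commute: "kern (x - y) = kern (y - x)" by (simp add: kern_def norm_minus_commute)

lemma kern_scaleR: "0 < c \<Longrightarrow> kern (c *\<^sub>R (z::'a::euclidean_space)) = c powr (- (real DIM('a) + 2 * s)) * kern z"
 unfolding kern_def by (simp add: powr_mult)

lemma wt_integrable: "integrable lborel (wt :: 'a::euclidean_space \<Rightarrow> real)"
 by (rule integrable_decay[OF dim_less])

lemma wt_le_1: "wt (y :: 'a::euclidean_space) \<le> 1"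
 by (rule decay_le_1[OF exponent_pos])

lemma wt_nonneg: "0 \<le> wt y" by (rule less_imp_le[OF decay_pos])

lemma wt_scale:
 assumes "0 < c" "c * (1 + norm y) \<le> 1 + norm (x :: 'a::euclidean_space)"
 shows "wt x \<le> c powr (- (real DIM('a) + 2 * s)) * wt (y :: 'a)"
proof -
 have "0 < 1 + norm y" using norm_ge_zero[of y] by linarith
 then have "wt x \<le> (c * (1 + norm y)) powr (- (real DIM('a) + 2 * s))"
  unfolding decay_def using assms exponent_pos[where 'a='a] by (intro powr_mono2') auto
 then show ?thesis using assms \<open>0 < 1 + norm y\<close> by (simp add: powr_mult decay_def)
qed

lemma kern_le_wt:
 assumes "0 < c" "c * (1 + norm y) \<le> norm (x :: 'a::euclidean_space)"
 shows "kern x \<le> c powr (- (real DIM('a) + 2 * s)) * wt (y :: 'a)"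
proof -
 have *: "0 < 1 + norm y" using norm_ge_zero[of y] by linarith
 then have "kern x \<le> (c * (1 + norm y)) powr (- (real DIM('a) + 2 * s))"
  unfolding kern_def using assms exponent_pos[where 'a='a] by (intro powr_mono2') auto
 then show ?thesis using assms * by (simp add: powr_mult decay_def)
qed

text \<open>The exponent near the origin is n + 2s - 2, below n because s < 1, and at infinity n +
  2s, above n because s > 0. Second differences of smooth bounded functions are of the size of this
  minimum.\<close>

lemma min_kern_integrable: "integrable lborel (\<lambda>w::'a::euclidean_space. min ((norm w)\<^sup>2) 1 * kern w)"
proof (rule Bochner_Integration.integrable_bound)
 let ?p = "real DIM('a) + 2 * s"
 show "integrable lborel (\<lambda>y::'a. norm y powr (- (?p - 2)) * indicator {..1} (norm y) + norm y powr (- ?p) * indicator {1..} (norm y))"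
  using s0 s1 by (intro Bochner_Integration.integrable_add integrable_norm_powr_inside integrable_norm_powr_outside) auto
 show "AE y::'a in lborel. norm (min ((norm y)\<^sup>2) 1 * kern y) \<le> norm (norm y powr (- (?p - 2)) * indicator {..1} (norm y) + norm y powr (- ?p) * indicator {1..} (norm y))"
 proof (rule AE_mp[OF AE_lborel_singleton[of 0]], intro AE_I2 impI)
  fix y :: 'a assume y: "y \<noteq> 0"
  show "norm (min ((norm y)\<^sup>2) 1 * kern y) \<le> norm (norm y powr (- (?p - 2)) * indicator {..1} (norm y) + norm y powr (- ?p) * indicator {1..} (norm y))"
  proof (cases "norm y \<le> 1")
   case True
   have "(norm y)\<^sup>2 * kern y = norm y powr (- (?p - 2))"
   proof -
    have "2 + - ?p = - (?p - 2)" by simp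
    then show ?thesis using powr_add[of "norm y" 2 "- ?p"] by (simp only: kern_def powr_numeral norm_ge_zero)
   qed
   moreover have "min ((norm y)\<^sup>2) 1 = (norm y)\<^sup>2" using True by (simp add: power_le_one)
   moreover have "0 \<le> norm y powr (- ?p) * indicator {1..} (norm y)" by simp
   ultimately show ?thesis using True by (simp add: add_increasing2)
  next
   case False
   then have "min ((norm y)\<^sup>2) 1 = 1" by (simp add: one_le_power)
   then show ?thesis using False by (simp add: kern_def)
  qed
 qed
qed measurable

text \<open>The fractional Laplacian in its absolutely convergent second difference form, without
  the normalising constant and with an extra factor 2.\<close>

definition flap :: "('a::euclidean_space \<Rightarrow> real) \<Rightarrow> 'a \<Rightarrow> real" where
 "flap f y = (LBINT w. sdiff f w y * kern w)"

text \<open>A function with \<open>admissible A f\<close> is a multiple of \<open>bump\<close> or of a second difference of it, and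
 the estimates for its fractional Laplacian are linear in \<open>A\<close>.\<close>

definition admissible :: "real \<Rightarrow> ('a::euclidean_space \<Rightarrow> real) \<Rightarrow> bool" where
 "admissible A f \<longleftrightarrow> continuous_on UNIV f \<and> (\<forall>y. \<bar>f y\<bar> \<le> A) \<and> (\<forall>y. 2 < norm y \<longrightarrow> f y = 0) \<and>
  (\<forall>w y. \<bar>sdiff f w y\<bar> \<le> A * (norm w)\<^sup>2)"

lemma admissible_bump: "admissible 264 (bump :: 'a::euclidean_space \<Rightarrow> real)"
 unfolding admissible_def
proof (intro conjI allI impI)
 show "\<bar>bump y\<bar> \<le> 264" for y :: 'a using trunc_pow_le_1[of 6 y] trunc_pow_nonneg[of 6 y] by simp
qed (auto intro!: continuous_intros sdiff_bump_bound simp: trunc_pow_zero)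

lemma admissible_sdiff_bump:
 assumes z: "norm z \<le> 1"
 shows "admissible (50000 * (norm z)\<^sup>2) (sdiff bump (z :: 'a::euclidean_space))"
 unfolding admissible_def
proof (intro conjI allI impI)
 show "continuous_on UNIV (sdiff bump z)"
  unfolding sdiff_def[abs_def] by (intro continuous_intros)
 show "\<bar>sdiff bump z y\<bar> \<le> 50000 * (norm z)\<^sup>2" for y
  by (rule order_trans[OF sdiff_bump_bound]) simp
 fix y :: 'a
 assume "2 < norm y"
 then have "1 \<le> norm y" "1 \<le> norm (y + z)" "1 \<le> norm (y - z)"
  using z norm_triangle_ineq2[of y z] norm_triangle_ineq2[of y "-z"] by auto
 then show "sdiff bump z y = 0" by (simp add: sdiff_def trunc_pow_zero)
qed (rule sdiff_sdiff_bump_bound)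

lemma admissibleD:
 assumes "admissible A f"
 shows "continuous_on UNIV f" "f \<in> borel_measurable borel" "\<bar>f y\<bar> \<le> A" "2 < norm y \<Longrightarrow> f y = 0"
  "\<bar>sdiff f w y\<bar> \<le> A * (norm w)\<^sup>2" "0 \<le> A"
proof -
 show "continuous_on UNIV f" "\<bar>f y\<bar> \<le> A" "2 < norm y \<Longrightarrow> f y = 0" "\<bar>sdiff f w y\<bar> \<le> A * (norm w)\<^sup>2"
  using assms by (auto simp: admissible_def)
 then show "f \<in> borel_measurable borel" "0 \<le> A" by (auto intro: borel_measurable_continuous_onI)
qed

lemma admissible_sdiff_le:
 assumes "admissible A f"
 shows "\<bar>sdiff f w y * kern w\<bar> \<le> 4 * A * (min ((norm w)\<^sup>2) 1 * kern w)"
proof -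
 note A = admissibleD[OF assms]
 have "\<bar>sdiff f w y\<bar> \<le> 4 * A"
  using A(3)[of y] A(3)[of "y + w"] A(3)[of "y - w"] unfolding sdiff_def by linarith
 moreover have "\<bar>sdiff f w y\<bar> \<le> 4 * A * (norm w)\<^sup>2"
  using A(5)[of w y] mult_right_mono[of A "4 * A" "(norm w)\<^sup>2"] A(6) by simp
 ultimately have "\<bar>sdiff f w y\<bar> \<le> 4 * A * min ((norm w)\<^sup>2) 1" by (simp add: min_def)
 from mult_right_mono[OF this kern_nonneg[of w]] show ?thesis
  by (simp add: abs_mult kern_nonneg mult.assoc)
qed

lemma admissible_sdiff_integrable:
 fixes f :: "'a::euclidean_space \<Rightarrow> real"
 assumes "admissible A f"
 shows "integrable lborel (\<lambda>w. sdiff f w y * kern w)"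
proof (rule Bochner_Integration.integrable_bound)
 have [measurable]: "f \<in> borel_measurable borel" using admissibleD[OF assms] by blast
 show "integrable lborel (\<lambda>w::'a. 4 * A * (min ((norm w)\<^sup>2) 1 * kern w))"
  using min_kern_integrable by (rule integrable_mult_right)
 show "(\<lambda>w. sdiff f w y * kern w) \<in> borel_measurable lborel" by measurable
 show "AE w in lborel. norm (sdiff f w y * kern w) \<le> norm (4 * A * (min ((norm w)\<^sup>2) 1 * kern w))"
  using admissible_sdiff_le[OF assms] by (intro AE_I2) (metis abs_ge_self order_trans real_norm_def)
qed

lemma admissible_integrable:
 fixes f :: "'a::euclidean_space \<Rightarrow> real"
 assumes "admissible A f"
 shows "integrable lborel (\<lambda>y. \<bar>f y\<bar>)" "(LBINT y. \<bar>f y\<bar>) \<le> A * measure lborel (cball (0::'a) 2)"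
proof -
 note A = admissibleD[OF assms]
 have [measurable]: "f \<in> borel_measurable borel" by (rule A)
 have ic: "integrable lborel (\<lambda>y::'a. A * indicator (cball 0 2) y)"
  by (intro integrable_mult_right integrable_real_indicator[OF _ emeasure_lborel_cball_finite]) simp
 have le: "\<bar>f y\<bar> \<le> A * indicator (cball 0 2) y" for y
  using A(3)[of y] A(4)[of y] by (auto simp: indicator_def not_le)
 show i: "integrable lborel (\<lambda>y. \<bar>f y\<bar>)"
  by (rule Bochner_Integration.integrable_bound[OF ic]) (use le A(6) in \<open>auto simp: abs_mult\<close>)
 have "(LBINT y. \<bar>f y\<bar>) \<le> (LBINT (y::'a). A * indicator (cball 0 2) y)"
  by (rule integral_mono[OF i ic le])
 then show "(LBINT y. \<bar>f y\<bar>) \<le> A * measure lborel (cball (0::'a) 2)" by simp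
qed

text \<open>For |y| > 4 the function vanishes at y, and a step w that reaches its support has |w|
  \<ge> |y| - 2 \<ge> (1 + |y|) / 4. So \<open>kern w\<close> can be pulled out as a multiple of
  \<open>wt y\<close>, and the integral of |f| remains. For |y| \<le> 4 a constant bound is
  enough.\<close>

lemma admissible_flap_decay:
 obtains C where "0 < C" "\<And>A f y. admissible A (f :: 'a::euclidean_space \<Rightarrow> real) \<Longrightarrow>
  (LBINT w. \<bar>sdiff f w y * kern w\<bar>) \<le> C * A * wt y"
proof -
 let ?p = "real DIM('a) + 2 * s"
 define J where "J = (LBINT (w::'a). min ((norm w)\<^sup>2) 1 * kern w)"
 define V where "V = measure lborel (cball (0::'a) 2)"
 have J: "0 \<le> J" unfolding J_def by (rule Bochner_Integration.integral_nonneg) (simp add: kern_nonneg)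
 have V: "0 \<le> V" by (simp add: V_def)
 \<comment> \<open>The first summand serves |y| \<le> 4, where 5^p \<open>wt y\<close> \<ge> 1, the
   second serves |y| > 4; the final 1 makes C positive.\<close>
 define C where "C = 4 * J * 5 powr ?p + 2 * (1/4) powr (- ?p) * V + 1"
 have C: "0 < C" using J V by (auto simp: C_def intro: add_nonneg_pos)
 show ?thesis
 proof (rule that[OF C])
  fix A and f :: "'a \<Rightarrow> real" and y :: 'a
  assume f: "admissible A f"
  note A = admissibleD[OF f]
  have [measurable]: "f \<in> borel_measurable borel" by (rule A)
  note i = integrable_abs[OF admissible_sdiff_integrable[OF f, of y]]
  show "(LBINT w. \<bar>sdiff f w y * kern w\<bar>) \<le> C * A * wt y"
  proof (cases "norm y \<le> 4")
   case True
   have "(LBINT w. \<bar>sdiff f w y * kern w\<bar>) \<le> (LBINT (w::'a). 4 * A * (min ((norm w)\<^sup>2) 1 * kern w))"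
    by (rule integral_mono[OF i integrable_mult_right[OF min_kern_integrable] admissible_sdiff_le[OF f]])
   also have "\<dots> = 4 * A * J" by (simp add: J_def)
   also have "\<dots> \<le> (4 * A * J) * (5 powr ?p * wt y)"
   proof -
    have "0 < 1 + norm y" using norm_ge_zero[of y] by linarith
    then have "5 powr (- ?p) \<le> wt y"
     unfolding decay_def using True exponent_pos[where 'a='a] by (intro powr_mono2') auto
    then have "5 powr ?p * 5 powr (- ?p) \<le> 5 powr ?p * wt y" by (intro mult_left_mono) auto
    moreover have "5 powr ?p * 5 powr (- ?p) = (1::real)"
     unfolding powr_add[symmetric] by simp
    ultimately have "1 \<le> 5 powr ?p * wt y" by (simp only:)
    from mult_left_mono[OF this, of "4 * A * J"] show ?thesis using A(6) J by simp
   qed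
   also have "\<dots> = (4 * J * 5 powr ?p) * (A * wt y)" by simp
   also have "\<dots> \<le> C * (A * wt y)"
    unfolding C_def using V A(6) wt_nonneg[of y] by (intro mult_right_mono) auto
   finally show ?thesis by (simp add: mult.assoc)
  next
   case False
   have fy: "f y = 0" using A(4)[of y] False by simp
   have nz: "kern w \<le> (1/4) powr (- ?p) * wt y" if "f (y + w) \<noteq> 0 \<or> f (y - w) \<noteq> 0" for w
   proof (rule kern_le_wt)
    have "norm (y + w) \<le> 2 \<or> norm (y - w) \<le> 2"
     using that A(4)[of "y + w"] A(4)[of "y - w"] by (meson not_le)
    then have "norm y - norm w \<le> 2"
     using norm_triangle_ineq2[of y w] norm_triangle_ineq2[of y "-w"] by auto
    then show "1/4 * (1 + norm y) \<le> norm w" using False by simp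
   qed simp
   have le: "\<bar>sdiff f w y * kern w\<bar> \<le> (1/4) powr (- ?p) * wt y * (\<bar>f (y + w)\<bar> + \<bar>f (y - w)\<bar>)" for w
   proof (cases "f (y + w) \<noteq> 0 \<or> f (y - w) \<noteq> 0")
    case True
    have "\<bar>sdiff f w y\<bar> * kern w \<le> (\<bar>f (y + w)\<bar> + \<bar>f (y - w)\<bar>) * ((1/4) powr (- ?p) * wt y)"
     using fy by (intro mult_mono nz[OF True] kern_nonneg) (auto simp: sdiff_def)
    then show ?thesis by (simp add: abs_mult kern_nonneg mult.commute)
   next
    case False then show ?thesis by (simp add: sdiff_def fy)
   qed
   have i1: "integrable lborel (\<lambda>w. \<bar>f (y + w)\<bar>)" "(LBINT w. \<bar>f (y + w)\<bar>) = (LBINT w. \<bar>f w\<bar>)"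
    using integrable_shift(1)[of "\<lambda>w. \<bar>f w\<bar>" y] integral_shift(1)[of "\<lambda>w. \<bar>f w\<bar>" y] admissible_integrable[OF f]
    by (simp_all add: add.commute)
   have i2: "integrable lborel (\<lambda>w. \<bar>f (y - w)\<bar>)" "(LBINT w. \<bar>f (y - w)\<bar>) = (LBINT w. \<bar>f w\<bar>)"
    using integrable_shift(3)[of "\<lambda>w. \<bar>f w\<bar>" y] integral_shift(3)[of "\<lambda>w. \<bar>f w\<bar>" y] admissible_integrable[OF f]
    by simp_all
   have "(LBINT w. \<bar>sdiff f w y * kern w\<bar>) \<le> (LBINT w. (1/4) powr (- ?p) * wt y * (\<bar>f (y + w)\<bar> + \<bar>f (y - w)\<bar>))"
    by (intro integral_mono i le integrable_mult_right Bochner_Integration.integrable_add i1 i2)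
   also have "\<dots> = (1/4) powr (- ?p) * wt y * (2 * (LBINT w. \<bar>f w\<bar>))"
    using i1 i2 by simp
   also have "\<dots> \<le> (1/4) powr (- ?p) * wt y * (2 * (A * V))"
    using admissible_integrable(2)[OF f] wt_nonneg[of y] by (intro mult_left_mono) (auto simp: V_def)
   also have "\<dots> = (2 * (1/4) powr (- ?p) * V) * (A * wt y)" by simp
   also have "\<dots> \<le> C * (A * wt y)"
    unfolding C_def using J A(6) wt_nonneg[of y] by (intro mult_right_mono) auto
   finally show ?thesis by (simp add: mult.assoc)
  qed
 qed
qed

lemma flap_le_integral: "\<bar>flap f y\<bar> \<le> (LBINT w. \<bar>sdiff f w y * kern w\<bar>)"
 unfolding flap_def by (rule integral_abs_bound)

definition ell :: "'a::euclidean_space \<Rightarrow> real" where "ell = flap bump"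

lemma ell_measurable [measurable]: "ell \<in> borel_measurable (borel :: 'a::euclidean_space measure)"
 unfolding ell_def flap_def[abs_def] by measurable

text \<open>Second differences commute with \<open>flap\<close>, so a second difference of
  \<open>ell\<close> is the fractional Laplacian of an admissible function whose constant is
  proportional to |z|^2. One decay estimate thus yields both bounds.\<close>

lemma ell_bound:
 obtains C where "0 < C" "\<And>y :: 'a::euclidean_space. \<bar>ell y\<bar> \<le> C * wt y"
  "\<And>z y :: 'a. norm z \<le> 1 \<Longrightarrow> \<bar>sdiff ell z y\<bar> \<le> C * (norm z)\<^sup>2 * wt y"
proof -
 obtain C where C: "0 < C" "\<And>A f y. admissible A (f :: 'a \<Rightarrow> real) \<Longrightarrow>
  (LBINT w. \<bar>sdiff f w y * kern w\<bar>) \<le> C * A * wt y"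
  using admissible_flap_decay[where 'a='a] by blast
 have e: "sdiff ell z y = flap (sdiff bump z) y" for z y :: 'a
 proof -
  note i = admissible_sdiff_integrable[OF admissible_bump]
  have "sdiff ell z y = (LBINT w. 2 * (sdiff bump w y * kern w) - sdiff bump w (y + z) * kern w - sdiff bump w (y - z) * kern w)"
   unfolding sdiff_def[of ell] unfolding ell_def flap_def using i[of y] i[of "y + z"] i[of "y - z"] by simp
  also have "\<dots> = flap (sdiff bump z) y"
   unfolding flap_def
  proof (rule Bochner_Integration.integral_cong[OF refl])
   fix w
   have "sdiff (sdiff bump w) z y = sdiff (sdiff bump z) w y" by (rule sdiff_commute)
   then show "2 * (sdiff bump w y * kern w) - sdiff bump w (y + z) * kern w - sdiff bump w (y - z) * kern w = sdiff (sdiff bump z) w y * kern w"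
    unfolding sdiff_def[of "sdiff bump w"] by (metis left_diff_distrib mult.assoc)
  qed
  finally show ?thesis .
 qed
 show ?thesis
 proof (rule that[of "C * 50000"])
  show "\<bar>ell y\<bar> \<le> C * 50000 * wt y" for y :: 'a
  proof -
   have "\<bar>ell y\<bar> \<le> C * 264 * wt y"
    unfolding ell_def by (rule order_trans[OF flap_le_integral C(2)[OF admissible_bump]])
   also have "\<dots> \<le> C * 50000 * wt y" using C(1) wt_nonneg[of y] by (intro mult_right_mono mult_left_mono) auto
   finally show ?thesis .
  qed
  show "\<bar>sdiff ell z y\<bar> \<le> C * 50000 * (norm z)\<^sup>2 * wt y" if "norm z \<le> 1" for z y :: 'a
   unfolding e using order_trans[OF flap_le_integral C(2)[OF admissible_sdiff_bump[OF that]]]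
   by (simp add: mult.assoc)
 qed (use C in simp)
qed

lemma ell_continuous: "isCont ell (x :: 'a::euclidean_space)"
 unfolding isCont_def ell_def flap_def
proof (rule tendsto_integral_dominated[where B="\<lambda>w. 4 * 264 * (min ((norm w)\<^sup>2) 1 * kern w)"])
 show "integrable lborel (\<lambda>w::'a. 4 * 264 * (min ((norm w)\<^sup>2) 1 * kern w))"
  by (intro integrable_mult_right min_kern_integrable)
 show "AE w in lborel. \<bar>sdiff bump w y * kern w\<bar> \<le> 4 * 264 * (min ((norm w)\<^sup>2) 1 * kern w)" for y :: 'a
  by (intro AE_I2 admissible_sdiff_le admissible_bump)
 have c: "isCont bump z" for z :: 'a
  using continuous_on_trunc_pow[OF continuous_on_id, of "UNIV :: 'a set" 6] by (simp add: continuous_on_eq_continuous_at)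
 have "isCont (\<lambda>y. sdiff bump w y * kern w) x" for w :: 'a
  unfolding sdiff_def by (intro continuous_intros isCont_o2[OF _ c])
 then show "AE w in lborel. ((\<lambda>y. sdiff bump w y * kern w) \<longlongrightarrow> sdiff bump w x * kern w) (at x)"
  by (simp add: isCont_def)
qed measurable

text \<open>Substituting the reflection that takes x to y changes neither the bump, nor the kernel,
  nor Lebesgue measure.\<close>

lemma ell_norm_cong:
 assumes "norm (x :: 'a) = norm (y :: 'a::euclidean_space)"
 shows "ell x = ell y"
proof -
 obtain T :: "'a \<Rightarrow> 'a" where T: "linear T" "\<And>z. norm (T z) = norm z" "\<And>z. T (T z) = z" "T x = y"
  "distr lborel borel T = lborel"
  by (rule exists_isometry_between[OF assms]) blast
 have [measurable]: "T \<in> borel_measurable borel"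
  using T(1) by (intro borel_measurable_continuous_onI) (simp add: linear_continuous_on linear_conv_bounded_linear)
 have b: "sdiff bump (T w) y = sdiff bump w x" for w
 proof -
  have "bump (y + T w) = bump (x + w)" "bump (y - T w) = bump (x - w)" "bump y = bump x"
   using T(2)[of "x + w"] T(2)[of "x - w"] assms T(1)
   by (auto intro!: trunc_pow_norm_cong simp: linear_add linear_diff T(4))
  then show ?thesis by (simp add: sdiff_def)
 qed
 have "ell y = (\<integral>w. sdiff bump w y * kern w \<partial>distr lborel borel T)"
  by (simp add: ell_def flap_def T(5))
 also have "\<dots> = (LBINT w. sdiff bump (T w) y * kern (T w))"
  by (rule integral_distr) measurable
 also have "\<dots> = ell x"
  by (simp add: b ell_def flap_def kern_def T(2))
 finally show ?thesis by simp
qed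

lemma ell_minus [simp]: "ell (- y) = ell y"
 by (rule ell_norm_cong) simp

lemma bump_integrable: "integrable lborel (bump :: 'a::euclidean_space \<Rightarrow> real)"
 using admissible_integrable(1)[OF admissible_bump[where 'a='a]] by (simp add: trunc_pow_nonneg)

text \<open>After exchanging the integrals, the inner one is that of a second difference of an
  integrable function, which is zero by translation invariance.\<close>

lemma integral_ell: "(LBINT y. ell (y :: 'a::euclidean_space)) = 0"
proof -
 obtain C where C: "0 < C" "\<And>A f y. admissible A (f :: 'a \<Rightarrow> real) \<Longrightarrow>
  (LBINT w. \<bar>sdiff f w y * kern w\<bar>) \<le> C * A * wt y"
  using admissible_flap_decay[where 'a='a] by blast
 let ?f = "\<lambda>(y::'a, w). sdiff bump w y * kern w"
 have int: "integrable (lborel \<Otimes>\<^sub>M lborel) ?f"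
 proof (rule lborel_pair.Fubini_integrable)
  show "?f \<in> borel_measurable (lborel \<Otimes>\<^sub>M lborel)" by measurable
  show "integrable lborel (\<lambda>y. \<integral>w. norm (?f (y, w)) \<partial>lborel)"
  proof (rule Bochner_Integration.integrable_bound[OF integrable_mult_right[OF wt_integrable, of "C * 264"]])
   show "AE y in lborel. norm (LBINT w. norm (?f (y, w))) \<le> norm (C * 264 * wt (y::'a))"
    using C(2)[OF admissible_bump] by (intro AE_I2) (simp, smt (verit))
  qed measurable
  show "AE y in lborel. integrable lborel (\<lambda>w. ?f (y, w))"
   using admissible_sdiff_integrable[OF admissible_bump[where 'a='a]] by simp
 qed
 have "(LBINT y. ell (y::'a)) = (LBINT y. \<integral>w. ?f (y, w) \<partial>lborel)"
  by (simp add: ell_def flap_def)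
 also have "\<dots> = (LBINT w. \<integral>y. ?f (y, w) \<partial>lborel)"
  using lborel_pair.Fubini_integral[of "\<lambda>(y::'a) w. sdiff bump w y * kern w"] int by simp
 also have "\<dots> = (LBINT (w::'a). 0)"
 proof (rule Bochner_Integration.integral_cong[OF refl])
  fix w :: 'a
  have "(LBINT y. sdiff bump w y) = 0"
   unfolding sdiff_def using bump_integrable[where 'a='a] integrable_shift[of bump w] integral_shift[of bump w]
   by simp
  then show "(LBINT y. ?f (y, w)) = 0" by simp
 qed
 finally show ?thesis by simp
qed

text \<open>Off the support of the bump, \<open>ell y\<close> is -2 times the integral of bump(z)
  K(z - y). Replacing K(z - y) by K(y) costs one power of |y| by the mean value inequality, as |z -
  y| \<ge> |y| / 2 for |z| \<le> 1 and |y| \<ge> 2.\<close>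

lemma ell_far:
 obtains C where "0 < C" "\<And>y :: 'a::euclidean_space. 2 \<le> norm y \<Longrightarrow>
  \<bar>ell y + 2 * (LBINT z. bump (z::'a)) * kern y\<bar> \<le> C * norm y powr (- (real DIM('a) + 2 * s) - 1)"
proof -
 let ?p = "real DIM('a) + 2 * s"
 let ?\<Phi> = "\<integral>z. bump (z::'a) \<partial>lborel"
 define C where "C = 2 * ?p * (1/2) powr (- ?p - 1) * ?\<Phi> + 1"
 have \<Phi>: "0 \<le> ?\<Phi>" by (rule Bochner_Integration.integral_nonneg) (simp add: trunc_pow_nonneg)
 have C: "0 < C" using \<Phi> exponent_pos[where 'a='a] by (auto simp: C_def intro!: add_nonneg_pos mult_nonneg_nonneg)
 show ?thesis
 proof (rule that[OF C])
  fix y :: 'a assume y: "2 \<le> norm y"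
  have diff: "\<bar>bump z * (kern (z - y) - kern y)\<bar> \<le> (?p * (norm y / 2) powr (- ?p - 1)) * bump z" for z
  proof (cases "norm z \<le> 1")
   case True
   have "\<bar>kern (z - y) - kern y\<bar> \<le> ?p * (norm y / 2) powr (- ?p - 1) * \<bar>norm (z - y) - norm y\<bar>"
    unfolding kern_def
   proof (rule powr_minus_diff_bound)
    show "norm y / 2 \<le> norm (z - y)" using norm_triangle_ineq2[of y z] True y by (simp add: norm_minus_commute)
   qed (use y exponent_pos[where 'a='a] in auto)
   also have "\<dots> \<le> ?p * (norm y / 2) powr (- ?p - 1) * 1"
    using norm_triangle_ineq3[of "y - z" y] True exponent_pos[where 'a='a]
    by (intro mult_left_mono) (auto simp: norm_minus_commute)
   finally have "bump z * \<bar>kern (z - y) - kern y\<bar> \<le> bump z * (?p * (norm y / 2) powr (- ?p - 1))"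
    by (intro mult_left_mono) (auto simp: trunc_pow_nonneg)
   then show ?thesis by (simp add: abs_mult trunc_pow_nonneg mult.commute)
  next
   case False then show ?thesis by (simp add: trunc_pow_zero)
  qed
  have i0: "integrable lborel (\<lambda>z::'a. bump z * (kern (z - y) - kern y))"
   by (rule Bochner_Integration.integrable_bound[OF integrable_mult_right[OF bump_integrable, of "?p * (norm y / 2) powr (- ?p - 1)"]])
    (use diff in \<open>auto intro!: AE_I2 order_trans[OF diff]\<close>)
  have i1: "integrable lborel (\<lambda>z::'a. bump z * kern y)" using bump_integrable[where 'a='a] by simp
  have i2: "integrable lborel (\<lambda>z::'a. bump z * kern (z - y))"
   using Bochner_Integration.integrable_add[OF i0 i1] by (simp add: algebra_simps)
  have ip: "integrable lborel (\<lambda>w. bump (w + y) * kern w)" "(LBINT w. bump (w + y) * kern w) = (LBINT z. bump z * kern (z - y))"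
   using integrable_shift(1)[of "\<lambda>z. bump z * kern (z - y)" y] integral_shift(1)[of "\<lambda>z. bump z * kern (z - y)" y] i2 by simp_all
  have im: "integrable lborel (\<lambda>w. bump (y - w) * kern w)" "(LBINT w. bump (y - w) * kern w) = (LBINT z. bump z * kern (z - y))"
   using integrable_shift(3)[of "\<lambda>z. bump z * kern (z - y)" y] integral_shift(3)[of "\<lambda>z. bump z * kern (z - y)" y] i2 by simp_all
  have "ell y = (LBINT w. - (bump (w + y) * kern w) - bump (y - w) * kern w)"
   unfolding ell_def flap_def using y
   by (intro Bochner_Integration.integral_cong) (auto simp: sdiff_def trunc_pow_zero algebra_simps)
  also have "\<dots> = - 2 * (LBINT z. bump z * kern (z - y))" using ip im by simp
  finally have "ell y + 2 * ?\<Phi> * kern y = - 2 * (LBINT z. bump z * (kern (z - y) - kern y))"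
   using i1 i2 by (simp add: right_diff_distrib)
  then have "\<bar>ell y + 2 * ?\<Phi> * kern y\<bar> = 2 * \<bar>\<integral>z. bump z * (kern (z - y) - kern y) \<partial>lborel\<bar>" by simp
  also have "\<dots> \<le> 2 * (LBINT z. \<bar>bump z * (kern (z - y) - kern y)\<bar>)"
   by (intro mult_left_mono integral_abs_bound) auto
  also have "\<dots> \<le> 2 * (LBINT z. (?p * (norm y / 2) powr (- ?p - 1)) * bump (z::'a))"
   by (intro mult_left_mono integral_mono integrable_abs i0 diff integrable_mult_right bump_integrable) auto
  also have "\<dots> = (2 * ?p * (1/2) powr (- ?p - 1) * ?\<Phi>) * norm y powr (- ?p - 1)"
   using powr_mult[of "1/2" "norm y" "- ?p - 1"] by simp
  also have "\<dots> \<le> C * norm y powr (- ?p - 1)"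
   unfolding C_def by (intro mult_right_mono) auto
  finally show "\<bar>ell y + 2 * ?\<Phi> * kern y\<bar> \<le> C * norm y powr (- ?p - 1)" .
 qed
qed

end

subsection \<open>The bilinear form against a bump\<close>

text \<open>With c = 1 the shear makes the difference of the two points a coordinate, so that K(x -
  y) depends on one variable only; c = -1 undoes it.\<close>

lemma integrable_shear:
 fixes G :: "'a::euclidean_space \<times> 'a \<Rightarrow> real"
 assumes G: "integrable (lborel \<Otimes>\<^sub>M lborel) G"
 shows "integrable (lborel \<Otimes>\<^sub>M lborel) (\<lambda>(x, z). G (x, z + c *\<^sub>R x))"
  and "(\<integral>p. G p \<partial>(lborel \<Otimes>\<^sub>M lborel)) = (LBINT x. \<integral>z. G (x, z + c *\<^sub>R x) \<partial>lborel)"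
proof -
 have m[measurable]: "G \<in> borel_measurable (lborel \<Otimes>\<^sub>M lborel)" using G by simp
 have ms: "(\<lambda>z. G (x, z)) \<in> borel_measurable borel" for x by measurable
 have ms': "(\<lambda>z. norm (G (x, z))) \<in> borel_measurable borel" for x by measurable
 show "integrable (lborel \<Otimes>\<^sub>M lborel) (\<lambda>(x, z). G (x, z + c *\<^sub>R x))"
 proof (rule lborel_pair.Fubini_integrable)
  show "(\<lambda>(x, z). G (x, z + c *\<^sub>R x)) \<in> borel_measurable (lborel \<Otimes>\<^sub>M lborel)" by measurable
  have "(LBINT z. norm (G (x, z + c *\<^sub>R x))) = (LBINT z. norm (G (x, z)))" for x
   using integral_shift(1)[OF ms'[of x], of "c *\<^sub>R x"] by simp
  then show "integrable lborel (\<lambda>x. \<integral>z. norm (case (x, z) of (x, z) \<Rightarrow> G (x, z + c *\<^sub>R x)) \<partial>lborel)"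
   using lborel_pair.integrable_fst'[OF integrable_norm[OF G]] by simp
  show "AE x in lborel. integrable lborel (\<lambda>z. case (x, z) of (x, z) \<Rightarrow> G (x, z + c *\<^sub>R x))"
   using lborel_pair.AE_integrable_fst'[OF G]
   by eventually_elim (use integrable_shift(1)[OF ms] in simp)
 qed
 have "(\<integral>p. G p \<partial>(lborel \<Otimes>\<^sub>M lborel)) = (LBINT x. \<integral>z. G (x, z) \<partial>lborel)"
  by (rule lborel_pair.integral_fst'[OF G, symmetric])
 also have "\<dots> = (LBINT x. \<integral>z. G (x, z + c *\<^sub>R x) \<partial>lborel)"
  using integral_shift(1)[OF ms] by simp
 finally show "(\<integral>p. G p \<partial>(lborel \<Otimes>\<^sub>M lborel)) = (LBINT x. \<integral>z. G (x, z + c *\<^sub>R x) \<partial>lborel)" .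
qed

lemma square_integrable_scale:
 fixes f :: "'a::euclidean_space \<Rightarrow> real"
 assumes f: "square_integrable f" and l: "0 < l"
 shows "square_integrable (\<lambda>y. f ((y - a) /\<^sub>R l))"
proof -
 have [measurable]: "f \<in> borel_measurable borel" using f by (rule square_integrableD)
 show ?thesis
  using integrable_scale[of "\<lambda>x. (f x)\<^sup>2" l a] l f by (simp add: square_integrable_def)
qed

definition sbump :: "'a::euclidean_space \<Rightarrow> real \<Rightarrow> 'a \<Rightarrow> real"
 where "sbump a l y = bump ((y - a) /\<^sub>R l)"

lemma sbump_measurable [measurable]: "sbump a l \<in> borel_measurable borel"
 unfolding sbump_def[abs_def] by measurable

lemma sbump_nonneg: "0 \<le> sbump a l y" by (simp add: sbump_def trunc_pow_nonneg)

lemma sbump_le_1: "sbump a l y \<le> 1" by (simp add: sbump_def trunc_pow_le_1)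

lemma sbump_zero: "0 < l \<Longrightarrow> l \<le> dist a y \<Longrightarrow> sbump a l y = 0"
proof -
 assume l: "0 < l" "l \<le> dist a y"
 then have "norm ((y - a) /\<^sub>R l) = dist a y / l"
  by (simp add: dist_norm norm_minus_commute divide_inverse mult.commute)
 then show ?thesis using l by (simp add: sbump_def trunc_pow_zero)
qed

lemma sbump_lipschitz: "0 < l \<Longrightarrow> \<bar>sbump a l x - sbump a l y\<bar> \<le> 12 / l * norm (x - y)"
 using bump_lipschitz[of "(x - a) /\<^sub>R l" "(y - a) /\<^sub>R l"]
 by (simp add: sbump_def divide_inverse mult.assoc flip: scaleR_diff_right)

lemma square_integrable_bump: "square_integrable (bump :: 'a::euclidean_space \<Rightarrow> real)"
proof (rule square_integrable_bounded_integrable[where B=1])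
 interpret frac "1 / 2" by unfold_locales auto
 show "integrable lborel (bump :: 'a \<Rightarrow> real)" by (rule bump_integrable)
qed (auto simp: trunc_pow_nonneg trunc_pow_le_1)

lemma square_integrable_sbump: "0 < l \<Longrightarrow> square_integrable (sbump a l)"
 unfolding sbump_def[abs_def] by (rule square_integrable_scale[OF square_integrable_bump])

context frac
begin

lemma kern_scale_dim:
 assumes "0 < l"
 shows "l ^ DIM('a) * kern (l *\<^sub>R (z::'a::euclidean_space)) = l powr (- 2 * s) * kern z"
proof -
 have "l ^ DIM('a) * l powr (- (real DIM('a) + 2 * s)) = l powr (- 2 * s)"
  using assms by (simp add: powr_realpow[symmetric] powr_add[symmetric])
 then show ?thesis using assms by (simp only: kern_scaleR mult.assoc[symmetric])
qed

text \<open>The factor l^(-2s) is the homogeneity of the fractional Laplacian. The function F allows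
  the same substitution for the integral and for the integral of absolute values.\<close>

lemma integral_sdiff_sbump:
 fixes a y :: "'a::euclidean_space" and F :: "real \<Rightarrow> real"
 assumes l: "0 < l" and [measurable]: "F \<in> borel_measurable borel"
 shows "integrable lborel (\<lambda>w. F (sdiff (sbump a l) w y) * kern w) \<longleftrightarrow>
   integrable lborel (\<lambda>w. F (sdiff bump w ((y - a) /\<^sub>R l)) * kern w)"
  and "(LBINT w. F (sdiff (sbump a l) w y) * kern w)
   = l powr (- 2 * s) * (LBINT w. F (sdiff bump w ((y - a) /\<^sub>R l)) * kern w)"
proof -
 have e: "sdiff (sbump a l) (l *\<^sub>R w) y = sdiff bump w ((y - a) /\<^sub>R l)" for w
 proof -
  have "(y + l *\<^sub>R w - a) /\<^sub>R l = (y - a) /\<^sub>R l + w" "(y - l *\<^sub>R w - a) /\<^sub>R l = (y - a) /\<^sub>R l - w"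
   using l by (simp_all add: algebra_simps)
  then show ?thesis by (simp add: sdiff_def sbump_def)
 qed
 let ?f = "\<lambda>w. F (sdiff (sbump a l) w y) * kern w"
 let ?g = "\<lambda>w. F (sdiff bump w ((y - a) /\<^sub>R l)) * kern w"
 have c: "l ^ DIM('a) * ?f (0 + l *\<^sub>R w) = l powr (- 2 * s) * ?g w" for w
  using kern_scale_dim[OF l, of w] by (simp add: e mult.left_commute)
 have i: "integrable lborel (\<lambda>w. l ^ DIM('a) * ?f (0 + l *\<^sub>R w)) \<longleftrightarrow> integrable lborel ?f"
  using integrable_lborel_affine_iff[of ?f l 0] l by simp
 show "integrable lborel ?f \<longleftrightarrow> integrable lborel ?g"
  using i l unfolding c by simp
 have "(LBINT w. ?f w) = (LBINT w. l ^ DIM('a) * ?f (0 + l *\<^sub>R w))"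
  using integral_lborel_affine[of ?f l 0] l by simp
 then show "(LBINT w. ?f w) = l powr (- 2 * s) * (LBINT w. ?g w)"
  unfolding c by simp
qed

lemma wt_scaled_integrable:
 fixes u :: "'a::euclidean_space \<Rightarrow> real"
 assumes "square_integrable u" "0 < l"
 shows "integrable lborel (\<lambda>y. \<bar>u y\<bar> * wt ((y - a) /\<^sub>R l))"
proof -
 have "integrable lborel (\<lambda>y. \<bar>u y * wt ((y - a) /\<^sub>R l)\<bar>)"
  by (intro integrable_abs integrable_square_integrable_mult assms square_integrable_scale square_integrable_decay dim_less)
 then show ?thesis by (simp add: abs_mult abs_of_nonneg[OF wt_nonneg])
qed

text \<open>Nonlocal integration by parts. For a fixed difference z of the two points, shifting x
  turns the four products into u times a second difference of the test function. The first exchange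
  of integrals rests on the assumed integrability of the form, the second on the decay of
  \<open>flap\<close> of the bump.\<close>

lemma form_sbump:
 fixes u :: "'a::euclidean_space \<Rightarrow> real"
 assumes u: "square_integrable u" and l: "0 < l"
  and int: "integrable (lborel \<Otimes>\<^sub>M lborel) (\<lambda>(x, y). (u x - u y) * (sbump a l x - sbump a l y) * kern (x - y))"
 shows "(\<integral>(x, y). (u x - u y) * (sbump a l x - sbump a l y) * kern (x - y) \<partial>(lborel \<Otimes>\<^sub>M lborel))
  = l powr (- 2 * s) * (LBINT y. u y * ell ((y - a) /\<^sub>R l))"
proof -
 have [measurable]: "u \<in> borel_measurable borel" using u by (rule square_integrableD)
 let ?v = "sbump a l"
 let ?G = "\<lambda>(x, y). (u x - u y) * (?v x - ?v y) * kern (x - y)"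
 let ?H = "\<lambda>x z. (u x - u (z + x)) * (?v x - ?v (z + x)) * kern z"
 have v: "square_integrable ?v" by (rule square_integrable_sbump[OF l])
 have iH: "integrable (lborel \<Otimes>\<^sub>M lborel) (\<lambda>(x, z). ?H x z)"
  using integrable_shear(1)[OF int, of 1] by (simp add: case_prod_unfold)
 have "(\<integral>p. ?G p \<partial>(lborel \<Otimes>\<^sub>M lborel)) = (LBINT x. \<integral>z. ?H x z \<partial>lborel)"
  using integrable_shear(2)[OF int, of 1] by simp
 also have "\<dots> = (LBINT z. \<integral>x. ?H x z \<partial>lborel)"
  by (rule lborel_pair.Fubini_integral[OF iH, symmetric])
 also have "\<dots> = (LBINT z. \<integral>x. u x * sdiff ?v z x * kern z \<partial>lborel)"
 proof (rule Bochner_Integration.integral_cong[OF refl])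
  fix z :: 'a
  have 1: "integrable lborel (\<lambda>x. u x * ?v x)" by (rule integrable_square_integrable_mult[OF u v])
  have 2: "integrable lborel (\<lambda>x. u x * ?v (x + z))" by (rule integrable_square_integrable_mult[OF u square_integrable_shift(1)[OF v]])
  have 3: "integrable lborel (\<lambda>x. u x * ?v (x - z))" by (rule integrable_square_integrable_mult[OF u square_integrable_shift(2)[OF v]])
  have 4: "integrable lborel (\<lambda>x. u (x + z) * ?v x)" "(LBINT x. u (x + z) * ?v x) = (LBINT x. u x * ?v (x - z))"
   using integrable_shift(1)[of "\<lambda>x. u x * ?v (x - z)" z] integral_shift(1)[of "\<lambda>x. u x * ?v (x - z)" z] 3 by simp_all
  have 5: "integrable lborel (\<lambda>x. u (x + z) * ?v (x + z))" "(LBINT x. u (x + z) * ?v (x + z)) = (LBINT x. u x * ?v x)"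
   using integrable_shift(1)[of "\<lambda>x. u x * ?v x" z] integral_shift(1)[of "\<lambda>x. u x * ?v x" z] 1 by simp_all
  have "(LBINT x. (u x - u (z + x)) * (?v x - ?v (z + x)))
   = (LBINT x. u x * ?v x - u x * ?v (x + z) - u (x + z) * ?v x + u (x + z) * ?v (x + z))"
   by (intro Bochner_Integration.integral_cong refl) (simp add: algebra_simps)
  also have "\<dots> = (LBINT x. 2 * (u x * ?v x) - u x * ?v (x + z) - u x * ?v (x - z))"
   using 1 2 3 4 5 by simp
  also have "\<dots> = (LBINT x. u x * sdiff ?v z x)"
   by (intro Bochner_Integration.integral_cong refl) (simp add: sdiff_def algebra_simps)
  finally show "(LBINT x. ?H x z) = (LBINT x. u x * sdiff ?v z x * kern z)" by simp
 qed
 also have "\<dots> = (LBINT x. \<integral>z. u x * sdiff ?v z x * kern z \<partial>lborel)"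
 proof (rule lborel_pair.Fubini_integral)
  obtain C where C: "0 < C" "\<And>A f y. admissible A (f :: 'a \<Rightarrow> real) \<Longrightarrow>
   (LBINT w. \<bar>sdiff f w y * kern w\<bar>) \<le> C * A * wt y"
   using admissible_flap_decay[where 'a='a] by blast
  show "integrable (lborel \<Otimes>\<^sub>M lborel) (\<lambda>(x, z). u x * sdiff ?v z x * kern z)"
  proof (rule lborel_pair.Fubini_integrable)
   show "(\<lambda>(x, z). u x * sdiff ?v z x * kern z) \<in> borel_measurable (lborel \<Otimes>\<^sub>M lborel)" by measurable
   have i: "integrable lborel (\<lambda>z. sdiff ?v z x * kern z)" for x
    using integral_sdiff_sbump(1)[OF l, of "\<lambda>t. t" a x] admissible_sdiff_integrable[OF admissible_bump, of "(x - a) /\<^sub>R l"] by simp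
   then show "AE x in lborel. integrable lborel (\<lambda>z. case (x, z) of (x, z) \<Rightarrow> u x * sdiff ?v z x * kern z)"
    by (simp add: mult.assoc)
   show "integrable lborel (\<lambda>x. \<integral>z. norm (case (x, z) of (x, z) \<Rightarrow> u x * sdiff ?v z x * kern z) \<partial>lborel)"
   proof (rule Bochner_Integration.integrable_bound[OF integrable_mult_right[OF wt_scaled_integrable[OF u l, of a], of "l powr (- 2 * s) * (C * 264)"]])
    show "AE x in lborel. norm (LBINT z. norm (case (x, z) of (x, z) \<Rightarrow> u x * sdiff ?v z x * kern z))
     \<le> norm (l powr (- 2 * s) * (C * 264) * (\<bar>u x\<bar> * wt ((x - a) /\<^sub>R l)))"
    proof (intro AE_I2)
     fix x
     have "(LBINT z. \<bar>u x * sdiff ?v z x * kern z\<bar>) = \<bar>u x\<bar> * (LBINT z. \<bar>sdiff ?v z x\<bar> * kern z)"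
      by (simp add: abs_mult kern_nonneg mult.assoc)
     also have "\<dots> = \<bar>u x\<bar> * (l powr (- 2 * s) * (LBINT w. \<bar>sdiff bump w ((x - a) /\<^sub>R l) * kern w\<bar>))"
      using integral_sdiff_sbump(2)[OF l, of "\<lambda>t. \<bar>t\<bar>" a x] by (simp add: abs_mult kern_nonneg)
     also have "\<dots> \<le> \<bar>u x\<bar> * (l powr (- 2 * s) * (C * 264 * wt ((x - a) /\<^sub>R l)))"
      by (intro mult_left_mono C(2) admissible_bump) auto
     finally show "norm (LBINT z. norm (case (x, z) of (x, z) \<Rightarrow> u x * sdiff ?v z x * kern z))
     \<le> norm (l powr (- 2 * s) * (C * 264) * (\<bar>u x\<bar> * wt ((x - a) /\<^sub>R l)))"
      using C(1) by (simp add: abs_mult abs_of_pos[OF decay_pos] mult_ac)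
    qed
   qed measurable
  qed
 qed
 also have "\<dots> = (LBINT x. l powr (- 2 * s) * (u x * ell ((x - a) /\<^sub>R l)))"
 proof (rule Bochner_Integration.integral_cong[OF refl])
  fix x
  have "(LBINT z. u x * sdiff ?v z x * kern z) = u x * (LBINT z. sdiff ?v z x * kern z)"
   by (simp add: mult.assoc)
  then show "(LBINT z. u x * sdiff ?v z x * kern z) = l powr (- 2 * s) * (u x * ell ((x - a) /\<^sub>R l))"
   using integral_sdiff_sbump(2)[OF l, of "\<lambda>t. t" a x] by (simp add: ell_def flap_def)
 qed
 finally show ?thesis by simp
qed

text \<open>A squared increment over z is at most C min(|z|^2, 1), where 1 accounts for values in
  [0, 1], and it vanishes unless one of the two points lies in the ball. Integrating over x first
  leaves \<open>min_kern_integrable\<close>.\<close>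

lemma lipschitz_energy_integrable:
 fixes v :: "'a::euclidean_space \<Rightarrow> real"
 assumes [measurable]: "v \<in> borel_measurable borel" and lip: "\<And>x y. \<bar>v x - v y\<bar> \<le> L * norm (x - y)"
  and v01: "\<And>x. 0 \<le> v x" "\<And>x. v x \<le> 1" and supp: "\<And>x. l \<le> dist a x \<Longrightarrow> v x = 0"
 shows "integrable (lborel \<Otimes>\<^sub>M lborel) (\<lambda>(x, y). (v x - v y)\<^sup>2 * kern (x - y))"
proof -
 let ?B = "indicator (ball a l) :: 'a \<Rightarrow> real"
 define C where "C = max 1 (L\<^sup>2)"
 have C: "0 < C" by (simp add: C_def)
 have vb: "(v x - v (x + z))\<^sup>2 \<le> C * min ((norm z)\<^sup>2) 1 * (?B x + ?B (x + z))" for x z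
 proof (cases "x \<in> ball a l \<or> x + z \<in> ball a l")
  case True
  have "\<bar>v x - v (x + z)\<bar> \<le> 1"
   using v01[of x] v01[of "x + z"] by linarith
  then have "(v x - v (x + z))\<^sup>2 \<le> 1" by (simp add: abs_square_le_1)
  moreover have "(v x - v (x + z))\<^sup>2 \<le> L\<^sup>2 * (norm z)\<^sup>2"
   using power_mono[OF lip[of x "x + z"], of 2] by (simp add: power_mult_distrib)
  moreover have "L\<^sup>2 * (norm z)\<^sup>2 \<le> C * (norm z)\<^sup>2" by (intro mult_right_mono) (auto simp: C_def)
  moreover have "1 \<le> C" by (simp add: C_def)
  ultimately have "(v x - v (x + z))\<^sup>2 \<le> C * min ((norm z)\<^sup>2) 1 * 1" by (auto simp: min_def)
  also have "\<dots> \<le> C * min ((norm z)\<^sup>2) 1 * (?B x + ?B (x + z))"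
   using True C by (intro mult_left_mono) (auto simp: indicator_def)
  finally show ?thesis .
 next
  case False
  then have "v x = 0" "v (x + z) = 0" by (auto intro!: supp simp: not_less)
  then show ?thesis using C by (simp add: indicator_def)
 qed
 let ?V = "measure lborel (ball a l)"
 have iB: "integrable lborel ?B" by (rule integrable_real_indicator[OF _ emeasure_lborel_ball_finite]) simp
 have iBz: "integrable lborel (\<lambda>x. ?B (x + z))" "(LBINT x. ?B (x + z)) = ?V" for z
  using integrable_shift(1)[of ?B z] integral_shift(1)[of ?B z] iB by simp_all
 have "integrable (lborel \<Otimes>\<^sub>M lborel) (\<lambda>(z, x). C * (min ((norm z)\<^sup>2) 1 * kern z) * (?B x + ?B (x + z)))"
 proof (rule lborel_pair.Fubini_integrable)
  show "(\<lambda>(z, x). C * (min ((norm z)\<^sup>2) 1 * kern z) * (?B x + ?B (x + z))) \<in> borel_measurable (lborel \<Otimes>\<^sub>M lborel)"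
  proof -
   have "?B = (\<lambda>x. indicator {..<l} (dist a x))" by (auto simp: indicator_def)
   then show ?thesis by simp
  qed
  show "AE z in lborel. integrable lborel (\<lambda>x. case (z, x) of (z, x) \<Rightarrow> C * (min ((norm z)\<^sup>2) 1 * kern z) * (?B x + ?B (x + z)))"
   using iB iBz by simp
  have "(LBINT x. norm (case (z, x) of (z, x) \<Rightarrow> C * (min ((norm z)\<^sup>2) 1 * kern z) * (?B x + ?B (x + z))))
   = (2 * C * ?V) * (min ((norm z)\<^sup>2) 1 * kern z)" for z
  proof -
   have "(LBINT x. norm (case (z, x) of (z, x) \<Rightarrow> C * (min ((norm z)\<^sup>2) 1 * kern z) * (?B x + ?B (x + z))))
    = (LBINT x. C * (min ((norm z)\<^sup>2) 1 * kern z) * (?B x + ?B (x + z)))"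
    using C kern_nonneg[of z] by (intro Bochner_Integration.integral_cong refl) (simp add: abs_mult)
   then show ?thesis using iB iBz by simp
  qed
  then show "integrable lborel (\<lambda>z. \<integral>x. norm (case (z, x) of (z, x) \<Rightarrow> C * (min ((norm z)\<^sup>2) 1 * kern z) * (?B x + ?B (x + z))) \<partial>lborel)"
   using integrable_mult_right[OF min_kern_integrable, of "2 * C * ?V"] by simp
 qed
 then have "integrable (lborel \<Otimes>\<^sub>M lborel) (\<lambda>(x, z). C * (min ((norm z)\<^sup>2) 1 * kern z) * (?B x + ?B (x + z)))"
  using lborel_pair.integrable_product_swap_iff[of "\<lambda>(x, z). C * (min ((norm z)\<^sup>2) 1 * kern z) * (?B x + ?B (x + z))"]
  by simp
 then have "integrable (lborel \<Otimes>\<^sub>M lborel) (\<lambda>(x, z). (v x - v (x + z))\<^sup>2 * kern z)"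
 proof (rule Bochner_Integration.integrable_bound)
  show "AE p in lborel \<Otimes>\<^sub>M lborel. norm (case p of (x, z) \<Rightarrow> (v x - v (x + z))\<^sup>2 * kern z)
   \<le> norm (case p of (x, z) \<Rightarrow> C * (min ((norm z)\<^sup>2) 1 * kern z) * (?B x + ?B (x + z)))"
  proof (intro AE_I2)
   fix p :: "'a \<times> 'a"
   obtain x z where p: "p = (x, z)" by fastforce
   have "(v x - v (x + z))\<^sup>2 * kern z \<le> C * min ((norm z)\<^sup>2) 1 * (?B x + ?B (x + z)) * kern z"
    by (intro mult_right_mono vb kern_nonneg)
   then show "norm (case p of (x, z) \<Rightarrow> (v x - v (x + z))\<^sup>2 * kern z)
   \<le> norm (case p of (x, z) \<Rightarrow> C * (min ((norm z)\<^sup>2) 1 * kern z) * (?B x + ?B (x + z)))"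
    using C kern_nonneg[of z] by (simp add: p abs_mult mult_ac)
  qed
 qed measurable
 from integrable_shear(1)[OF this, of "-1"] show ?thesis
  by (simp add: case_prod_unfold kern_commute)
qed

lemma sbump_energy_integrable:
 assumes "0 < l"
 shows "integrable (lborel \<Otimes>\<^sub>M lborel) (\<lambda>(x::'a::euclidean_space, y). (sbump a l x - sbump a l y)\<^sup>2 * kern (x - y))"
 by (rule lipschitz_energy_integrable[OF sbump_measurable sbump_lipschitz sbump_nonneg sbump_le_1 sbump_zero]) (use assms in auto)

end

subsection \<open>The averaging kernel\<close>

text \<open>The change of variables t to a / t maps the half line onto itself; it is carried out for
  the Lebesgue integral and transferred back to Borel integrands.\<close>

lemma set_integral_inversion:
 fixes f :: "real \<Rightarrow> real"
 assumes [measurable]: "f \<in> borel_measurable borel" and f: "integrable lborel (\<lambda>t. f t * indicator {0<..} t)" and a: "0 < a"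
 shows "(LBINT t. f t * indicator {0<..} t) = (LBINT t. a / t\<^sup>2 * f (a / t) * indicator {0<..} t)"
proof -
 let ?S = "{0<..} :: real set"
 let ?h = "\<lambda>t. \<bar>- a / t\<^sup>2\<bar> * f (a / t)"
 have im: "(\<lambda>t. a / t) ` ?S = ?S"
 proof (intro set_eqI iffI)
  fix x assume "x \<in> ?S"
  then show "x \<in> (\<lambda>t. a / t) ` ?S" using a by (intro image_eqI[of _ _ "a / x"]) auto
 qed (use a in auto)
 have fl: "f absolutely_integrable_on ?S"
  using f integrable_completion[of "\<lambda>t. f t * indicator {0<..} t" lborel]
  by (simp add: set_integrable_def mult.commute)
 have "?h absolutely_integrable_on ?S \<and> integral ?S ?h = integral ?S f"
  by (subst has_absolute_integral_change_of_variables_1'[where g="\<lambda>t. a / t"])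
   (use a fl im in \<open>auto intro!: derivative_eq_intros inj_onI simp: power2_eq_square\<close>)
 then have h: "set_integrable lebesgue ?S ?h" "integral ?S ?h = integral ?S f" by auto
 have "(LBINT t. f t * indicator {0<..} t) = (\<integral>t. f t * indicator {0<..} t \<partial>lebesgue)"
  by (rule integral_completion[symmetric]) measurable
 also have "\<dots> = integral ?S f"
  using set_lebesgue_integral_eq_integral(2)[OF fl] by (simp add: set_lebesgue_integral_def mult.commute)
 also have "\<dots> = (\<integral>t. ?h t * indicator {0<..} t \<partial>lebesgue)"
  using set_lebesgue_integral_eq_integral(2)[OF h(1)] h(2) by (simp add: set_lebesgue_integral_def mult.commute)
 also have "\<dots> = (LBINT t. ?h t * indicator {0<..} t)"
  by (rule integral_completion) measurable
 finally show ?thesis using a by simp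
qed

lemma integrable_powr_tail:
 assumes "1 < q" "0 < (r::real)"
 shows "integrable lborel (\<lambda>t. t powr (- q) * indicator {r<..} t)"
proof (rule Bochner_Integration.integrable_bound)
 show "integrable lborel (\<lambda>t::real. norm t powr (- q) * indicator {r..} (norm t))"
  using assms by (intro integrable_norm_powr_outside) auto
 show "AE t in lborel. norm (t powr (- q) * indicator {r<..} t) \<le> norm (norm t powr (- q) * indicator {r..} (norm t))"
  using assms by (intro AE_I2) (auto simp: indicator_def)
qed measurable

lemma integrable_powr_head:
 assumes "-1 < q" "0 < (r::real)"
 shows "integrable lborel (\<lambda>t. t powr q * indicator {0<..r} t)"
  and "(LBINT t. t powr q * indicator {0<..r} t) = r powr (q + 1) / (q + 1)"
proof -
 have "(\<integral>\<^sup>+t. ennreal (t powr q * indicator {0<..r} t) \<partial>lborel) = (\<integral>\<^sup>+t. ennreal (t powr q) * indicator {0..r} t \<partial>lborel)"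
  by (rule nn_integral_cong) (auto simp: indicator_def)
 also have "\<dots> = ennreal (r powr (q + 1) / (q + 1))"
  using assms by (intro nn_integral_has_integral_lebesgue' has_integral_powr_from_0) auto
 finally have e: "(\<integral>\<^sup>+t. ennreal (t powr q * indicator {0<..r} t) \<partial>lborel) = ennreal (r powr (q + 1) / (q + 1))" .
 then show "integrable lborel (\<lambda>t. t powr q * indicator {0<..r} t)"
  by (intro integrableI_nonneg) auto
 show "(LBINT t. t powr q * indicator {0<..r} t) = r powr (q + 1) / (q + 1)"
  by (subst integral_eq_nn_integral) (use e assms in auto)
qed

lemma powr_divide_minus: "0 < t \<Longrightarrow> 0 \<le> x \<Longrightarrow> (x / t) powr (- k) = x powr (- k) * t powr (k::real)"
proof -
 assume t: "0 < t" "0 \<le> x"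
 have "(x / t) powr (- k) = x powr (- k) / t powr (- k)" by (rule powr_divide)
 also have "\<dots> = x powr (- k) * t powr k" by (simp add: powr_minus[of t k] divide_inverse)
 finally show ?thesis .
qed

context frac
begin

lemma kern_divide: "0 < t \<Longrightarrow> kern ((y::'a::euclidean_space) /\<^sub>R t) = t powr (real DIM('a) + 2 * s) * kern y"
proof -
 assume t: "0 < t"
 then have "norm (y /\<^sub>R t) = norm y / t" by (simp add: divide_inverse mult.commute)
 then show ?thesis
  using powr_divide_minus[OF t, of "norm y" "real DIM('a) + 2 * s"] unfolding kern_def by (simp only: norm_ge_zero mult.commute simp_thms)
qed

text \<open>The dilate t^(-n) ell(y / t), which preserves integrals, times the scale-invariant
  density 1 / t.\<close>

abbreviation lay :: "real \<Rightarrow> 'a::euclidean_space \<Rightarrow> real" where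
 "lay t y \<equiv> t powr (- (real DIM('a) + 1)) * ell (y /\<^sub>R t)"

text \<open>All layers above scale e. Lowering e adds exactly one layer, and that layer is what a
  scaled bump yields in the weak equation.\<close>

definition avg :: "real \<Rightarrow> 'a::euclidean_space \<Rightarrow> real" where
 "avg e y = (LBINT t. lay t y * indicator {e<..} t)"

lemma avg_measurable [measurable]: "avg e \<in> borel_measurable (borel :: 'a::euclidean_space measure)"
 unfolding avg_def[abs_def] by measurable

lemma lay_tail_integrable:
 assumes e: "0 < e"
 shows "integrable lborel (\<lambda>t. lay t (y::'a::euclidean_space) * indicator {e<..} t)"
proof -
 obtain C where C: "0 < C" "\<And>y :: 'a. \<bar>ell y\<bar> \<le> C * wt y"
  by (rule ell_bound[where 'a='a]) (rule that)
 show ?thesis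
 proof (rule Bochner_Integration.integrable_bound)
  show "integrable lborel (\<lambda>t. C * (t powr (- (real DIM('a) + 1)) * indicator {e<..} t))"
   using e by (intro integrable_mult_right integrable_powr_tail) auto
  show "AE t in lborel. norm (lay t y * indicator {e<..} t) \<le> norm (C * (t powr (- (real DIM('a) + 1)) * indicator {e<..} t))"
  proof (intro AE_I2)
   fix t
   have "\<bar>ell (y /\<^sub>R t)\<bar> \<le> C * 1" using order_trans[OF C(2) mult_left_mono[OF wt_le_1]] C(1) by auto
   then have "t powr (- (real DIM('a) + 1)) * \<bar>ell (y /\<^sub>R t)\<bar> \<le> t powr (- (real DIM('a) + 1)) * (C * 1)"
    by (intro mult_left_mono) auto
   then show "norm (lay t y * indicator {e<..} t) \<le> norm (C * (t powr (- (real DIM('a) + 1)) * indicator {e<..} t))"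
    using C(1) by (simp add: abs_mult indicator_def mult.commute)
  qed
 qed measurable
qed

text \<open>For small t the argument y / t is large, so the decay of \<open>ell\<close> takes over
  and supplies t^(2s-1), which is integrable at 0.\<close>

lemma lay_head_bound:
 obtains C where "0 < C" "\<And>(t::real) (y::'a::euclidean_space). y \<noteq> 0 \<Longrightarrow> 0 < t \<Longrightarrow> \<bar>lay t y\<bar> \<le> C * kern y * t powr (2 * s - 1)"
proof -
 let ?n = "real DIM('a)"
 obtain C where C: "0 < C" "\<And>y :: 'a. \<bar>ell y\<bar> \<le> C * wt y"
  by (rule ell_bound[where 'a='a]) (rule that)
 show ?thesis
 proof (rule that[OF C(1)])
  fix t :: real and y :: 'a assume y: "y \<noteq> 0" and t: "0 < t"
  have "wt (y /\<^sub>R t) \<le> norm (y /\<^sub>R t) powr (- (?n + 2 * s))"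
   unfolding decay_def using y t exponent_pos[where 'a='a] by (intro powr_mono2') auto
  also have "\<dots> = kern y * t powr (?n + 2 * s)"
   using kern_divide[OF t, of y] by (simp only: kern_def mult.commute)
  finally have "\<bar>ell (y /\<^sub>R t)\<bar> \<le> C * (kern y * t powr (?n + 2 * s))"
   using order_trans[OF C(2) mult_left_mono] C(1) by auto
  then have "t powr (- (?n + 1)) * \<bar>ell (y /\<^sub>R t)\<bar> \<le> t powr (- (?n + 1)) * (C * (kern y * t powr (?n + 2 * s)))"
   by (intro mult_left_mono) auto
  also have "\<dots> = C * kern y * (t powr (- (?n + 1)) * t powr (?n + 2 * s))" by simp
  also have "t powr (- (?n + 1)) * t powr (?n + 2 * s) = t powr (2 * s - 1)"
   by (simp add: powr_add[symmetric])
  finally show "\<bar>lay t y\<bar> \<le> C * kern y * t powr (2 * s - 1)" by (simp add: abs_mult)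
 qed
qed

lemma lay_head_integrable:
 assumes r: "0 < r" and y: "y \<noteq> 0"
 shows "integrable lborel (\<lambda>t. lay t (y::'a::euclidean_space) * indicator {0<..r} t)"
proof -
 obtain C where C: "0 < C" "\<And>(t::real) (y::'a). y \<noteq> 0 \<Longrightarrow> 0 < t \<Longrightarrow> \<bar>lay t y\<bar> \<le> C * kern y * t powr (2 * s - 1)"
  using lay_head_bound[where 'a='a] by blast
 show ?thesis
 proof (rule Bochner_Integration.integrable_bound)
  show "integrable lborel (\<lambda>t. C * kern y * (t powr (2 * s - 1) * indicator {0<..r} t))"
   using r s0 by (intro integrable_mult_right integrable_powr_head) auto
  show "AE t in lborel. norm (lay t y * indicator {0<..r} t) \<le> norm (C * kern y * (t powr (2 * s - 1) * indicator {0<..r} t))"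
   using C(2)[OF y] C(1) kern_nonneg[of y] by (intro AE_I2) (auto simp: indicator_def intro: order_trans[OF _ abs_ge_self])
 qed measurable
qed

text \<open>Since \<open>ell\<close> is radial, the substitution of |y| / t for t turns the integral
  into |y|^(-n) times the integral of r^(n-1) L(r), the polar form of the vanishing integral of
  \<open>ell\<close>.\<close>

lemma lay_total:
 assumes y: "y \<noteq> (0::'a::euclidean_space)"
 shows "(LBINT t. lay t y * indicator {0<..} t) = 0"
proof -
 let ?n = "real DIM('a)"
 obtain S where S: "0 < S" "distr (lborel :: 'a measure) borel norm
   = density lborel (\<lambda>t. ennreal (S * t ^ (DIM('a) - 1) * indicator {0<..} t))"
  using distr_norm_lborel[where 'a='a] by blast
 define b where "b = y /\<^sub>R norm y"
 have b: "norm b = 1" using y by (simp add: b_def)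
 define L where "L t = ell (t *\<^sub>R b)" for t :: real
 have [measurable]: "L \<in> borel_measurable borel" unfolding L_def by measurable
 have Ln: "ell z = L (norm z)" for z :: 'a unfolding L_def by (rule ell_norm_cong) (simp add: b)
 have "0 = (LBINT z. L (norm (z::'a)))" using integral_ell[where 'a='a] by (simp add: Ln[symmetric])
 also have "\<dots> = (\<integral>t. L t \<partial>distr (lborel :: 'a measure) borel norm)" by (simp add: integral_distr)
 also have "\<dots> = (LBINT t. (S * t ^ (DIM('a) - 1) * indicator {0<..} t) * L t)"
  unfolding S(2) using S(1) by (subst integral_density) (auto intro!: AE_I2 simp: indicator_def)
 also have "\<dots> = S * (LBINT t. t ^ (DIM('a) - 1) * L t * indicator {0<..} t)"
  by (subst integral_mult_right_zero[symmetric]) (intro Bochner_Integration.integral_cong refl, simp add: mult_ac)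
 finally have z: "(LBINT t. t ^ (DIM('a) - 1) * L t * indicator {0<..} t) = 0" using S(1) by simp
 have "integrable lborel (\<lambda>t. lay t y * indicator {0<..1} t + lay t y * indicator {1<..} t)"
  by (intro Bochner_Integration.integrable_add lay_head_integrable lay_tail_integrable y) auto
 also have "(\<lambda>t. lay t y * indicator {0<..1} t + lay t y * indicator {1<..} t) = (\<lambda>t. lay t y * indicator {0<..} t)"
  by (auto simp: indicator_def fun_eq_iff)
 finally have "(LBINT t. lay t y * indicator {0<..} t)
  = (LBINT t. norm y / t\<^sup>2 * lay (norm y / t) y * indicator {0<..} t)"
  using y by (intro set_integral_inversion) auto
 also have "\<dots> = (LBINT t. norm y powr (- ?n) * (t ^ (DIM('a) - 1) * L t * indicator {0<..} t))"
 proof (rule Bochner_Integration.integral_cong[OF refl])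
  fix t :: real
  show "norm y / t\<^sup>2 * lay (norm y / t) y * indicator {0<..} t = norm y powr (- ?n) * (t ^ (DIM('a) - 1) * L t * indicator {0<..} t)"
  proof (cases "0 < t")
   case True
   have eq1: "y /\<^sub>R (norm y / t) = t *\<^sub>R b" using True y by (simp add: b_def field_simps)
   have eq2: "norm y / t\<^sup>2 * (norm y / t) powr (- (?n + 1)) = norm y powr (- ?n) * t ^ (DIM('a) - 1)"
   proof -
    have "t ^ (DIM('a) - 1) = t powr (?n - 1)"
     using True DIM_positive[where 'a='a] by (simp add: powr_realpow[symmetric] of_nat_diff)
    moreover have "(norm y / t) powr (- (?n + 1)) = norm y powr (- (?n + 1)) * t powr (?n + 1)"
     using True by (intro powr_divide_minus) auto
    moreover have "norm y * norm y powr (- (?n + 1)) = norm y powr (- ?n)"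
     using y powr_mult_base[of "norm y" "- (?n + 1)"] by simp
    moreover have "t powr (?n + 1) / t\<^sup>2 = t powr (?n - 1)"
     using True by (simp add: powr_diff[symmetric] flip: powr_numeral)
    moreover have "norm y / t\<^sup>2 * (norm y powr (- (?n + 1)) * t powr (?n + 1))
     = (norm y * norm y powr (- (?n + 1))) * (t powr (?n + 1) / t\<^sup>2)"
     by (simp only: times_divide_eq_left times_divide_eq_right mult_ac)
    ultimately show ?thesis by (simp only:)
   qed
   have "norm y / t\<^sup>2 * lay (norm y / t) y = (norm y / t\<^sup>2 * (norm y / t) powr (- (?n + 1))) * ell (y /\<^sub>R (norm y / t))"
    by (simp only: mult.assoc)
   also have "\<dots> = norm y powr (- ?n) * t ^ (DIM('a) - 1) * L t" by (simp only: eq1 eq2 L_def)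
   finally have eq3: "norm y / t\<^sup>2 * lay (norm y / t) y = norm y powr (- ?n) * t ^ (DIM('a) - 1) * L t" .
   have i: "indicator {0<..} t = (1::real)" using True by simp
   show ?thesis unfolding i mult_1_right eq3 by (simp only: mult.assoc)
  qed simp
 qed
 also have "\<dots> = 0" using z by simp
 finally show ?thesis .
qed

lemma avg_eq_head:
 assumes y: "y \<noteq> (0::'a::euclidean_space)" and e: "0 < e"
 shows "avg e y = - (LBINT t. lay t y * indicator {0<..e} t)"
proof -
 have "(LBINT t. lay t y * indicator {0<..} t) = (LBINT t. lay t y * indicator {0<..e} t + lay t y * indicator {e<..} t)"
  using e by (intro Bochner_Integration.integral_cong refl) (auto simp: indicator_def)
 also have "\<dots> = (LBINT t. lay t y * indicator {0<..e} t) + avg e y"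
  unfolding avg_def by (intro Bochner_Integration.integral_add lay_head_integrable lay_tail_integrable y e)
 finally show ?thesis using lay_total[OF y] by simp
qed

text \<open>Near the origin the layers with t > 1 are summed directly. Away from it the layers with
  t \<le> 1 are summed instead, by \<open>avg_eq_head\<close>; each is at most a multiple of K(y)
  t^(2s-1), so the decay of K is inherited.\<close>

lemma avg_bound:
 obtains C where "0 < C" "\<And>y :: 'a::euclidean_space. \<bar>avg 1 y\<bar> \<le> C * wt y"
proof -
 let ?p = "real DIM('a) + 2 * s"
 obtain C where C: "0 < C" "\<And>(t::real) (y::'a). y \<noteq> 0 \<Longrightarrow> 0 < t \<Longrightarrow> \<bar>lay t y\<bar> \<le> C * kern y * t powr (2 * s - 1)"
  using lay_head_bound[where 'a='a] by blast
 obtain B where B: "0 < B" "\<And>y :: 'a. \<bar>ell y\<bar> \<le> B * wt y"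
  by (rule ell_bound[where 'a='a]) (rule that)
 define T where "T = (LBINT (t::real). t powr (- (real DIM('a) + 1)) * indicator {1<..} t)"
 have T: "0 \<le> T" unfolding T_def by (rule Bochner_Integration.integral_nonneg) simp
 define D where "D = B * T * 2 powr ?p + C / (2 * s) * (1/2) powr (- ?p) + 1"
 have D: "0 < D" using B C T s0 by (auto simp: D_def intro!: add_nonneg_pos)
 show ?thesis
 proof (rule that[OF D])
  fix y :: 'a
  show "\<bar>avg 1 y\<bar> \<le> D * wt y"
  proof (cases "norm y < 1")
   case True
   have "\<bar>avg 1 y\<bar> \<le> (LBINT t. \<bar>lay t y * indicator {1<..} t\<bar>)"
    unfolding avg_def by (rule integral_abs_bound)
   also have "\<dots> \<le> (LBINT t. B * (t powr (- (real DIM('a) + 1)) * indicator {1<..} t))"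
   proof (rule integral_mono)
    fix t
    have "\<bar>ell (y /\<^sub>R t)\<bar> \<le> B * 1" using order_trans[OF B(2) mult_left_mono[OF wt_le_1]] B(1) by auto
    then have "t powr (- (real DIM('a) + 1)) * \<bar>ell (y /\<^sub>R t)\<bar> \<le> t powr (- (real DIM('a) + 1)) * (B * 1)"
     by (intro mult_left_mono) auto
    then show "\<bar>lay t y * indicator {1<..} t\<bar> \<le> B * (t powr (- (real DIM('a) + 1)) * indicator {1<..} t)"
     by (simp add: abs_mult indicator_def mult.commute)
   next
    show "integrable lborel (\<lambda>t. \<bar>lay t y * indicator {1<..} t\<bar>)" by (intro integrable_abs lay_tail_integrable) simp
    show "integrable lborel (\<lambda>t. B * (t powr (- (real DIM('a) + 1)) * indicator {1<..} t))"
     by (intro integrable_mult_right integrable_powr_tail) auto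
   qed
   also have "\<dots> = B * T" by (simp add: T_def)
   also have "\<dots> \<le> (B * T) * (2 powr ?p * wt y)"
   proof -
    have "0 < 1 + norm y" using norm_ge_zero[of y] by linarith
    then have "2 powr (- ?p) \<le> wt y"
     unfolding decay_def using True exponent_pos[where 'a='a] by (intro powr_mono2') auto
    then have "2 powr ?p * 2 powr (- ?p) \<le> 2 powr ?p * wt y" by (intro mult_left_mono) auto
    moreover have "2 powr ?p * 2 powr (- ?p) = (1::real)" unfolding powr_add[symmetric] by simp
    ultimately have "1 \<le> 2 powr ?p * wt y" by (simp only:)
    from mult_left_mono[OF this, of "B * T"] show ?thesis using B T by simp
   qed
   also have "\<dots> = (B * T * 2 powr ?p) * wt y" by simp
   also have "\<dots> \<le> D * wt y"
    unfolding D_def using C s0 wt_nonneg[of y] by (intro mult_right_mono) auto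
   finally show ?thesis .
  next
   case False
   then have y: "y \<noteq> 0" by auto
   have "\<bar>avg 1 y\<bar> \<le> (LBINT t. \<bar>lay t y * indicator {0<..1} t\<bar>)"
    unfolding avg_eq_head[OF y zero_less_one] abs_minus_cancel by (rule integral_abs_bound)
   also have "\<dots> \<le> (LBINT t. C * kern y * (t powr (2 * s - 1) * indicator {0<..1} t))"
   proof (rule integral_mono)
    show "\<bar>lay t y * indicator {0<..1} t\<bar> \<le> C * kern y * (t powr (2 * s - 1) * indicator {0<..1} t)" for t
     using C(2)[OF y, of t] by (auto simp: indicator_def)
    show "integrable lborel (\<lambda>t. \<bar>lay t y * indicator {0<..1} t\<bar>)" by (intro integrable_abs lay_head_integrable y) simp
    show "integrable lborel (\<lambda>t. C * kern y * (t powr (2 * s - 1) * indicator {0<..1} t))"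
     using s0 by (intro integrable_mult_right integrable_powr_head) auto
   qed
   also have "\<dots> = C / (2 * s) * kern y"
    using integrable_powr_head(2)[of "2 * s - 1" 1] s0 by simp
   also have "\<dots> \<le> C / (2 * s) * ((1/2) powr (- ?p) * wt y)"
    using False C s0 by (intro mult_left_mono kern_le_wt) auto
   also have "\<dots> = (C / (2 * s) * (1/2) powr (- ?p)) * wt y" by simp
   also have "\<dots> \<le> D * wt y"
    unfolding D_def using B T wt_nonneg[of y] by (intro mult_right_mono) auto
   finally show ?thesis .
  qed
 qed
qed

lemma avg_integrable: "integrable lborel (avg 1 :: 'a::euclidean_space \<Rightarrow> real)"
proof -
 obtain C where C: "0 < C" "\<And>y :: 'a. \<bar>avg 1 y\<bar> \<le> C * wt y" using avg_bound[where 'a='a] by blast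
 show ?thesis
  by (rule Bochner_Integration.integrable_bound[OF integrable_mult_right[OF wt_integrable, of C]])
   (use C in \<open>auto simp: abs_mult abs_of_nonneg[OF wt_nonneg]\<close>)
qed

lemma avg_norm_cong: "norm (x::'a) = norm (y::'a::euclidean_space) \<Longrightarrow> avg e x = avg e y"
proof -
 assume "norm x = norm y"
 then have "ell (x /\<^sub>R t) = ell (y /\<^sub>R t)" for t by (intro ell_norm_cong) simp
 then show ?thesis by (simp add: avg_def)
qed

lemma avg_minus [simp]: "avg e (- y) = avg e y"
 by (rule avg_norm_cong) simp

lemma avg_scale:
 assumes e: "0 < e"
 shows "avg e (y::'a::euclidean_space) = e powr (- real DIM('a)) * avg 1 (y /\<^sub>R e)"
proof -
 have "avg e y = \<bar>e\<bar> *\<^sub>R (LBINT t. lay (0 + e * t) y * indicator {e<..} (0 + e * t))"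
  unfolding avg_def using e by (intro lborel_integral_real_affine) auto
 also have "\<dots> = e * (LBINT t. e powr (- (real DIM('a) + 1)) * (lay t (y /\<^sub>R e) * indicator {1<..} t))"
 proof -
  have "lay (0 + e * t) y * indicator {e<..} (0 + e * t) = e powr (- (real DIM('a) + 1)) * (lay t (y /\<^sub>R e) * indicator {1<..} t)" for t
  proof (cases "1 < t")
   case True
   have "y /\<^sub>R (e * t) = y /\<^sub>R e /\<^sub>R t" by (simp add: mult.commute)
   then show ?thesis using e True by (simp add: powr_mult mult.commute[of "inverse t" "inverse e"])
  next
   case False
   then show ?thesis using e by simp
  qed
  then show ?thesis using e by simp
 qed
 also have "\<dots> = (e * e powr (- (real DIM('a) + 1))) * avg 1 (y /\<^sub>R e)"
  by (simp add: avg_def)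
 also have "e * e powr (- (real DIM('a) + 1)) = e powr (- real DIM('a))"
  using powr_mult_base[of e "- (real DIM('a) + 1)"] e by simp
 finally show ?thesis .
qed

text \<open>The layer at scale t sees the step h / t, and its weight at y / t is at most t^(n+2s)
  \<open>wt y\<close>. Together these leave |h|^2 t^(2s-3), integrable at infinity because s <
  1.\<close>

lemma sdiff_avg_bound:
 obtains C where "0 < C" "\<And>h y :: 'a::euclidean_space. norm h \<le> 1 \<Longrightarrow> \<bar>sdiff (avg 1) h y\<bar> \<le> C * (norm h)\<^sup>2 * wt y"
proof -
 let ?n = "real DIM('a)" and ?p = "real DIM('a) + 2 * s"
 obtain C where C: "0 < C" "\<And>z y :: 'a. norm z \<le> 1 \<Longrightarrow> \<bar>sdiff ell z y\<bar> \<le> C * (norm z)\<^sup>2 * wt y"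
  by (rule ell_bound[where 'a='a]) (rule that)
 define T where "T = (LBINT (t::real). t powr (- (3 - 2 * s)) * indicator {1<..} t)"
 have T: "0 \<le> T" unfolding T_def by (rule Bochner_Integration.integral_nonneg) simp
 have iT: "integrable lborel (\<lambda>t::real. t powr (- (3 - 2 * s)) * indicator {1<..} t)"
  using s1 by (intro integrable_powr_tail) auto
 show ?thesis
 proof (rule that[of "C * T + 1"])
  show "0 < C * T + 1" using C T by (intro add_nonneg_pos) auto
  fix h y :: 'a assume h: "norm h \<le> 1"
  let ?f = "\<lambda>t. t powr (- (?n + 1)) * sdiff ell (h /\<^sub>R t) (y /\<^sub>R t) * indicator {1<..} t"
  note i = lay_tail_integrable[OF zero_less_one]
  have e: "?f t = 2 * (lay t y * indicator {1<..} t) - lay t (y + h) * indicator {1<..} t - lay t (y - h) * indicator {1<..} t" for t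
   by (simp add: sdiff_def algebra_simps)
  have i0: "integrable lborel ?f" unfolding e using i[of y] i[of "y + h"] i[of "y - h"] by simp
  have "sdiff (avg 1) h y = (LBINT t. ?f t)"
   unfolding e using i[of y] i[of "y + h"] i[of "y - h"] by (simp add: sdiff_def avg_def)
  also have "\<bar>\<dots>\<bar> \<le> (LBINT t. \<bar>?f t\<bar>)" by (rule integral_abs_bound)
  also have "\<dots> \<le> (LBINT t. C * (norm h)\<^sup>2 * wt y * (t powr (- (3 - 2 * s)) * indicator {1<..} t))"
  proof (rule integral_mono)
   fix t :: real
   show "\<bar>?f t\<bar> \<le> C * (norm h)\<^sup>2 * wt y * (t powr (- (3 - 2 * s)) * indicator {1<..} t)"
   proof (cases "1 < t")
    case True
    have "norm (h /\<^sub>R t) \<le> 1" using True h by (simp add: field_simps)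
    then have "\<bar>sdiff ell (h /\<^sub>R t) (y /\<^sub>R t)\<bar> \<le> C * (norm (h /\<^sub>R t))\<^sup>2 * wt (y /\<^sub>R t)" by (rule C(2))
    also have "\<dots> \<le> C * (norm (h /\<^sub>R t))\<^sup>2 * ((1 / t) powr (- ?p) * wt y)"
    proof (intro mult_left_mono wt_scale)
     show "1 / t * (1 + norm y) \<le> 1 + norm (y /\<^sub>R t)" using True by (simp add: field_simps)
    qed (use True C in auto)
    also have "\<dots> = C * (norm h)\<^sup>2 * wt y * (t powr ?p / t\<^sup>2)"
    proof -
     have e3: "(1 / t) powr (- ?p) = t powr ?p" using powr_divide_minus[of t 1 ?p] True by simp
     show ?thesis unfolding e3 using True by (simp add: power_mult_distrib divide_inverse power_inverse)
    qed
    finally have "t powr (- (?n + 1)) * \<bar>sdiff ell (h /\<^sub>R t) (y /\<^sub>R t)\<bar> \<le> t powr (- (?n + 1)) * (C * (norm h)\<^sup>2 * wt y * (t powr ?p / t\<^sup>2))"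
     by (intro mult_left_mono) auto
    also have "\<dots> = C * (norm h)\<^sup>2 * wt y * (t powr (- (?n + 1)) * (t powr ?p / t powr 2))"
     using True by (simp add: powr_numeral)
    also have "t powr (- (?n + 1)) * (t powr ?p / t powr 2) = t powr (- (3 - 2 * s))"
     by (simp only: powr_diff[symmetric] powr_add[symmetric]) (simp add: algebra_simps)
    finally show ?thesis using True by (simp add: abs_mult)
   qed simp
  next
   show "integrable lborel (\<lambda>t. \<bar>?f t\<bar>)" using i0 by (rule integrable_abs)
   show "integrable lborel (\<lambda>t. C * (norm h)\<^sup>2 * wt y * (t powr (- (3 - 2 * s)) * indicator {1<..} t))"
    using iT by (rule integrable_mult_right)
  qed
  also have "\<dots> = C * (norm h)\<^sup>2 * wt y * T" by (simp add: T_def)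
  also have "\<dots> \<le> (C * T + 1) * (norm h)\<^sup>2 * wt y"
   using wt_nonneg[of y] by (simp add: algebra_simps)
  finally show "\<bar>sdiff (avg 1) h y\<bar> \<le> (C * T + 1) * (norm h)\<^sup>2 * wt y" .
 qed
qed

lemma avg_continuous:
 assumes e: "0 < e"
 shows "isCont (avg e) (y::'a::euclidean_space)"
proof -
 obtain C where C: "0 < C" "\<And>y :: 'a. \<bar>ell y\<bar> \<le> C * wt y"
  by (rule ell_bound[where 'a='a]) (rule that)
 show ?thesis
  unfolding isCont_def avg_def
 proof (rule tendsto_integral_dominated[where B="\<lambda>t. C * (t powr (- (real DIM('a) + 1)) * indicator {e<..} t)"])
  show "integrable lborel (\<lambda>t. C * (t powr (- (real DIM('a) + 1)) * indicator {e<..} t))"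
   using e by (intro integrable_mult_right integrable_powr_tail) auto
  show "AE t in lborel. \<bar>lay t z * indicator {e<..} t\<bar> \<le> C * (t powr (- (real DIM('a) + 1)) * indicator {e<..} t)" for z :: 'a
  proof (intro AE_I2)
   fix t
   have "\<bar>ell (z /\<^sub>R t)\<bar> \<le> C * 1" using order_trans[OF C(2) mult_left_mono[OF wt_le_1]] C(1) by auto
   then have "t powr (- (real DIM('a) + 1)) * \<bar>ell (z /\<^sub>R t)\<bar> \<le> t powr (- (real DIM('a) + 1)) * (C * 1)"
    by (intro mult_left_mono) auto
   then show "\<bar>lay t z * indicator {e<..} t\<bar> \<le> C * (t powr (- (real DIM('a) + 1)) * indicator {e<..} t)"
    by (simp add: abs_mult indicator_def mult.commute)
  qed
  have "isCont (\<lambda>z. lay t z * indicator {e<..} t) y" for t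
   by (intro continuous_intros isCont_o2[OF _ ell_continuous])
  then show "AE t in lborel. ((\<lambda>z. lay t z * indicator {e<..} t) \<longlongrightarrow> lay t y * indicator {e<..} t) (at y)"
   by (simp add: isCont_def)
 qed measurable
qed

text \<open>Inserting the expansion of \<open>ell\<close> into the small scales gives the main term
  2 \<Phi> K(y) times the integral of t^(2s-1) over (0, 1], which is \<Phi> K(y) / s, with \<Phi>
  the integral of the bump. The error has the integrable density t^(2s).\<close>

lemma avg_far:
 obtains C where "0 < C" "\<And>y :: 'a::euclidean_space. 1 \<le> norm y \<Longrightarrow>
  \<bar>avg 1 y - (LBINT z. bump (z::'a)) / s * kern y\<bar> \<le> C * norm y powr (- (real DIM('a) + 2 * s) - 1)"
proof -
 let ?n = "real DIM('a)" and ?p = "real DIM('a) + 2 * s" and ?\<Phi> = "\<integral>z. bump (z::'a) \<partial>lborel"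
 obtain C where C: "0 < C" "\<And>y :: 'a. 2 \<le> norm y \<Longrightarrow> \<bar>ell y + 2 * ?\<Phi> * kern y\<bar> \<le> C * norm y powr (- ?p - 1)"
  by (rule ell_far[where 'a='a]) (rule that)
 obtain B where B: "0 < B" "\<And>y :: 'a. \<bar>avg 1 y\<bar> \<le> B * wt y" using avg_bound[where 'a='a] by blast
 have \<Phi>: "0 \<le> ?\<Phi>" by (rule Bochner_Integration.integral_nonneg) (simp add: trunc_pow_nonneg)
 define D where "D = (B + ?\<Phi> / s) * 2 powr (?p + 1) + C"
 have D: "0 < D" using B C \<Phi> s0 by (auto simp: D_def intro!: add_nonneg_pos)
 show ?thesis
 proof (rule that[OF D])
  fix y :: 'a assume y1: "1 \<le> norm y"
  then have y: "y \<noteq> 0" by auto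
  show "\<bar>avg 1 y - ?\<Phi> / s * kern y\<bar> \<le> D * norm y powr (- ?p - 1)"
  \<comment> \<open>The expansion of \<open>ell\<close> needs |y / t| \<ge> 2 for every t \<le> 1.
    For 1 \<le> |y| < 2 a constant bound suffices, paid for by the factor 2^(p+1) in D.\<close>
  proof (cases "norm y < 2")
   case True
   have "kern y \<le> 1"
    unfolding kern_def using y1 exponent_pos[where 'a='a] powr_mono2'[of "- ?p" 1 "norm y"] by simp
   then have "\<bar>avg 1 y - ?\<Phi> / s * kern y\<bar> \<le> B * 1 + ?\<Phi> / s * 1"
    using order_trans[OF B(2) mult_left_mono[OF wt_le_1], of y] B(1) \<Phi> s0 kern_nonneg[of y]
     mult_left_mono[of "kern y" 1 "?\<Phi> / s"] mult_nonneg_nonneg[of "?\<Phi> / s" "kern y"]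
    by (smt (verit) divide_nonneg_nonneg mult.right_neutral)
   also have "\<dots> = (B + ?\<Phi> / s) * (2 powr (?p + 1) * 2 powr (- ?p - 1))"
    unfolding powr_add[symmetric] by simp
   also have "\<dots> \<le> (B + ?\<Phi> / s) * (2 powr (?p + 1) * norm y powr (- ?p - 1))"
    using True y1 B \<Phi> s0 exponent_pos[where 'a='a] by (intro mult_left_mono powr_mono2') auto
   also have "\<dots> \<le> D * norm y powr (- ?p - 1)"
    unfolding D_def using C by (simp add: distrib_right mult.assoc)
   finally show ?thesis .
  next
   case False
   let ?g = "\<lambda>t. t powr (- (?n + 1)) * (ell (y /\<^sub>R t) + 2 * ?\<Phi> * kern (y /\<^sub>R t)) * indicator {0<..1} t"
   have k: "t powr (- (?n + 1)) * kern (y /\<^sub>R t) = t powr (2 * s - 1) * kern y" if "0 < t" for t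
   proof -
    have "kern (y /\<^sub>R t) = t powr ?p * kern y"
     using that by (rule kern_divide)
    moreover have "t powr (- (?n + 1)) * t powr ?p = t powr (2 * s - 1)" by (simp add: powr_add[symmetric])
    ultimately show ?thesis by (simp only: mult.assoc[symmetric])
   qed
   have e: "?g t = lay t y * indicator {0<..1} t + 2 * ?\<Phi> * kern y * (t powr (2 * s - 1) * indicator {0<..1} t)" for t
   proof (cases "0 < t")
    case True
    show ?thesis using k[OF True] by (simp add: distrib_left distrib_right mult_ac)
   qed simp
   have h: "integrable lborel (\<lambda>t. t powr (2 * s - 1) * indicator {0<..1} t)" "(LBINT t. t powr (2 * s - 1) * indicator {0<..1} t) = 1 / (2 * s)"
    using integrable_powr_head[of "2 * s - 1" 1] s0 by simp_all
   have h2: "integrable lborel (\<lambda>t. t powr (2 * s) * indicator {0<..1} t)" "(LBINT t. t powr (2 * s) * indicator {0<..1} t) = 1 / (2 * s + 1)"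
    using integrable_powr_head[of "2 * s" 1] s0 by simp_all
   have ig: "integrable lborel ?g" unfolding e
    by (intro Bochner_Integration.integrable_add integrable_mult_right lay_head_integrable y h) simp
   have "(LBINT t. ?g t) = - avg 1 y + 2 * ?\<Phi> * kern y * (1 / (2 * s))"
    unfolding e avg_eq_head[OF y zero_less_one] using lay_head_integrable[OF zero_less_one y] h by simp
   then have "\<bar>avg 1 y - ?\<Phi> / s * kern y\<bar> = \<bar>\<integral>t. ?g t \<partial>lborel\<bar>" by (simp add: abs_minus_commute)
   also have "\<dots> \<le> (LBINT t. \<bar>?g t\<bar>)" by (rule integral_abs_bound)
   also have "\<dots> \<le> (LBINT t. C * norm y powr (- ?p - 1) * (t powr (2 * s) * indicator {0<..1} t))"
   proof (rule integral_mono)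
    fix t :: real
    show "\<bar>?g t\<bar> \<le> C * norm y powr (- ?p - 1) * (t powr (2 * s) * indicator {0<..1} t)"
    proof (cases "0 < t \<and> t \<le> 1")
     case True
     have "2 \<le> norm (y /\<^sub>R t)" using True False by (simp add: field_simps)
     from C(2)[OF this] have "t powr (- (?n + 1)) * \<bar>ell (y /\<^sub>R t) + 2 * ?\<Phi> * kern (y /\<^sub>R t)\<bar>
      \<le> t powr (- (?n + 1)) * (C * norm (y /\<^sub>R t) powr (- ?p - 1))" by (intro mult_left_mono) auto
     also have "norm (y /\<^sub>R t) powr (- ?p - 1) = t powr (?p + 1) * norm y powr (- ?p - 1)"
     proof -
      have "norm (y /\<^sub>R t) = norm y / t" "- ?p - 1 = - (?p + 1)" using True by (simp_all add: divide_inverse mult.commute)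
      then show ?thesis using True powr_divide_minus[of t "norm y" "?p + 1"] by (simp only: mult.commute norm_ge_zero simp_thms)
     qed
     also have "t powr (- (?n + 1)) * (C * (t powr (?p + 1) * norm y powr (- ?p - 1)))
      = C * norm y powr (- ?p - 1) * (t powr (- (?n + 1)) * t powr (?p + 1))" by simp
     also have "t powr (- (?n + 1)) * t powr (?p + 1) = t powr (2 * s)" by (simp add: powr_add[symmetric])
     finally show ?thesis using True by (simp add: abs_mult)
    qed (auto simp: indicator_def)
   next
    show "integrable lborel (\<lambda>t. \<bar>?g t\<bar>)" using ig by (rule integrable_abs)
    show "integrable lborel (\<lambda>t. C * norm y powr (- ?p - 1) * (t powr (2 * s) * indicator {0<..1} t))"
     using h2(1) by (rule integrable_mult_right)
   qed
   also have "\<dots> = C * norm y powr (- ?p - 1) * (1 / (2 * s + 1))" using h2(2) by simp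
   also have "\<dots> \<le> C * norm y powr (- ?p - 1) * 1" using s0 C by (intro mult_left_mono) auto
   also have "\<dots> \<le> D * norm y powr (- ?p - 1)"
    unfolding D_def using B \<Phi> s0 by (simp add: distrib_right)
   finally show ?thesis .
  qed
 qed
qed

end

section \<open>Averages of a function and the mass of the averaging kernel\<close>

lemma integrable_mult_of_squares:
 fixes f g :: "'b \<Rightarrow> real"
 assumes [measurable]: "f \<in> borel_measurable M" "g \<in> borel_measurable M" "k \<in> borel_measurable M"
  and "integrable M (\<lambda>x. (f x)\<^sup>2 * k x)" "integrable M (\<lambda>x. (g x)\<^sup>2 * k x)" and k: "\<And>x. 0 \<le> k x"
 shows "integrable M (\<lambda>x. f x * g x * k x)"
proof (rule Bochner_Integration.integrable_bound)
 show "integrable M (\<lambda>x. (f x)\<^sup>2 * k x + (g x)\<^sup>2 * k x)" using assms by simp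
 have "\<bar>f x * g x\<bar> \<le> (f x)\<^sup>2 + (g x)\<^sup>2" for x
 proof -
  have "0 \<le> \<bar>f x\<bar> * \<bar>g x\<bar>" by simp
  then show ?thesis using sum_squares_bound[of "\<bar>f x\<bar>" "\<bar>g x\<bar>"] unfolding abs_mult power2_abs by linarith
 qed
 from mult_right_mono[OF this k]
 show "AE x in M. norm (f x * g x * k x) \<le> norm ((f x)\<^sup>2 * k x + (g x)\<^sup>2 * k x)"
  using k by (intro AE_I2) (simp add: abs_mult distrib_right)
qed measurable

context frac
begin

definition mean :: "('a::euclidean_space \<Rightarrow> real) \<Rightarrow> real \<Rightarrow> 'a \<Rightarrow> real" where
 "mean u e x = (LBINT y. u y * avg e (y - x))"

text \<open>The averages are not normalised, so they tend to \<open>mass\<close> times the function.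
  \<open>ell\<close> has integral zero and the sign of \<open>avg\<close> is not evident, which is
  why positivity of the mass gets a proof of its own.\<close>

definition mass :: "'a::euclidean_space itself \<Rightarrow> real" where
 "mass _ = (LBINT y. avg 1 (y::'a))"

lemma avg_bound_scaled:
 assumes e: "0 < e"
 obtains C where "0 < C" "\<And>y :: 'a::euclidean_space. \<bar>avg e y\<bar> \<le> C * wt y"
proof -
 let ?p = "real DIM('a) + 2 * s"
 obtain C where C: "0 < C" "\<And>y :: 'a. \<bar>avg 1 y\<bar> \<le> C * wt y" using avg_bound[where 'a='a] by blast
 define c where "c = min 1 (1 / e)"
 have c: "0 < c" using e by (simp add: c_def)
 show ?thesis
 proof (rule that)
  show "0 < e powr (- real DIM('a)) * (C * c powr (- ?p))" using C e c by simp
  fix y :: 'a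
  have "wt (y /\<^sub>R e) \<le> c powr (- ?p) * wt y"
  proof (rule wt_scale[OF c])
   have c1: "c \<le> 1" "c \<le> 1 / e" by (auto simp: c_def)
   have "c * norm y \<le> 1 / e * norm y" by (rule mult_right_mono[OF c1(2) norm_ge_zero])
   moreover note c1(1)
   ultimately show "c * (1 + norm y) \<le> 1 + norm (y /\<^sub>R e)"
    using e by (simp add: distrib_left divide_inverse mult.commute)
  qed
  then have "\<bar>avg 1 (y /\<^sub>R e)\<bar> \<le> C * (c powr (- ?p) * wt y)"
   using order_trans[OF C(2) mult_left_mono] C(1) by auto
  then show "\<bar>avg e y\<bar> \<le> e powr (- real DIM('a)) * (C * c powr (- ?p)) * wt y"
   unfolding avg_scale[OF e] by (simp add: abs_mult mult_left_mono mult.assoc)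
 qed
qed

lemma square_integrable_avg:
 assumes e: "0 < e"
 shows "square_integrable (avg e :: 'a::euclidean_space \<Rightarrow> real)"
proof -
 obtain C where C: "0 < C" "\<And>y :: 'a. \<bar>avg e y\<bar> \<le> C * wt y"
  using avg_bound_scaled[OF e, where 'a='a] by blast
 show ?thesis
 proof (rule square_integrable_bounded_integrable)
  show "integrable lborel (\<lambda>y::'a. C * wt y)" using wt_integrable[where 'a='a] by simp
  show "\<bar>avg e y\<bar> \<le> C" for y :: 'a
   using order_trans[OF C(2) mult_left_mono[OF wt_le_1]] C(1) by auto
 qed (use C in auto)
qed

lemma mean_integrable:
 fixes u :: "'a::euclidean_space \<Rightarrow> real"
 assumes "square_integrable u" "0 < e"
 shows "integrable lborel (\<lambda>y. u y * avg e (y - x))"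
 by (rule integrable_square_integrable_mult[OF assms(1) square_integrable_shift(2)[OF square_integrable_avg[OF assms(2)]]])

lemma abs_integral_mult_le:
 fixes f g :: "'a::euclidean_space \<Rightarrow> real"
 assumes "square_integrable f" "square_integrable g"
 shows "(LBINT y. \<bar>f y * g y\<bar>) \<le> (LBINT y. (f y)\<^sup>2) + (LBINT y. (g y)\<^sup>2)"
proof -
 have "(LBINT y. \<bar>f y * g y\<bar>) \<le> (LBINT y. (f y)\<^sup>2 + (g y)\<^sup>2)"
 proof (rule integral_mono)
  fix y
  have "0 \<le> \<bar>f y\<bar> * \<bar>g y\<bar>" by simp
  then show "\<bar>f y * g y\<bar> \<le> (f y)\<^sup>2 + (g y)\<^sup>2"
   using sum_squares_bound[of "\<bar>f y\<bar>" "\<bar>g y\<bar>"] unfolding abs_mult power2_abs by linarith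
 qed (use assms integrable_square_integrable_mult[OF assms] in \<open>auto simp: square_integrable_def\<close>)
 then show ?thesis using assms by (simp add: square_integrable_def)
qed

text \<open>The crude |a b| \<le> a^2 + b^2 is enough, as only uniformity in x matters.\<close>

lemma mean_bounded:
 fixes u :: "'a::euclidean_space \<Rightarrow> real"
 assumes u: "square_integrable u" and e: "0 < e"
 shows "\<bar>mean u e x\<bar> \<le> (LBINT y. (u y)\<^sup>2) + (LBINT y. (avg e (y::'a))\<^sup>2)"
proof -
 have "\<bar>mean u e x\<bar> \<le> (LBINT y. \<bar>u y * avg e (y - x)\<bar>)"
  unfolding mean_def by (rule integral_abs_bound)
 also have "\<dots> \<le> (LBINT y. (u y)\<^sup>2) + (LBINT y. (avg e (y - x))\<^sup>2)"
  by (rule abs_integral_mult_le[OF u square_integrable_shift(2)[OF square_integrable_avg[OF e]]])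
 also have "(LBINT y. (avg e (y - x))\<^sup>2) = (LBINT y. (avg e (y::'a))\<^sup>2)"
  using integral_shift(2)[of "\<lambda>y::'a. (avg e y)\<^sup>2" x] by simp
 finally show ?thesis .
qed

lemma mean_diff:
 fixes u :: "'a::euclidean_space \<Rightarrow> real"
 assumes u: "square_integrable u" and e: "0 < e" "e \<le> d"
 shows "mean u e x - mean u d x =
   (LBINT t. t powr (- (real DIM('a) + 1)) * (LBINT y. u y * ell ((y - x) /\<^sub>R t)) * indicator {e<..d} t)"
  and "integrable lborel (\<lambda>t. t powr (- (real DIM('a) + 1)) * (LBINT y. u y * ell ((y - x) /\<^sub>R t)) * indicator {e<..d} t)"
proof -
 let ?p = "real DIM('a) + 2 * s"
 have [measurable]: "u \<in> borel_measurable borel" using u by (rule square_integrableD)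
 have d: "0 < d" using e by linarith
 let ?f = "\<lambda>(y, t). u y * (lay t (y - x) * indicator {e<..d} t)"
 obtain C where C: "0 < C" "\<And>y :: 'a. \<bar>ell y\<bar> \<le> C * wt y"
  by (rule ell_bound[where 'a='a]) (rule that)
 \<comment> \<open>For t \<le> d one has |z| / t \<ge> c |z|, so a single weight dominates the
   layers at all scales in the range.\<close>
 define c where "c = min 1 (1 / d)"
 have c: "0 < c" using d by (simp add: c_def)
 define K where "K = (LBINT t. t powr (- (real DIM('a) + 1)) * indicator {e<..} t)"
 have iK: "integrable lborel (\<lambda>t::real. t powr (- (real DIM('a) + 1)) * indicator {e<..} t)"
  using e by (intro integrable_powr_tail) auto
 have bd: "\<bar>lay t z * indicator {e<..d} t\<bar> \<le> C * c powr (- ?p) * wt z * (t powr (- (real DIM('a) + 1)) * indicator {e<..} t)" for t and z :: 'a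
 proof (cases "e < t \<and> t \<le> d")
  case True
  have "wt (z /\<^sub>R t) \<le> c powr (- ?p) * wt z"
  proof (rule wt_scale[OF c])
   have "c * 1 \<le> 1" by (simp add: c_def)
   moreover have "c * norm z \<le> 1 / t * norm z"
    using True e by (intro mult_right_mono) (auto simp: c_def min_def frac_le)
   ultimately show "c * (1 + norm z) \<le> 1 + norm (z /\<^sub>R t)"
    using True e by (simp add: distrib_left divide_inverse mult.commute)
  qed
  then have "\<bar>ell (z /\<^sub>R t)\<bar> \<le> C * (c powr (- ?p) * wt z)"
   using order_trans[OF C(2) mult_left_mono] C(1) by auto
  then have "t powr (- (real DIM('a) + 1)) * \<bar>ell (z /\<^sub>R t)\<bar> \<le> t powr (- (real DIM('a) + 1)) * (C * (c powr (- ?p) * wt z))"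
   by (intro mult_left_mono) auto
  then show ?thesis using True by (simp add: abs_mult mult_ac)
 next
  case False
  then show ?thesis using C(1) wt_nonneg[of z] by (simp add: indicator_def)
 qed
 have int: "integrable (lborel \<Otimes>\<^sub>M lborel) ?f"
 proof (rule lborel_pair.Fubini_integrable)
  show "?f \<in> borel_measurable (lborel \<Otimes>\<^sub>M lborel)" by measurable
  have il: "integrable lborel (\<lambda>t. lay t z * indicator {e<..d} t)" for z :: 'a
   by (rule Bochner_Integration.integrable_bound[OF integrable_mult_right[OF iK, of "C * c powr (- ?p) * wt z"]])
    (measurable, use bd in \<open>auto intro!: AE_I2 intro: order_trans[OF _ abs_ge_self]\<close>)
  then show "AE y in lborel. integrable lborel (\<lambda>t. ?f (y, t))" by simp
  show "integrable lborel (\<lambda>y. \<integral>t. norm (?f (y, t)) \<partial>lborel)"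
  proof (rule Bochner_Integration.integrable_bound[OF integrable_mult_right[OF integrable_mult_decay[OF u dim_less], of "C * c powr (- ?p) * K" x]])
   show "AE y in lborel. norm (LBINT t. norm (?f (y, t))) \<le> norm (C * c powr (- ?p) * K * (\<bar>u y\<bar> * wt (y - x)))"
   proof (intro AE_I2)
    fix y
    have "(LBINT t. norm (?f (y, t))) = \<bar>u y\<bar> * (LBINT t. \<bar>lay t (y - x) * indicator {e<..d} t\<bar>)"
     by (simp add: abs_mult)
    also have "\<dots> \<le> \<bar>u y\<bar> * (LBINT t. C * c powr (- ?p) * wt (y - x) * (t powr (- (real DIM('a) + 1)) * indicator {e<..} t))"
     by (intro mult_left_mono integral_mono integrable_abs il integrable_mult_right iK bd) auto
    also have "\<dots> = C * c powr (- ?p) * K * (\<bar>u y\<bar> * wt (y - x))" by (simp add: K_def)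
    finally show "norm (LBINT t. norm (?f (y, t))) \<le> norm (C * c powr (- ?p) * K * (\<bar>u y\<bar> * wt (y - x)))"
     by simp
   qed
  qed measurable
 qed
 have av: "avg e z - avg d z = (LBINT t. lay t z * indicator {e<..d} t)" for z :: 'a
 proof -
  have "avg e z - avg d z = (LBINT t. lay t z * indicator {e<..} t - lay t z * indicator {d<..} t)"
   unfolding avg_def by (intro Bochner_Integration.integral_diff[symmetric] lay_tail_integrable e d)
  also have "\<dots> = (LBINT t. lay t z * indicator {e<..d} t)"
   using e by (intro Bochner_Integration.integral_cong refl) (auto simp: indicator_def)
  finally show ?thesis .
 qed
 have sw: "(LBINT y. u y * (lay t (y - x) * indicator {e<..d} t)) = t powr (- (real DIM('a) + 1)) * (LBINT y. u y * ell ((y - x) /\<^sub>R t)) * indicator {e<..d} t" for t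
 proof -
  have "(LBINT y. u y * (lay t (y - x) * indicator {e<..d} t)) = (LBINT y. t powr (- (real DIM('a) + 1)) * indicator {e<..d} t * (u y * ell ((y - x) /\<^sub>R t)))"
   by (intro Bochner_Integration.integral_cong refl) (simp add: mult_ac)
  then show ?thesis by simp
 qed
 have "mean u e x - mean u d x = (LBINT y. u y * avg e (y - x) - u y * avg d (y - x))"
  unfolding mean_def by (intro Bochner_Integration.integral_diff[symmetric] mean_integrable u e d)
 also have "\<dots> = (LBINT y. \<integral>t. ?f (y, t) \<partial>lborel)"
  by (simp add: right_diff_distrib[symmetric] av)
 also have "\<dots> = (LBINT t. \<integral>y. ?f (y, t) \<partial>lborel)"
  using lborel_pair.Fubini_integral[of "\<lambda>y t. ?f (y, t)"] int by simp
 also have "\<dots> = (LBINT t. t powr (- (real DIM('a) + 1)) * (LBINT y. u y * ell ((y - x) /\<^sub>R t)) * indicator {e<..d} t)"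
  by (simp only: case_prod_conv sw)
 finally show "mean u e x - mean u d x =
   (LBINT t. t powr (- (real DIM('a) + 1)) * (LBINT y. u y * ell ((y - x) /\<^sub>R t)) * indicator {e<..d} t)" .
 show "integrable lborel (\<lambda>t. t powr (- (real DIM('a) + 1)) * (LBINT y. u y * ell ((y - x) /\<^sub>R t)) * indicator {e<..d} t)"
  using lborel_pair.integrable_snd[of "\<lambda>y t. ?f (y, t)"] int by (simp only: case_prod_conv sw simp_thms)
qed

lemma mean_rescaled:
 fixes u :: "'a::euclidean_space \<Rightarrow> real"
 assumes [measurable]: "u \<in> borel_measurable borel" and e: "0 < e"
 shows "mean u e x = (LBINT z. u (x + e *\<^sub>R z) * avg 1 z)"
proof -
 have "mean u e x = \<bar>e\<bar> ^ DIM('a) * (LBINT z. u (x + e *\<^sub>R z) * avg e (x + e *\<^sub>R z - x))"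
  unfolding mean_def using e by (intro integral_lborel_affine) auto
 also have "\<dots> = (LBINT z. e ^ DIM('a) * (u (x + e *\<^sub>R z) * avg e (x + e *\<^sub>R z - x)))"
  using e by simp
 also have "\<dots> = (LBINT z. u (x + e *\<^sub>R z) * avg 1 z)"
 proof (rule Bochner_Integration.integral_cong[OF refl])
  fix z :: 'a
  have "avg e (x + e *\<^sub>R z - x) = e powr (- real DIM('a)) * avg 1 z"
   using e by (subst avg_scale[OF e]) simp
  moreover have "e ^ DIM('a) * e powr (- real DIM('a)) = 1"
   using e by (simp add: powr_realpow[symmetric] powr_add[symmetric])
  ultimately show "e ^ DIM('a) * (u (x + e *\<^sub>R z) * avg e (x + e *\<^sub>R z - x)) = u (x + e *\<^sub>R z) * avg 1 z"
   by (metis mult.assoc mult.commute mult_1)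
 qed
 finally show ?thesis .
qed

lemma mean_continuous:
 fixes u :: "'a::euclidean_space \<Rightarrow> real"
 assumes u: "square_integrable u" and e: "0 < e"
 shows "isCont (mean u e) x"
proof -
 let ?p = "real DIM('a) + 2 * s"
 have [measurable]: "u \<in> borel_measurable borel" using u by (rule square_integrableD)
 obtain C where C: "0 < C" "\<And>y :: 'a. \<bar>avg e y\<bar> \<le> C * wt y"
  using avg_bound_scaled[OF e, where 'a='a] by blast
 have "((\<lambda>z. \<integral>y. u y * avg e (y - z) \<partial>lborel) \<longlongrightarrow> (LBINT y. u y * avg e (y - x))) (at x within ball x 1)"
 proof (rule tendsto_integral_dominated[where B="\<lambda>y. C * (1/2) powr (- ?p) * (\<bar>u y\<bar> * wt (y - x))"])
  show "integrable lborel (\<lambda>y. C * (1/2) powr (- ?p) * (\<bar>u y\<bar> * wt (y - x)))"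
   by (intro integrable_mult_right integrable_mult_decay u dim_less)
  fix z assume z: "z \<in> ball x 1"
  show "AE y in lborel. \<bar>u y * avg e (y - z)\<bar> \<le> C * (1/2) powr (- ?p) * (\<bar>u y\<bar> * wt (y - x))"
  proof (intro AE_I2)
   fix y
   have "wt (y - z) \<le> (1/2) powr (- ?p) * wt (y - x)"
   proof (rule wt_scale)
    have "norm (y - x) \<le> norm (y - z) + norm (z - x)" using norm_triangle_ineq[of "y - z" "z - x"] by simp
    moreover have "norm (z - x) < 1" using z by (simp add: dist_norm norm_minus_commute)
    moreover have "0 \<le> norm (y - z)" by simp
    moreover have "1/2 * (1 + a) \<le> 1 + b" if "a \<le> b + c" "c < 1" "0 \<le> b" for a b c :: real
     using that by simp
    ultimately show "1/2 * (1 + norm (y - x)) \<le> 1 + norm (y - z)" by metis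
   qed simp
   then have "\<bar>avg e (y - z)\<bar> \<le> C * ((1/2) powr (- ?p) * wt (y - x))"
    using order_trans[OF C(2) mult_left_mono] C(1) by auto
   then have "\<bar>u y\<bar> * \<bar>avg e (y - z)\<bar> \<le> \<bar>u y\<bar> * (C * ((1/2) powr (- ?p) * wt (y - x)))" by (intro mult_left_mono) auto
   then show "\<bar>u y * avg e (y - z)\<bar> \<le> C * (1/2) powr (- ?p) * (\<bar>u y\<bar> * wt (y - x))" by (simp add: abs_mult mult_ac)
  qed
 next
  have ic: "isCont (\<lambda>z. u y * avg e (y - z)) x" for y
   by (intro continuous_intros isCont_o2[OF _ avg_continuous[OF e]])
  show "AE y in lborel. ((\<lambda>z. u y * avg e (y - z)) \<longlongrightarrow> u y * avg e (y - x)) (at x within ball x 1)"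
   by (rule AE_I2, rule tendsto_within_subset[OF _ subset_UNIV], use ic in \<open>simp add: isCont_def\<close>)
 qed measurable
 then show ?thesis
  unfolding isCont_def mean_def using at_within_open[of x "ball x 1"] by simp
qed

lemma sdiff_mean_bound:
 fixes u :: "'a::euclidean_space \<Rightarrow> real"
 assumes u: "square_integrable u" and e: "0 < e"
 obtains K where "0 < K" "\<And>h. norm h \<le> e \<Longrightarrow> \<bar>sdiff (mean u e) h x\<bar> \<le> K * (norm h)\<^sup>2"
proof -
 have [measurable]: "u \<in> borel_measurable borel" using u by (rule square_integrableD)
 obtain C where C: "0 < C" "\<And>h y :: 'a. norm h \<le> 1 \<Longrightarrow> \<bar>sdiff (avg 1) h y\<bar> \<le> C * (norm h)\<^sup>2 * wt y"
  using sdiff_avg_bound[where 'a='a] by blast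
 define J where "J = (LBINT y. \<bar>u y\<bar> * wt ((y - x) /\<^sub>R e))"
 have iJ: "integrable lborel (\<lambda>y. \<bar>u y\<bar> * wt ((y - x) /\<^sub>R e))" by (rule wt_scaled_integrable[OF u e])
 have J: "0 \<le> J" unfolding J_def by (rule Bochner_Integration.integral_nonneg) (simp add: wt_nonneg)
 define D where "D = e powr (- real DIM('a)) * (C / e\<^sup>2)"
 have D: "0 < D" using C e by (simp add: D_def)
 show ?thesis
 proof (rule that[of "D * J + 1"])
  show "0 < D * J + 1" using D J by (intro add_nonneg_pos) auto
  fix h :: 'a assume h: "norm h \<le> e"
  have av: "\<bar>sdiff (avg e) h z\<bar> \<le> D * (norm h)\<^sup>2 * wt (z /\<^sub>R e)" for z :: 'a
  proof -
   have "sdiff (avg e) h z = e powr (- real DIM('a)) * sdiff (avg 1) (h /\<^sub>R e) (z /\<^sub>R e)"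
    unfolding sdiff_def avg_scale[OF e] by (simp add: algebra_simps)
   moreover have "\<bar>sdiff (avg 1) (h /\<^sub>R e) (z /\<^sub>R e)\<bar> \<le> C * (norm (h /\<^sub>R e))\<^sup>2 * wt (z /\<^sub>R e)"
    using h e by (intro C(2)) (simp add: field_simps)
   moreover have "(norm (h /\<^sub>R e))\<^sup>2 = (norm h)\<^sup>2 / e\<^sup>2" using e by (simp add: power_mult_distrib divide_inverse power_inverse)
   ultimately have "\<bar>sdiff (avg e) h z\<bar> = e powr (- real DIM('a)) * \<bar>sdiff (avg 1) (h /\<^sub>R e) (z /\<^sub>R e)\<bar>"
    and le: "\<bar>sdiff (avg 1) (h /\<^sub>R e) (z /\<^sub>R e)\<bar> \<le> C * ((norm h)\<^sup>2 / e\<^sup>2) * wt (z /\<^sub>R e)"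
    by (simp_all only: abs_mult abs_of_nonneg[OF powr_ge_zero])
   note this(1)
   also have "e powr (- real DIM('a)) * \<bar>sdiff (avg 1) (h /\<^sub>R e) (z /\<^sub>R e)\<bar> \<le> e powr (- real DIM('a)) * (C * ((norm h)\<^sup>2 / e\<^sup>2) * wt (z /\<^sub>R e))"
    by (rule mult_left_mono[OF le]) simp
   finally show ?thesis by (simp add: D_def mult_ac)
  qed
  note i = mean_integrable[OF u e]
  have eq: "u y * sdiff (avg e) h (y - x) = 2 * (u y * avg e (y - x)) - u y * avg e (y - (x - h)) - u y * avg e (y - (x + h))" for y
   by (simp add: sdiff_def algebra_simps)
  have i0: "integrable lborel (\<lambda>y. u y * sdiff (avg e) h (y - x))"
   unfolding eq using i[of x] i[of "x - h"] i[of "x + h"] by simp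
  have "sdiff (mean u e) h x = (LBINT y. u y * sdiff (avg e) h (y - x))"
   unfolding eq using i[of x] i[of "x - h"] i[of "x + h"] by (simp add: sdiff_def mean_def)
  also have "\<bar>\<dots>\<bar> \<le> (LBINT y. \<bar>u y * sdiff (avg e) h (y - x)\<bar>)" by (rule integral_abs_bound)
  also have "\<dots> \<le> (LBINT y. D * (norm h)\<^sup>2 * (\<bar>u y\<bar> * wt ((y - x) /\<^sub>R e)))"
  proof (rule integral_mono)
   fix y
   have "\<bar>u y\<bar> * \<bar>sdiff (avg e) h (y - x)\<bar> \<le> \<bar>u y\<bar> * (D * (norm h)\<^sup>2 * wt ((y - x) /\<^sub>R e))"
    by (intro mult_left_mono av) auto
   then show "\<bar>u y * sdiff (avg e) h (y - x)\<bar> \<le> D * (norm h)\<^sup>2 * (\<bar>u y\<bar> * wt ((y - x) /\<^sub>R e))"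
    by (simp add: abs_mult mult_ac)
  qed (use i0 iJ in auto)
  also have "\<dots> = D * J * (norm h)\<^sup>2" by (simp add: J_def)
  also have "\<dots> \<le> (D * J + 1) * (norm h)\<^sup>2" by (simp add: distrib_right)
  finally show "\<bar>sdiff (mean u e) h x\<bar> \<le> (D * J + 1) * (norm h)\<^sup>2" .
 qed
qed

text \<open>Moving the averaging onto the correlation F of u with g leaves a bounded function that
  is continuous at 0, so the limit follows by dominated convergence. A limit in this weak sense
  holds for every square integrable u and serves to identify all later limits.\<close>

lemma tendsto_mean_test:
 fixes u :: "'a::euclidean_space \<Rightarrow> real"
 assumes u: "square_integrable u" and g: "continuous_on UNIV g" and gb: "\<And>x. \<bar>g x\<bar> \<le> 1"
  and supp: "\<And>x. g x \<noteq> 0 \<Longrightarrow> norm x < R"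
 shows "((\<lambda>e. \<integral>x. mean u e x * g x \<partial>lborel) \<longlongrightarrow> mass TYPE('a) * (LBINT x. u x * g x)) (at_right 0)"
proof -
 have [measurable]: "u \<in> borel_measurable borel" using u by (rule square_integrableD)
 have [measurable]: "g \<in> borel_measurable borel" using g by (rule borel_measurable_continuous_onI)
 have iB: "integrable lborel (indicator (ball (0::'a) r) :: 'a \<Rightarrow> real)" for r
  by (rule integrable_real_indicator[OF _ emeasure_lborel_ball_finite]) simp
 have sB: "square_integrable (indicator (ball (0::'a) r) :: 'a \<Rightarrow> real)" for r
  by (rule square_integrable_bounded_integrable[OF _ iB[of r], of _ 1])
   (intro borel_measurable_indicator borel_open open_ball, auto simp: indicator_def)
 have gi: "\<bar>g x\<bar> \<le> indicator (ball 0 R) x" for x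
  using gb[of x] supp[of x] by (auto simp: indicator_def)
 have sg: "square_integrable g"
  by (rule square_integrable_bounded_integrable[OF _ iB[of R], of _ 1]) (use gb gi in auto)
 define F where "F h = (LBINT x. u x * g (x - h))" for h
 define K where "K = (LBINT x. (u x)\<^sup>2) + (LBINT x. (g x)\<^sup>2)"
 have Fabs: "(LBINT x. \<bar>u x * g (x - h)\<bar>) \<le> K" for h
 proof -
  have "(LBINT x. \<bar>u x * g (x - h)\<bar>) \<le> (LBINT x. (u x)\<^sup>2) + (LBINT x. (g (x - h))\<^sup>2)"
   by (rule abs_integral_mult_le[OF u square_integrable_shift(2)[OF sg]])
  also have "(LBINT x. (g (x - h))\<^sup>2) = (LBINT x. (g x)\<^sup>2)"
   using integral_shift(2)[of "\<lambda>x. (g x)\<^sup>2" h] by simp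
  finally show ?thesis by (simp add: K_def)
 qed
 have FK: "\<bar>F h\<bar> \<le> K" for h
  unfolding F_def by (rule order_trans[OF integral_abs_bound Fabs])
 have [measurable]: "F \<in> borel_measurable borel" unfolding F_def by measurable
 have F0: "(F \<longlongrightarrow> F 0) (at 0)"
 proof -
  have "((\<lambda>h. \<integral>x. u x * g (x - h) \<partial>lborel) \<longlongrightarrow> (LBINT x. u x * g (x - 0))) (at 0 within ball 0 1)"
  proof (rule tendsto_integral_dominated[where B="\<lambda>x. \<bar>u x * indicator (ball 0 (R + 1)) x\<bar>"])
   show "integrable lborel (\<lambda>x. \<bar>u x * indicator (ball 0 (R + 1)) x\<bar>)"
    by (intro integrable_abs integrable_square_integrable_mult u sB)
   fix h :: 'a assume h: "h \<in> ball 0 1"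
   show "AE x in lborel. \<bar>u x * g (x - h)\<bar> \<le> \<bar>u x * indicator (ball 0 (R + 1)) x\<bar>"
   proof (intro AE_I2)
    fix x
    have "\<bar>g (x - h)\<bar> \<le> indicator (ball 0 (R + 1)) x"
    proof (cases "g (x - h) = 0")
     case False
     then have "norm x < R + 1" using supp[OF False] h norm_triangle_ineq[of "x - h" h] by simp
     then show ?thesis using gb by simp
    qed simp
    then have "\<bar>u x\<bar> * \<bar>g (x - h)\<bar> \<le> \<bar>u x\<bar> * indicator (ball 0 (R + 1)) x" by (intro mult_left_mono) auto
    then show "\<bar>u x * g (x - h)\<bar> \<le> \<bar>u x * indicator (ball 0 (R + 1)) x\<bar>" by (simp add: abs_mult)
   qed
  next
   have gc: "isCont g x" for x using g by (simp add: continuous_on_eq_continuous_at)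
   have ic: "isCont (\<lambda>h. u x * g (x - h)) 0" for x
    by (intro continuous_intros isCont_o2[OF _ gc])
   show "AE x in lborel. ((\<lambda>h. u x * g (x - h)) \<longlongrightarrow> u x * g (x - 0)) (at 0 within ball 0 1)"
    by (rule AE_I2, rule tendsto_within_subset[OF _ subset_UNIV], use ic in \<open>simp add: isCont_def\<close>)
  qed measurable
  then show ?thesis
   unfolding F_def using at_within_open[of "0::'a" "ball 0 1"] by simp
 qed
 \<comment> \<open>In the rescaled variable the kernel no longer depends on e; the scale enters only
   through the argument of F.\<close>
 have eq: "(LBINT x. mean u e x * g x) = (LBINT z. avg 1 z * F (e *\<^sub>R z))" if e: "0 < e" for e
 proof -
  let ?f = "\<lambda>(z, x). avg 1 z * (u (x + e *\<^sub>R z) * g x)"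
  have sh: "integrable lborel (\<lambda>x. u (x + h) * g x)" "(LBINT x. u (x + h) * g x) = F h"
   "(LBINT x. \<bar>u (x + h) * g x\<bar>) \<le> K" for h
  proof -
   show "integrable lborel (\<lambda>x. u (x + h) * g x)"
    by (rule integrable_square_integrable_mult[OF square_integrable_shift(1)[OF u] sg])
   show "(LBINT x. u (x + h) * g x) = F h"
    unfolding F_def using integral_shift(1)[of "\<lambda>x. u x * g (x - h)" h] by simp
   have "(LBINT x. \<bar>u (x + h) * g x\<bar>) = (LBINT x. \<bar>u x * g (x - h)\<bar>)"
    using integral_shift(1)[of "\<lambda>x. \<bar>u x * g (x - h)\<bar>" h] by simp
   then show "(LBINT x. \<bar>u (x + h) * g x\<bar>) \<le> K" using Fabs by simp
  qed
  have int: "integrable (lborel \<Otimes>\<^sub>M lborel) ?f"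
  proof (rule lborel_pair.Fubini_integrable)
   show "?f \<in> borel_measurable (lborel \<Otimes>\<^sub>M lborel)" by measurable
   show "AE z in lborel. integrable lborel (\<lambda>x. ?f (z, x))" using sh(1) by simp
   show "integrable lborel (\<lambda>z. \<integral>x. norm (?f (z, x)) \<partial>lborel)"
   proof (rule Bochner_Integration.integrable_bound[OF integrable_mult_right[OF integrable_abs[OF avg_integrable], of K]])
    show "AE z in lborel. norm (LBINT x. norm (?f (z, x))) \<le> norm (K * \<bar>avg 1 (z::'a)\<bar>)"
    proof (intro AE_I2)
     fix z :: 'a
     have "(LBINT x. norm (?f (z, x))) = \<bar>avg 1 z\<bar> * (LBINT x. \<bar>u (x + e *\<^sub>R z) * g x\<bar>)"
      by (simp add: abs_mult)
     also have "\<dots> \<le> \<bar>avg 1 z\<bar> * K" by (intro mult_left_mono sh(3)) auto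
     finally show "norm (LBINT x. norm (?f (z, x))) \<le> norm (K * \<bar>avg 1 (z::'a)\<bar>)"
      by (simp add: mult.commute)
    qed
   qed measurable
  qed
  have "(LBINT x. mean u e x * g x) = (LBINT x. \<integral>z. ?f (z, x) \<partial>lborel)"
  proof (rule Bochner_Integration.integral_cong[OF refl])
   fix x
   have "mean u e x * g x = (LBINT z. u (x + e *\<^sub>R z) * avg 1 z * g x)"
    by (simp add: mean_rescaled[OF _ e])
   also have "\<dots> = (LBINT z. ?f (z, x))"
    by (rule Bochner_Integration.integral_cong[OF refl]) (simp only: case_prod_conv mult_ac)
   finally show "mean u e x * g x = (LBINT z. ?f (z, x))" .
  qed
  also have "\<dots> = (LBINT z. \<integral>x. ?f (z, x) \<partial>lborel)"
  proof -
   have "integrable (lborel \<Otimes>\<^sub>M lborel) (case_prod (\<lambda>z x. ?f (z, x)))"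
    using int by (simp only: case_prod_conv)
   then show ?thesis by (rule lborel_pair.Fubini_integral)
  qed
  also have "\<dots> = (LBINT z. avg 1 z * F (e *\<^sub>R z))" by (simp add: sh(2))
  finally show ?thesis .
 qed
 have "((\<lambda>e. \<integral>z. avg 1 z * F (e *\<^sub>R z) \<partial>lborel) \<longlongrightarrow> (LBINT z. avg 1 (z::'a) * F 0)) (at_right 0)"
 proof (rule tendsto_integral_dominated[where B="\<lambda>z. K * \<bar>avg 1 z\<bar>"])
  show "integrable lborel (\<lambda>z::'a. K * \<bar>avg 1 z\<bar>)" by (intro integrable_mult_right integrable_abs avg_integrable)
  fix e :: real
  show "AE z in lborel. \<bar>avg 1 z * F (e *\<^sub>R z)\<bar> \<le> K * \<bar>avg 1 z\<bar>"
  proof (intro AE_I2)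
   fix z :: 'a
   have "\<bar>F (e *\<^sub>R z)\<bar> * \<bar>avg 1 z\<bar> \<le> K * \<bar>avg 1 z\<bar>" by (intro mult_right_mono FK) auto
   then show "\<bar>avg 1 z * F (e *\<^sub>R z)\<bar> \<le> K * \<bar>avg 1 z\<bar>" by (simp add: abs_mult mult.commute)
  qed
 next
  show "AE z in lborel. ((\<lambda>e. avg 1 z * F (e *\<^sub>R z)) \<longlongrightarrow> avg 1 (z::'a) * F 0) (at_right 0)"
  proof (intro AE_I2 tendsto_mult tendsto_const)
   fix z :: 'a
   have "isCont F 0" using F0 by (simp add: isCont_def)
   moreover have "((\<lambda>e. e *\<^sub>R z) \<longlongrightarrow> 0 *\<^sub>R z) (at_right (0::real))"
    by (rule tendsto_scaleR[OF tendsto_ident_at tendsto_const])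
   ultimately show "((\<lambda>e. F (e *\<^sub>R z)) \<longlongrightarrow> F 0) (at_right 0)"
    using isCont_tendsto_compose[of 0 F "\<lambda>e. e *\<^sub>R z"] by simp
  qed
 qed measurable
 also have "(LBINT z. avg 1 (z::'a) * F 0) = mass TYPE('a) * (LBINT x. u x * g x)"
  by (simp add: mass_def F_def)
 finally show ?thesis
 proof (rule Lim_transform_eventually)
  show "eventually (\<lambda>e. (LBINT z. avg 1 z * F (e *\<^sub>R z)) = (LBINT x. mean u e x * g x)) (at_right 0)"
   unfolding eventually_at_filter by (intro always_eventually allI impI) (simp add: eq)
 qed
qed

text \<open>The bump and its dilate are both radially decreasing, so their increments between two
  points have the same sign and the integrand of their energy is nonnegative.\<close>

lemma bump_form_pos:
 fixes t :: real
 assumes t: "0 < t"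
 shows "0 \<le> (LBINT y. bump y * ell ((y::'a::euclidean_space) /\<^sub>R t))"
  and "0 < (LBINT y. bump y * ell ((y::'a::euclidean_space) /\<^sub>R t))"
proof -
 let ?v = "sbump (0::'a) t"
 let ?G = "\<lambda>(x::'a, y). (bump x - bump y) * (?v x - ?v y) * kern (x - y)"
 have 1: "sbump (0::'a) 1 = bump" by (simp add: sbump_def[abs_def])
 have int: "integrable (lborel \<Otimes>\<^sub>M lborel) ?G"
  using integrable_mult_of_squares[of "\<lambda>(x, y). bump x - bump y" "lborel \<Otimes>\<^sub>M lborel" "\<lambda>(x, y). ?v x - ?v y" "\<lambda>(x::'a, y). kern (x - y)"]
   sbump_energy_integrable[OF zero_less_one, of "0::'a"] sbump_energy_integrable[OF t, of "0::'a"]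
  unfolding 1 by (simp add: case_prod_unfold kern_nonneg)
 have f: "(\<integral>p. ?G p \<partial>(lborel \<Otimes>\<^sub>M lborel)) = t powr (- 2 * s) * (LBINT y. bump y * ell ((y::'a) /\<^sub>R t))"
  using form_sbump[OF square_integrable_bump t int] by simp
 have vm: "norm x \<le> norm y \<Longrightarrow> ?v y \<le> ?v x" for x y
  unfolding sbump_def using t by (intro trunc_pow_mono) (simp add: mult_left_mono)
 have nn: "0 \<le> ?G p" for p
 proof -
  obtain x y where p: "p = (x, y)" by fastforce
  have "0 \<le> (bump x - bump y) * (?v x - ?v y)"
  proof (cases "norm x \<le> norm y")
   case True
   then show ?thesis using trunc_pow_mono[OF True, of 6] vm[OF True] by (intro mult_nonneg_nonneg) auto
  next
   case False
   then have *: "norm y \<le> norm x" by simp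
   show ?thesis using trunc_pow_mono[OF *, of 6] vm[OF *] by (intro mult_nonpos_nonpos) auto
  qed
  then show ?thesis by (simp add: p kern_nonneg)
 qed
 have ge: "0 \<le> (\<integral>p. ?G p \<partial>(lborel \<Otimes>\<^sub>M lborel))" by (rule Bochner_Integration.integral_nonneg) (rule nn)
 then show ge': "0 \<le> (LBINT y. bump y * ell ((y::'a) /\<^sub>R t))"
  unfolding f using t by (simp add: zero_le_mult_iff)
 have "(\<integral>p. ?G p \<partial>(lborel \<Otimes>\<^sub>M lborel)) \<noteq> 0"
 proof
  assume "(\<integral>p. ?G p \<partial>(lborel \<Otimes>\<^sub>M lborel)) = 0"
  then have ae: "AE p in lborel \<Otimes>\<^sub>M lborel. ?G p = 0"
   using integral_nonneg_eq_0_iff_AE[OF int] nn by simp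
  \<comment> \<open>Two small balls with |x| < r and |y| > 2 r. Since r is below both 1 and t, both
    profiles are strictly larger at x than at y, so the integrand is nonzero on a product set of
    positive measure.\<close>
  define r where "r = min 1 t / 4"
  have r: "0 < r" "4 * r \<le> 1" "4 * r \<le> t" using t by (auto simp: r_def)
  obtain b :: 'a where b: "b \<in> Basis" using nonempty_Basis by blast
  define A where "A = ball (0::'a) r"
  define B where "B = ball ((3 * r) *\<^sub>R b) r"
  have pos: "?G (x, y) \<noteq> 0" if "x \<in> A" "y \<in> B" for x y
  proof -
   have x: "norm x < r" using that by (simp add: A_def)
   have "norm ((3 * r) *\<^sub>R b) \<le> norm y + norm ((3 * r) *\<^sub>R b - y)"
    using norm_triangle_ineq[of y "(3 * r) *\<^sub>R b - y"] by simp
   then have y: "2 * r < norm y" using that b r by (simp add: B_def dist_norm)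
   have xy: "norm x < norm y" using x y r by linarith
   have "bump y < bump x" using x r by (intro trunc_pow_strict_mono xy) auto
   moreover have "?v y < ?v x"
    unfolding sbump_def using x r t xy
    by (intro trunc_pow_strict_mono) (auto simp: field_simps)
   moreover have "kern (x - y) \<noteq> 0" using xy by (auto simp: kern_def)
   ultimately show ?thesis by simp
  qed
  have "AE p in lborel \<Otimes>\<^sub>M lborel. p \<notin> A \<times> B"
   using ae by eventually_elim (use pos in auto)
  then have "emeasure (lborel \<Otimes>\<^sub>M lborel) (A \<times> B) = 0"
   by (subst (asm) AE_iff_measurable[of "A \<times> B"]) (auto simp: A_def B_def space_pair_measure)
  moreover have "emeasure (lborel \<Otimes>\<^sub>M lborel) (A \<times> B) = emeasure lborel A * emeasure lborel B"
   by (rule lborel.emeasure_pair_measure_Times) (auto simp: A_def B_def)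
  ultimately show False
   using r by (auto simp: A_def B_def emeasure_ball unit_ball_vol_pos[THEN less_imp_neq, symmetric])
 qed
 then have "(LBINT y. bump y * ell ((y::'a) /\<^sub>R t)) \<noteq> 0" unfolding f by auto
 with ge' show "0 < (LBINT y. bump y * ell ((y::'a) /\<^sub>R t))" by (simp only: less_le) simp
qed

text \<open>The averages of the bump at the origin tend to \<open>mass\<close> as the scale tends to
  0, since bump(0) = 1. By positivity of the form they strictly decrease in the scale, and they stay
  nonnegative because they tend to 0 at infinity.\<close>

lemma mass_pos: "0 < mass TYPE('a::euclidean_space)"
proof -
 let ?m = "\<lambda>e. mean bump e (0::'a)"
 let ?h = "\<lambda>t. t powr (- (real DIM('a) + 1)) * (LBINT y. bump y * ell ((y - (0::'a)) /\<^sub>R t))"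
 note sb = square_integrable_bump[where 'a='a]
 have hpos: "0 < ?h t" if "0 < t" for t using bump_form_pos(2)[OF that, where 'a='a] that by simp
 have mono: "?m d \<le> ?m e" if e: "0 < e" "e \<le> d" for e d
 proof -
  have "0 \<le> (LBINT t. ?h t * indicator {e<..d} t)"
   using hpos e by (intro Bochner_Integration.integral_nonneg) (auto simp: indicator_def less_imp_le)
  then show ?thesis using mean_diff(1)[OF sb e, of 0] by simp
 qed
 have strict: "?m 2 < ?m 1"
 proof (rule ccontr)
  assume "\<not> ?thesis"
  then have z: "(LBINT t. ?h t * indicator {1<..2} t) = 0"
   using mean_diff(1)[OF sb, of 1 2 0] mono[of 1 2] by simp
  have "AE t in lborel. ?h t * indicator {1<..2} t = 0"
   using integral_nonneg_eq_0_iff_AE[OF mean_diff(2)[OF sb, of 1 2 0]] z hpos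
   by (auto simp: indicator_def less_imp_le)
  then have "AE t in lborel. t \<notin> {1<..2::real}"
  proof eventually_elim
   fix t assume "?h t * indicator {1<..2} t = 0"
   moreover have "t \<in> {1<..2} \<Longrightarrow> 0 < ?h t" by (rule hpos) simp
   moreover have "x \<notin> S" if "a * indicator S x = 0" "x \<in> S \<Longrightarrow> 0 < a" for a x :: real and S
    using that by (cases "x \<in> S") auto
   ultimately show "t \<notin> {1<..2}" by blast
  qed
  then have "emeasure lborel {1<..2::real} = 0"
   by (subst (asm) AE_iff_measurable[of "{1<..2}"]) auto
  then show False by simp
 qed
 have pos2: "0 \<le> ?m 2"
 proof -
  obtain C where C: "0 < C" "\<And>y :: 'a. \<bar>avg 1 y\<bar> \<le> C * wt y" using avg_bound[where 'a='a] by blast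
  \<comment> \<open>The kernel at scale d is O(d^(-n)) uniformly. This lower bound tends to 0 as d
    grows, and by monotonicity it also bounds the average at scale 2.\<close>
  have "- (C * (LBINT y. bump (y::'a))) * d powr (- real DIM('a)) \<le> ?m d" if d: "0 < d" for d
  proof -
   have "\<bar>avg d y\<bar> \<le> d powr (- real DIM('a)) * C" for y :: 'a
    unfolding avg_scale[OF d] abs_mult
    using order_trans[OF C(2) mult_left_mono[OF wt_le_1]] C(1) by (auto intro!: mult_left_mono)
   then have le: "bump y * (- (d powr (- real DIM('a)) * C)) \<le> bump y * avg d (y - 0)" for y :: 'a
    by (intro mult_left_mono trunc_pow_nonneg) (simp add: abs_le_iff minus_le_iff)
   have "(LBINT (y::'a). bump y * (- (d powr (- real DIM('a)) * C))) \<le> ?m d"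
    unfolding mean_def using mean_integrable[OF sb d, of 0] bump_integrable[where 'a='a] le by (intro integral_mono) auto
   then show ?thesis by (simp add: mult_ac)
  qed
  then have "- (C * (LBINT y. bump (y::'a))) * d powr (- real DIM('a)) \<le> ?m 2" if "2 \<le> d" for d
   using mono[of 2 d] that by (meson order_trans zero_less_numeral less_le_trans)
  then have ev: "eventually (\<lambda>d. - (C * (LBINT y. bump (y::'a))) * d powr (- real DIM('a)) \<le> ?m 2) at_top"
   by (rule eventually_mono[OF eventually_ge_at_top[of 2]])
  have "((\<lambda>d. - (C * (LBINT y. bump (y::'a))) * d powr (- real DIM('a))) \<longlongrightarrow> - (C * (LBINT y. bump (y::'a))) * 0) at_top"
   by (intro tendsto_mult tendsto_const tendsto_neg_powr filterlim_ident) simp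
  from tendsto_upperbound[OF this ev] show ?thesis by simp
 qed
 have lim: "(?m \<longlongrightarrow> mass TYPE('a)) (at_right 0)"
 proof -
  have "((\<lambda>e. \<integral>z. bump (0 + e *\<^sub>R z) * avg 1 (z::'a) \<partial>lborel) \<longlongrightarrow> (LBINT z. 1 * avg 1 (z::'a))) (at_right 0)"
  proof (rule tendsto_integral_dominated[where B="\<lambda>z. \<bar>avg 1 z\<bar>"])
   show "integrable lborel (\<lambda>z::'a. \<bar>avg 1 z\<bar>)" by (intro integrable_abs avg_integrable)
   show "AE z in lborel. \<bar>bump (0 + e *\<^sub>R z) * avg 1 (z::'a)\<bar> \<le> \<bar>avg 1 z\<bar>" for e
    by (intro AE_I2) (simp add: abs_mult mult_left_le_one_le abs_of_nonneg[OF trunc_pow_nonneg] trunc_pow_le_1 trunc_pow_nonneg)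
   show "AE z in lborel. ((\<lambda>e. bump (0 + e *\<^sub>R z) * avg 1 (z::'a)) \<longlongrightarrow> 1 * avg 1 z) (at_right 0)"
   proof (intro AE_I2 tendsto_mult tendsto_const)
    fix z :: 'a
    have "isCont (\<lambda>e::real. bump (0 + e *\<^sub>R z)) 0"
     unfolding trunc_pow_def by (intro continuous_intros)
    then have "((\<lambda>e::real. bump (0 + e *\<^sub>R z)) \<longlongrightarrow> bump (0::'a)) (at 0)" by (simp add: isCont_def)
    moreover have "bump (0::'a) = 1" by (simp add: trunc_pow_def)
    ultimately show "((\<lambda>e::real. bump (0 + e *\<^sub>R z)) \<longlongrightarrow> 1) (at_right 0)"
     by (metis tendsto_within_subset subset_UNIV)
   qed
  qed measurable
  then have "((\<lambda>e. \<integral>z. bump (0 + e *\<^sub>R z) * avg 1 (z::'a) \<partial>lborel) \<longlongrightarrow> mass TYPE('a)) (at_right 0)"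
   by (simp add: mass_def)
  then show ?thesis
  proof (rule Lim_transform_eventually)
   show "eventually (\<lambda>e. (LBINT z. bump (0 + e *\<^sub>R z) * avg 1 (z::'a)) = ?m e) (at_right 0)"
    unfolding eventually_at_filter by (rule always_eventually) (use mean_rescaled[of "bump :: 'a \<Rightarrow> real" _ 0] in auto)
  qed
 qed
 have "eventually (\<lambda>e. ?m 1 \<le> ?m e) (at_right 0)"
  using eventually_at_right_less[of 0] eventually_at_right[of 0 1, THEN iffD2, of "\<lambda>e. e \<le> 1"]
  by (auto simp: eventually_at_right_field intro!: exI[of _ 1] mono)
 from tendsto_lowerbound[OF lim this] have "?m 1 \<le> mass TYPE('a)" by simp
 then show ?thesis using strict pos2 by linarith
qed

end

subsection \<open>Local boundedness and the continuous representative\<close>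

lemma ball_indicator_measurable [measurable]:
 "indicator (ball (c::'a::euclidean_space) r) \<in> borel_measurable borel"
 by (intro borel_measurable_indicator borel_open open_ball)

lemma square_integrable_ball: "square_integrable (indicator (ball (c::'a::euclidean_space) r))"
proof (rule square_integrable_bounded_integrable[where B=1])
 show "integrable lborel (indicator (ball c r) :: 'a \<Rightarrow> real)"
  by (rule integrable_real_indicator[OF _ emeasure_lborel_ball_finite]) simp
qed (auto simp: indicator_def)

lemma square_integrable_imp_loc:
 "square_integrable u \<Longrightarrow> integrable lborel (\<lambda>x. u x * indicator (ball c r) x)"
 by (rule integrable_square_integrable_mult[OF _ square_integrable_ball])

lemma test_function_integrable:
 fixes g :: "'a::euclidean_space \<Rightarrow> real"
 assumes "L-lipschitz_on UNIV g" "\<And>x. \<bar>g x\<bar> \<le> 1" "\<And>x. g x \<noteq> 0 \<Longrightarrow> norm x < R"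
 shows "square_integrable g" "integrable lborel g" "continuous_on UNIV g"
proof -
 show c: "continuous_on UNIV g" using assms(1) by (rule lipschitz_on_continuous_on)
 then have [measurable]: "g \<in> borel_measurable borel" by (rule borel_measurable_continuous_onI)
 have iB: "integrable lborel (indicator (ball (0::'a) R) :: 'a \<Rightarrow> real)"
  by (rule integrable_real_indicator[OF _ emeasure_lborel_ball_finite]) simp
 have gi: "\<bar>g x\<bar> \<le> indicator (ball 0 R) x" for x
  using assms(2)[of x] assms(3)[of x] by (auto simp: indicator_def)
 show "square_integrable g"
  by (rule square_integrable_bounded_integrable[OF _ iB, of _ 1]) (use assms gi in auto)
 show "integrable lborel g"
  by (rule Bochner_Integration.integrable_bound[OF iB]) (use gi in auto)
qed

context frac
begin

text \<open>For a subsolution every layer is nonpositive, so the averages do not exceed the average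
  at the fixed scale r, which is bounded by L2 norms. Since the averages converge weakly to
  \<open>mass\<close> times u, the bound passes to u. The doubled radius makes room for layers up to
  scale r around points of the smaller ball.\<close>

lemma subsolution_locally_bounded:
 fixes u :: "'a::euclidean_space \<Rightarrow> real"
 assumes u: "square_integrable u" and r: "0 < r"
  and sub: "\<And>x t. 0 < t \<Longrightarrow> cball x t \<subseteq> ball x0 (2 * r) \<Longrightarrow> (LBINT y. u y * ell ((y - x) /\<^sub>R t)) \<le> 0"
 obtains B where "AE y in lborel. y \<in> ball x0 r \<longrightarrow> u y \<le> B"
proof -
 have [measurable]: "u \<in> borel_measurable borel" using u by (rule square_integrableD)
 define K where "K = (LBINT y. (u y)\<^sup>2) + (LBINT y. (avg r (y::'a))\<^sup>2)"
 have le: "mean u e x \<le> K" if e: "0 < e" "e \<le> r" and x: "x \<in> ball x0 r" for e x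
 proof -
  have "t powr (- (real DIM('a) + 1)) * (LBINT y. u y * ell ((y - x) /\<^sub>R t)) * indicator {e<..r} t \<le> 0" for t
  proof (cases "e < t \<and> t \<le> r")
   case True
   have "cball x t \<subseteq> ball x0 (2 * r)"
   proof
    fix y assume "y \<in> cball x t"
    then show "y \<in> ball x0 (2 * r)" using x True dist_triangle[of x0 y x] by simp
   qed
   then have "(LBINT y. u y * ell ((y - x) /\<^sub>R t)) \<le> 0" using True e by (intro sub) auto
   then show ?thesis using True by (simp add: mult_nonneg_nonpos)
  next
   case False
   then have "indicator {e<..r} t = (0::real)" by auto
   then show ?thesis by simp
  qed
  then have "0 \<le> (LBINT t. - (t powr (- (real DIM('a) + 1)) * (LBINT y. u y * ell ((y - x) /\<^sub>R t)) * indicator {e<..r} t))"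
   by (intro Bochner_Integration.integral_nonneg) (simp only: neg_0_le_iff_le)
  then have "mean u e x \<le> mean u r x" using mean_diff(1)[OF u e, of x] by simp
  then show ?thesis using mean_bounded[OF u r, of x] by (simp add: K_def)
 qed
 have "AE x in lborel. x \<in> ball x0 r \<longrightarrow> mass TYPE('a) * u x - K \<le> 0"
 proof (rule AE_nonpos_of_lipschitz_test)
  show "integrable lborel (\<lambda>x. (mass TYPE('a) * u x - K) * indicator (ball 0 R) x)" for R
   using square_integrable_imp_loc[OF u, of 0 R] integrable_real_indicator[OF _ emeasure_lborel_ball_finite, of "0::'a" R]
   by (simp add: left_diff_distrib mult.assoc)
  fix g :: "'a \<Rightarrow> real" and L R
  assume g: "L-lipschitz_on UNIV g" "\<And>x. 0 \<le> g x" "\<And>x. g x \<le> 1" "\<And>x. g x \<noteq> 0 \<Longrightarrow> x \<in> ball x0 r \<and> norm x < R"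
  have g1: "\<bar>g x\<bar> \<le> 1" for x using g(2,3)[of x] by simp
  have g2: "g x \<noteq> 0 \<Longrightarrow> norm x < R" for x using g(4)[of x] by simp
  note tf = test_function_integrable[OF g(1) g1 g2]
  have [measurable]: "g \<in> borel_measurable borel" using tf(1) by (rule square_integrableD)
  have ev: "eventually (\<lambda>e. (LBINT x. mean u e x * g x) \<le> K * (LBINT x. g x)) (at_right 0)"
   unfolding eventually_at_right_field
  proof (intro exI[of _ r] conjI allI impI)
   fix e assume e: "0 < e" "e < r"
   have cm: "continuous_on UNIV (mean u e)" using mean_continuous[OF u e(1)] by (simp add: continuous_at_imp_continuous_on)
   have [measurable]: "mean u e \<in> borel_measurable borel" using cm by (rule borel_measurable_continuous_onI)
   have "integrable lborel (\<lambda>x. mean u e x * g x)"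
   proof (rule Bochner_Integration.integrable_bound)
    show "integrable lborel (\<lambda>x. ((LBINT y. (u y)\<^sup>2) + (LBINT y. (avg e (y::'a))\<^sup>2)) * g x)"
     using tf(2) by simp
    have "norm (mean u e x * g x) \<le> norm (((LBINT y. (u y)\<^sup>2) + (LBINT y. (avg e (y::'a))\<^sup>2)) * g x)" for x
     unfolding norm_mult
     using order_trans[OF mean_bounded[OF u e(1), of x] abs_ge_self] by (intro mult_right_mono) auto
    then show "AE x in lborel. norm (mean u e x * g x) \<le> norm (((LBINT y. (u y)\<^sup>2) + (LBINT y. (avg e (y::'a))\<^sup>2)) * g x)"
     by (rule AE_I2)
   qed measurable
   moreover have "mean u e x * g x \<le> K * g x" for x
   proof (cases "g x = 0")
    case False
    then have "mean u e x \<le> K" using g(4) e by (intro le) auto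
    then show ?thesis by (intro mult_right_mono g(2))
   qed simp
   ultimately have "(LBINT x. mean u e x * g x) \<le> (LBINT x. K * g x)"
    using tf(2) by (intro integral_mono) auto
   then show "(LBINT x. mean u e x * g x) \<le> K * (LBINT x. g x)" by simp
  qed (use r in auto)
  have "mass TYPE('a) * (LBINT x. u x * g x) \<le> K * (LBINT x. g x)"
   by (rule tendsto_upperbound[OF tendsto_mean_test[OF u tf(3) g1 g2] ev trivial_limit_at_right_real])
  moreover have "(LBINT x. (mass TYPE('a) * u x - K) * g x) = mass TYPE('a) * (LBINT x. u x * g x) - K * (LBINT x. g x)"
   using integrable_square_integrable_mult[OF u tf(1)] tf(2) by (simp add: left_diff_distrib mult.assoc)
  ultimately show "(LBINT x. (mass TYPE('a) * u x - K) * g x) \<le> 0" by simp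
 qed auto
 then have "AE y in lborel. y \<in> ball x0 r \<longrightarrow> u y \<le> K / mass TYPE('a)"
  by eventually_elim (use mass_pos[where 'a='a] in \<open>auto simp: field_simps\<close>)
 with that show ?thesis by blast
qed

abbreviation layer :: "('a::euclidean_space \<Rightarrow> real) \<Rightarrow> 'a \<Rightarrow> real \<Rightarrow> real" where
 "layer u x t \<equiv> t powr (- (real DIM('a) + 1)) * (LBINT y. u y * ell ((y - x) /\<^sub>R t))"

lemma powr_tendsto_0: "((\<lambda>e::real. e powr (2 * s)) \<longlongrightarrow> 0) (at_right 0)"
proof -
 have "eventually (\<lambda>e::real. 0 \<le> e) (at_right 0)"
  by (rule eventually_at_rightI[of 0 1]) auto
 then have "((\<lambda>e::real. e powr (2 * s)) \<longlongrightarrow> 0 powr (2 * s)) (at_right 0)"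
  using s0 by (intro tendsto_powr'[OF tendsto_ident_at tendsto_const]) auto
 then show ?thesis by simp
qed

text \<open>The density t^(2s-1) is integrable at 0, so the layers below scale e add up absolutely
  to at most C e^(2s) / (2s). The limit l is the average at scale r plus all smaller layers.\<close>

lemma mean_tendsto:
 fixes u :: "'a::euclidean_space \<Rightarrow> real"
 assumes u: "square_integrable u" and r: "0 < r"
  and bd: "\<And>t. 0 < t \<Longrightarrow> t \<le> r \<Longrightarrow> \<bar>layer u x t\<bar> \<le> C * t powr (2 * s - 1)"
 obtains l where "((\<lambda>e. mean u e x) \<longlongrightarrow> l) (at_right 0)"
  "\<And>e. 0 < e \<Longrightarrow> e \<le> r \<Longrightarrow> integrable lborel (\<lambda>t. layer u x t * indicator {0<..e} t)"
  "\<And>e. 0 < e \<Longrightarrow> e \<le> r \<Longrightarrow> l - mean u e x = (LBINT t. layer u x t * indicator {0<..e} t)"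
  "\<And>e. 0 < e \<Longrightarrow> e \<le> r \<Longrightarrow> \<bar>l - mean u e x\<bar> \<le> C / (2 * s) * e powr (2 * s)"
proof -
 have [measurable]: "u \<in> borel_measurable borel" using u by (rule square_integrableD)
 have hI: "integrable lborel (\<lambda>t::real. t powr (2 * s - 1) * indicator {0<..e} t)"
  "(LBINT t. t powr (2 * s - 1) * indicator {0<..e} t) = e powr (2 * s) / (2 * s)" if "0 < e" for e
  using integrable_powr_head[of "2 * s - 1" e] s0 that by simp_all
 have le: "\<bar>layer u x t * indicator {0<..e} t\<bar> \<le> C * (t powr (2 * s - 1) * indicator {0<..e} t)" if "e \<le> r" for t e
  using bd[of t] that by (auto simp: indicator_def)
 have lI: "integrable lborel (\<lambda>t. layer u x t * indicator {0<..e} t)" if "0 < e" "e \<le> r" for e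
 proof (rule Bochner_Integration.integrable_bound[OF integrable_mult_right[OF hI(1)[OF that(1)], of C]])
  show "AE t in lborel. norm (layer u x t * indicator {0<..e} t) \<le> norm (C * (t powr (2 * s - 1) * indicator {0<..e} t))"
   using order_trans[OF le[OF that(2)] abs_ge_self] by (intro AE_I2) (simp only: real_norm_def)
 qed measurable
 define l where "l = mean u r x + (LBINT t. layer u x t * indicator {0<..r} t)"
 have l: "l - mean u e x = (LBINT t. layer u x t * indicator {0<..e} t)" if e: "0 < e" "e \<le> r" for e
 proof -
  have "(LBINT t. layer u x t * indicator {0<..r} t) = (LBINT t. layer u x t * indicator {0<..e} t + layer u x t * indicator {e<..r} t)"
   using e by (intro Bochner_Integration.integral_cong refl) (auto simp: indicator_def)
  also have "\<dots> = (LBINT t. layer u x t * indicator {0<..e} t) + (mean u e x - mean u r x)"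
   unfolding mean_diff(1)[OF u e, of x] by (intro Bochner_Integration.integral_add lI e mean_diff(2)[OF u e])
  finally show ?thesis by (simp add: l_def)
 qed
 have lb: "\<bar>l - mean u e x\<bar> \<le> C / (2 * s) * e powr (2 * s)" if e: "0 < e" "e \<le> r" for e
 proof -
  have "\<bar>l - mean u e x\<bar> \<le> (LBINT t. \<bar>layer u x t * indicator {0<..e} t\<bar>)"
   unfolding l[OF e] by (rule integral_abs_bound)
  also have "\<dots> \<le> (LBINT t. C * (t powr (2 * s - 1) * indicator {0<..e} t))"
   by (rule integral_mono[OF integrable_abs[OF lI[OF e]] integrable_mult_right[OF hI(1)[OF e(1)]] le[OF e(2)]])
  also have "\<dots> = C / (2 * s) * e powr (2 * s)" using hI(2)[OF e(1)] by simp
  finally show ?thesis .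
 qed
 have "((\<lambda>e. mean u e x) \<longlongrightarrow> l) (at_right 0)"
 proof (rule LIM_zero_cancel, rule Lim_null_comparison)
  show "eventually (\<lambda>e. norm (mean u e x - l) \<le> C / (2 * s) * e powr (2 * s)) (at_right 0)"
   unfolding eventually_at_right_field using lb r by (intro exI[of _ r]) (auto simp: abs_minus_commute)
  show "((\<lambda>e. C / (2 * s) * e powr (2 * s)) \<longlongrightarrow> 0) (at_right 0)"
   by (intro tendsto_mult_right_zero powr_tendsto_0)
 qed
 with that lI l lb show ?thesis by blast
qed

text \<open>The equation \<open>flap u\<close> = g in \<Omega>, tested only with scaled bumps
  supported in \<Omega>. The factor t^(2s) is the homogeneity from
  \<open>form_sbump\<close>.\<close>

definition weak_eq :: "'a::euclidean_space set \<Rightarrow> ('a \<Rightarrow> real) \<Rightarrow> ('a \<Rightarrow> real) \<Rightarrow> bool" where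
 "weak_eq \<Omega> u g \<longleftrightarrow> (\<forall>x t. 0 < t \<longrightarrow> cball x t \<subseteq> \<Omega> \<longrightarrow>
  (LBINT y. u y * ell ((y - x) /\<^sub>R t)) = t powr (2 * s) * (LBINT y. g y * sbump x t y))"

lemma weak_eqD: "weak_eq \<Omega> u g \<Longrightarrow> 0 < t \<Longrightarrow> cball x t \<subseteq> \<Omega> \<Longrightarrow>
  (LBINT y. u y * ell ((y - x) /\<^sub>R t)) = t powr (2 * s) * (LBINT y. g y * sbump x t y)"
 by (simp add: weak_eq_def)

lemma sbump_integrable: "0 < t \<Longrightarrow> integrable lborel (sbump (x::'a::euclidean_space) t)"
 and sbump_integral: "0 < t \<Longrightarrow> (LBINT y. sbump (x::'a::euclidean_space) t y) = t ^ DIM('a) * (LBINT y. bump (y::'a))"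
 unfolding sbump_def[abs_def]
 using integrable_scale[of "bump :: 'a \<Rightarrow> real" t x] integral_scale[of "bump :: 'a \<Rightarrow> real" t x] bump_integrable[where 'a='a]
 by auto

lemma bump_mass_nonneg: "0 \<le> (LBINT y. bump (y::'a::euclidean_space))"
 by (rule Bochner_Integration.integral_nonneg) (simp add: trunc_pow_nonneg)

lemma integral_mult_sbump_bound:
 fixes g :: "'a::euclidean_space \<Rightarrow> real"
 assumes [measurable]: "g \<in> borel_measurable borel" and t: "0 < t" and B: "0 \<le> B"
  and g: "AE y in lborel. y \<in> ball x t \<longrightarrow> \<bar>g y\<bar> \<le> B"
 shows "integrable lborel (\<lambda>y. g y * sbump x t y)"
  "\<bar>\<integral>y. g y * sbump x t y \<partial>lborel\<bar> \<le> B * (LBINT y. bump (y::'a)) * t ^ DIM('a)"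
proof -
 have ae: "AE y in lborel. \<bar>g y * sbump x t y\<bar> \<le> B * sbump x t y"
  using g
 proof eventually_elim
  fix y assume *: "y \<in> ball x t \<longrightarrow> \<bar>g y\<bar> \<le> B"
  show "\<bar>g y * sbump x t y\<bar> \<le> B * sbump x t y"
  proof (cases "y \<in> ball x t")
   case True
   then show ?thesis using * sbump_nonneg[of x t y] by (simp add: abs_mult mult_right_mono)
  next
   case False
   then have "sbump x t y = 0" using t by (intro sbump_zero) auto
   then show ?thesis by simp
  qed
 qed
 have ib: "integrable lborel (\<lambda>y. B * sbump x t y)" using sbump_integrable[OF t, of x] by simp
 show i: "integrable lborel (\<lambda>y. g y * sbump x t y)"
 proof (rule Bochner_Integration.integrable_bound[OF ib])
  show "AE y in lborel. norm (g y * sbump x t y) \<le> norm (B * sbump x t y)"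
   using ae by eventually_elim (simp add: order_trans[OF _ abs_ge_self])
 qed measurable
 have "\<bar>\<integral>y. g y * sbump x t y \<partial>lborel\<bar> \<le> (LBINT y. \<bar>g y * sbump x t y\<bar>)" by (rule integral_abs_bound)
 also have "\<dots> \<le> (LBINT y. B * sbump x t y)" by (rule integral_mono_AE[OF integrable_abs[OF i] ib ae])
 also have "\<dots> = B * (LBINT y. bump (y::'a)) * t ^ DIM('a)" using sbump_integral[OF t, of x] by simp
 finally show "\<bar>\<integral>y. g y * sbump x t y \<partial>lborel\<bar> \<le> B * (LBINT y. bump (y::'a)) * t ^ DIM('a)" .
qed

lemma layer_exponent:
 assumes "0 < t"
 shows "t powr (- (real DIM('a) + 1)) * (t powr (2 * s) * (c * t ^ DIM('a::euclidean_space))) = c * t powr (2 * s - 1)"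
proof -
 have "t powr (- (real DIM('a) + 1)) * (t powr (2 * s) * t powr real DIM('a)) = t powr (2 * s - 1)"
  by (simp only: powr_add[symmetric]) simp
 then show ?thesis using assms by (simp add: powr_realpow mult_ac)
qed

lemma layer_bound:
 fixes g :: "'a::euclidean_space \<Rightarrow> real"
 assumes g: "g \<in> borel_measurable borel" "0 \<le> B" "AE y in lborel. y \<in> ball x t \<longrightarrow> \<bar>g y\<bar> \<le> B"
  and w: "weak_eq \<Omega> u g" "0 < t" "cball x t \<subseteq> \<Omega>"
 shows "\<bar>layer u x t\<bar> \<le> B * (LBINT y. bump (y::'a)) * t powr (2 * s - 1)"
proof -
 have "\<bar>layer u x t\<bar> = t powr (- (real DIM('a) + 1)) * (t powr (2 * s) * \<bar>\<integral>y. g y * sbump x t y \<partial>lborel\<bar>)"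
  unfolding weak_eqD[OF w] by (simp add: abs_mult)
 also have "\<dots> \<le> t powr (- (real DIM('a) + 1)) * (t powr (2 * s) * ((B * (LBINT y. bump (y::'a))) * t ^ DIM('a)))"
  by (intro mult_left_mono integral_mult_sbump_bound(2)[OF g(1) w(2) g(2,3)]) auto
 also have "\<dots> = B * (LBINT y. bump (y::'a)) * t powr (2 * s - 1)" by (rule layer_exponent[OF w(2)])
 finally show ?thesis .
qed

text \<open>A locally bounded right-hand side makes the layers O(t^(2s-1)) locally uniformly, so the
  averages, which are continuous, converge locally uniformly. Testing identifies the limit with
  \<open>mass\<close> times u almost everywhere. The last conclusion fixes the value of w at every
  point of \<Omega>, which a statement up to null sets could not do.\<close>

lemma continuous_representative:
 fixes u g :: "'a::euclidean_space \<Rightarrow> real"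
 assumes u: "square_integrable u" and \<Omega>: "open \<Omega>" and g: "g \<in> borel_measurable borel"
  and loc: "\<And>x. x \<in> \<Omega> \<Longrightarrow> \<exists>r>0. \<exists>B. AE y in lborel. y \<in> ball x r \<longrightarrow> \<bar>g y\<bar> \<le> B"
  and eq: "weak_eq \<Omega> u g"
 obtains w where "continuous_on \<Omega> w" "AE y in lborel. y \<in> \<Omega> \<longrightarrow> w y = u y"
  "\<And>x. x \<in> \<Omega> \<Longrightarrow> ((\<lambda>e. mean u e x) \<longlongrightarrow> mass TYPE('a) * w x) (at_right 0)"
proof -
 have [measurable]: "u \<in> borel_measurable borel" using u by (rule square_integrableD)
 \<comment> \<open>\<open>Lim\<close> is arbitrary where no limit exists, but only points of
   \<Omega> enter below.\<close>
 define W where "W x = Lim (at_right 0) (\<lambda>e. mean u e x)" for x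
 have main: "\<exists>r>0. ball x0 r \<subseteq> \<Omega> \<and> continuous_on (ball x0 r) W \<and> (\<forall>x\<in>ball x0 r. ((\<lambda>e. mean u e x) \<longlongrightarrow> W x) (at_right 0)) \<and>
   (AE y in lborel. y \<in> ball x0 r \<longrightarrow> W y = mass TYPE('a) * u y)" if x0: "x0 \<in> \<Omega>" for x0
 proof -
  obtain r1 where r1: "0 < r1" "ball x0 r1 \<subseteq> \<Omega>" using \<Omega> x0 openE by blast
  obtain r2 B0 where r2: "0 < r2" "AE y in lborel. y \<in> ball x0 r2 \<longrightarrow> \<bar>g y\<bar> \<le> B0" using loc[OF x0] by blast
  define B where "B = max B0 0"
  \<comment> \<open>With centre in the ball of radius r and scale at most r, closed balls stay
    within radius 3 r, where g is bounded and the equation holds.\<close>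
  define r where "r = min r1 r2 / 3"
  have r: "0 < r" "3 * r \<le> r1" "3 * r \<le> r2" using r1 r2 by (auto simp: r_def)
  define C where "C = B * (LBINT y. bump (y::'a))"
  have bd: "\<bar>layer u x t\<bar> \<le> C * t powr (2 * s - 1)" if "x \<in> ball x0 r" "0 < t" "t \<le> r" for x t
   unfolding C_def
  proof (rule layer_bound[OF g _ _ eq that(2)])
   have sub: "cball x t \<subseteq> ball x0 (3 * r)"
   proof
    fix y assume "y \<in> cball x t"
    then show "y \<in> ball x0 (3 * r)" using that dist_triangle[of x0 y x] by simp
   qed
   then show "cball x t \<subseteq> \<Omega>" using r r1 by (meson order_trans subset_ball)
   show "AE y in lborel. y \<in> ball x t \<longrightarrow> \<bar>g y\<bar> \<le> B"
    using r2(2)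
   proof eventually_elim
    fix y assume *: "y \<in> ball x0 r2 \<longrightarrow> \<bar>g y\<bar> \<le> B0"
    show "y \<in> ball x t \<longrightarrow> \<bar>g y\<bar> \<le> B"
    proof
     assume "y \<in> ball x t"
     then have "y \<in> ball x0 r2" using sub r(3) by (meson ball_subset_cball order_trans subset_ball subset_eq)
     then show "\<bar>g y\<bar> \<le> B" using * by (simp add: B_def)
    qed
   qed
  qed (simp add: B_def)
  have ex: "((\<lambda>e. mean u e x) \<longlongrightarrow> W x) (at_right 0) \<and> (\<forall>e. 0 < e \<longrightarrow> e \<le> r \<longrightarrow> \<bar>W x - mean u e x\<bar> \<le> C / (2 * s) * e powr (2 * s))"
   if x: "x \<in> ball x0 r" for x
  proof -
   obtain l where l: "((\<lambda>e. mean u e x) \<longlongrightarrow> l) (at_right 0)"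
    "\<And>e. 0 < e \<Longrightarrow> e \<le> r \<Longrightarrow> integrable lborel (\<lambda>t. layer u x t * indicator {0<..e} t)"
    "\<And>e. 0 < e \<Longrightarrow> e \<le> r \<Longrightarrow> l - mean u e x = (LBINT t. layer u x t * indicator {0<..e} t)"
    "\<And>e. 0 < e \<Longrightarrow> e \<le> r \<Longrightarrow> \<bar>l - mean u e x\<bar> \<le> C / (2 * s) * e powr (2 * s)"
    by (rule mean_tendsto[OF u r(1) bd[OF x]]) (assumption, assumption, rule that)
   have "W x = l" unfolding W_def by (rule tendsto_Lim[OF _ l(1)]) simp
   then show ?thesis using l by blast
  qed
  have pz: "((\<lambda>e. K * (C / (2 * s) * e powr (2 * s))) \<longlongrightarrow> 0) (at_right 0)" for K
   by (intro tendsto_mult_right_zero powr_tendsto_0)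
  have er: "eventually (\<lambda>e. 0 < e \<and> e \<le> r) (at_right 0)"
   unfolding eventually_at_right_field using r by (intro exI[of _ r]) auto
  have cont: "continuous_on (ball x0 r) W"
  proof (rule uniform_limit_theorem)
   show "uniform_limit (ball x0 r) (\<lambda>e x. mean u e x) W (at_right 0)"
    unfolding uniform_limit_iff
   proof (intro allI impI)
    fix \<epsilon> :: real assume \<epsilon>: "0 < \<epsilon>"
    have "eventually (\<lambda>e. 1 * (C / (2 * s) * e powr (2 * s)) < \<epsilon>) (at_right 0)"
     using order_tendstoD(2)[OF pz \<epsilon>] .
    with er show "eventually (\<lambda>e. \<forall>x\<in>ball x0 r. dist (mean u e x) (W x) < \<epsilon>) (at_right 0)"
    proof eventually_elim
     fix e assume a: "0 < e \<and> e \<le> r" and b: "1 * (C / (2 * s) * e powr (2 * s)) < \<epsilon>"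
     show "\<forall>x\<in>ball x0 r. dist (mean u e x) (W x) < \<epsilon>"
     proof
      fix x assume "x \<in> ball x0 r"
      then have "\<bar>W x - mean u e x\<bar> \<le> C / (2 * s) * e powr (2 * s)" using ex a by blast
      then show "dist (mean u e x) (W x) < \<epsilon>" using b by (simp only: dist_real_def abs_minus_commute mult_1)
     qed
    qed
   qed
   show "eventually (\<lambda>e. continuous_on (ball x0 r) (mean u e)) (at_right 0)"
    using er by eventually_elim (use mean_continuous[OF u] in \<open>simp add: continuous_at_imp_continuous_on\<close>)
  qed simp
  define K where "K = (LBINT y. (u y)\<^sup>2) + (LBINT y. (avg r (y::'a))\<^sup>2) + C / (2 * s) * r powr (2 * s)"
  have WK: "\<bar>W x\<bar> \<le> K" if "x \<in> ball x0 r" for x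
  proof -
   have "\<bar>W x - mean u r x\<bar> \<le> C / (2 * s) * r powr (2 * s)" using ex[OF that] r(1) by blast
   then show ?thesis using mean_bounded[OF u r(1), of x] unfolding K_def by linarith
  qed
  \<comment> \<open>Cut off to the ball so that h is measurable and integrable on the whole space;
    nothing is known about W elsewhere.\<close>
  define h where "h x = (W x - mass TYPE('a) * u x) * indicator (ball x0 r) x" for x
  have Wm: "(\<lambda>x. W x * indicator (ball x0 r) x) \<in> borel_measurable borel"
   using borel_measurable_continuous_on_indicator[OF _ cont] by (simp add: mult.commute)
  have hd: "h = (\<lambda>x. W x * indicator (ball x0 r) x - mass TYPE('a) * u x * indicator (ball x0 r) x)"
   by (simp add: h_def fun_eq_iff left_diff_distrib)
  have hm[measurable]: "h \<in> borel_measurable borel" unfolding hd using Wm by measurable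
  have Wi: "integrable lborel (\<lambda>x. W x * indicator (ball x0 r) x)"
  proof (rule Bochner_Integration.integrable_bound)
   show "integrable lborel (\<lambda>x. K * indicator (ball x0 r) x)"
    by (intro integrable_mult_right integrable_real_indicator[OF _ emeasure_lborel_ball_finite]) simp
   show "AE x in lborel. norm (W x * indicator (ball x0 r) x) \<le> norm (K * indicator (ball x0 r) x)"
   proof (intro AE_I2)
    fix x
    show "norm (W x * indicator (ball x0 r) x) \<le> norm (K * indicator (ball x0 r) x)"
     using WK[of x] by (cases "x \<in> ball x0 r") auto
   qed
  qed (use Wm in simp)
  have hi: "integrable lborel h"
   unfolding hd using Wi square_integrable_imp_loc[OF u, of x0 r] by (simp add: mult.assoc)
  have hloc: "integrable lborel (\<lambda>x. h x * indicator (ball 0 R) x)" for R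
   by (rule Bochner_Integration.integrable_bound[OF hi]) (measurable, auto simp: indicator_def)
  have test: "(LBINT x. h x * g x) = 0"
   if g: "L-lipschitz_on UNIV g" "\<And>x. 0 \<le> g x" "\<And>x. g x \<le> 1" "\<And>x. g x \<noteq> 0 \<Longrightarrow> x \<in> ball x0 r \<and> norm x < R" for g L R
  proof -
   have g1: "\<bar>g x\<bar> \<le> 1" for x using g(2,3)[of x] by simp
   have g2: "g x \<noteq> 0 \<Longrightarrow> norm x < R" for x using g(4)[of x] by simp
   note tf = test_function_integrable[OF g(1) g1 g2]
   have [measurable]: "g \<in> borel_measurable borel" using tf(1) by (rule square_integrableD)
   have Wg: "integrable lborel (\<lambda>x. W x * g x)"
   proof -
    have "(\<lambda>x. W x * g x) = (\<lambda>x. W x * indicator (ball x0 r) x * g x)"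
     using g(4) by (auto simp: fun_eq_iff indicator_def)
    moreover have "integrable lborel (\<lambda>x. W x * indicator (ball x0 r) x * g x)"
     by (rule Bochner_Integration.integrable_bound[OF Wi])
      (use Wm g1 in \<open>auto simp: abs_mult intro!: mult_left_le\<close>)
    ultimately show ?thesis by simp
   qed
   have lim1: "((\<lambda>e. \<integral>x. mean u e x * g x \<partial>lborel) \<longlongrightarrow> mass TYPE('a) * (LBINT x. u x * g x)) (at_right 0)"
    by (rule tendsto_mean_test[OF u tf(3) g1 g2])
   have lim2: "((\<lambda>e. \<integral>x. mean u e x * g x \<partial>lborel) \<longlongrightarrow> (LBINT x. W x * g x)) (at_right 0)"
   proof (rule LIM_zero_cancel, rule Lim_null_comparison[OF _ pz[of "\<integral>x. g x \<partial>lborel"]])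
    show "eventually (\<lambda>e. norm ((LBINT x. mean u e x * g x) - (LBINT x. W x * g x))
      \<le> (LBINT x. g x) * (C / (2 * s) * e powr (2 * s))) (at_right 0)"
     using er
    proof eventually_elim
     fix e assume e: "0 < e \<and> e \<le> r"
     have cm: "continuous_on UNIV (mean u e)" using mean_continuous[OF u] e by (simp add: continuous_at_imp_continuous_on)
     have [measurable]: "mean u e \<in> borel_measurable borel" using cm by (rule borel_measurable_continuous_onI)
     have d: "\<bar>mean u e x * g x - W x * g x\<bar> \<le> g x * (C / (2 * s) * e powr (2 * s))" for x
     proof (cases "g x = 0")
      case False
      then have "\<bar>W x - mean u e x\<bar> \<le> C / (2 * s) * e powr (2 * s)" using g(4) ex e by blast
      then have "g x * \<bar>W x - mean u e x\<bar> \<le> g x * (C / (2 * s) * e powr (2 * s))" by (intro mult_left_mono g(2))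
      moreover have "\<bar>mean u e x * g x - W x * g x\<bar> = g x * \<bar>W x - mean u e x\<bar>"
      proof -
       have "mean u e x * g x - W x * g x = - (g x * (W x - mean u e x))" by (simp add: algebra_simps)
       then show ?thesis by (simp only: abs_minus_cancel abs_mult abs_of_nonneg[OF g(2)])
      qed
      ultimately show ?thesis by simp
     qed simp
     have ig: "integrable lborel (\<lambda>x. g x * (C / (2 * s) * e powr (2 * s)))" using tf(2) by simp
     have id: "integrable lborel (\<lambda>x. mean u e x * g x - W x * g x)"
      by (rule Bochner_Integration.integrable_bound[OF ig])
       (use Wg in simp, intro AE_I2, simp only: real_norm_def order_trans[OF d abs_ge_self])
     have im: "integrable lborel (\<lambda>x. mean u e x * g x)"
      using Bochner_Integration.integrable_add[OF id Wg] by simp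
     have "(LBINT x. mean u e x * g x) - (LBINT x. W x * g x) = (LBINT x. mean u e x * g x - W x * g x)"
      using im Wg by simp
     also have "\<bar>\<dots>\<bar> \<le> (LBINT x. \<bar>mean u e x * g x - W x * g x\<bar>)" by (rule integral_abs_bound)
     also have "\<dots> \<le> (LBINT x. g x * (C / (2 * s) * e powr (2 * s)))"
      by (rule integral_mono[OF integrable_abs[OF id] ig d])
     also have "\<dots> = (LBINT x. g x) * (C / (2 * s) * e powr (2 * s))" by simp
     finally show "norm ((LBINT x. mean u e x * g x) - (LBINT x. W x * g x))
      \<le> (LBINT x. g x) * (C / (2 * s) * e powr (2 * s))" by simp
    qed
   qed
   have "mass TYPE('a) * (LBINT x. u x * g x) = (LBINT x. W x * g x)"
    by (rule tendsto_unique[OF _ lim1 lim2]) simp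
   moreover have "(LBINT x. h x * g x) = (LBINT x. W x * g x - mass TYPE('a) * (u x * g x))"
   proof (rule Bochner_Integration.integral_cong[OF refl])
    fix x show "h x * g x = W x * g x - mass TYPE('a) * (u x * g x)"
     using g(4)[of x] by (cases "g x = 0") (auto simp: h_def left_diff_distrib)
   qed
   ultimately show ?thesis using Wg integrable_square_integrable_mult[OF u tf(1)] by simp
  qed
  have "AE x in lborel. x \<in> ball x0 r \<longrightarrow> h x \<le> 0"
  proof (rule AE_nonpos_of_lipschitz_test[OF open_ball hm hloc])
   fix g :: "'a \<Rightarrow> real" and L R
   assume "L-lipschitz_on UNIV g" "\<And>x. 0 \<le> g x" "\<And>x. g x \<le> 1" "\<And>x. g x \<noteq> 0 \<Longrightarrow> x \<in> ball x0 r \<and> norm x < R"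
   from test[OF this] show "(LBINT x. h x * g x) \<le> 0" by simp
  qed
  moreover have "AE x in lborel. x \<in> ball x0 r \<longrightarrow> - h x \<le> 0"
  proof (rule AE_nonpos_of_lipschitz_test[OF open_ball])
   show "(\<lambda>x. - h x) \<in> borel_measurable borel" by measurable
   show "integrable lborel (\<lambda>x. - h x * indicator (ball 0 R) x)" for R using hloc[of R] by simp
   fix g :: "'a \<Rightarrow> real" and L R
   assume "L-lipschitz_on UNIV g" "\<And>x. 0 \<le> g x" "\<And>x. g x \<le> 1" "\<And>x. g x \<noteq> 0 \<Longrightarrow> x \<in> ball x0 r \<and> norm x < R"
   from test[OF this] show "(LBINT x. - h x * g x) \<le> 0" by simp
  qed
  ultimately have "AE x in lborel. x \<in> ball x0 r \<longrightarrow> W x = mass TYPE('a) * u x"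
   by eventually_elim (auto simp: h_def)
  moreover have "ball x0 r \<subseteq> \<Omega>" using r r1 subset_ball[of r r1 x0] by auto
  ultimately show ?thesis using r(1) cont ex by (intro exI[of _ r]) auto
 qed
 have mp: "mass TYPE('a) \<noteq> 0" using mass_pos[where 'a='a] by simp
 show ?thesis
 proof (rule that[of "\<lambda>x. W x / mass TYPE('a)"])
  have "continuous_on \<Omega> W"
   unfolding continuous_on_eq_continuous_at[OF \<Omega>]
  proof
   fix x assume "x \<in> \<Omega>"
   then obtain r where "0 < r" "continuous_on (ball x r) W" using main by blast
   then show "isCont W x" by (simp add: continuous_on_eq_continuous_at)
  qed
  then show "continuous_on \<Omega> (\<lambda>x. W x / mass TYPE('a))" by (intro continuous_intros) (use mp in auto)
  show "AE y in lborel. y \<in> \<Omega> \<longrightarrow> W y / mass TYPE('a) = u y"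
  proof (rule AE_ball_cover[OF \<Omega>])
   fix x assume "x \<in> \<Omega>"
   then obtain r where r: "0 < r" "AE y in lborel. y \<in> ball x r \<longrightarrow> W y = mass TYPE('a) * u y" using main by blast
   from r(2) have "AE y in lborel. y \<in> ball x r \<longrightarrow> W y / mass TYPE('a) = u y"
    by eventually_elim (use mp in auto)
   with r(1) show "\<exists>r>0. AE y in lborel. y \<in> ball x r \<longrightarrow> W y / mass TYPE('a) = u y" by blast
  qed
  fix x assume "x \<in> \<Omega>"
  then obtain r where "0 < r" "\<forall>x\<in>ball x r. ((\<lambda>e. mean u e x) \<longlongrightarrow> W x) (at_right 0)" using main by blast
  then show "((\<lambda>e. mean u e x) \<longlongrightarrow> mass TYPE('a) * (W x / mass TYPE('a))) (at_right 0)" using mp by simp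
 qed
qed

end

subsection \<open>The principal value\<close>

context frac
begin

text \<open>The indicator of |y| \<ge> 1 imitates the truncation in the principal value. The global
  bound is used close to x, after rescaling; the second form, a pure power, gives a factor e away
  from x.\<close>

lemma avg_remainder_bound:
 obtains C where "0 < C" "\<And>y :: 'a::euclidean_space.
  \<bar>avg 1 y - (LBINT z. bump (z::'a)) / s * kern y * indicator {1..} (norm y)\<bar> \<le> C * decay (real DIM('a) + 2 * s + 1) y"
  "\<And>y :: 'a. 1 \<le> norm y \<Longrightarrow>
  \<bar>avg 1 y - (LBINT z. bump (z::'a)) / s * kern y * indicator {1..} (norm y)\<bar> \<le> C * norm y powr (- (real DIM('a) + 2 * s + 1))"
proof -
 let ?p = "real DIM('a) + 2 * s" and ?\<Phi> = "\<integral>z. bump (z::'a) \<partial>lborel"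
 obtain C where C: "0 < C" "\<And>y :: 'a. 1 \<le> norm y \<Longrightarrow> \<bar>avg 1 y - ?\<Phi> / s * kern y\<bar> \<le> C * norm y powr (- ?p - 1)"
  by (rule avg_far[where 'a='a]) (rule that)
 obtain B where B: "0 < B" "\<And>y :: 'a. \<bar>avg 1 y\<bar> \<le> B * wt y" using avg_bound[where 'a='a] by blast
 have e: "- ?p - 1 = - (?p + 1)" by simp
 have far: "\<bar>avg 1 y - ?\<Phi> / s * kern y * indicator {1..} (norm y)\<bar> \<le> C * norm y powr (- (?p + 1))" if "1 \<le> norm y" for y :: 'a
  using C(2)[OF that] that unfolding e by simp
 define D where "D = (B + C) * 2 powr (?p + 1)"
 have p1: "0 \<le> ?p + 1" using exponent_pos[where 'a='a] by simp
 have D: "0 < D" using B C by (simp add: D_def)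
 have two: "1 \<le> (2::real) powr (?p + 1)" using p1 by (intro ge_one_powr_ge_zero) auto
 show ?thesis
 proof (rule that)
  show "0 < D + C" using C D by simp
  show "\<bar>avg 1 y - ?\<Phi> / s * kern y * indicator {1..} (norm y)\<bar> \<le> (D + C) * norm y powr (- (?p + 1))" if "1 \<le> norm y" for y :: 'a
   by (rule order_trans[OF far[OF that]]) (use D in \<open>intro mult_right_mono, auto\<close>)
  fix y :: 'a
  have y0: "0 < 1 + norm y" using norm_ge_zero[of y] by linarith
  show "\<bar>avg 1 y - ?\<Phi> / s * kern y * indicator {1..} (norm y)\<bar> \<le> (D + C) * decay (?p + 1) y"
  proof (cases "1 \<le> norm y")
   case True
   have "norm y powr (- (?p + 1)) = ((1 + norm y) / ((1 + norm y) / norm y)) powr (- (?p + 1))" using y0 True by simp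
   also have "\<dots> = (1 + norm y) powr (- (?p + 1)) * ((1 + norm y) / norm y) powr (?p + 1)"
   proof (rule powr_divide_minus)
    show "0 < (1 + norm y) / norm y" using y0 True by (intro divide_pos_pos) auto
   qed (use y0 in simp)
   also have "\<dots> \<le> (1 + norm y) powr (- (?p + 1)) * 2 powr (?p + 1)"
   proof (intro mult_left_mono powr_mono2)
    show "(1 + norm y) / norm y \<le> 2" using True by (subst pos_divide_le_eq) auto
    show "0 \<le> (1 + norm y) / norm y" using y0 by simp
   qed (use p1 in auto)
   finally have "C * norm y powr (- (?p + 1)) \<le> C * ((1 + norm y) powr (- (?p + 1)) * 2 powr (?p + 1))"
    using C by (intro mult_left_mono) auto
   also have "\<dots> = (C * 2 powr (?p + 1)) * decay (?p + 1) y" by (simp add: decay_def)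
   also have "\<dots> \<le> (D + C) * decay (?p + 1) y"
   proof (rule mult_right_mono)
    have "0 \<le> B * 2 powr (?p + 1)" using B by simp
    then show "C * 2 powr (?p + 1) \<le> D + C" using C unfolding D_def distrib_right by linarith
   qed (rule less_imp_le[OF decay_pos])
   finally show ?thesis using far[OF True] by linarith
  next
   case False
   have "B * wt y \<le> B * 1" by (intro mult_left_mono wt_le_1) (use B(1) in simp)
   then have "\<bar>avg 1 y\<bar> \<le> B" using B(2)[of y] by simp
   also have "B \<le> D * decay (?p + 1) y"
   proof -
    have "2 powr (- (?p + 1)) \<le> decay (?p + 1) y"
     unfolding decay_def using False y0 p1 by (intro powr_mono2') auto
    then have "D * 2 powr (- (?p + 1)) \<le> D * decay (?p + 1) y" using D by (intro mult_left_mono) auto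
    moreover have "D * 2 powr (- (?p + 1)) = B + C"
     unfolding D_def mult.assoc powr_add[symmetric] by simp
    ultimately show ?thesis using C by linarith
   qed
   also have "\<dots> \<le> (D + C) * decay (?p + 1) y"
    using C decay_pos[of "?p + 1" y] by (simp add: distrib_right)
   finally show ?thesis using False by simp
  qed
 qed
qed

text \<open>The extra power of decay in the remainder is what makes |y|^(2s) integrable against it;
  against K itself this fails logarithmically.\<close>

lemma integrable_powr_mult_decay:
 "integrable lborel (\<lambda>y::'a::euclidean_space. norm y powr (2 * s) * decay (real DIM('a) + 2 * s + 1) y)"
proof (rule Bochner_Integration.integrable_bound)
 show "integrable lborel (decay (real DIM('a) + 1) :: 'a \<Rightarrow> real)" by (rule integrable_decay) simp
 show "AE y::'a in lborel. norm (norm y powr (2 * s) * decay (real DIM('a) + 2 * s + 1) y) \<le> norm (decay (real DIM('a) + 1) y)"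
 proof (intro AE_I2)
  fix y :: 'a
  have y0: "0 < 1 + norm y" using norm_ge_zero[of y] by linarith
  have "norm y powr (2 * s) * decay (real DIM('a) + 2 * s + 1) y \<le> (1 + norm y) powr (2 * s) * decay (real DIM('a) + 2 * s + 1) y"
   using s0 by (intro mult_right_mono powr_mono2 less_imp_le[OF decay_pos]) auto
  also have "\<dots> = decay (real DIM('a) + 1) y"
   unfolding decay_def powr_add[symmetric] by simp
  finally show "norm (norm y powr (2 * s) * decay (real DIM('a) + 2 * s + 1) y) \<le> norm (decay (real DIM('a) + 1) y)"
   using decay_pos[of _ y] by (simp add: abs_mult abs_of_pos)
 qed
qed measurable

text \<open>The subtraction of \<open>c\<close> is free because second differences integrate to zero.\<close>

lemma integral_mult_sdiff_sbump:
 fixes g :: "'a::euclidean_space \<Rightarrow> real"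
 assumes i: "integrable lborel (\<lambda>y. g y * sbump x t y)" "integrable lborel (\<lambda>y. g y * sbump (x + h) t y)"
   "integrable lborel (\<lambda>y. g y * sbump (x - h) t y)" and t: "0 < t"
 shows "2 * (LBINT y. g y * sbump x t y) - (LBINT y. g y * sbump (x + h) t y) - (LBINT y. g y * sbump (x - h) t y)
  = (LBINT y. (g y - c) * (2 * sbump x t y - sbump (x + h) t y - sbump (x - h) t y))"
  and "integrable lborel (\<lambda>y. (g y - c) * (2 * sbump x t y - sbump (x + h) t y - sbump (x - h) t y))"
proof -
 note b = sbump_integrable[OF t, of x] sbump_integrable[OF t, of "x + h"] sbump_integrable[OF t, of "x - h"]
 have e: "(g y - c) * (2 * sbump x t y - sbump (x + h) t y - sbump (x - h) t y)
  = (2 * (g y * sbump x t y) - g y * sbump (x + h) t y - g y * sbump (x - h) t y)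
   - c * (2 * sbump x t y - sbump (x + h) t y - sbump (x - h) t y)" for y
  by (simp add: algebra_simps)
 show "integrable lborel (\<lambda>y. (g y - c) * (2 * sbump x t y - sbump (x + h) t y - sbump (x - h) t y))"
  unfolding e using i b by simp
 show "2 * (LBINT y. g y * sbump x t y) - (LBINT y. g y * sbump (x + h) t y) - (LBINT y. g y * sbump (x - h) t y)
  = (LBINT y. (g y - c) * (2 * sbump x t y - sbump (x + h) t y - sbump (x - h) t y))"
  unfolding e using i b by (simp add: sbump_integral[OF t])
qed

lemma sdiff_sbump_center_bound:
 fixes x h y :: "'a::euclidean_space"
 assumes t: "0 < t"
 shows "\<bar>2 * sbump x t y - sbump (x + h) t y - sbump (x - h) t y\<bar> \<le> min 4 (264 * (norm h / t)\<^sup>2)"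
proof -
 have e: "2 * sbump x t y - sbump (x + h) t y - sbump (x - h) t y = sdiff bump (h /\<^sub>R t) ((y - x) /\<^sub>R t)"
  by (simp add: sbump_def sdiff_def algebra_simps)
 have "norm (h /\<^sub>R t) = norm h / t" using t by (simp add: divide_inverse mult.commute)
 then have "\<bar>2 * sbump x t y - sbump (x + h) t y - sbump (x - h) t y\<bar> \<le> 264 * (norm h / t)\<^sup>2"
  unfolding e using sdiff_bump_bound[of "h /\<^sub>R t" "(y - x) /\<^sub>R t"] by simp
 moreover have "\<bar>2 * sbump x t y - sbump (x + h) t y - sbump (x - h) t y\<bar> \<le> 4"
  using sbump_nonneg[of x t y] sbump_le_1[of x t y] sbump_nonneg[of "x + h" t y] sbump_le_1[of "x + h" t y]
   sbump_nonneg[of "x - h" t y] sbump_le_1[of "x - h" t y] by linarith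
 ultimately show ?thesis by simp
qed

end

text \<open>Here w is the continuous version of a solution of \<open>flap w\<close> = g with
  continuous g. The assumption \<open>mean_lim\<close> ties the values of w at individual points to
  its averages.\<close>

locale pointwise_solution = frac s for s +
 fixes \<Omega> :: "'a::euclidean_space set" and w g :: "'a \<Rightarrow> real"
 assumes open_\<Omega>: "open \<Omega>" and w: "square_integrable w" and w_cont: "continuous_on \<Omega> w"
  and g_meas: "g \<in> borel_measurable borel" and g_cont: "continuous_on \<Omega> g"
  and eq: "weak_eq \<Omega> w g"
  and mean_lim: "\<And>x. x \<in> \<Omega> \<Longrightarrow> ((\<lambda>e. mean w e x) \<longlongrightarrow> mass TYPE('a) * w x) (at_right 0)"
begin

lemma w_meas [measurable]: "w \<in> borel_measurable borel"
 using w by (rule square_integrableD)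

lemma g_near:
 assumes x: "x \<in> \<Omega>" and \<epsilon>: "0 < \<epsilon>"
 obtains \<delta> where "0 < \<delta>" "ball x \<delta> \<subseteq> \<Omega>" "\<And>y. y \<in> ball x \<delta> \<Longrightarrow> \<bar>g y - g x\<bar> \<le> \<epsilon>"
proof -
 have "isCont g x" using g_cont x open_\<Omega> by (simp add: continuous_on_eq_continuous_at)
 then obtain d where d: "0 < d" "\<And>y. dist y x < d \<Longrightarrow> dist (g y) (g x) < \<epsilon>"
  using \<epsilon> unfolding continuous_at_eps_delta dist_norm by blast
 obtain r where r: "0 < r" "ball x r \<subseteq> \<Omega>" using open_\<Omega> x openE by blast
 show ?thesis
  by (rule that[of "min d r"]) (use d r in \<open>auto simp: dist_commute dist_real_def less_imp_le\<close>)
qed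

lemma layer_near:
 assumes x: "x \<in> \<Omega>"
 obtains \<delta> C where "0 < \<delta>" "0 \<le> C" "ball x (3 * \<delta>) \<subseteq> \<Omega>"
  "\<And>z t. z \<in> ball x \<delta> \<Longrightarrow> 0 < t \<Longrightarrow> t \<le> \<delta> \<Longrightarrow> \<bar>layer w z t\<bar> \<le> C * t powr (2 * s - 1)"
  "\<And>z t. z \<in> ball x \<delta> \<Longrightarrow> 0 < t \<Longrightarrow> t \<le> \<delta> \<Longrightarrow> integrable lborel (\<lambda>y. g y * sbump z t y)"
proof -
 obtain d where d: "0 < d" "ball x d \<subseteq> \<Omega>" "\<And>y. y \<in> ball x d \<Longrightarrow> \<bar>g y - g x\<bar> \<le> 1"
  using g_near[OF x zero_less_one] by blast
 define \<delta> where "\<delta> = d / 3"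
 have \<delta>: "0 < \<delta>" "3 * \<delta> = d" using d by (auto simp: \<delta>_def)
 have sub: "cball z t \<subseteq> ball x d" if "z \<in> ball x \<delta>" "t \<le> \<delta>" for z t
 proof
  fix y assume "y \<in> cball z t"
  then show "y \<in> ball x d" using that \<delta> dist_triangle[of x y z] by simp
 qed
 have gb: "AE y in lborel. y \<in> ball z t \<longrightarrow> \<bar>g y\<bar> \<le> \<bar>g x\<bar> + 1" if z: "z \<in> ball x \<delta>" "t \<le> \<delta>" for z t
 proof (intro AE_I2 impI)
  fix y assume "y \<in> ball z t"
  then have "y \<in> ball x d" using sub[OF z] ball_subset_cball by blast
  from d(3)[OF this] show "\<bar>g y\<bar> \<le> \<bar>g x\<bar> + 1" by linarith
 qed
 show ?thesis
 proof (rule that[of \<delta> "(\<bar>g x\<bar> + 1) * (LBINT y. bump (y::'a))"])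
  show "0 \<le> (\<bar>g x\<bar> + 1) * (LBINT y. bump (y::'a))" using bump_mass_nonneg[where 'a='a] by simp
  show "ball x (3 * \<delta>) \<subseteq> \<Omega>" using d \<delta> by simp
  fix z t assume z: "z \<in> ball x \<delta>" "0 < t" "t \<le> \<delta>"
  show "\<bar>layer w z t\<bar> \<le> (\<bar>g x\<bar> + 1) * (LBINT y. bump (y::'a)) * t powr (2 * s - 1)"
   by (rule layer_bound[OF g_meas _ gb[OF z(1,3)] eq z(2)]) (use sub[OF z(1,3)] d(2) in auto)
  show "integrable lborel (\<lambda>y. g y * sbump z t y)"
   by (rule integral_mult_sbump_bound(1)[OF g_meas z(2) _ gb[OF z(1,3)]]) simp
 qed (use \<delta> in auto)
qed

text \<open>One radius \<delta> for all z near x, because second differences involve x, x + h and x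
  - h simultaneously.\<close>

lemma mean_formula:
 assumes x: "x \<in> \<Omega>"
 obtains \<delta> where "0 < \<delta>" "ball x (3 * \<delta>) \<subseteq> \<Omega>"
  "\<And>z t. z \<in> ball x \<delta> \<Longrightarrow> 0 < t \<Longrightarrow> t \<le> \<delta> \<Longrightarrow> integrable lborel (\<lambda>y. g y * sbump z t y)"
  "\<And>z e. z \<in> ball x \<delta> \<Longrightarrow> 0 < e \<Longrightarrow> e \<le> \<delta> \<Longrightarrow> integrable lborel (\<lambda>t. layer w z t * indicator {0<..e} t)"
  "\<And>z e. z \<in> ball x \<delta> \<Longrightarrow> 0 < e \<Longrightarrow> e \<le> \<delta> \<Longrightarrow>
   mass TYPE('a) * w z - mean w e z = (LBINT t. layer w z t * indicator {0<..e} t)"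
proof -
 obtain \<delta> C where \<delta>: "0 < \<delta>" "0 \<le> C" "ball x (3 * \<delta>) \<subseteq> \<Omega>"
  "\<And>z t. z \<in> ball x \<delta> \<Longrightarrow> 0 < t \<Longrightarrow> t \<le> \<delta> \<Longrightarrow> \<bar>layer w z t\<bar> \<le> C * t powr (2 * s - 1)"
  "\<And>z t. z \<in> ball x \<delta> \<Longrightarrow> 0 < t \<Longrightarrow> t \<le> \<delta> \<Longrightarrow> integrable lborel (\<lambda>y. g y * sbump z t y)"
  by (rule layer_near[OF x]) (rule that)
 have *: "integrable lborel (\<lambda>t. layer w z t * indicator {0<..e} t) \<and>
   mass TYPE('a) * w z - mean w e z = (LBINT t. layer w z t * indicator {0<..e} t)"
  if z: "z \<in> ball x \<delta>" and e: "0 < e" "e \<le> \<delta>" for z e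
 proof -
  obtain l where l: "((\<lambda>e. mean w e z) \<longlongrightarrow> l) (at_right 0)"
   "\<And>e. 0 < e \<Longrightarrow> e \<le> \<delta> \<Longrightarrow> integrable lborel (\<lambda>t. layer w z t * indicator {0<..e} t)"
   "\<And>e. 0 < e \<Longrightarrow> e \<le> \<delta> \<Longrightarrow> l - mean w e z = (LBINT t. layer w z t * indicator {0<..e} t)"
   "\<And>e. 0 < e \<Longrightarrow> e \<le> \<delta> \<Longrightarrow> \<bar>l - mean w e z\<bar> \<le> C / (2 * s) * e powr (2 * s)"
   by (rule mean_tendsto[OF w \<delta>(1) \<delta>(4)[OF z]]) (assumption, assumption, rule that)
  have "z \<in> ball x (3 * \<delta>)" using z \<delta>(1) by simp
  then have "z \<in> \<Omega>" using \<delta>(3) by blast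
  then have "l = mass TYPE('a) * w z" using tendsto_unique[OF _ l(1) mean_lim] by simp
  then show ?thesis using l(2,3)[OF e] by simp
 qed
 show ?thesis using that[OF \<delta>(1,3,5)] * by blast
qed

text \<open>Replacing g by its value at x turns the layer into \<Phi> g(x) t^(2s-1), with \<Phi> the
  integral of the bump, whose integral up to e is \<Phi> g(x) e^(2s) / (2s). Continuity of g makes
  the error o (e^(2s)).\<close>

lemma mean_quotient:
 assumes x: "x \<in> \<Omega>"
 shows "((\<lambda>e. e powr (- 2 * s) * (mass TYPE('a) * w x - mean w e x)) \<longlongrightarrow> (LBINT y. bump (y::'a)) * g x / (2 * s)) (at_right 0)"
proof (rule tendstoI)
 fix \<epsilon> :: real assume \<epsilon>: "0 < \<epsilon>"
 obtain \<delta> where \<delta>: "0 < \<delta>" "ball x (3 * \<delta>) \<subseteq> \<Omega>"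
  "\<And>z t. z \<in> ball x \<delta> \<Longrightarrow> 0 < t \<Longrightarrow> t \<le> \<delta> \<Longrightarrow> integrable lborel (\<lambda>y. g y * sbump z t y)"
  "\<And>z e. z \<in> ball x \<delta> \<Longrightarrow> 0 < e \<Longrightarrow> e \<le> \<delta> \<Longrightarrow> integrable lborel (\<lambda>t. layer w z t * indicator {0<..e} t)"
  "\<And>z e. z \<in> ball x \<delta> \<Longrightarrow> 0 < e \<Longrightarrow> e \<le> \<delta> \<Longrightarrow>
   mass TYPE('a) * w z - mean w e z = (LBINT t. layer w z t * indicator {0<..e} t)"
  by (rule mean_formula[OF x]) (rule that)
 \<comment> \<open>Chosen so that the final error \<eta> \<Phi> / (2s) is at most \<epsilon> / 2;
   the added 1 prevents a division by zero.\<close>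
 define \<eta> where "\<eta> = \<epsilon> * s / ((LBINT y. bump (y::'a)) + 1)"
 have \<Phi>: "0 \<le> (LBINT y. bump (y::'a))" by (rule bump_mass_nonneg)
 have \<eta>: "0 < \<eta>" using \<epsilon> s0 \<Phi> by (simp add: \<eta>_def)
 obtain d where d: "0 < d" "ball x d \<subseteq> \<Omega>" "\<And>y. y \<in> ball x d \<Longrightarrow> \<bar>g y - g x\<bar> \<le> \<eta>"
  using g_near[OF x \<eta>] by blast
 define r where "r = min d \<delta> / 2"
 have r: "0 < r" "r < d" "r \<le> \<delta>" using d \<delta> by (auto simp: r_def min_def)
 have bd: "\<bar>e powr (- 2 * s) * (mass TYPE('a) * w x - mean w e x) - (LBINT y. bump (y::'a)) * g x / (2 * s)\<bar> < \<epsilon>" if e: "0 < e" "e < r" for e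
 proof -
  have hI: "integrable lborel (\<lambda>t::real. t powr (2 * s - 1) * indicator {0<..e} t)"
   "(LBINT t. t powr (2 * s - 1) * indicator {0<..e} t) = e powr (2 * s) / (2 * s)"
   using integrable_powr_head[of "2 * s - 1" e] s0 e by simp_all
  have xx: "x \<in> ball x \<delta>" using \<delta> by simp
  have lI: "integrable lborel (\<lambda>t. layer w x t * indicator {0<..e} t)" using \<delta>(4)[OF xx] e r by simp
  have pt: "\<bar>layer w x t * indicator {0<..e} t - (LBINT y. bump (y::'a)) * g x * (t powr (2 * s - 1) * indicator {0<..e} t)\<bar>
    \<le> \<eta> * (LBINT y. bump (y::'a)) * (t powr (2 * s - 1) * indicator {0<..e} t)" for t
  proof (cases "0 < t \<and> t \<le> e")
   case True
   have t: "0 < t" "t < d" "t \<le> \<delta>" using True e r by auto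
   have cb: "cball x t \<subseteq> \<Omega>" using d(2) t by (force simp: subset_iff)
   have "AE y in lborel. y \<in> ball x t \<longrightarrow> \<bar>g y - g x\<bar> \<le> \<eta>" using d(3) t by (intro AE_I2) auto
   then have b: "\<bar>\<integral>y. (g y - g x) * sbump x t y \<partial>lborel\<bar> \<le> \<eta> * (LBINT y. bump (y::'a)) * t ^ DIM('a)"
    using \<eta> g_meas t by (intro integral_mult_sbump_bound(2)) auto
   have i: "integrable lborel (\<lambda>y. g y * sbump x t y)" by (rule \<delta>(3)[OF xx t(1,3)])
   have Jeq: "(LBINT y. (g y - g x) * sbump x t y) = (LBINT y. g y * sbump x t y) - g x * (t ^ DIM('a) * (LBINT y. bump (y::'a)))"
    using i sbump_integrable[OF t(1), of x] sbump_integral[OF t(1), of x] by (simp add: left_diff_distrib)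
   have "layer w x t - (LBINT y. bump (y::'a)) * g x * t powr (2 * s - 1)
    = t powr (- (real DIM('a) + 1)) * (t powr (2 * s) * (LBINT y. (g y - g x) * sbump x t y))"
    unfolding weak_eqD[OF eq t(1) cb] layer_exponent[OF t(1), of "(LBINT y. bump (y::'a)) * g x", where 'a='a, symmetric] Jeq
    by (simp only: right_diff_distrib mult_ac)
   then have "\<bar>layer w x t - (LBINT y. bump (y::'a)) * g x * t powr (2 * s - 1)\<bar>
    = t powr (- (real DIM('a) + 1)) * (t powr (2 * s) * \<bar>\<integral>y. (g y - g x) * sbump x t y \<partial>lborel\<bar>)"
    by (simp add: abs_mult)
   also have "\<dots> \<le> t powr (- (real DIM('a) + 1)) * (t powr (2 * s) * ((\<eta> * (LBINT y. bump (y::'a))) * t ^ DIM('a)))"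
    by (intro mult_left_mono b) auto
   also have "\<dots> = \<eta> * (LBINT y. bump (y::'a)) * t powr (2 * s - 1)" by (rule layer_exponent[OF t(1)])
   finally show ?thesis using True by simp
  next
   case False
   then have "indicator {0<..e} t = (0::real)" by auto
   then show ?thesis by simp
  qed
  define M where "M = (LBINT y. bump (y::'a))"
  define F where "F t = layer w x t * indicator {0<..e} t" for t
  define G where "G t = t powr (2 * s - 1) * indicator {0<..e} t" for t :: real
  have FI: "integrable lborel F" "(LBINT t. F t) = mass TYPE('a) * w x - mean w e x"
   using \<delta>(5)[OF xx, of e] e r lI by (simp_all add: F_def[abs_def])
  have GI: "integrable lborel G" "(LBINT t. G t) = e powr (2 * s) / (2 * s)"
   using hI by (simp_all add: G_def[abs_def])
  have fI: "integrable lborel (\<lambda>t. F t - M * g x * G t)" using FI GI by simp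
  have "mass TYPE('a) * w x - mean w e x - M * g x * (e powr (2 * s) / (2 * s)) = (LBINT t. F t - M * g x * G t)"
   using FI GI by simp
  also have "\<bar>\<dots>\<bar> \<le> (LBINT t. \<bar>F t - M * g x * G t\<bar>)" by (rule integral_abs_bound)
  also have "\<dots> \<le> (LBINT t. \<eta> * M * G t)"
  proof (rule integral_mono)
   show "\<bar>F t - M * g x * G t\<bar> \<le> \<eta> * M * G t" for t unfolding F_def G_def M_def by (rule pt)
  qed (use fI GI in simp_all)
  also have "\<dots> = \<eta> * M * (e powr (2 * s) / (2 * s))" using GI by simp
  finally have main: "\<bar>mass TYPE('a) * w x - mean w e x - (LBINT y. bump (y::'a)) * g x * (e powr (2 * s) / (2 * s))\<bar> \<le> \<eta> * (LBINT y. bump (y::'a)) * (e powr (2 * s) / (2 * s))"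
   unfolding M_def .
  have ee: "e powr (- 2 * s) * e powr (2 * s) = 1" using e by (simp add: powr_add[symmetric])
  have "e powr (- 2 * s) * (mass TYPE('a) * w x - mean w e x) - (LBINT y. bump (y::'a)) * g x / (2 * s)
   = e powr (- 2 * s) * (mass TYPE('a) * w x - mean w e x - (LBINT y. bump (y::'a)) * g x * (e powr (2 * s) / (2 * s)))"
  proof -
   have "e powr (- 2 * s) * ((LBINT y. bump (y::'a)) * g x * (e powr (2 * s) / (2 * s))) = (e powr (- 2 * s) * e powr (2 * s)) * ((LBINT y. bump (y::'a)) * g x / (2 * s))" by simp
   then show ?thesis unfolding ee by (simp only: right_diff_distrib mult_1)
  qed
  then have "\<bar>e powr (- 2 * s) * (mass TYPE('a) * w x - mean w e x) - (LBINT y. bump (y::'a)) * g x / (2 * s)\<bar>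
   = e powr (- 2 * s) * \<bar>mass TYPE('a) * w x - mean w e x - (LBINT y. bump (y::'a)) * g x * (e powr (2 * s) / (2 * s))\<bar>"
   by (simp only: abs_mult abs_of_nonneg[OF powr_ge_zero])
  also have "\<dots> \<le> e powr (- 2 * s) * (\<eta> * (LBINT y. bump (y::'a)) * (e powr (2 * s) / (2 * s)))"
   by (rule mult_left_mono[OF main]) simp
  also have "\<dots> = (e powr (- 2 * s) * e powr (2 * s)) * (\<eta> * (LBINT y. bump (y::'a)) / (2 * s))" by simp
  also have "\<dots> = \<eta> * (LBINT y. bump (y::'a)) / (2 * s)" unfolding ee by simp
  also have "\<dots> = \<epsilon> * ((LBINT y. bump (y::'a)) / ((LBINT y. bump (y::'a)) + 1)) / 2" using s0 by (simp add: \<eta>_def)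
  also have "\<dots> \<le> \<epsilon> * 1 / 2" using \<Phi> \<epsilon> by (intro divide_right_mono mult_left_mono) auto
  also have "\<dots> < \<epsilon>" using \<epsilon> by simp
  finally show ?thesis .
 qed
 then show "eventually (\<lambda>e. dist (e powr (- 2 * s) * (mass TYPE('a) * w x - mean w e x)) ((LBINT y. bump (y::'a)) * g x / (2 * s)) < \<epsilon>) (at_right 0)"
  unfolding eventually_at_right_field dist_real_def using r by (intro exI[of _ r]) auto
qed

text \<open>The average at a fixed scale has second differences O(|h|^2), which is o (|h|^(2s)). The
  layers below that scale contribute \<eta> D |h|^(2s), where \<eta> is the oscillation of g near x
  and can be made small. Only the symmetric difference profits from this: it annihilates the
  constant g(x).\<close>

lemma sdiff_little_o:
 assumes x: "x \<in> \<Omega>"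
 shows "((\<lambda>h. norm h powr (- 2 * s) * sdiff w h x) \<longlongrightarrow> 0) (at 0)"
proof (rule tendstoI)
 fix \<epsilon> :: real assume \<epsilon>: "0 < \<epsilon>"
 obtain \<delta> where \<delta>: "0 < \<delta>" "ball x (3 * \<delta>) \<subseteq> \<Omega>"
  "\<And>z t. z \<in> ball x \<delta> \<Longrightarrow> 0 < t \<Longrightarrow> t \<le> \<delta> \<Longrightarrow> integrable lborel (\<lambda>y. g y * sbump z t y)"
  "\<And>z e. z \<in> ball x \<delta> \<Longrightarrow> 0 < e \<Longrightarrow> e \<le> \<delta> \<Longrightarrow> integrable lborel (\<lambda>t. layer w z t * indicator {0<..e} t)"
  "\<And>z e. z \<in> ball x \<delta> \<Longrightarrow> 0 < e \<Longrightarrow> e \<le> \<delta> \<Longrightarrow>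
   mass TYPE('a) * w z - mean w e z = (LBINT t. layer w z t * indicator {0<..e} t)"
  by (rule mean_formula[OF x]) (rule that)
 define V where "V = measure lborel (cball (0::'a) 2)"
 have V: "0 \<le> V" by (simp add: V_def)
 have mp: "0 < mass TYPE('a)" by (rule mass_pos)
 \<comment> \<open>The first summand stems from the scales t \<le> |h|, the second from t > |h|; the
   latter converges because s < 1.\<close>
 define D where "D = 4 * (LBINT y. bump (y::'a)) / (2 * s) + 264 * V / (2 - 2 * s)"
 have \<Phi>: "0 \<le> (LBINT y. bump (y::'a))" by (rule bump_mass_nonneg)
 have D: "0 \<le> D" using \<Phi> V s0 s1 by (simp add: D_def)
 define \<eta> where "\<eta> = \<epsilon> * mass TYPE('a) / (2 * (D + 1))"
 have \<eta>: "0 < \<eta>" using \<epsilon> mp D by (simp add: \<eta>_def)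
 obtain d where d: "0 < d" "ball x d \<subseteq> \<Omega>" "\<And>y. y \<in> ball x d \<Longrightarrow> \<bar>g y - g x\<bar> \<le> \<eta>"
  using g_near[OF x \<eta>] by blast
 \<comment> \<open>Bumps of radius at most r centred at x, x + h or x - h with |h| < r live in the
   ball of radius 2 r < d, where g differs from g(x) by at most \<eta>.\<close>
 define r where "r = min d \<delta> / 4"
 have r: "0 < r" "2 * r < d" "r < \<delta>" using d \<delta> by (auto simp: r_def min_def)
 obtain K where K: "0 < K" "\<And>h. norm h \<le> r \<Longrightarrow> \<bar>sdiff (mean w r) h x\<bar> \<le> K * (norm h)\<^sup>2"
  using sdiff_mean_bound[OF w r(1), of x] by blast
 have bd: "mass TYPE('a) * \<bar>sdiff w h x\<bar> \<le> K * (norm h)\<^sup>2 + \<eta> * D * norm h powr (2 * s)"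
  if h: "h \<noteq> 0" "norm h < r" for h
 proof -
  have zs: "x \<in> ball x \<delta>" "x + h \<in> ball x \<delta>" "x - h \<in> ball x \<delta>" using h r \<delta> by (auto simp: dist_norm)
  note lI = \<delta>(4)[OF zs(1) r(1)] \<delta>(4)[OF zs(2) r(1)] \<delta>(4)[OF zs(3) r(1)]
  let ?L = "\<lambda>t. 2 * (layer w x t * indicator {0<..r} t) - layer w (x + h) t * indicator {0<..r} t - layer w (x - h) t * indicator {0<..r} t"
  have LI: "integrable lborel ?L" using lI r by simp
  have rd: "r \<le> \<delta>" using r by simp
  have e1: "mass TYPE('a) * sdiff w h x = sdiff (mean w r) h x + (LBINT t. ?L t)"
  proof -
   have "(LBINT t. ?L t) = 2 * (mass TYPE('a) * w x - mean w r x) - (mass TYPE('a) * w (x + h) - mean w r (x + h)) - (mass TYPE('a) * w (x - h) - mean w r (x - h))"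
    unfolding \<delta>(5)[OF zs(1) r(1) rd] \<delta>(5)[OF zs(2) r(1) rd] \<delta>(5)[OF zs(3) r(1) rd] using lI rd by simp
   then show ?thesis by (simp add: sdiff_def algebra_simps)
  qed
  let ?h1 = "\<lambda>t::real. t powr (2 * s - 1) * indicator {0<..norm h} t"
  let ?h2 = "\<lambda>t::real. t powr (- (3 - 2 * s)) * indicator {norm h<..} t"
  have h0: "0 < norm h" using h by simp
  have h1: "integrable lborel ?h1" "(LBINT t. ?h1 t) = norm h powr (2 * s) / (2 * s)"
   using integrable_powr_head[of "2 * s - 1" "norm h"] s0 h0 by simp_all
  have h2i: "integrable lborel ?h2" using s1 h0 by (intro integrable_powr_tail) auto
  have h2v: "(LBINT t. ?h2 t) = norm h powr (2 * s - 2) / (2 - 2 * s)"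
  proof -
   have "(\<integral>\<^sup>+t. ennreal (?h2 t) \<partial>lborel) = (\<integral>\<^sup>+t. ennreal (t powr (2 * s - 3)) * indicator {norm h..} t \<partial>lborel)"
    using AE_lborel_singleton[of "norm h"] by (intro nn_integral_cong_AE, eventually_elim) (auto simp: indicator_def)
   also have "\<dots> = ennreal (-(norm h powr (2 * s - 3 + 1)) / (2 * s - 3 + 1))"
    using s1 h0 by (intro nn_integral_has_integral_lebesgue' has_integral_powr_to_inf) auto
   also have "-(norm h powr (2 * s - 3 + 1)) / (2 * s - 3 + 1) = norm h powr (2 * s - 2) / (2 - 2 * s)"
    using s1 by (simp add: field_simps)
   finally show ?thesis using s1 by (subst integral_eq_nn_integral) auto
  qed
  have pt: "\<bar>?L t\<bar> \<le> \<eta> * (4 * (LBINT y. bump (y::'a))) * ?h1 t + \<eta> * (264 * V * (norm h)\<^sup>2) * ?h2 t" for t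
  proof (cases "0 < t \<and> t \<le> r")
   case True
   then have t: "0 < t" "t \<le> r" by auto
   have td: "t \<le> \<delta>" using t r by simp
   have cb: "cball z t \<subseteq> \<Omega>" if "z \<in> ball x r" for z
   proof
    fix y assume "y \<in> cball z t"
    then have "y \<in> ball x d" using that t r dist_triangle[of x y z] by simp
    then show "y \<in> \<Omega>" using d(2) by blast
   qed
   have zr: "x \<in> ball x r" "x + h \<in> ball x r" "x - h \<in> ball x r" using h r by (auto simp: dist_norm)
   let ?S = "\<lambda>y. 2 * sbump x t y - sbump (x + h) t y - sbump (x - h) t y"
   note gi = \<delta>(3)[OF zs(1) t(1) td] \<delta>(3)[OF zs(2) t(1) td] \<delta>(3)[OF zs(3) t(1) td]
   \<comment> \<open>Subtracting the constant g(x) leaves the smallness factor \<eta> in front of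
     the absolute second difference of the bumps.\<close>
   note ms = integral_mult_sdiff_sbump[OF gi t(1), of "g x"]
   let ?J = "\<integral>y. (g y - g x) * ?S y \<partial>lborel"
   have "?L t = t powr (- (real DIM('a) + 1)) * (t powr (2 * s) * ?J)"
   proof -
    have "?L t = t powr (- (real DIM('a) + 1)) * (t powr (2 * s) * (2 * (LBINT y. g y * sbump x t y) - (LBINT y. g y * sbump (x + h) t y) - (LBINT y. g y * sbump (x - h) t y)))"
     using t unfolding weak_eqD[OF eq t(1) cb[OF zr(1)]] weak_eqD[OF eq t(1) cb[OF zr(2)]] weak_eqD[OF eq t(1) cb[OF zr(3)]]
     by (simp add: algebra_simps)
    then show ?thesis unfolding ms(1) .
   qed
   then have Labs: "\<bar>?L t\<bar> = t powr (- (real DIM('a) + 1)) * (t powr (2 * s) * \<bar>?J\<bar>)"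
    by (simp only: abs_mult abs_of_nonneg[OF powr_ge_zero])
   have gS: "\<bar>(g y - g x) * ?S y\<bar> \<le> \<eta> * \<bar>?S y\<bar>" for y
   proof (cases "y \<in> ball x d")
    case True
    then show ?thesis unfolding abs_mult by (intro mult_right_mono d(3)) auto
   next
    case False
    have z: "sbump z t y = 0" if "z \<in> ball x r" for z
    proof (rule sbump_zero[OF t(1)])
     show "t \<le> dist z y" using that False t r dist_triangle[of x y z] by simp
    qed
    show ?thesis using z[OF zr(1)] z[OF zr(2)] z[OF zr(3)] by simp
   qed
   have Si: "integrable lborel (\<lambda>y. \<bar>?S y\<bar>)"
    using sbump_integrable[OF t(1)] by (intro integrable_abs Bochner_Integration.integrable_diff integrable_mult_right)
   have "\<bar>?J\<bar> \<le> (LBINT y. \<bar>(g y - g x) * ?S y\<bar>)" by (rule integral_abs_bound)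
   also have "\<dots> \<le> (LBINT y. \<eta> * \<bar>?S y\<bar>)"
    by (rule integral_mono[OF integrable_abs[OF ms(2)] integrable_mult_right[OF Si] gS])
   finally have J: "\<bar>?J\<bar> \<le> \<eta> * (LBINT y. \<bar>?S y\<bar>)" by simp
   show ?thesis
   \<comment> \<open>Below |h| the three bumps hardly interact and their masses are added. Above |h|
     the second difference is at most 264 (|h| / t)^2, on a ball of radius 2 t because the centres
     move by less than t.\<close>
   proof (cases "t \<le> norm h")
    case True
    have "(LBINT y. \<bar>?S y\<bar>) \<le> (LBINT y. 2 * sbump x t y + sbump (x + h) t y + sbump (x - h) t y)"
    proof (rule integral_mono[OF Si])
     show "integrable lborel (\<lambda>y. 2 * sbump x t y + sbump (x + h) t y + sbump (x - h) t y)"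
      using sbump_integrable[OF t(1)] by (intro Bochner_Integration.integrable_add integrable_mult_right)
     show "\<bar>?S y\<bar> \<le> 2 * sbump x t y + sbump (x + h) t y + sbump (x - h) t y" for y
      using sbump_nonneg[of x t y] sbump_nonneg[of "x + h" t y] sbump_nonneg[of "x - h" t y] by linarith
    qed
    also have "\<dots> = 4 * (LBINT y. bump (y::'a)) * t ^ DIM('a)"
     using sbump_integrable[OF t(1), of x] sbump_integrable[OF t(1), of "x + h"] sbump_integrable[OF t(1), of "x - h"]
      sbump_integral[OF t(1), of x] sbump_integral[OF t(1), of "x + h"] sbump_integral[OF t(1), of "x - h"] by simp
    finally have S4: "(LBINT y. \<bar>?S y\<bar>) \<le> 4 * (LBINT y. bump (y::'a)) * t ^ DIM('a)" .
    have "\<bar>?J\<bar> \<le> \<eta> * (4 * (LBINT y. bump (y::'a)) * t ^ DIM('a))"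
     by (rule order_trans[OF J mult_left_mono[OF S4 less_imp_le[OF \<eta>]]])
    then have "\<bar>?J\<bar> \<le> (\<eta> * (4 * (LBINT y. bump (y::'a)))) * t ^ DIM('a)" by (simp only: mult.assoc)
    then have "\<bar>?L t\<bar> \<le> t powr (- (real DIM('a) + 1)) * (t powr (2 * s) * ((\<eta> * (4 * (LBINT y. bump (y::'a)))) * t ^ DIM('a)))"
     unfolding Labs by (intro mult_left_mono) auto
    also have "\<dots> = \<eta> * (4 * (LBINT y. bump (y::'a))) * t powr (2 * s - 1)" by (rule layer_exponent[OF t(1)])
    finally show ?thesis using t True by simp
   next
    case False
    have "(LBINT y. \<bar>?S y\<bar>) \<le> (LBINT y. 264 * (norm h / t)\<^sup>2 * indicator (cball 0 2) ((y - x) /\<^sub>R t))"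
    proof (rule integral_mono[OF Si])
     have ci: "integrable lborel (indicator (cball (0::'a) 2) :: 'a \<Rightarrow> real)"
      by (rule integrable_real_indicator[OF _ emeasure_lborel_cball_finite]) simp
     then show "integrable lborel (\<lambda>y. 264 * (norm h / t)\<^sup>2 * indicator (cball 0 2) ((y - x) /\<^sub>R t))"
      using integrable_scale[of "indicator (cball (0::'a) 2)" t x] t by simp
     fix y
     show "\<bar>?S y\<bar> \<le> 264 * (norm h / t)\<^sup>2 * indicator (cball 0 2) ((y - x) /\<^sub>R t)"
     proof (cases "dist x y \<le> 2 * t")
      case True
      have "norm ((y - x) /\<^sub>R t) = dist x y / t" using t by (simp add: dist_norm norm_minus_commute divide_inverse mult.commute)
      also have "\<dots> \<le> 2" using True t by (subst pos_divide_le_eq) auto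
      finally have "(y - x) /\<^sub>R t \<in> cball 0 2" by (simp only: mem_cball_0)
      then show ?thesis using sdiff_sbump_center_bound[OF t(1), of x y h] by simp
     next
      case F: False
      have z: "sbump z t y = 0" if "dist x z \<le> t" for z
      proof (rule sbump_zero[OF t(1)])
       show "t \<le> dist z y" using that F dist_triangle[of x y z] by simp
      qed
      have "dist x (x + h) \<le> t" "dist x (x - h) \<le> t" "dist x x \<le> t" using False t by (auto simp: dist_norm)
      then show ?thesis using z by simp
     qed
    qed
    also have "\<dots> = 264 * (norm h / t)\<^sup>2 * (t ^ DIM('a) * V)"
    proof -
     have "indicator (cball (0::'a) 2) \<in> borel_measurable borel"
      by (intro borel_measurable_indicator borel_closed closed_cball)
     from integral_scale[OF this t(1), of x]
     have "(LBINT y. indicator (cball 0 2) ((y - x) /\<^sub>R t)) = t ^ DIM('a) * V" by (simp add: V_def)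
     then show ?thesis by simp
    qed
    finally have S5: "(LBINT y. \<bar>?S y\<bar>) \<le> 264 * (norm h / t)\<^sup>2 * (t ^ DIM('a) * V)" .
    have "\<bar>?J\<bar> \<le> \<eta> * (264 * (norm h / t)\<^sup>2 * (t ^ DIM('a) * V))"
     by (rule order_trans[OF J mult_left_mono[OF S5 less_imp_le[OF \<eta>]]])
    also have "\<dots> = (\<eta> * (264 * V * (norm h)\<^sup>2) / t\<^sup>2) * t ^ DIM('a)"
     by (simp add: power_divide)
    finally have "\<bar>?L t\<bar> \<le> t powr (- (real DIM('a) + 1)) * (t powr (2 * s) * ((\<eta> * (264 * V * (norm h)\<^sup>2) / t\<^sup>2) * t ^ DIM('a)))"
     unfolding Labs by (intro mult_left_mono) auto
    also have "\<dots> = (\<eta> * (264 * V * (norm h)\<^sup>2) / t\<^sup>2) * t powr (2 * s - 1)" by (rule layer_exponent[OF t(1)])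
    also have "\<dots> = \<eta> * (264 * V * (norm h)\<^sup>2) * (t powr (2 * s - 1) / t powr 2)" using t by (simp add: powr_numeral)
    also have "t powr (2 * s - 1) / t powr 2 = t powr (- (3 - 2 * s))"
     unfolding powr_diff[symmetric] by simp
    finally show ?thesis using t False by simp
   qed
  next
   case False
   then have "indicator {0<..r} t = (0::real)" by auto
   moreover have "0 \<le> \<eta> * (4 * (LBINT y. bump (y::'a))) * ?h1 t" using \<eta> \<Phi> by simp
   moreover have "0 \<le> \<eta> * (264 * V * (norm h)\<^sup>2) * ?h2 t" using \<eta> V by simp
   ultimately show ?thesis by simp
  qed
  have "\<bar>\<integral>t. ?L t \<partial>lborel\<bar> \<le> (LBINT t. \<bar>?L t\<bar>)" by (rule integral_abs_bound)
  also have "\<dots> \<le> (LBINT t. \<eta> * (4 * (LBINT y. bump (y::'a))) * ?h1 t + \<eta> * (264 * V * (norm h)\<^sup>2) * ?h2 t)"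
   by (rule integral_mono[OF integrable_abs[OF LI] Bochner_Integration.integrable_add[OF integrable_mult_right[OF h1(1)] integrable_mult_right[OF h2i]] pt])
  also have "\<dots> = \<eta> * (4 * (LBINT y. bump (y::'a))) * (norm h powr (2 * s) / (2 * s)) + \<eta> * (264 * V * (norm h)\<^sup>2) * (norm h powr (2 * s - 2) / (2 - 2 * s))"
   using h1 h2i h2v by (subst Bochner_Integration.integral_add) (auto intro: integrable_mult_right)
  also have "\<dots> = \<eta> * D * norm h powr (2 * s)"
  proof -
   have hh: "(norm h)\<^sup>2 * norm h powr (2 * s - 2) = norm h powr (2 * s)"
    using powr_add[of "norm h" 2 "2 * s - 2"] h0 by (simp add: powr_numeral)
   have "\<eta> * (264 * V * (norm h)\<^sup>2) * (norm h powr (2 * s - 2) / (2 - 2 * s)) = \<eta> * (264 * V / (2 - 2 * s)) * ((norm h)\<^sup>2 * norm h powr (2 * s - 2))"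
    by (simp only: divide_inverse mult_ac)
   then have e5: "\<eta> * (264 * V * (norm h)\<^sup>2) * (norm h powr (2 * s - 2) / (2 - 2 * s)) = \<eta> * (264 * V / (2 - 2 * s)) * norm h powr (2 * s)"
    unfolding hh .
   show ?thesis unfolding e5 D_def by (simp add: distrib_left distrib_right)
  qed
  finally have "\<bar>\<integral>t. ?L t \<partial>lborel\<bar> \<le> \<eta> * D * norm h powr (2 * s)" .
  moreover have "\<bar>sdiff (mean w r) h x\<bar> \<le> K * (norm h)\<^sup>2" using h by (intro K(2)) simp
  moreover have "mass TYPE('a) * \<bar>sdiff w h x\<bar> = \<bar>mass TYPE('a) * sdiff w h x\<bar>" using mp by (simp add: abs_mult)
  ultimately show ?thesis unfolding e1 by linarith
 qed
 have "((\<lambda>h::'a. K * norm h powr (2 - 2 * s)) \<longlongrightarrow> K * 0) (at 0)"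
 proof (intro tendsto_mult tendsto_const)
  have "((\<lambda>h::'a. norm h powr (2 - 2 * s)) \<longlongrightarrow> norm (0::'a) powr (2 - 2 * s)) (at 0)"
   using s1 by (intro tendsto_powr' tendsto_norm tendsto_ident_at tendsto_const) auto
  then show "((\<lambda>h::'a. norm h powr (2 - 2 * s)) \<longlongrightarrow> 0) (at 0)" by simp
 qed
 then have ev: "eventually (\<lambda>h::'a. K * norm h powr (2 - 2 * s) < \<epsilon> * mass TYPE('a) / 2) (at 0)"
  by (rule order_tendstoD(2)) (use \<epsilon> mp in simp)
 have "eventually (\<lambda>h::'a. h \<noteq> 0 \<and> norm h < r) (at 0)"
  unfolding eventually_at using r by (intro exI[of _ r]) auto
 with ev show "eventually (\<lambda>h. dist (norm h powr (- 2 * s) * sdiff w h x) 0 < \<epsilon>) (at 0)"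
 proof eventually_elim
  fix h :: 'a assume a: "K * norm h powr (2 - 2 * s) < \<epsilon> * mass TYPE('a) / 2" and h: "h \<noteq> 0 \<and> norm h < r"
  have h0: "0 < norm h" using h by simp
  have e1: "norm h powr (- 2 * s) * (norm h)\<^sup>2 = norm h powr (2 - 2 * s)"
   using powr_add[of "norm h" "- 2 * s" 2] h0 by (simp add: powr_numeral)
  have e2: "norm h powr (- 2 * s) * norm h powr (2 * s) = 1"
   using h0 by (simp add: powr_add[symmetric])
  have "norm h powr (- 2 * s) * (mass TYPE('a) * \<bar>sdiff w h x\<bar>) \<le> norm h powr (- 2 * s) * (K * (norm h)\<^sup>2 + \<eta> * D * norm h powr (2 * s))"
   using bd h by (intro mult_left_mono) auto
  also have "\<dots> = K * (norm h powr (- 2 * s) * (norm h)\<^sup>2) + \<eta> * D * (norm h powr (- 2 * s) * norm h powr (2 * s))"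
   by (simp add: algebra_simps)
  also have "\<dots> = K * norm h powr (2 - 2 * s) + \<eta> * D" unfolding e1 e2 by simp
  also have "\<eta> * D \<le> \<epsilon> * mass TYPE('a) / 2"
  proof -
   have "\<eta> * D \<le> \<eta> * (D + 1)" using \<eta> by simp
   also have "\<dots> = \<epsilon> * mass TYPE('a) / 2"
   proof -
    have "c / (2 * E) * E = c / 2" if "E \<noteq> 0" for c E :: real using that by simp
    from this[of "D + 1" "\<epsilon> * mass TYPE('a)"] D show ?thesis unfolding \<eta>_def by linarith
   qed
   finally show ?thesis .
  qed
  finally have "mass TYPE('a) * (norm h powr (- 2 * s) * \<bar>sdiff w h x\<bar>) < mass TYPE('a) * \<epsilon>"
   using a by (simp add: mult.left_commute mult.commute)
  then have "norm h powr (- 2 * s) * \<bar>sdiff w h x\<bar> < \<epsilon>" using mp by simp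
  then show "dist (norm h powr (- 2 * s) * sdiff w h x) 0 < \<epsilon>" by (simp add: dist_real_def abs_mult)
 qed
qed

end

context frac
begin

lemma bump_mass_pos: "0 < (LBINT y. bump (y::'a::euclidean_space))"
proof -
 have "(LBINT y. bump (y::'a)) \<noteq> 0"
 proof
  assume z: "(LBINT y. bump (y::'a)) = 0"
  have "AE y in lborel. bump (y::'a) = 0"
   using integral_nonneg_eq_0_iff_AE[OF bump_integrable[where 'a='a]] z trunc_pow_nonneg by auto
  then have "AE y in lborel. y \<notin> ball (0::'a) 1"
  proof eventually_elim
   fix y :: 'a assume "bump y = 0"
   then show "y \<notin> ball 0 1" using power_strict_mono[of "norm y" 1 2] by (auto simp: trunc_pow_def dot_square_norm)
  qed
  then have "emeasure lborel (ball (0::'a) 1) = 0"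
   by (subst (asm) AE_iff_measurable[of "ball 0 1"]) auto
  then show False by (auto simp: emeasure_ball unit_ball_vol_pos[THEN less_imp_neq, symmetric])
 qed
 then show ?thesis using bump_mass_nonneg[where 'a='a] by simp
qed

lemma square_integrable_norm_powr:
 assumes "real DIM('a) < q" "0 < e"
 shows "square_integrable (\<lambda>z::'a::euclidean_space. norm z powr (- q) * indicator {e..} (norm z))"
  "integrable lborel (\<lambda>z::'a::euclidean_space. norm z powr (- q) * indicator {e..} (norm z))"
proof -
 show i: "integrable lborel (\<lambda>z::'a. norm z powr (- q) * indicator {e..} (norm z))"
  by (rule integrable_norm_powr_outside[OF assms])
 show "square_integrable (\<lambda>z::'a. norm z powr (- q) * indicator {e..} (norm z))"
 proof (rule square_integrable_bounded_integrable[OF _ i, of _ "e powr (- q)"])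
  have q: "0 \<le> q" using assms(1) of_nat_0_le_iff[of "DIM('a)", where 'a=real] by linarith
  show "\<bar>norm z powr (- q) * indicator {e..} (norm z)\<bar> \<le> e powr (- q)" for z :: 'a
   using powr_mono2'[of "- q" e "norm z"] q assms(2) by (simp add: indicator_def)
 qed (use i in \<open>auto simp: indicator_def\<close>)
qed

lemma integral_avg: "0 < e \<Longrightarrow> integrable lborel (avg e :: 'a::euclidean_space \<Rightarrow> real)"
 "0 < e \<Longrightarrow> (LBINT z. avg e (z::'a::euclidean_space)) = mass TYPE('a)"
proof -
 assume e: "0 < e"
 have "avg e = (\<lambda>z::'a. e powr (- real DIM('a)) * avg 1 ((z - 0) /\<^sub>R e))"
  using avg_scale[where 'a='a, OF e] by (simp add: fun_eq_iff)
 moreover have "e powr (- real DIM('a)) * e ^ DIM('a) = 1"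
  using e by (simp add: powr_realpow[symmetric] powr_add[symmetric])
 ultimately show "integrable lborel (avg e :: 'a \<Rightarrow> real)" "(LBINT z. avg e (z::'a)) = mass TYPE('a)"
  using integrable_scale[of "avg 1 :: 'a \<Rightarrow> real" e 0] integral_scale[of "avg 1 :: 'a \<Rightarrow> real" e 0] e avg_integrable[where 'a='a]
  by (simp_all add: mass_def mult.assoc[symmetric])
qed

text \<open>Averaging over z and -z against an even kernel turns first differences into half of the
  second difference, the only quantity with a bound of the right order.\<close>

lemma symmetrized_integral:
 fixes w k :: "'a::euclidean_space \<Rightarrow> real"
 assumes w: "square_integrable w" and k: "square_integrable k" "integrable lborel k" and even: "\<And>z. k (- z) = k z"
 shows "integrable lborel (\<lambda>z. (w x - w (x + z)) * k z)"
  "integrable lborel (\<lambda>z. sdiff w z x * k z)"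
  "(LBINT z. (w x - w (x + z)) * k z) = (LBINT z. sdiff w z x * k z) / 2"
proof -
 let ?f = "\<lambda>z. (w x - w (x + z)) * k z"
 have "integrable lborel (\<lambda>z. w (z + x) * k z)"
  by (rule integrable_square_integrable_mult[OF square_integrable_shift(1)[OF w] k(1)])
 then show i: "integrable lborel ?f"
  using k(2) by (simp add: left_diff_distrib add.commute)
 have [measurable]: "?f \<in> borel_measurable borel" using i by simp
 have i': "integrable lborel (\<lambda>z. ?f (0 - z))" "(LBINT z. ?f (0 - z)) = (LBINT z. ?f z)"
  using integrable_shift(3)[of ?f 0] integral_shift(3)[of ?f 0] i by simp_all
 have e: "sdiff w z x * k z = ?f z + ?f (0 - z)" for z
  by (simp add: sdiff_def even algebra_simps)
 show "integrable lborel (\<lambda>z. sdiff w z x * k z)" unfolding e using i i'(1) by (rule Bochner_Integration.integrable_add)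
 have "(LBINT z. sdiff w z x * k z) = (LBINT z. ?f z) + (LBINT z. ?f (0 - z))"
  unfolding e using i i'(1) by (rule Bochner_Integration.integral_add)
 then show "(LBINT z. ?f z) = (LBINT z. sdiff w z x * k z) / 2" using i'(2) by simp
qed

end

context pointwise_solution
begin

text \<open>Both the averages and the truncated integrals are integrals of second differences of w.
  Their kernels, matched by the factors e^(-2s) and \<Phi> / s with \<Phi> the integral of the bump,
  differ by a rescaled remainder that contributes nothing in the limit. So \<Phi> / s times the
  truncated integral has the limit \<Phi> g(x) / (2s) of the averages.\<close>

lemma principal_value:
 assumes x: "x \<in> \<Omega>"
 shows "0 < e \<Longrightarrow> integrable lborel (\<lambda>z. (w x - w (x + z)) * (kern z * indicator {e..} (norm z)))"
  and "((\<lambda>e. \<integral>z. (w x - w (x + z)) * (kern z * indicator {e..} (norm z)) \<partial>lborel) \<longlongrightarrow> g x / 2) (at_right 0)"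
proof -
 let ?p = "real DIM('a) + 2 * s"
 define M where "M = (LBINT y. bump (y::'a))"
 have M: "0 < M" unfolding M_def by (rule bump_mass_pos)
 let ?k = "\<lambda>e z. kern z * indicator {e..} (norm (z::'a))"
 have k: "square_integrable (?k e)" "integrable lborel (?k e)" "\<And>z. ?k e (- z) = ?k e z" if "0 < e" for e
  using square_integrable_norm_powr[OF dim_less that, where 'a='a] by (simp_all add: kern_def)
 show "integrable lborel (\<lambda>z. (w x - w (x + z)) * ?k e z)" if "0 < e" for e
  by (rule symmetrized_integral(1)[OF w k[OF that]])
 define P where "P e = (LBINT z. (w x - w (x + z)) * ?k e z)" for e
 have P: "P e = (LBINT z. sdiff w z x * ?k e z) / 2" if "0 < e" for e
  unfolding P_def by (rule symmetrized_integral(3)[OF w k[OF that]])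
 have mean: "mass TYPE('a) * w x - mean w e x = (LBINT z. sdiff w z x * avg e z) / 2" if e: "0 < e" for e
 proof -
  have sa: "square_integrable (avg e :: 'a \<Rightarrow> real)" by (rule square_integrable_avg[OF e])
  have m: "mean w e x = (LBINT z. w (z + x) * avg e z)"
   unfolding mean_def using integral_shift(1)[of "\<lambda>y. w y * avg e (y - x)" x] by simp
  have "integrable lborel (\<lambda>z. w (z + x) * avg e z)"
   by (rule integrable_square_integrable_mult[OF square_integrable_shift(1)[OF w] sa])
  then have "(LBINT z. (w x - w (x + z)) * avg e z) = w x * mass TYPE('a) - mean w e x"
   using integral_avg[OF e, where 'a='a] unfolding m by (simp add: left_diff_distrib add.commute)
  then have "(LBINT z. (w x - w (x + z)) * avg e z) = mass TYPE('a) * w x - mean w e x"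
   by (simp only: mult.commute)
  then show ?thesis
   using symmetrized_integral(3)[OF w sa integral_avg(1)[OF e], of x] by simp
 qed
 define B where "B y = avg 1 y - M / s * kern y * indicator {1..} (norm y)" for y :: 'a
 obtain C where C: "0 < C" "\<And>y :: 'a. \<bar>B y\<bar> \<le> C * decay (?p + 1) y"
  "\<And>y :: 'a. 1 \<le> norm y \<Longrightarrow> \<bar>B y\<bar> \<le> C * norm y powr (- (?p + 1))"
  by (rule avg_remainder_bound[where 'a='a]) (rule that; simp add: B_def M_def)
 have [measurable]: "B \<in> borel_measurable borel" unfolding B_def by measurable
 \<comment> \<open>Homogeneity: after rescaling, the kernel difference at scale e is the fixed
   remainder B at z / e times e^(-n-2s).\<close>
 have Be: "e powr (- 2 * s) * avg e z - M / s * ?k e z = e powr (- ?p) * B (z /\<^sub>R e)" if e: "0 < e" for e and z :: 'a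
 proof -
  have 1: "e powr (- 2 * s) * avg e z = e powr (- ?p) * avg 1 (z /\<^sub>R e)"
  proof -
   have "- 2 * s + - real DIM('a) = - ?p" by simp
   then show ?thesis unfolding avg_scale[OF e, of z] mult.assoc[symmetric] powr_add[symmetric] by (simp only:)
  qed
  have 2: "kern z = e powr (- ?p) * kern (z /\<^sub>R e)"
  proof -
   have "e powr (- ?p) * e powr ?p = 1" unfolding powr_add[symmetric] using e by simp
   then show ?thesis unfolding kern_divide[OF e] mult.assoc[symmetric] by (simp only: mult_1)
  qed
  have 3: "indicator {e..} (norm z) = (indicator {1..} (norm (z /\<^sub>R e)) :: real)"
  proof -
   have "norm (z /\<^sub>R e) = norm z / e" using e by (simp add: divide_inverse mult.commute)
   then have "e \<le> norm z \<longleftrightarrow> 1 \<le> norm (z /\<^sub>R e)" using e by (simp only: pos_le_divide_eq mult_1)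
   then show ?thesis by (simp only: indicator_def atLeast_iff)
  qed
  show ?thesis unfolding 1 3 B_def by (subst 2) (simp only: right_diff_distrib mult_ac)
 qed
 have so: "((\<lambda>h. norm h powr (- 2 * s) * sdiff w h x) \<longlongrightarrow> 0) (at 0)" by (rule sdiff_little_o[OF x])
 have "eventually (\<lambda>h. dist (norm h powr (- 2 * s) * sdiff w h x) 0 < 1) (at 0)" by (rule tendstoD[OF so]) simp
 then obtain \<delta> where \<delta>: "0 < \<delta>" "\<And>h. h \<noteq> 0 \<Longrightarrow> norm h < \<delta> \<Longrightarrow> \<bar>norm h powr (- 2 * s) * sdiff w h x\<bar> < 1"
  unfolding eventually_at by (auto simp: dist_real_def)
 have sb: "\<bar>sdiff w h x\<bar> \<le> norm h powr (2 * s)" if "norm h < \<delta>" for h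
 proof (cases "h = 0")
  case False
  have e: "norm h powr (2 * s) * norm h powr (- 2 * s) = 1" using False by (simp add: powr_add[symmetric])
  have "norm h powr (2 * s) * \<bar>norm h powr (- 2 * s) * sdiff w h x\<bar> \<le> norm h powr (2 * s) * 1"
   using \<delta>(2)[OF False that] by (intro mult_left_mono) auto
  moreover have "norm h powr (2 * s) * \<bar>norm h powr (- 2 * s) * sdiff w h x\<bar> = \<bar>sdiff w h x\<bar>"
  proof -
   have "norm h powr (2 * s) * \<bar>norm h powr (- 2 * s) * sdiff w h x\<bar> = norm h powr (2 * s) * norm h powr (- 2 * s) * \<bar>sdiff w h x\<bar>"
    by (simp only: abs_mult abs_of_nonneg[OF powr_ge_zero] mult.assoc)
   then show ?thesis unfolding e by simp
  qed
  ultimately show ?thesis by simp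
 qed (simp add: sdiff_def)
 \<comment> \<open>The part |z| < \<delta>, written in the variable z / e: the integrand is
   dominated by |\<zeta>|^(2s) |B(\<zeta>)| and tends to 0 pointwise by
   \<open>sdiff_little_o\<close>. The other part, \<open>I2\<close>, is O(e) because B has one more
   power of decay than K.\<close>
 define I1 where "I1 e = (LBINT \<zeta>. e powr (- 2 * s) * (sdiff w (e *\<^sub>R \<zeta>) x * indicator {..<\<delta>} (norm (e *\<^sub>R \<zeta>))) * B \<zeta>)" for e
 define I2 where "I2 e = (LBINT z. sdiff w z x * indicator {\<delta>..} (norm z) * (e powr (- ?p) * B (z /\<^sub>R e)))" for e
 have lim1: "(I1 \<longlongrightarrow> 0) (at_right 0)"
 proof -
  have "(I1 \<longlongrightarrow> (LBINT (\<zeta>::'a). 0)) (at_right 0)"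
   unfolding I1_def
  proof (rule tendsto_integral_dominated[where B="\<lambda>\<zeta>. C * (norm \<zeta> powr (2 * s) * decay (?p + 1) \<zeta>)"])
   show "integrable lborel (\<lambda>\<zeta>::'a. C * (norm \<zeta> powr (2 * s) * decay (?p + 1) \<zeta>))"
    by (intro integrable_mult_right integrable_powr_mult_decay)
   fix e :: real assume e: "e \<in> {0<..}"
   show "AE \<zeta> in lborel. \<bar>e powr (- 2 * s) * (sdiff w (e *\<^sub>R \<zeta>) x * indicator {..<\<delta>} (norm (e *\<^sub>R \<zeta>))) * B \<zeta>\<bar>
     \<le> C * (norm \<zeta> powr (2 * s) * decay (?p + 1) \<zeta>)"
   proof (intro AE_I2)
    fix \<zeta> :: 'a
    have "\<bar>sdiff w (e *\<^sub>R \<zeta>) x * indicator {..<\<delta>} (norm (e *\<^sub>R \<zeta>))\<bar> \<le> norm (e *\<^sub>R \<zeta>) powr (2 * s)"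
     using sb[of "e *\<^sub>R \<zeta>"] by (cases "norm (e *\<^sub>R \<zeta>) < \<delta>") (simp_all add: indicator_def)
    also have "\<dots> = e powr (2 * s) * norm \<zeta> powr (2 * s)" using e by (simp add: powr_mult)
    finally have "e powr (- 2 * s) * \<bar>sdiff w (e *\<^sub>R \<zeta>) x * indicator {..<\<delta>} (norm (e *\<^sub>R \<zeta>))\<bar> * \<bar>B \<zeta>\<bar>
      \<le> e powr (- 2 * s) * (e powr (2 * s) * norm \<zeta> powr (2 * s)) * (C * decay (?p + 1) \<zeta>)"
     by (intro mult_mono mult_left_mono C(2)) auto
    also have "\<dots> = (e powr (- 2 * s) * e powr (2 * s)) * (C * (norm \<zeta> powr (2 * s) * decay (?p + 1) \<zeta>))" by (simp only: mult_ac)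
    also have "e powr (- 2 * s) * e powr (2 * s) = 1" using e by (simp add: powr_add[symmetric])
    finally show "\<bar>e powr (- 2 * s) * (sdiff w (e *\<^sub>R \<zeta>) x * indicator {..<\<delta>} (norm (e *\<^sub>R \<zeta>))) * B \<zeta>\<bar>
     \<le> C * (norm \<zeta> powr (2 * s) * decay (?p + 1) \<zeta>)"
     by (simp only: abs_mult abs_of_nonneg[OF powr_ge_zero] mult_1 mult.assoc)
   qed
  next
   show "AE \<zeta> in lborel. ((\<lambda>e. e powr (- 2 * s) * (sdiff w (e *\<^sub>R \<zeta>) x * indicator {..<\<delta>} (norm (e *\<^sub>R \<zeta>))) * B \<zeta>) \<longlongrightarrow> 0) (at_right 0)"
   proof (intro AE_I2)
    fix \<zeta> :: 'a
    show "((\<lambda>e. e powr (- 2 * s) * (sdiff w (e *\<^sub>R \<zeta>) x * indicator {..<\<delta>} (norm (e *\<^sub>R \<zeta>))) * B \<zeta>) \<longlongrightarrow> 0) (at_right 0)"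
    proof (cases "\<zeta> = 0")
     case False
     have t0: "((\<lambda>e::real. e *\<^sub>R \<zeta>) \<longlongrightarrow> 0 *\<^sub>R \<zeta>) (at_right 0)"
      by (rule tendsto_scaleR[OF tendsto_ident_at tendsto_const])
     have f: "filterlim (\<lambda>e::real. e *\<^sub>R \<zeta>) (at 0) (at_right 0)"
      unfolding filterlim_at using t0 False by (auto simp: eventually_at_filter)
     have l: "((\<lambda>e. norm (e *\<^sub>R \<zeta>) powr (- 2 * s) * sdiff w (e *\<^sub>R \<zeta>) x) \<longlongrightarrow> 0) (at_right 0)"
      by (rule filterlim_compose[OF so f])
     have "((\<lambda>e. \<bar>norm \<zeta> powr (2 * s) * B \<zeta>\<bar> * \<bar>norm (e *\<^sub>R \<zeta>) powr (- 2 * s) * sdiff w (e *\<^sub>R \<zeta>) x\<bar>) \<longlongrightarrow> 0) (at_right 0)"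
      by (rule tendsto_mult_right_zero[OF tendsto_rabs_zero[OF l]])
     then show ?thesis
     proof (rule Lim_null_comparison[rotated])
      show "eventually (\<lambda>e. norm (e powr (- 2 * s) * (sdiff w (e *\<^sub>R \<zeta>) x * indicator {..<\<delta>} (norm (e *\<^sub>R \<zeta>))) * B \<zeta>)
       \<le> \<bar>norm \<zeta> powr (2 * s) * B \<zeta>\<bar> * \<bar>norm (e *\<^sub>R \<zeta>) powr (- 2 * s) * sdiff w (e *\<^sub>R \<zeta>) x\<bar>) (at_right 0)"
       unfolding eventually_at_filter
      proof (intro always_eventually allI impI)
       fix e :: real assume "e \<in> {0<..}"
       then have e: "0 < e" by simp
       have nn: "norm \<zeta> powr (2 * s) * norm (e *\<^sub>R \<zeta>) powr (- 2 * s) = e powr (- 2 * s)"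
       proof -
        have "norm \<zeta> powr (2 * s) * norm \<zeta> powr (- 2 * s) = 1" using False by (simp add: powr_add[symmetric])
        then show ?thesis using e by (simp add: powr_mult mult.left_commute)
       qed
       have "\<bar>norm \<zeta> powr (2 * s) * B \<zeta>\<bar> * \<bar>norm (e *\<^sub>R \<zeta>) powr (- 2 * s) * sdiff w (e *\<^sub>R \<zeta>) x\<bar>
        = e powr (- 2 * s) * \<bar>sdiff w (e *\<^sub>R \<zeta>) x\<bar> * \<bar>B \<zeta>\<bar>"
        unfolding nn[symmetric] by (simp only: abs_mult abs_of_nonneg[OF powr_ge_zero] mult_ac)
       moreover have "\<bar>sdiff w (e *\<^sub>R \<zeta>) x * indicator {..<\<delta>} (norm (e *\<^sub>R \<zeta>))\<bar> \<le> \<bar>sdiff w (e *\<^sub>R \<zeta>) x\<bar>"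
        by (simp add: indicator_def)
       then have "e powr (- 2 * s) * \<bar>sdiff w (e *\<^sub>R \<zeta>) x * indicator {..<\<delta>} (norm (e *\<^sub>R \<zeta>))\<bar> * \<bar>B \<zeta>\<bar>
        \<le> e powr (- 2 * s) * \<bar>sdiff w (e *\<^sub>R \<zeta>) x\<bar> * \<bar>B \<zeta>\<bar>"
        by (intro mult_right_mono mult_left_mono) auto
       ultimately show "norm (e powr (- 2 * s) * (sdiff w (e *\<^sub>R \<zeta>) x * indicator {..<\<delta>} (norm (e *\<^sub>R \<zeta>))) * B \<zeta>)
        \<le> \<bar>norm \<zeta> powr (2 * s) * B \<zeta>\<bar> * \<bar>norm (e *\<^sub>R \<zeta>) powr (- 2 * s) * sdiff w (e *\<^sub>R \<zeta>) x\<bar>"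
        by (simp only: real_norm_def abs_mult abs_of_nonneg[OF powr_ge_zero])
      qed
     qed
    qed (simp add: sdiff_def)
   qed
  qed measurable
  then show ?thesis by simp
 qed
 have p1: "real DIM('a) < ?p + 1" using s0 by simp
 let ?q = "\<lambda>z::'a. norm z powr (- (?p + 1)) * indicator {\<delta>..} (norm z)"
 have iq: "integrable lborel (\<lambda>z. sdiff w z x * ?q z)"
  by (rule symmetrized_integral(2)[OF w square_integrable_norm_powr[OF p1 \<delta>(1)]]) simp
 have b2: "\<bar>sdiff w z x * indicator {\<delta>..} (norm z) * (e powr (- ?p) * B (z /\<^sub>R e))\<bar> \<le> C * e * \<bar>sdiff w z x * ?q z\<bar>"
  if e: "0 < e" "e < \<delta>" for e z
 proof (cases "\<delta> \<le> norm z")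
  case True
  have n: "norm (z /\<^sub>R e) = norm z / e" using e by (simp add: divide_inverse mult.commute)
  have "1 \<le> norm (z /\<^sub>R e)" unfolding n using True e by (subst pos_le_divide_eq) auto
  from C(3)[OF this] have "\<bar>B (z /\<^sub>R e)\<bar> \<le> C * (norm z powr (- (?p + 1)) * e powr (?p + 1))"
   unfolding n powr_divide_minus[OF e(1) norm_ge_zero] .
  then have "e powr (- ?p) * \<bar>B (z /\<^sub>R e)\<bar> \<le> e powr (- ?p) * (C * (norm z powr (- (?p + 1)) * e powr (?p + 1)))"
   by (rule mult_left_mono) simp
  also have "\<dots> = C * norm z powr (- (?p + 1)) * (e powr (- ?p) * e powr (?p + 1))" by (simp only: mult_ac)
  also have "e powr (- ?p) * e powr (?p + 1) = e" unfolding powr_add[symmetric] using e by simp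
  finally have "\<bar>sdiff w z x\<bar> * (e powr (- ?p) * \<bar>B (z /\<^sub>R e)\<bar>) \<le> \<bar>sdiff w z x\<bar> * (C * norm z powr (- (?p + 1)) * e)"
   by (rule mult_left_mono) simp
  also have "\<dots> = C * e * \<bar>sdiff w z x * norm z powr (- (?p + 1))\<bar>"
   unfolding abs_mult abs_of_nonneg[OF powr_ge_zero] by (simp only: mult_ac)
  finally have f: "\<bar>sdiff w z x\<bar> * (e powr (- ?p) * \<bar>B (z /\<^sub>R e)\<bar>) \<le> C * e * \<bar>sdiff w z x * norm z powr (- (?p + 1))\<bar>" .
  have i: "indicator {\<delta>..} (norm z) = (1::real)" using True by simp
  show ?thesis unfolding i mult_1_right using f by (simp only: abs_mult abs_of_nonneg[OF powr_ge_zero])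
 next
  case False
  then have i: "indicator {\<delta>..} (norm z) = (0::real)" by simp
  show ?thesis unfolding i by simp
 qed
 have i2: "integrable lborel (\<lambda>z. sdiff w z x * indicator {\<delta>..} (norm z) * (e powr (- ?p) * B (z /\<^sub>R e)))"
  if e: "0 < e" "e < \<delta>" for e
 proof (rule Bochner_Integration.integrable_bound[OF integrable_mult_right[OF integrable_abs[OF iq], of "C * e"]])
  show "AE z in lborel. norm (sdiff w z x * indicator {\<delta>..} (norm z) * (e powr (- ?p) * B (z /\<^sub>R e))) \<le> norm (C * e * \<bar>sdiff w z x * ?q z\<bar>)"
   unfolding real_norm_def by (intro AE_I2 order_trans[OF b2[OF e] abs_ge_self])
 qed measurable
 have lim2: "(I2 \<longlongrightarrow> 0) (at_right 0)"
 proof (rule Lim_null_comparison)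
  define J where "J = (LBINT z. \<bar>sdiff w z x * ?q z\<bar>)"
  show "eventually (\<lambda>e. norm (I2 e) \<le> C * e * J) (at_right 0)"
   unfolding eventually_at_right_field
  proof (intro exI[of _ \<delta>] conjI allI impI \<delta>(1))
   fix e assume e: "0 < e" "e < \<delta>"
   have "\<bar>I2 e\<bar> \<le> (LBINT z. \<bar>sdiff w z x * indicator {\<delta>..} (norm z) * (e powr (- ?p) * B (z /\<^sub>R e))\<bar>)"
    unfolding I2_def by (rule integral_abs_bound)
   also have "\<dots> \<le> (LBINT z. C * e * \<bar>sdiff w z x * ?q z\<bar>)"
   proof (rule integral_mono)
    show "integrable lborel (\<lambda>z. \<bar>sdiff w z x * indicator {\<delta>..} (norm z) * (e powr (- ?p) * B (z /\<^sub>R e))\<bar>)"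
     by (rule integrable_abs[OF i2[OF e]])
    show "integrable lborel (\<lambda>z. C * e * \<bar>sdiff w z x * ?q z\<bar>)"
     by (rule integrable_mult_right[OF integrable_abs[OF iq]])
    show "\<bar>sdiff w z x * indicator {\<delta>..} (norm z) * (e powr (- ?p) * B (z /\<^sub>R e))\<bar> \<le> C * e * \<bar>sdiff w z x * ?q z\<bar>" for z
     by (rule b2[OF e])
   qed
   also have "\<dots> = C * e * J" unfolding J_def by (rule integral_mult_right_zero)
   finally show "norm (I2 e) \<le> C * e * J" by simp
  qed
  have "((\<lambda>e. C * e * J) \<longlongrightarrow> C * 0 * J) (at_right 0)"
   by (rule tendsto_mult[OF tendsto_mult[OF tendsto_const tendsto_ident_at] tendsto_const])
  then show "((\<lambda>e. C * e * J) \<longlongrightarrow> 0) (at_right 0)" by simp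
 qed
 \<comment> \<open>The factor 1/2 comes from the symmetrisation of both integrals.\<close>
 have split: "e powr (- 2 * s) * (mass TYPE('a) * w x - mean w e x) - M / s * P e = (I1 e + I2 e) / 2" if e: "0 < e" "e < \<delta>" for e
 proof -
  let ?b = "\<lambda>z. e powr (- ?p) * B (z /\<^sub>R e)"
  have ia: "integrable lborel (\<lambda>z. sdiff w z x * avg e z)"
   by (rule symmetrized_integral(2)[OF w square_integrable_avg[OF e(1)] integral_avg(1)[OF e(1)]]) simp
  have ik: "integrable lborel (\<lambda>z. sdiff w z x * ?k e z)"
   by (rule symmetrized_integral(2)[OF w k[OF e(1)]])
  have eqb: "sdiff w z x * ?b z = e powr (- 2 * s) * (sdiff w z x * avg e z) - M / s * (sdiff w z x * ?k e z)" for z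
   unfolding Be[OF e(1), symmetric] by (simp only: right_diff_distrib mult_ac)
  have ib: "integrable lborel (\<lambda>z. sdiff w z x * ?b z)"
   unfolding eqb using ia ik by (intro Bochner_Integration.integrable_diff integrable_mult_right)
  have "(LBINT z. sdiff w z x * ?b z) = e powr (- 2 * s) * (LBINT z. sdiff w z x * avg e z) - M / s * (LBINT z. sdiff w z x * ?k e z)"
   unfolding eqb using ia ik by (simp only: Bochner_Integration.integral_diff integrable_mult_right integral_mult_right_zero)
  then have "e powr (- 2 * s) * (mass TYPE('a) * w x - mean w e x) - M / s * P e = (LBINT z. sdiff w z x * ?b z) / 2"
   unfolding mean[OF e(1)] P[OF e(1)] by (simp add: diff_divide_distrib)
  moreover have "(LBINT z. sdiff w z x * ?b z) = I1 e + I2 e"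
  proof -
   let ?f1 = "\<lambda>z. sdiff w z x * indicator {..<\<delta>} (norm z) * ?b z"
   let ?f2 = "\<lambda>z. sdiff w z x * indicator {\<delta>..} (norm z) * ?b z"
   have sp: "?f1 z = sdiff w z x * ?b z - ?f2 z" for z
    by (cases "norm z < \<delta>") (simp_all add: indicator_def)
   have if1: "integrable lborel ?f1" unfolding sp using ib i2[OF e] by (rule Bochner_Integration.integrable_diff)
   have s1: "(LBINT z. ?f1 z) = (LBINT z. sdiff w z x * ?b z) - I2 e"
    unfolding sp I2_def using ib i2[OF e] by (rule Bochner_Integration.integral_diff)
   have "(LBINT z. ?f1 z) = \<bar>e\<bar> ^ DIM('a) * (LBINT \<zeta>. ?f1 (0 + e *\<^sub>R \<zeta>))"
    using e by (intro integral_lborel_affine) auto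
   also have "\<dots> = (LBINT \<zeta>. e ^ DIM('a) * ?f1 (0 + e *\<^sub>R \<zeta>))" using e by simp
   also have "\<dots> = I1 e"
    unfolding I1_def
   proof (rule Bochner_Integration.integral_cong[OF refl])
    fix \<zeta> :: 'a
    have ee: "e ^ DIM('a) * e powr (- ?p) = e powr (- 2 * s)"
     using e by (simp add: powr_realpow[symmetric] powr_add[symmetric])
    have z: "(0 + e *\<^sub>R \<zeta>) /\<^sub>R e = \<zeta>" using e by simp
    show "e ^ DIM('a) * ?f1 (0 + e *\<^sub>R \<zeta>) = e powr (- 2 * s) * (sdiff w (e *\<^sub>R \<zeta>) x * indicator {..<\<delta>} (norm (e *\<^sub>R \<zeta>))) * B \<zeta>"
     unfolding z ee[symmetric] by (simp only: add_0 mult_ac)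
   qed
   finally show ?thesis using s1 by simp
  qed
  ultimately show ?thesis by simp
 qed
 have "((\<lambda>e. s / M * (e powr (- 2 * s) * (mass TYPE('a) * w x - mean w e x) - (I1 e + I2 e) / 2)) \<longlongrightarrow> s / M * (M * g x / (2 * s) - (0 + 0) / 2)) (at_right 0)"
  by (intro tendsto_mult tendsto_const tendsto_diff tendsto_divide tendsto_add lim1 lim2 mean_quotient[OF x, folded M_def]) simp
 then have "((\<lambda>e. s / M * (e powr (- 2 * s) * (mass TYPE('a) * w x - mean w e x) - (I1 e + I2 e) / 2)) \<longlongrightarrow> g x / 2) (at_right 0)"
  using M s0 by simp
 then have "(P \<longlongrightarrow> g x / 2) (at_right 0)"
 proof (rule Lim_transform_eventually)
  show "eventually (\<lambda>e. s / M * (e powr (- 2 * s) * (mass TYPE('a) * w x - mean w e x) - (I1 e + I2 e) / 2) = P e) (at_right 0)"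
   unfolding eventually_at_right_field
  proof (intro exI[of _ \<delta>] conjI allI impI \<delta>(1))
   fix e assume e: "0 < e" "e < \<delta>"
   have "e powr (- 2 * s) * (mass TYPE('a) * w x - mean w e x) - (I1 e + I2 e) / 2 = M / s * P e"
    using split[OF e] by linarith
   then show "s / M * (e powr (- 2 * s) * (mass TYPE('a) * w x - mean w e x) - (I1 e + I2 e) / 2) = P e"
    using M s0 by simp
  qed
 qed
 then show "((\<lambda>e. \<integral>z. (w x - w (x + z)) * ?k e z \<partial>lborel) \<longlongrightarrow> g x / 2) (at_right 0)"
  unfolding P_def .
qed

end

context frac
begin

text \<open>Shrinking the bump to a point x inside the ball makes its rescaled fractional Laplacian
  converge, on the support of u, to a nonzero multiple of K(y - x). The tested equation thus becomes
  the orthogonality to K that \<open>unique_continuation_origin\<close> requires; half the radius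
  keeps x away from the support.\<close>

lemma weak_unique_continuation:
 fixes u :: "'a::euclidean_space \<Rightarrow> real"
 assumes u: "square_integrable u" and r: "0 < r" and zero: "\<And>y. y \<in> ball x0 r \<Longrightarrow> u y = 0"
  and eq: "weak_eq (ball x0 r) u (\<lambda>_. 0)"
 shows "AE y in lborel. u y = 0"
proof -
 let ?p = "real DIM('a) + 2 * s"
 have [measurable]: "u \<in> borel_measurable borel" using u by (rule square_integrableD)
 obtain B where B: "0 < B" "\<And>y :: 'a. \<bar>ell y\<bar> \<le> B * wt y"
  by (rule ell_bound[where 'a='a]) (rule that)
 define M where "M = (LBINT y. bump (y::'a))"
 have M: "0 < M" unfolding M_def by (rule bump_mass_pos)
 obtain C where C0: "0 < C" "\<And>y :: 'a. 2 \<le> norm y \<Longrightarrow> \<bar>ell y + 2 * (LBINT y. bump (y::'a)) * kern y\<bar> \<le> C * norm y powr (- ?p - 1)"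
  by (rule ell_far[where 'a='a]) (rule that)
 note C = C0[folded M_def]
 have ker: "(LBINT y. u y * kern (y - x)) = 0" if x: "x \<in> ball x0 (r / 2)" for x
 proof -
  \<comment> \<open>As t / (1 + t) is increasing, distances of at least r / 2 are at least c times 1
    plus the distance.\<close>
  define c where "c = (r / 2) / (1 + r / 2)"
  have c: "0 < c" using r by (simp add: c_def)
  have far: "r / 2 \<le> norm (y - x)" if "u y \<noteq> 0" for y
  proof -
   have "r \<le> dist x0 y" using zero[of y] that by (metis mem_ball not_le)
   then show ?thesis using x dist_triangle[of x0 y x] by (simp add: dist_norm norm_minus_commute)
  qed
  have cfar: "c * (1 + n) \<le> n" if "r / 2 \<le> n" for n
   using that r by (simp add: c_def field_simps)
  \<comment> \<open>The normalisation e^(-n-2s) cancels the homogeneity of K in the expansion of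
    \<open>ell\<close> at infinity; the error is of order e.\<close>
  have "((\<lambda>e. \<integral>y. e powr (- ?p) * (u y * ell ((y - x) /\<^sub>R e)) \<partial>lborel) \<longlongrightarrow> (LBINT y. - 2 * M * (u y * kern (y - x)))) (at_right 0)"
  proof (rule tendsto_integral_dominated[where B="\<lambda>y. B * c powr (- ?p) * (\<bar>u y\<bar> * wt (y - x))"])
   show "integrable lborel (\<lambda>y. B * c powr (- ?p) * (\<bar>u y\<bar> * wt (y - x)))"
    by (rule integrable_mult_right[OF integrable_mult_decay[OF u dim_less]])
   fix e :: real assume "e \<in> {0<..}"
   then have e: "0 < e" by simp
   show "AE y in lborel. \<bar>e powr (- ?p) * (u y * ell ((y - x) /\<^sub>R e))\<bar> \<le> B * c powr (- ?p) * (\<bar>u y\<bar> * wt (y - x))"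
   proof (intro AE_I2)
    fix y
    show "\<bar>e powr (- ?p) * (u y * ell ((y - x) /\<^sub>R e))\<bar> \<le> B * c powr (- ?p) * (\<bar>u y\<bar> * wt (y - x))"
    proof (cases "u y = 0")
     case False
     have n: "r / 2 \<le> norm (y - x)" by (rule far[OF False])
     have n0: "0 < norm (y - x)" using n r by linarith
     have ne: "norm ((y - x) /\<^sub>R e) = norm (y - x) / e" using e by (simp add: divide_inverse mult.commute)
     have "wt ((y - x) /\<^sub>R e) \<le> norm ((y - x) /\<^sub>R e) powr (- ?p)"
      unfolding decay_def using n0 e exponent_pos[where 'a='a] by (intro powr_mono2') auto
     also have "\<dots> = norm (y - x) powr (- ?p) * e powr ?p"
      unfolding ne by (rule powr_divide_minus[OF e norm_ge_zero])
     finally have w1: "wt ((y - x) /\<^sub>R e) \<le> norm (y - x) powr (- ?p) * e powr ?p" .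
     have "norm (y - x) powr (- ?p) \<le> c powr (- ?p) * wt (y - x)"
      using kern_le_wt[OF c cfar[OF n]] by (simp only: kern_def)
     then have "norm (y - x) powr (- ?p) * e powr ?p \<le> c powr (- ?p) * wt (y - x) * e powr ?p"
      by (rule mult_right_mono) simp
     with w1 have w2: "wt ((y - x) /\<^sub>R e) \<le> c powr (- ?p) * wt (y - x) * e powr ?p" by linarith
     have "\<bar>ell ((y - x) /\<^sub>R e)\<bar> \<le> B * (c powr (- ?p) * wt (y - x) * e powr ?p)"
      by (rule order_trans[OF B(2) mult_left_mono[OF w2 less_imp_le[OF B(1)]]])
     then have "e powr (- ?p) * (\<bar>u y\<bar> * \<bar>ell ((y - x) /\<^sub>R e)\<bar>) \<le> e powr (- ?p) * (\<bar>u y\<bar> * (B * (c powr (- ?p) * wt (y - x) * e powr ?p)))"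
      by (intro mult_left_mono) auto
     also have "\<dots> = (e powr (- ?p) * e powr ?p) * (B * c powr (- ?p) * (\<bar>u y\<bar> * wt (y - x)))"
      by (simp only: mult_ac)
     also have "e powr (- ?p) * e powr ?p = 1" unfolding powr_add[symmetric] using e by simp
     finally show ?thesis by (simp only: abs_mult abs_of_nonneg[OF powr_ge_zero] mult_1)
    qed simp
   qed
  next
   show "AE y in lborel. ((\<lambda>e. e powr (- ?p) * (u y * ell ((y - x) /\<^sub>R e))) \<longlongrightarrow> - 2 * M * (u y * kern (y - x))) (at_right 0)"
   proof (intro AE_I2)
    fix y
    show "((\<lambda>e. e powr (- ?p) * (u y * ell ((y - x) /\<^sub>R e))) \<longlongrightarrow> - 2 * M * (u y * kern (y - x))) (at_right 0)"
    proof (cases "u y = 0")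
     case False
     have n: "r / 2 \<le> norm (y - x)" by (rule far[OF False])
     show ?thesis
     proof (rule LIM_zero_cancel, rule Lim_null_comparison)
      show "eventually (\<lambda>e. norm (e powr (- ?p) * (u y * ell ((y - x) /\<^sub>R e)) - - 2 * M * (u y * kern (y - x)))
       \<le> \<bar>u y\<bar> * (C * norm (y - x) powr (- (?p + 1))) * e) (at_right 0)"
       unfolding eventually_at_right_field
      proof (intro exI[of _ "r / 4"] conjI allI impI)
       fix e assume e: "0 < e" "e < r / 4"
       have ne: "norm ((y - x) /\<^sub>R e) = norm (y - x) / e" using e(1) by (simp add: divide_inverse mult.commute)
       have n2: "2 \<le> norm ((y - x) /\<^sub>R e)" unfolding ne using n e by (subst pos_le_divide_eq) linarith+
       have e3: "- ?p - 1 = - (?p + 1)" by simp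
       from C(2)[OF n2] have c1: "\<bar>ell ((y - x) /\<^sub>R e) + 2 * M * kern ((y - x) /\<^sub>R e)\<bar> \<le> C * (norm (y - x) powr (- (?p + 1)) * e powr (?p + 1))"
        unfolding e3 ne powr_divide_minus[OF e(1) norm_ge_zero] .
       have e1: "e powr (- ?p) * e powr ?p = 1" unfolding powr_add[symmetric] using e by simp
       have e2: "e powr (- ?p) * e powr (?p + 1) = e" unfolding powr_add[symmetric] using e by simp
       have "e powr (- ?p) * (u y * ell ((y - x) /\<^sub>R e)) - - 2 * M * (u y * kern (y - x))
        = u y * (e powr (- ?p) * (ell ((y - x) /\<^sub>R e) + 2 * M * kern ((y - x) /\<^sub>R e)))"
       proof -
        have k: "e powr (- ?p) * kern ((y - x) /\<^sub>R e) = kern (y - x)"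
         unfolding kern_divide[OF e(1)] mult.assoc[symmetric] e1 by (simp only: mult_1)
        have "a * (v * l) - - 2 * M * (v * K) = v * (a * (l + 2 * M * k))" if "a * k = K" for a l k K v :: real
         unfolding that[symmetric] by (simp add: algebra_simps)
        from this[OF k] show ?thesis .
       qed
       then have "norm (e powr (- ?p) * (u y * ell ((y - x) /\<^sub>R e)) - - 2 * M * (u y * kern (y - x)))
        = \<bar>u y\<bar> * (e powr (- ?p) * \<bar>ell ((y - x) /\<^sub>R e) + 2 * M * kern ((y - x) /\<^sub>R e)\<bar>)"
        by (simp only: real_norm_def abs_mult abs_of_nonneg[OF powr_ge_zero])
       also have "\<dots> \<le> \<bar>u y\<bar> * (e powr (- ?p) * (C * (norm (y - x) powr (- (?p + 1)) * e powr (?p + 1))))"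
        by (intro mult_left_mono c1) auto
       also have "\<dots> = \<bar>u y\<bar> * (C * norm (y - x) powr (- (?p + 1))) * (e powr (- ?p) * e powr (?p + 1))"
        by (simp only: mult_ac)
       finally show "norm (e powr (- ?p) * (u y * ell ((y - x) /\<^sub>R e)) - - 2 * M * (u y * kern (y - x)))
        \<le> \<bar>u y\<bar> * (C * norm (y - x) powr (- (?p + 1))) * e" unfolding e2 .
      qed (use r in simp)
      have "((\<lambda>e. \<bar>u y\<bar> * (C * norm (y - x) powr (- (?p + 1))) * e) \<longlongrightarrow> \<bar>u y\<bar> * (C * norm (y - x) powr (- (?p + 1))) * 0) (at_right 0)"
       by (rule tendsto_mult[OF tendsto_const tendsto_ident_at])
      then show "((\<lambda>e. \<bar>u y\<bar> * (C * norm (y - x) powr (- (?p + 1))) * e) \<longlongrightarrow> 0) (at_right 0)" by simp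
     qed
    qed simp
   qed
  qed measurable
  moreover have "eventually (\<lambda>e. (LBINT y. e powr (- ?p) * (u y * ell ((y - x) /\<^sub>R e))) = 0) (at_right 0)"
   unfolding eventually_at_right_field
  proof (intro exI[of _ "r / 2"] conjI allI impI)
   fix e assume e: "0 < e" "e < r / 2"
   have "cball x e \<subseteq> ball x0 r"
   proof
    fix y assume "y \<in> cball x e"
    then show "y \<in> ball x0 r" using x e dist_triangle[of x0 y x] by simp
   qed
   from weak_eqD[OF eq e(1) this] show "(LBINT y. e powr (- ?p) * (u y * ell ((y - x) /\<^sub>R e))) = 0" by simp
  qed (use r in simp)
  ultimately have "((\<lambda>e. 0) \<longlongrightarrow> (LBINT y. - 2 * M * (u y * kern (y - x)))) (at_right (0::real))"
   by (rule Lim_transform_eventually)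
  from tendsto_unique[OF trivial_limit_at_right_real this tendsto_const]
  have "(LBINT y. - 2 * M * (u y * kern (y - x))) = 0" .
  then have "- 2 * M * (LBINT y. u y * kern (y - x)) = 0" by (simp only: integral_mult_right_zero)
  then show ?thesis using M by simp
 qed
 have "AE y in lborel. u (y + x0) = 0"
 proof (rule unique_continuation_origin[where \<rho>="r / 2" and r=r and p="?p"])
  show "square_integrable (\<lambda>y. u (y + x0))" by (rule square_integrable_shift(1)[OF u])
  show "u (y + x0) = 0" if "norm y < r" for y using that by (intro zero) (simp add: dist_norm)
  fix x :: 'a assume "norm x < r / 2"
  then have "x + x0 \<in> ball x0 (r / 2)" by (simp add: dist_norm)
  from ker[OF this] have "(LBINT y. u (y + x0) * kern (y + x0 - (x + x0))) = 0"
   using integral_shift(1)[of "\<lambda>y. u y * kern (y - (x + x0))" x0] by simp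
  then show "(LBINT y. u (y + x0) * norm (x - y) powr (- ?p)) = 0"
   by (simp add: kern_def norm_minus_commute)
 qed (use r s0 in auto)
 then have "AE y in distr lborel borel (\<lambda>y. y + x0). u y = 0"
  by (subst AE_distr_iff) auto
 also have "distr lborel borel (\<lambda>y. y + x0) = lborel"
  using lborel_distr_plus[of x0] unfolding add.commute[of _ x0] .
 finally show ?thesis .
qed

end

section \<open>Products of Lebesgue measures\<close>

lemma measurable_id_lebesgue_pair:
 "(\<lambda>z. z) \<in> measurable (lebesgue \<Otimes>\<^sub>M lebesgue) (lborel \<Otimes>\<^sub>M lborel :: ('a::euclidean_space \<times> 'a) measure)"
proof -
 have m: "(\<lambda>x. x) \<in> measurable lebesgue (lborel::'a measure)" by (rule measurable_completion) simp
 have "(\<lambda>z::'a \<times> 'a. (fst z, snd z)) \<in> measurable (lebesgue \<Otimes>\<^sub>M lebesgue) (lborel \<Otimes>\<^sub>M lborel)"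
  by (intro measurable_Pair measurable_compose[OF measurable_fst m] measurable_compose[OF measurable_snd m])
 then show ?thesis by simp
qed

text \<open>The product of two completions lives on a larger sigma algebra than the Borel product,
  but the identity pushes it forward to the Borel product. Integrals of Borel functions may
  therefore be moved between the two.\<close>

lemma distr_lebesgue_pair:
 "distr (lebesgue \<Otimes>\<^sub>M lebesgue) (lborel \<Otimes>\<^sub>M lborel) (\<lambda>z. z) = (lborel \<Otimes>\<^sub>M lborel :: ('a::euclidean_space \<times> 'a) measure)"
proof -
 have m: "(\<lambda>x. x) \<in> measurable lebesgue (lborel::'a measure)" by (rule measurable_completion) simp
 have d: "distr lebesgue lborel (\<lambda>x. x) = (lborel :: 'a measure)"
  by (subst distr_completion) (simp_all add: distr_id2)
 show ?thesis
  using pair_measure_distr[OF m m] sigma_finite_lborel[where 'a='a] unfolding d by (simp add: case_prod_unfold)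
qed

lemma lebesgue_pair_borel:
 fixes F :: "'a::euclidean_space \<times> 'a \<Rightarrow> real"
 assumes F: "F \<in> borel_measurable (lborel \<Otimes>\<^sub>M lborel)"
 shows "F \<in> borel_measurable (lebesgue \<Otimes>\<^sub>M lebesgue)"
  "integrable (lebesgue \<Otimes>\<^sub>M lebesgue) F \<longleftrightarrow> integrable (lborel \<Otimes>\<^sub>M lborel) F"
  "(\<integral>z. F z \<partial>(lebesgue \<Otimes>\<^sub>M lebesgue)) = (\<integral>z. F z \<partial>(lborel \<Otimes>\<^sub>M lborel))"
 using measurable_compose[OF measurable_id_lebesgue_pair F]
  integrable_distr_eq[OF measurable_id_lebesgue_pair F, unfolded distr_lebesgue_pair]
  integral_distr[OF measurable_id_lebesgue_pair F, unfolded distr_lebesgue_pair] by simp_all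

text \<open>A null set N of exceptions yields the exceptional pairs in N x UNIV and UNIV x N, both
  null; this lets functions be changed on null sets inside the double integral.\<close>

lemma AE_lebesgue_pair:
 assumes "AE x in lebesgue. P (x::'a::euclidean_space)"
 shows "AE z in lebesgue \<Otimes>\<^sub>M lebesgue. P (fst z) \<and> P (snd z)"
proof -
 have "AE x in lborel. P x" using assms by (simp add: AE_completion_iff)
 then obtain N where N: "N \<in> null_sets lborel" "{x \<in> space lborel. \<not> P x} \<subseteq> N"
  unfolding eventually_ae_filter by auto
 then have n: "N \<times> UNIV \<union> UNIV \<times> N \<in> null_sets (lborel \<Otimes>\<^sub>M lborel)"
  by (intro null_sets.Un) (auto simp: null_sets_def lborel.emeasure_pair_measure_Times)
 have "AE z in lborel \<Otimes>\<^sub>M lborel. P (fst z) \<and> P (snd z)"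
  by (rule AE_I'[OF n]) (use N in auto)
 then have "AE z in distr (lebesgue \<Otimes>\<^sub>M lebesgue) (lborel \<Otimes>\<^sub>M lborel) (\<lambda>z. z). P (fst z) \<and> P (snd z)"
  unfolding distr_lebesgue_pair .
 from AE_distrD[OF measurable_id_lebesgue_pair this] show ?thesis .
qed

lemma frac_const_pos: "0 < s \<Longrightarrow> s < 1 \<Longrightarrow> 0 < frac_const n s"
 by (auto simp: frac_const_def intro!: divide_pos_pos mult_pos_pos Gamma_real_pos add_pos_nonneg)

section \<open>The energy space of the Robin problem\<close>

locale robin_setting = frac s for s +
 fixes \<Omega> :: "'a::euclidean_space set" and \<theta> :: "'a \<Rightarrow> real"
 assumes open_dom: "open \<Omega>" and bounded_dom: "bounded \<Omega>" and \<theta>: "\<theta> \<in> Lambda1 \<Omega>"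
begin

abbreviation "W \<equiv> W_space s \<Omega> \<theta>"

text \<open>The integration domain of the energy is absorbed into the kernel, so that plain
  integrals over the product space can be used throughout.\<close>

definition ker_cross :: "'a \<times> 'a \<Rightarrow> real"
 where "ker_cross z = kern (fst z - snd z) * indicator (- ((- \<Omega>) \<times> (- \<Omega>))) z"

definition form :: "('a \<Rightarrow> real) \<Rightarrow> ('a \<Rightarrow> real) \<Rightarrow> 'a \<times> 'a \<Rightarrow> real"
 where "form u v z = (u (fst z) - u (snd z)) * (v (fst z) - v (snd z)) * ker_cross z"

definition ext_weight :: "'a \<Rightarrow> real"
 where "ext_weight x = \<theta> x * indicator (- \<Omega>) x"

lemma fc_pos: "0 < (frac_const DIM('a) s / 2)"
 using frac_const_pos[OF s0 s1, of "DIM('a)"] by simp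

lemma dom_measurable [measurable]: "\<Omega> \<in> sets borel"
 using open_dom by simp

lemma indicator_dom_measurable [measurable]:
 "(indicator \<Omega> :: 'a \<Rightarrow> real) \<in> borel_measurable lebesgue"
 "(indicator (- \<Omega>) :: 'a \<Rightarrow> real) \<in> borel_measurable lebesgue"
 by (rule measurable_completion, simp)+

lemma ker_cross_nonneg: "0 \<le> ker_cross z"
 by (simp add: ker_cross_def kern_def)

lemma ker_cross_measurable [measurable]:
 "ker_cross \<in> borel_measurable (lborel \<Otimes>\<^sub>M lborel)"
 "ker_cross \<in> borel_measurable (lebesgue \<Otimes>\<^sub>M lebesgue)"
proof -
 have "ker_cross = (\<lambda>z. kern (fst z - snd z) * (1 - indicator (- \<Omega>) (fst z) * indicator (- \<Omega>) (snd z)))"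
  by (auto simp: fun_eq_iff ker_cross_def indicator_def)
 also have "\<dots> \<in> borel_measurable (lborel \<Otimes>\<^sub>M lborel)"
  unfolding kern_def by measurable
 finally show "ker_cross \<in> borel_measurable (lborel \<Otimes>\<^sub>M lborel)" .
 then show "ker_cross \<in> borel_measurable (lebesgue \<Otimes>\<^sub>M lebesgue)" by (rule lebesgue_pair_borel)
qed

lemma form_measurable:
 assumes "u \<in> borel_measurable lebesgue" "v \<in> borel_measurable lebesgue"
 shows "form u v \<in> borel_measurable (lebesgue \<Otimes>\<^sub>M lebesgue)"
proof -
 note [measurable] = measurable_compose[OF measurable_fst assms(1)] measurable_compose[OF measurable_snd assms(1)]
  measurable_compose[OF measurable_fst assms(2)] measurable_compose[OF measurable_snd assms(2)]
 show ?thesis unfolding form_def[abs_def] by measurable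
qed

lemma form_measurable_borel:
 assumes [measurable]: "u \<in> borel_measurable borel" "v \<in> borel_measurable borel"
 shows "form u v \<in> borel_measurable (lborel \<Otimes>\<^sub>M lborel)"
 unfolding form_def[abs_def] by measurable

lemma form_self_nonneg: "0 \<le> form u u z"
 by (simp add: form_def ker_cross_nonneg)

lemma energy_form: "energy s \<Omega> u v = (frac_const DIM('a) s / 2) * (\<integral>z. form u v z \<partial>(lebesgue \<Otimes>\<^sub>M lebesgue))"
proof -
 have "indicator (- ((- \<Omega>) \<times> (- \<Omega>))) z *\<^sub>R ((u (fst z) - u (snd z)) * (v (fst z) - v (snd z)) / norm (fst z - snd z) powr (real DIM('a) + 2 * s)) = form u v z" for z
  unfolding form_def ker_cross_def kern_def real_scaleR_def powr_minus divide_inverse by (simp only: mult_ac)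
 then show ?thesis by (simp only: energy_def set_lebesgue_integral_def)
qed

lemma ext_weight_bound: obtains a where "0 < a" "AE x in lebesgue. x \<in> - \<Omega> \<longrightarrow> a < ext_weight x"
proof -
 obtain a where "0 < a" "AE x in lebesgue. x \<in> - \<Omega> \<longrightarrow> \<theta> x - a > 0" using \<theta> by (auto simp: Lambda1_def)
 then show ?thesis by (intro that[of a]) (auto simp: ext_weight_def elim!: eventually_mono)
qed

lemma ext_weight_nonneg: "AE x in lebesgue. 0 \<le> ext_weight x"
proof -
 obtain a where "0 < a" "AE x in lebesgue. x \<in> - \<Omega> \<longrightarrow> a < ext_weight x" by (rule ext_weight_bound)
 then show ?thesis by (auto simp: ext_weight_def elim!: eventually_mono)
qed

lemma ext_weight_measurable [measurable]: "ext_weight \<in> borel_measurable lebesgue"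
proof -
 obtain a where "set_integrable lebesgue (- \<Omega>) (\<lambda>x. \<theta> x - a)" using \<theta> by (auto simp: Lambda1_def)
 then have [measurable]: "(\<lambda>x. indicator (- \<Omega>) x *\<^sub>R (\<theta> x - a)) \<in> borel_measurable lebesgue"
  unfolding set_integrable_def by (rule borel_measurable_integrable)
 have "ext_weight = (\<lambda>x. indicator (- \<Omega>) x *\<^sub>R (\<theta> x - a) + a * indicator (- \<Omega>) x)"
  by (auto simp: fun_eq_iff ext_weight_def indicator_def)
 also have "\<dots> \<in> borel_measurable lebesgue" by measurable
 finally show ?thesis .
qed

text \<open>Finiteness of the \<open>ennreal\<close> integrals becomes integrability, which is
  closed under the algebra needed for bilinear forms.\<close>

lemma W_iff:
 "u \<in> W \<longleftrightarrow> u \<in> borel_measurable lebesgue \<and> integrable (lebesgue \<Otimes>\<^sub>M lebesgue) (form u u) \<and>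
  integrable lebesgue (\<lambda>x. (u x)\<^sup>2 * indicator \<Omega> x) \<and> integrable lebesgue (\<lambda>x. (u x)\<^sup>2 * \<bar>ext_weight x\<bar>)"
proof (cases "u \<in> borel_measurable lebesgue")
 case True
 note [measurable] = True
 note [measurable] = form_measurable[OF True True]
 have int: "integrable M F \<longleftrightarrow> (\<integral>\<^sup>+x. ennreal (F x) \<partial>M) < \<infinity>" if "F \<in> borel_measurable M" "\<And>x. 0 \<le> F x"
  for M :: "'b measure" and F :: "'b \<Rightarrow> real"
  using that by (simp add: integrable_iff_bounded)
 have 1: "(\<integral>\<^sup>+z\<in>- ((- \<Omega>) \<times> (- \<Omega>)). ennreal ((u (fst z) - u (snd z))\<^sup>2
     / norm (fst z - snd z) powr (real DIM('a) + 2 * s)) \<partial>(lebesgue \<Otimes>\<^sub>M lebesgue)) = (\<integral>\<^sup>+z. ennreal (form u u z) \<partial>(lebesgue \<Otimes>\<^sub>M lebesgue))"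
 proof (rule nn_integral_cong)
  fix z
  have "(u (fst z) - u (snd z))\<^sup>2 / norm (fst z - snd z) powr (real DIM('a) + 2 * s)
   = (u (fst z) - u (snd z)) * (u (fst z) - u (snd z)) * kern (fst z - snd z)"
   unfolding kern_def powr_minus divide_inverse power2_eq_square by (simp only: mult_ac)
  then show "ennreal ((u (fst z) - u (snd z))\<^sup>2 / norm (fst z - snd z) powr (real DIM('a) + 2 * s)) * indicator (- ((- \<Omega>) \<times> (- \<Omega>))) z = ennreal (form u u z)"
   by (simp add: form_def ker_cross_def split: split_indicator)
 qed
 have 2: "(\<integral>\<^sup>+x\<in>\<Omega>. ennreal ((u x)\<^sup>2) \<partial>lebesgue) = (\<integral>\<^sup>+x. ennreal ((u x)\<^sup>2 * indicator \<Omega> x) \<partial>lebesgue)"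
  by (intro nn_integral_cong) (simp split: split_indicator)
 have 3: "(\<integral>\<^sup>+x\<in>- \<Omega>. ennreal (\<bar>\<theta> x\<bar> * (u x)\<^sup>2) \<partial>lebesgue) = (\<integral>\<^sup>+x. ennreal ((u x)\<^sup>2 * \<bar>ext_weight x\<bar>) \<partial>lebesgue)"
  by (intro nn_integral_cong) (simp add: ext_weight_def mult.commute split: split_indicator)
 have "0 < ennreal (frac_const DIM('a) s / 2)" using fc_pos by simp
 then have 4: "ennreal (frac_const DIM('a) s / 2) * I < \<infinity> \<longleftrightarrow> I < \<infinity>" for I
  by (auto simp: ennreal_mult_less_top)
 have i1: "integrable (lebesgue \<Otimes>\<^sub>M lebesgue) (form u u) \<longleftrightarrow> (\<integral>\<^sup>+z. ennreal (form u u z) \<partial>(lebesgue \<Otimes>\<^sub>M lebesgue)) < \<infinity>"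
  by (rule int) (auto simp: form_self_nonneg)
 have i2: "integrable lebesgue (\<lambda>x. (u x)\<^sup>2 * indicator \<Omega> x) \<longleftrightarrow> (\<integral>\<^sup>+x. ennreal ((u x)\<^sup>2 * indicator \<Omega> x) \<partial>lebesgue) < \<infinity>"
  by (rule int) auto
 have i3: "integrable lebesgue (\<lambda>x. (u x)\<^sup>2 * \<bar>ext_weight x\<bar>) \<longleftrightarrow> (\<integral>\<^sup>+x. ennreal ((u x)\<^sup>2 * \<bar>ext_weight x\<bar>) \<partial>lebesgue) < \<infinity>"
  by (rule int) auto
 have "W_norm_sq s \<Omega> \<theta> u < \<infinity> \<longleftrightarrow> integrable (lebesgue \<Otimes>\<^sub>M lebesgue) (form u u) \<and>
  integrable lebesgue (\<lambda>x. (u x)\<^sup>2 * indicator \<Omega> x) \<and> integrable lebesgue (\<lambda>x. (u x)\<^sup>2 * \<bar>ext_weight x\<bar>)"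
  unfolding W_norm_sq_def 1 2 3 i1 i2 i3 using 4 by (auto simp: less_top[symmetric])
 then show ?thesis using True by (simp add: W_space_def)
qed (simp add: W_space_def)

lemma W_measurable: "u \<in> W \<Longrightarrow> u \<in> borel_measurable lebesgue"
 by (simp add: W_iff)

lemma W_cong:
 assumes u: "u \<in> W" and v: "v \<in> borel_measurable lebesgue" "AE x in lebesgue. v x = u x"
 shows "v \<in> W"
proof -
 note [measurable] = W_measurable[OF u] v(1)
 have 1: "AE z in lebesgue \<Otimes>\<^sub>M lebesgue. form u u z = form v v z"
  using AE_lebesgue_pair[OF v(2)] by eventually_elim (simp add: form_def)
 have 2: "AE x in lebesgue. (u x)\<^sup>2 * indicator \<Omega> x = (v x)\<^sup>2 * indicator \<Omega> x"
  "AE x in lebesgue. (u x)\<^sup>2 * \<bar>ext_weight x\<bar> = (v x)\<^sup>2 * \<bar>ext_weight x\<bar>"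
  using v(2) by (eventually_elim, simp)+
 show ?thesis
  using u integrable_cong_AE_imp[OF _ form_measurable[OF v(1) v(1)] 1]
   integrable_cong_AE_imp[OF _ _ 2(1)] integrable_cong_AE_imp[OF _ _ 2(2)] v(1)
  by (simp add: W_iff)
qed

text \<open>The lower bound a > 0 on \<theta> in the exterior, part of \<open>Lambda1\<close>,
  controls the L2 norm there by the weighted one.\<close>

lemma W_square_integrable:
 assumes u: "u \<in> W" shows "integrable lebesgue (\<lambda>x. (u x)\<^sup>2)"
proof -
 note [measurable] = W_measurable[OF u]
 obtain a where a: "0 < a" "AE x in lebesgue. x \<in> - \<Omega> \<longrightarrow> a < ext_weight x" by (rule ext_weight_bound)
 show ?thesis
 proof (rule Bochner_Integration.integrable_bound)
  show "integrable lebesgue (\<lambda>x. (u x)\<^sup>2 * indicator \<Omega> x + (u x)\<^sup>2 * \<bar>ext_weight x\<bar> / a)"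
   using u by (intro Bochner_Integration.integrable_add integrable_divide) (auto simp: W_iff)
  show "AE x in lebesgue. norm ((u x)\<^sup>2) \<le> norm ((u x)\<^sup>2 * indicator \<Omega> x + (u x)\<^sup>2 * \<bar>ext_weight x\<bar> / a)"
   using a(2)
  proof eventually_elim
   fix x assume x: "x \<in> - \<Omega> \<longrightarrow> a < ext_weight x"
   show "norm ((u x)\<^sup>2) \<le> norm ((u x)\<^sup>2 * indicator \<Omega> x + (u x)\<^sup>2 * \<bar>ext_weight x\<bar> / a)"
   proof (cases "x \<in> \<Omega>")
    case False
    then have "1 \<le> \<bar>ext_weight x\<bar> / a" using x a(1) by simp
    then have "(u x)\<^sup>2 * 1 \<le> (u x)\<^sup>2 * (\<bar>ext_weight x\<bar> / a)" by (rule mult_left_mono) simp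
    then show ?thesis using False a(1) by simp
   qed (simp add: ext_weight_def)
  qed
 qed measurable
qed

lemma W_integrable:
 assumes u: "u \<in> W" and v: "v \<in> W"
 shows "integrable (lebesgue \<Otimes>\<^sub>M lebesgue) (form u v)"
  "integrable lebesgue (\<lambda>x. u x * v x * ext_weight x)"
  "integrable lebesgue (\<lambda>x. u x * v x * indicator \<Omega> x)"
proof -
 note [measurable] = W_measurable[OF u] W_measurable[OF v]
 note [measurable] = measurable_compose[OF measurable_fst W_measurable[OF u]] measurable_compose[OF measurable_snd W_measurable[OF u]]
  measurable_compose[OF measurable_fst W_measurable[OF v]] measurable_compose[OF measurable_snd W_measurable[OF v]]
 have "integrable (lebesgue \<Otimes>\<^sub>M lebesgue) (\<lambda>z. (u (fst z) - u (snd z)) * (v (fst z) - v (snd z)) * ker_cross z)"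
  using u v by (intro integrable_mult_of_squares) (auto simp: W_iff form_def[abs_def] power2_eq_square ker_cross_nonneg)
 then show "integrable (lebesgue \<Otimes>\<^sub>M lebesgue) (form u v)" by (simp add: form_def[abs_def])
 have "integrable lebesgue (\<lambda>x. u x * v x * \<bar>ext_weight x\<bar>)"
  using u v by (intro integrable_mult_of_squares) (auto simp: W_iff)
 then show "integrable lebesgue (\<lambda>x. u x * v x * ext_weight x)"
  by (rule Bochner_Integration.integrable_bound) (auto simp: abs_mult)
 show "integrable lebesgue (\<lambda>x. u x * v x * indicator \<Omega> x)"
  using u v by (intro integrable_mult_of_squares) (auto simp: W_iff)
qed

lemma W_diff:
 assumes u: "u \<in> W" and v: "v \<in> W" shows "(\<lambda>x. u x - v x) \<in> W"
proof -
 note [measurable] = W_measurable[OF u] W_measurable[OF v]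
 have e: "form (\<lambda>x. u x - v x) (\<lambda>x. u x - v x) z = form u u z - 2 * form u v z + form v v z" for z
  unfolding form_def by (simp add: algebra_simps)
 have e2: "(u x - v x)\<^sup>2 * k = (u x)\<^sup>2 * k - 2 * (u x * v x * k) + (v x)\<^sup>2 * k" for x k
  by (simp add: power2_eq_square algebra_simps)
 have 3: "integrable lebesgue (\<lambda>x. u x * v x * \<bar>ext_weight x\<bar>)"
  using W_integrable(2)[OF u v] by (rule Bochner_Integration.integrable_bound) (auto simp: abs_mult)
 show ?thesis
  unfolding W_iff e[abs_def] e2 using u v W_integrable[OF u v] 3
  by (auto simp: W_iff intro!: Bochner_Integration.integrable_add Bochner_Integration.integrable_diff integrable_mult_right)
qed

text \<open>Two exterior points give a zero factor as soon as one of the functions vanishes in the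
  exterior, so the restricted kernel may be replaced by the full one and whole-space identities
  apply.\<close>

lemma form_full:
 assumes "(\<forall>x\<in>- \<Omega>. u x = 0) \<or> (\<forall>x\<in>- \<Omega>. v x = 0)"
 shows "form u v z = (u (fst z) - u (snd z)) * (v (fst z) - v (snd z)) * kern (fst z - snd z)"
 using assms by (auto simp: form_def ker_cross_def indicator_def mem_Times_iff)

text \<open>Bounded functions of bounded support need only finite energy: local integrability of
  \<theta> controls the exterior term on the compact part of the exterior that meets the
  support.\<close>

lemma W_I_borel:
 assumes [measurable]: "v \<in> borel_measurable borel" and B: "\<And>x. \<bar>v x\<bar> \<le> B" "\<And>x. R < norm x \<Longrightarrow> v x = 0"
  and f: "integrable (lborel \<Otimes>\<^sub>M lborel) (form v v)"
 shows "v \<in> W"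
proof -
 have vm [measurable]: "v \<in> borel_measurable lebesgue" by (rule measurable_completion) simp
 define K where "K = cball 0 R \<inter> - \<Omega>"
 have "compact K" unfolding K_def using open_dom by (intro compact_Int_closed) auto
 then have K: "set_integrable lebesgue K \<theta>" using \<theta> by (auto simp: Lambda1_def K_def)
 have B2: "(v x)\<^sup>2 \<le> B\<^sup>2" for x using B(1)[of x] by (metis abs_ge_zero power2_abs power_mono)
 have 1: "integrable lebesgue (\<lambda>x. (v x)\<^sup>2 * indicator \<Omega> x)"
 proof (rule Bochner_Integration.integrable_bound)
  have "integrable lborel (indicator \<Omega> :: 'a \<Rightarrow> real)"
   using emeasure_bounded_finite[OF bounded_dom] by (intro integrable_real_indicator) auto
  then show "integrable lebesgue (\<lambda>x. B\<^sup>2 * indicator \<Omega> x :: real)"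
   by (intro integrable_mult_right) (simp add: integrable_completion)
  show "AE x in lebesgue. norm ((v x)\<^sup>2 * indicator \<Omega> x) \<le> norm (B\<^sup>2 * indicator \<Omega> x)"
   using B2 by (intro AE_I2) (auto simp: indicator_def)
 qed measurable
 have 2: "integrable lebesgue (\<lambda>x. (v x)\<^sup>2 * \<bar>ext_weight x\<bar>)"
 proof (rule Bochner_Integration.integrable_bound)
  show "integrable lebesgue (\<lambda>x. B\<^sup>2 * (indicator K x *\<^sub>R \<theta> x))"
   using K unfolding set_integrable_def by (rule integrable_mult_right)
  show "AE x in lebesgue. norm ((v x)\<^sup>2 * \<bar>ext_weight x\<bar>) \<le> norm (B\<^sup>2 * (indicator K x *\<^sub>R \<theta> x))"
  proof (intro AE_I2)
   fix x
   show "norm ((v x)\<^sup>2 * \<bar>ext_weight x\<bar>) \<le> norm (B\<^sup>2 * (indicator K x *\<^sub>R \<theta> x))"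
    using B(2)[of x] mult_right_mono[OF B2[of x], of "\<bar>\<theta> x\<bar>"]
    by (cases "R < norm x") (auto simp: K_def ext_weight_def abs_mult indicator_def)
  qed
 qed measurable
 have "integrable (lebesgue \<Otimes>\<^sub>M lebesgue) (form v v)"
  using f lebesgue_pair_borel(2)[OF form_measurable_borel[of v v]] by simp
 then show ?thesis using vm 1 2 by (simp add: W_iff)
qed

lemma form_lborel_full:
 assumes u: "u \<in> W" "u \<in> borel_measurable borel" and v: "v \<in> W" "v \<in> borel_measurable borel"
  and z: "(\<forall>x\<in>- \<Omega>. u x = 0) \<or> (\<forall>x\<in>- \<Omega>. v x = 0)"
 shows "integrable (lborel \<Otimes>\<^sub>M lborel) (\<lambda>(x, y). (u x - u y) * (v x - v y) * kern (x - y))"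
  "(\<integral>z. form u v z \<partial>(lebesgue \<Otimes>\<^sub>M lebesgue)) = (\<integral>(x, y). (u x - u y) * (v x - v y) * kern (x - y) \<partial>(lborel \<Otimes>\<^sub>M lborel))"
 using W_integrable(1)[OF u(1) v(1)] lebesgue_pair_borel(2,3)[OF form_measurable_borel[OF u(2) v(2)]]
 by (simp_all add: form_full[OF z, abs_def] case_prod_unfold)

lemma sbump_W: assumes t: "0 < t" shows "sbump x t \<in> W"
proof (rule W_I_borel[where B=1 and R="norm x + t"])
 show "sbump x t y = 0" if "norm x + t < norm y" for y
 proof (rule sbump_zero[OF t])
  show "t \<le> dist x y" using that norm_triangle_ineq2[of y x] by (simp add: dist_norm norm_minus_commute)
 qed
 show "integrable (lborel \<Otimes>\<^sub>M lborel) (form (sbump x t) (sbump x t))"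
 proof (rule Bochner_Integration.integrable_bound[OF sbump_energy_integrable[OF t, of x]])
  show "AE z in lborel \<Otimes>\<^sub>M lborel. norm (form (sbump x t) (sbump x t) z) \<le> norm (case z of (xa, y) \<Rightarrow> (sbump x t xa - sbump x t y)\<^sup>2 * kern (xa - y))"
   by (intro AE_I2) (auto simp: form_def ker_cross_def indicator_def power2_eq_square)
 qed (rule form_measurable_borel; simp)
qed (auto simp: sbump_nonneg sbump_le_1)

lemma square_integrable_W:
 assumes "u \<in> W" "u \<in> borel_measurable borel" shows "square_integrable u"
 using W_square_integrable[OF assms(1)] assms(2) by (simp add: square_integrable_def integrable_completion)

text \<open>Two uses share the statement: bumps inside \<Omega> for the interior equation, and
  arbitrary bumps against a function vanishing in the exterior for unique continuation.\<close>

lemma weak_form_sbump: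
 assumes u: "u \<in> W" "u \<in> borel_measurable borel" and t: "0 < t"
  and z: "(\<forall>x\<in>- \<Omega>. u x = 0) \<or> cball x t \<subseteq> \<Omega>"
 shows "(\<integral>z. form u (sbump x t) z \<partial>(lebesgue \<Otimes>\<^sub>M lebesgue)) = t powr (- 2 * s) * (LBINT y. u y * ell ((y - x) /\<^sub>R t))"
proof -
 have z': "(\<forall>y\<in>- \<Omega>. u y = 0) \<or> (\<forall>y\<in>- \<Omega>. sbump x t y = 0)"
  using z by (auto intro!: sbump_zero[OF t] simp: subset_eq not_le[symmetric])
 note f = form_lborel_full[OF u sbump_W[OF t] sbump_measurable z']
 show ?thesis unfolding f(2) by (rule form_sbump[OF square_integrable_W[OF u] t f(1)])
qed

end

text \<open>A smooth convex substitute for the absolute value and its derivative, for Kato's inequality.\<close>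

definition soft_abs :: "real \<Rightarrow> real" where "soft_abs r = sqrt (1 + r\<^sup>2) - 1"

definition soft_sgn :: "real \<Rightarrow> real" where "soft_sgn r = r / sqrt (1 + r\<^sup>2)"

lemma sqrt_one_plus_pos: "0 < sqrt (1 + (r::real)\<^sup>2)"
 by (simp add: add_pos_nonneg)

text \<open>Cauchy-Schwarz for the plane vectors (1, a) and (1, b).\<close>

lemma one_plus_mult_le: "1 + a * b \<le> sqrt (1 + a\<^sup>2) * sqrt (1 + (b::real)\<^sup>2)"
proof -
 have "0 \<le> (a - b)\<^sup>2" by simp
 then have "(1 + a * b)\<^sup>2 \<le> (1 + a\<^sup>2) * (1 + b\<^sup>2)" by (simp add: power2_eq_square algebra_simps)
 then have "1 + a * b \<le> sqrt ((1 + a\<^sup>2) * (1 + b\<^sup>2))" by (rule real_le_rsqrt)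
 then show ?thesis by (simp add: real_sqrt_mult)
qed

lemma soft_abs_convex: "soft_abs a - soft_abs b \<le> (a - b) * soft_sgn a"
proof -
 let ?A = "sqrt (1 + a\<^sup>2)" and ?B = "sqrt (1 + b\<^sup>2)"
 have A: "0 < ?A" by (rule sqrt_one_plus_pos)
 have "?A * ?A = \<bar>1 + a\<^sup>2\<bar>" by (rule real_sqrt_mult_self)
 also have "\<dots> = 1 + a\<^sup>2" by (rule abs_of_nonneg) simp
 finally have AA: "?A * ?A = 1 + a\<^sup>2" .
 have "(?A - ?B) * ?A = 1 + a\<^sup>2 - ?A * ?B" unfolding left_diff_distrib AA by (simp only: mult.commute)
 moreover have "(a - b) * a = a\<^sup>2 - a * b" by (simp add: power2_eq_square algebra_simps)
 ultimately have "(?A - ?B) * ?A \<le> (a - b) * a" using one_plus_mult_le[of a b] by linarith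
 then have "?A - ?B \<le> (a - b) * a / ?A" using A by (simp only: pos_le_divide_eq)
 then show ?thesis by (simp add: soft_abs_def soft_sgn_def)
qed

lemma soft_sgn_abs_le_1: "\<bar>soft_sgn r\<bar> \<le> 1"
proof -
 have "\<bar>r\<bar> \<le> sqrt (1 + r\<^sup>2)" by (rule real_le_rsqrt) simp
 then show ?thesis using sqrt_one_plus_pos[of r] by (simp add: soft_sgn_def)
qed

lemma soft_abs_lipschitz: "\<bar>soft_abs a - soft_abs b\<bar> \<le> \<bar>a - b\<bar>"
proof -
 have *: "soft_abs a - soft_abs b \<le> \<bar>a - b\<bar>" for a b
 proof -
  have "(a - b) * soft_sgn a \<le> \<bar>(a - b) * soft_sgn a\<bar>" by (rule abs_ge_self)
  also have "\<dots> \<le> \<bar>a - b\<bar>" using mult_left_mono[OF soft_sgn_abs_le_1[of a], of "\<bar>a - b\<bar>"] by (simp add: abs_mult)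
  finally show ?thesis using soft_abs_convex[of a b] by linarith
 qed
 show ?thesis using *[of a b] *[of b a] by linarith
qed

lemma abs_le_soft_abs: "\<bar>r\<bar> \<le> soft_abs r + 1"
proof -
 have "\<bar>r\<bar> \<le> sqrt (1 + r\<^sup>2)" by (rule real_le_rsqrt) simp
 then show ?thesis by (simp add: soft_abs_def)
qed

lemma soft_abs_bound: "\<bar>soft_abs r\<bar> \<le> \<bar>r\<bar>"
 using soft_abs_lipschitz[of r 0] by (simp add: soft_abs_def)

text \<open>\<open>soft_sgn r\<close> is a coordinate of the radial projection of the point (1, r)
  to the unit circle. Such points have norm at least 1, where this projection does not increase
  distances. In the proof D is the squared distance of the projections, and A, B are the norms of
  the points.\<close>

lemma soft_sgn_lipschitz: "\<bar>soft_sgn a - soft_sgn b\<bar> \<le> \<bar>a - b\<bar>"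
proof -
 have "\<bar>a / A - b / B\<bar> \<le> \<bar>a - b\<bar>"
  if A: "1 \<le> A" "1 \<le> B" and sq: "A\<^sup>2 = 1 + a\<^sup>2" "B\<^sup>2 = 1 + b\<^sup>2" and ab: "1 + a * b \<le> A * B" for A B
 proof -
  have AB: "1 \<le> A * B" using mult_mono[of 1 A 1 B] A by simp
  define D where "D = 2 - 2 * ((1 + a * b) / (A * B))"
  have "(1 + a * b) / (A * B) \<le> 1" using ab AB by simp
  then have D0: "0 \<le> D" unfolding D_def by linarith
  have id: "(a * X - b * Y)\<^sup>2 = (a\<^sup>2 + 1) * X\<^sup>2 + (b\<^sup>2 + 1) * Y\<^sup>2 - 2 * ((1 + a * b) * (X * Y)) - (X - Y)\<^sup>2" for X Y :: real
   by (simp add: power2_eq_square algebra_simps)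
  have "a\<^sup>2 + 1 = A\<^sup>2" "b\<^sup>2 + 1 = B\<^sup>2" unfolding sq by simp_all
  then have "(a\<^sup>2 + 1) * (1 / A)\<^sup>2 = 1" "(b\<^sup>2 + 1) * (1 / B)\<^sup>2 = 1" using A by (simp_all only: power_divide) simp_all
  then have "(a * (1 / A) - b * (1 / B))\<^sup>2 = D - (1 / A - 1 / B)\<^sup>2" unfolding id by (simp add: D_def)
  then have 1: "(a / A - b / B)\<^sup>2 \<le> D" by simp
  have "D * 1 \<le> D * (A * B)" by (rule mult_left_mono[OF AB D0])
  also have "D * (A * B) = 2 * (A * B) - 2 * (1 + a * b)" 
  proof -
   have "(2 - 2 * (c / p)) * p = 2 * p - 2 * c" if "p \<noteq> 0" for c p :: real using that by (simp add: left_diff_distrib)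
   from this[of "A * B" "1 + a * b"] AB show ?thesis unfolding D_def by linarith
  qed
  also have "\<dots> \<le> A\<^sup>2 + B\<^sup>2 - 2 * (1 + a * b)" using sum_squares_bound[of A B] by simp
  also have "\<dots> = (a - b)\<^sup>2" unfolding sq by (simp add: power2_eq_square algebra_simps)
  finally have "(a / A - b / B)\<^sup>2 \<le> (a - b)\<^sup>2" using 1 by linarith
  then show ?thesis by (simp only: abs_le_square_iff)
 qed
 moreover have "(sqrt (1 + r\<^sup>2))\<^sup>2 = 1 + r\<^sup>2" for r :: real by (rule real_sqrt_pow2) simp
 ultimately show ?thesis unfolding soft_sgn_def using one_plus_mult_le[of a b] by simp
qed

lemma soft_measurable [measurable]:
 "soft_abs \<in> borel_measurable borel" "soft_sgn \<in> borel_measurable borel"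
 unfolding soft_abs_def[abs_def] soft_sgn_def[abs_def] by measurable

text \<open>The subtracted 1 in \<open>soft_abs\<close> makes it vanish at 0, so it is dominated by
  the absolute value and stays in L2. The price is the additive 1 in
  \<open>abs_le_soft_abs\<close>.\<close>

lemma square_integrable_soft_abs:
 assumes u: "square_integrable u" shows "square_integrable (\<lambda>y. soft_abs (u y))"
proof -
 have [measurable]: "u \<in> borel_measurable borel" using u by (rule square_integrableD)
 have "(soft_abs r)\<^sup>2 \<le> r\<^sup>2" for r using soft_abs_bound[of r] by (simp only: abs_le_square_iff)
 then have "integrable lborel (\<lambda>y. (soft_abs (u y))\<^sup>2)"
  by (intro Bochner_Integration.integrable_bound[OF square_integrableD(2)[OF u]]) auto
 then show ?thesis by (simp add: square_integrable_def)
qed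

lemma borel_representative:
 fixes u :: "'a::euclidean_space \<Rightarrow> real"
 assumes "u \<in> borel_measurable lebesgue"
 obtains v where "v \<in> borel_measurable borel" "AE x in lebesgue. v x = u x"
proof -
 obtain v where v: "v \<in> borel_measurable lborel" "AE x in lborel. u x = v x"
  using completion_ex_borel_measurable_real[OF assms] by blast
 from AE_completion[OF v(2)] have "AE x in lebesgue. v x = u x" by eventually_elim simp
 then show ?thesis using v(1) by (intro that) simp_all
qed

context robin_setting
begin

text \<open>The test function of Kato's inequality. Both factors are bounded by 1 and
  \<open>soft_sgn\<close> is Lipschitz, so the energy density is controlled by those of the bump and
  of u.\<close>

lemma cutoff_soft_sgn_W:
 assumes u: "u \<in> W" "u \<in> borel_measurable borel" and t: "0 < t"
 shows "(\<lambda>y. sbump x t y * soft_sgn (u y)) \<in> W"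
proof -
 note [measurable] = u(2)
 let ?v = "\<lambda>y. sbump x t y * soft_sgn (u y)"
 have vm: "?v \<in> borel_measurable borel" by measurable
 show ?thesis
 proof (rule W_I_borel[OF vm, where B=1 and R="norm x + t"])
  show "\<bar>?v y\<bar> \<le> 1" for y
   using mult_mono[OF sbump_le_1[of x t y] soft_sgn_abs_le_1[of "u y"]] sbump_nonneg[of x t y] by (simp add: abs_mult)
  show "?v y = 0" if "norm x + t < norm y" for y
  proof -
   have "t \<le> dist x y" using that norm_triangle_ineq2[of y x] by (simp add: dist_norm norm_minus_commute)
   then show ?thesis using sbump_zero[OF t, of x y] by simp
  qed
  have fu: "integrable (lborel \<Otimes>\<^sub>M lborel) (form u u)"
   using u lebesgue_pair_borel(2)[OF form_measurable_borel[OF u(2) u(2)]] by (simp add: W_iff)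
  show "integrable (lborel \<Otimes>\<^sub>M lborel) (form ?v ?v)"
  proof (rule Bochner_Integration.integrable_bound[OF Bochner_Integration.integrable_add[OF
     integrable_mult_right[OF sbump_energy_integrable[OF t, of x], of 2] integrable_mult_right[OF fu, of 2]]])
   show "form ?v ?v \<in> borel_measurable (lborel \<Otimes>\<^sub>M lborel)" by (rule form_measurable_borel[OF vm vm])
   have "norm (form ?v ?v (a, b)) \<le> norm (2 * ((sbump x t a - sbump x t b)\<^sup>2 * kern (a - b)) + 2 * form u u (a, b))" for a b
   proof -
    \<comment> \<open>The increment of the product, split by changing one factor at a time.\<close>
    let ?d = "(sbump x t a - sbump x t b) * soft_sgn (u a)" and ?e = "sbump x t b * (soft_sgn (u a) - soft_sgn (u b))"
    have "\<bar>?d\<bar> \<le> \<bar>sbump x t a - sbump x t b\<bar>"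
     using mult_left_mono[OF soft_sgn_abs_le_1[of "u a"], of "\<bar>sbump x t a - sbump x t b\<bar>"] by (simp add: abs_mult)
    then have d: "?d\<^sup>2 \<le> (sbump x t a - sbump x t b)\<^sup>2" by (simp only: abs_le_square_iff)
    have "\<bar>?e\<bar> \<le> 1 * \<bar>soft_sgn (u a) - soft_sgn (u b)\<bar>"
     unfolding abs_mult by (intro mult_right_mono) (auto simp: sbump_le_1 sbump_nonneg)
    then have "\<bar>?e\<bar> \<le> \<bar>u a - u b\<bar>" unfolding mult_1 by (rule order_trans[OF _ soft_sgn_lipschitz])
    then have e: "?e\<^sup>2 \<le> (u a - u b)\<^sup>2" by (simp only: abs_le_square_iff)
    have "?v a - ?v b = ?d + ?e" by (simp add: algebra_simps)
    then have "(?v a - ?v b)\<^sup>2 \<le> 2 * ?d\<^sup>2 + 2 * ?e\<^sup>2"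
     using sum_squares_bound[of ?d ?e] by (simp only: power2_sum)
    then have "(?v a - ?v b)\<^sup>2 \<le> 2 * (sbump x t a - sbump x t b)\<^sup>2 + 2 * (u a - u b)\<^sup>2" using d e by linarith
    then have "(?v a - ?v b)\<^sup>2 * ker_cross (a, b) \<le> (2 * (sbump x t a - sbump x t b)\<^sup>2 + 2 * (u a - u b)\<^sup>2) * ker_cross (a, b)"
     by (rule mult_right_mono[OF _ ker_cross_nonneg])
    moreover have "(sbump x t a - sbump x t b)\<^sup>2 * ker_cross (a, b) \<le> (sbump x t a - sbump x t b)\<^sup>2 * kern (a - b)"
     by (intro mult_left_mono) (auto simp: ker_cross_def indicator_def kern_nonneg)
    moreover have "form ?v ?v (a, b) = (?v a - ?v b)\<^sup>2 * ker_cross (a, b)" "form u u (a, b) = (u a - u b)\<^sup>2 * ker_cross (a, b)"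
     by (simp_all add: form_def power2_eq_square)
    ultimately have "form ?v ?v (a, b) \<le> 2 * ((sbump x t a - sbump x t b)\<^sup>2 * kern (a - b)) + 2 * form u u (a, b)"
     by (simp add: distrib_right)
    then show ?thesis using form_self_nonneg[of ?v "(a, b)"] by simp
   qed
   then show "AE z in lborel \<Otimes>\<^sub>M lborel. norm (form ?v ?v z) \<le> norm (2 * (case z of (a, b) \<Rightarrow> (sbump x t a - sbump x t b)\<^sup>2 * kern (a - b)) + 2 * form u u z)"
    by (intro AE_I2) (auto simp: split_paired_all)
  qed
 qed
qed

end

section \<open>Weak solutions: uniqueness, interior regularity and Kato's inequality\<close>

locale robin_problem = robin_setting s \<Omega> \<theta> for s and \<Omega> :: "'a::euclidean_space set" and \<theta> +
 fixes q :: "'a \<Rightarrow> real" and q0 :: real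
 assumes q_cont: "continuous_on (closure \<Omega>) q" and q0: "0 < q0" and q_ge: "\<And>x. x \<in> \<Omega> \<Longrightarrow> q0 \<le> q x"
begin

definition pot :: "'a \<Rightarrow> real" where "pot x = q x * indicator \<Omega> x"

lemma q_cont_dom: "continuous_on \<Omega> q"
 using q_cont closure_subset by (rule continuous_on_subset)

lemma pot_measurable [measurable]: "pot \<in> borel_measurable borel" "pot \<in> borel_measurable lebesgue"
proof -
 have "(\<lambda>x. indicator \<Omega> x *\<^sub>R q x) \<in> borel_measurable borel"
  by (rule borel_measurable_continuous_on_indicator[OF _ q_cont_dom]) simp
 then show "pot \<in> borel_measurable borel" by (simp add: pot_def[abs_def] mult.commute)
 then show "pot \<in> borel_measurable lebesgue" by (intro measurable_completion) simp
qed

lemma pot_nonneg: "0 \<le> pot x"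
 using q_ge[of x] q0 by (cases "x \<in> \<Omega>") (auto simp: pot_def)

lemma pot_bound: obtains Q where "0 \<le> Q" "\<And>x. \<bar>pot x\<bar> \<le> Q * indicator \<Omega> x"
proof -
 have "bounded (q ` closure \<Omega>)"
  by (intro compact_imp_bounded compact_continuous_image[OF q_cont]) (simp add: bounded_dom)
 then obtain Q where Q: "\<And>x. x \<in> closure \<Omega> \<Longrightarrow> \<bar>q x\<bar> \<le> Q" by (auto simp: bounded_iff)
 then show ?thesis
  by (intro that[of "max 0 Q"]) (auto simp: pot_def indicator_def max.coboundedI2 closure_subset[THEN subsetD])
qed

lemma robin_solution_iff: "robin_solution s \<Omega> \<theta> q f u \<longleftrightarrow> u \<in> W \<and>
  (\<forall>v\<in>W. (frac_const DIM('a) s / 2) * (\<integral>z. form u v z \<partial>(lebesgue \<Otimes>\<^sub>M lebesgue)) + (\<integral>x. u x * v x * pot x \<partial>lebesgue)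
   + (\<integral>x. u x * v x * ext_weight x \<partial>lebesgue) = (\<integral>x. v x * (f x * indicator (- \<Omega>) x) \<partial>lebesgue))"
proof -
 have 1: "indicator \<Omega> x * (q x * a * b) = a * b * pot x" for a b x by (simp add: pot_def)
 have 2: "indicator (- \<Omega>) x * (\<theta> x * a * b) = a * b * ext_weight x" for a b x by (simp add: ext_weight_def)
 have 3: "indicator (- \<Omega>) x * (f x * b) = b * (f x * indicator (- \<Omega>) x)" for b x by simp
 show ?thesis unfolding robin_solution_def energy_form set_lebesgue_integral_def real_scaleR_def 1 2 3 ..
qed

lemma pot_integrable:
 assumes u: "u \<in> W" and v: "v \<in> W" shows "integrable lebesgue (\<lambda>x. u x * v x * pot x)"
proof -
 note [measurable] = W_measurable[OF u] W_measurable[OF v]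
 obtain Q where Q: "0 \<le> Q" "\<And>x. \<bar>pot x\<bar> \<le> Q * indicator \<Omega> x" by (rule pot_bound) (rule that)
 show ?thesis
 proof (rule Bochner_Integration.integrable_bound[OF integrable_mult_right[OF integrable_abs[OF W_integrable(3)[OF u v]], of Q]])
  show "AE x in lebesgue. norm (u x * v x * pot x) \<le> norm (Q * \<bar>u x * v x * indicator \<Omega> x\<bar>)"
  proof (intro AE_I2)
   fix x
   have "\<bar>u x * v x\<bar> * \<bar>pot x\<bar> \<le> \<bar>u x * v x\<bar> * (Q * indicator \<Omega> x)" by (intro mult_left_mono Q) simp
   then show "norm (u x * v x * pot x) \<le> norm (Q * \<bar>u x * v x * indicator \<Omega> x\<bar>)"
    using Q(1) by (simp add: abs_mult mult_ac)
  qed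
 qed measurable
qed

lemma robin_solution_cong:
 assumes u: "robin_solution s \<Omega> \<theta> q f u" and v: "v \<in> borel_measurable lebesgue" "AE x in lebesgue. v x = u x"
 shows "robin_solution s \<Omega> \<theta> q f v"
 unfolding robin_solution_iff
proof (intro conjI ballI)
 have uW: "u \<in> W" using u by (simp add: robin_solution_iff)
 show "v \<in> W" by (rule W_cong[OF uW v])
 fix w assume w: "w \<in> W"
 note [measurable] = W_measurable[OF uW] W_measurable[OF w] v(1)
 have 1: "(\<integral>z. form v w z \<partial>(lebesgue \<Otimes>\<^sub>M lebesgue)) = (\<integral>z. form u w z \<partial>(lebesgue \<Otimes>\<^sub>M lebesgue))"
 proof (rule integral_cong_AE)
  show "AE z in lebesgue \<Otimes>\<^sub>M lebesgue. form v w z = form u w z"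
   using AE_lebesgue_pair[OF v(2)] by eventually_elim (simp add: form_def)
 qed (rule form_measurable; simp)+
 have 2: "(\<integral>x. v x * w x * k x \<partial>lebesgue) = (\<integral>x. u x * w x * k x \<partial>lebesgue)" if [measurable]: "k \<in> borel_measurable lebesgue" for k
  by (rule integral_cong_AE) (use v(2) in \<open>auto elim: eventually_mono\<close>)
 show "(frac_const DIM('a) s / 2) * (\<integral>z. form v w z \<partial>(lebesgue \<Otimes>\<^sub>M lebesgue)) + (\<integral>x. v x * w x * pot x \<partial>lebesgue)
   + (\<integral>x. v x * w x * ext_weight x \<partial>lebesgue) = (\<integral>x. w x * (f x * indicator (- \<Omega>) x) \<partial>lebesgue)"
  unfolding 1 2[OF pot_measurable(2)] 2[OF ext_weight_measurable] using u w by (simp add: robin_solution_iff)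
qed

text \<open>Tested with itself, the difference of two solutions makes three nonnegative terms sum to
  zero. The potential is positive in \<Omega> and the weight is positive almost everywhere outside,
  so the two zeroth order terms alone force the difference to vanish.\<close>

lemma robin_solution_unique:
 assumes u: "robin_solution s \<Omega> \<theta> q f u" and v: "robin_solution s \<Omega> \<theta> q f v"
 shows "AE x in lebesgue. u x = v x"
proof -
 let ?d = "\<lambda>x. u x - v x"
 have uW: "u \<in> W" and vW: "v \<in> W" using u v by (simp_all add: robin_solution_iff)
 have d: "?d \<in> W" by (rule W_diff[OF uW vW])
 have 1: "(\<integral>z. form ?d ?d z \<partial>(lebesgue \<Otimes>\<^sub>M lebesgue)) = (\<integral>z. form u ?d z \<partial>(lebesgue \<Otimes>\<^sub>M lebesgue)) - (\<integral>z. form v ?d z \<partial>(lebesgue \<Otimes>\<^sub>M lebesgue))"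
  unfolding Bochner_Integration.integral_diff[OF W_integrable(1)[OF uW d] W_integrable(1)[OF vW d], symmetric]
  by (rule Bochner_Integration.integral_cong) (simp_all add: form_def algebra_simps)
 have 2: "(\<integral>x. ?d x * ?d x * k x \<partial>lebesgue) = (\<integral>x. u x * ?d x * k x \<partial>lebesgue) - (\<integral>x. v x * ?d x * k x \<partial>lebesgue)"
  if "integrable lebesgue (\<lambda>x. u x * ?d x * k x)" "integrable lebesgue (\<lambda>x. v x * ?d x * k x)" for k
  unfolding Bochner_Integration.integral_diff[OF that, symmetric]
  by (rule Bochner_Integration.integral_cong) (simp_all only: left_diff_distrib)
 note P = 2[OF pot_integrable[OF uW d] pot_integrable[OF vW d]]
 note E = 2[OF W_integrable(2)[OF uW d] W_integrable(2)[OF vW d]]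
 have eq: "(frac_const DIM('a) s / 2) * (\<integral>z. form ?d ?d z \<partial>(lebesgue \<Otimes>\<^sub>M lebesgue)) + (\<integral>x. ?d x * ?d x * pot x \<partial>lebesgue)
   + (\<integral>x. ?d x * ?d x * ext_weight x \<partial>lebesgue) = 0"
  using u v d unfolding robin_solution_iff 1 P E right_diff_distrib[of "frac_const DIM('a) s / 2"] by fastforce
 have F0: "0 \<le> (frac_const DIM('a) s / 2) * (\<integral>z. form ?d ?d z \<partial>(lebesgue \<Otimes>\<^sub>M lebesgue))"
  using fc_pos by (intro mult_nonneg_nonneg Bochner_Integration.integral_nonneg form_self_nonneg) simp
 have p: "AE x in lebesgue. 0 \<le> ?d x * ?d x * pot x" by (intro AE_I2 mult_nonneg_nonneg[OF zero_le_square pot_nonneg])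
 have e: "AE x in lebesgue. 0 \<le> ?d x * ?d x * ext_weight x"
  using ext_weight_nonneg by eventually_elim (simp only: mult_nonneg_nonneg zero_le_square)
 have P0: "(\<integral>x. ?d x * ?d x * pot x \<partial>lebesgue) = 0" and E0: "(\<integral>x. ?d x * ?d x * ext_weight x \<partial>lebesgue) = 0"
  using eq F0 integral_nonneg_AE[OF p] integral_nonneg_AE[OF e] by linarith+
 obtain a where a: "0 < a" "AE x in lebesgue. x \<in> - \<Omega> \<longrightarrow> a < ext_weight x" by (rule ext_weight_bound)
 have "AE x in lebesgue. ?d x * ?d x * pot x = 0" "AE x in lebesgue. ?d x * ?d x * ext_weight x = 0"
  using integral_nonneg_eq_0_iff_AE[OF pot_integrable[OF d d] p] P0
   integral_nonneg_eq_0_iff_AE[OF W_integrable(2)[OF d d] e] E0 by simp_all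
 then show ?thesis using a(2)
 proof eventually_elim
  fix x assume x: "?d x * ?d x * pot x = 0" "?d x * ?d x * ext_weight x = 0" "x \<in> - \<Omega> \<longrightarrow> a < ext_weight x"
  have "pot x \<noteq> 0 \<or> ext_weight x \<noteq> 0"
   using x(3) a(1) q_ge[of x] q0 by (cases "x \<in> \<Omega>") (auto simp: pot_def)
  then show "u x = v x" using x(1,2) by auto
 qed
qed

lemma interior_test:
 assumes u: "robin_solution s \<Omega> \<theta> q f u" and v: "v \<in> W" "\<And>x. x \<in> - \<Omega> \<Longrightarrow> v x = 0"
 shows "(frac_const DIM('a) s / 2) * (\<integral>z. form u v z \<partial>(lebesgue \<Otimes>\<^sub>M lebesgue)) + (\<integral>x. u x * v x * pot x \<partial>lebesgue) = 0"
proof -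
 have 1: "u x * v x * ext_weight x = 0" "v x * (f x * indicator (- \<Omega>) x) = 0" for x
  using v(2)[of x] by (cases "x \<in> \<Omega>"; simp add: ext_weight_def)+
 have "(frac_const DIM('a) s / 2) * (\<integral>z. form u v z \<partial>(lebesgue \<Otimes>\<^sub>M lebesgue)) + (\<integral>x. u x * v x * pot x \<partial>lebesgue)
   + (\<integral>x. u x * v x * ext_weight x \<partial>lebesgue) = (\<integral>x. v x * (f x * indicator (- \<Omega>) x) \<partial>lebesgue)"
  using u v(1) by (simp add: robin_solution_iff)
 then show ?thesis unfolding 1 by simp
qed

text \<open>Divided by half the normalising constant, the prefactor of the energy, so that the
  equation reads \<open>flap u\<close> = \<open>source u\<close>.\<close>

definition source :: "('a \<Rightarrow> real) \<Rightarrow> 'a \<Rightarrow> real"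
 where "source u x = - (pot x * u x / (frac_const DIM('a) s / 2))"

lemma robin_weak_eq:
 assumes u: "robin_solution s \<Omega> \<theta> q f u" "u \<in> borel_measurable borel"
 shows "weak_eq \<Omega> u (source u)"
 unfolding weak_eq_def
proof (intro allI impI)
 note [measurable] = u(2)
 have uW: "u \<in> W" using u(1) by (simp add: robin_solution_iff)
 fix x t assume t: "0 < t" "cball x t \<subseteq> \<Omega>"
 let ?C = "frac_const DIM('a) s / 2" and ?I = "\<integral>y. u y * ell ((y - x) /\<^sub>R t) \<partial>lborel"
 have z: "sbump x t y = 0" if "y \<in> - \<Omega>" for y
  using that t by (intro sbump_zero[OF t(1)]) (auto simp: subset_eq not_le[symmetric])
 have "(\<integral>y. u y * sbump x t y * pot y \<partial>lebesgue) = (LBINT y. u y * sbump x t y * pot y)"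
  by (rule integral_completion) measurable
 then have "?C * (t powr (- 2 * s) * ?I) + (LBINT y. u y * sbump x t y * pot y) = 0"
  using interior_test[OF u(1) sbump_W[OF t(1)] z] weak_form_sbump[OF uW u(2) t(1), of x] t(2) by simp
 moreover have "X = - (J / c)" if "c * X + J = 0" "0 < c" for X J c :: real
 proof -
  have "X = c * X / c" using that by simp
  also have "c * X = - J" using that by linarith
  finally show ?thesis by simp
 qed
 ultimately have "t powr (- 2 * s) * ?I = - ((LBINT y. u y * sbump x t y * pot y) / ?C)" using fc_pos by blast
 also have "\<dots> = (LBINT y. source u y * sbump x t y)"
 proof -
  have "- (a * b / c) * d = (- 1 / c) * (b * d * a)" for a b c d :: real by (simp add: divide_inverse mult_ac)
  then have "(LBINT y. source u y * sbump x t y) = (- 1 / ?C) * (LBINT y. u y * sbump x t y * pot y)"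
   by (simp only: source_def integral_mult_right_zero)
  then show ?thesis by simp
 qed
 finally have e: "t powr (- 2 * s) * ?I = (LBINT y. source u y * sbump x t y)" .
 have "t powr (2 * s) * (t powr (- 2 * s) * ?I) = ?I"
  using t(1) by (simp add: mult.assoc[symmetric] powr_add[symmetric])
 then show "?I = t powr (2 * s) * (LBINT y. source u y * sbump x t y)" unfolding e ..
qed

text \<open>Kato's inequality: by convexity the form of \<open>soft_abs\<close> of u with the bump
  is at most that of u with the bump times \<open>soft_sgn\<close> of u. The latter product is an
  admissible test function, and the potential gives the sign.\<close>

lemma soft_abs_subsolution:
 assumes u: "robin_solution s \<Omega> \<theta> q f u" "u \<in> borel_measurable borel" and t: "0 < t" "cball x t \<subseteq> \<Omega>"
 shows "(LBINT y. soft_abs (u y) * ell ((y - x) /\<^sub>R t)) \<le> 0"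
proof -
 note [measurable] = u(2)
 have uW: "u \<in> W" using u(1) by (simp add: robin_solution_iff)
 let ?p = "sbump x t" and ?v = "\<lambda>y. sbump x t y * soft_sgn (u y)" and ?h = "\<lambda>y. soft_abs (u y)"
 have z: "?p y = 0" if "y \<in> - \<Omega>" for y
  using that t by (intro sbump_zero[OF t(1)]) (auto simp: subset_eq not_le[symmetric])
 have vW: "?v \<in> W" by (rule cutoff_soft_sgn_W[OF uW u(2) t(1)])
 have vm: "?v \<in> borel_measurable borel" by measurable
 have h: "square_integrable ?h" by (rule square_integrable_soft_abs[OF square_integrable_W[OF uW u(2)]])
 have i1: "integrable (lborel \<Otimes>\<^sub>M lborel) (\<lambda>(a, b). (u a - u b) * (?p a - ?p b) * kern (a - b))"
  by (rule form_lborel_full(1)[OF uW u(2) sbump_W[OF t(1)] sbump_measurable]) (use z in auto)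
 have i2: "integrable (lborel \<Otimes>\<^sub>M lborel) (\<lambda>(a, b). (u a - u b) * (?v a - ?v b) * kern (a - b))"
  and f2: "(\<integral>z. form u ?v z \<partial>(lebesgue \<Otimes>\<^sub>M lebesgue)) = (\<integral>(a, b). (u a - u b) * (?v a - ?v b) * kern (a - b) \<partial>(lborel \<Otimes>\<^sub>M lborel))"
  by (rule form_lborel_full[OF uW u(2) vW vm]; use z in auto)+
 have i3: "integrable (lborel \<Otimes>\<^sub>M lborel) (\<lambda>(a, b). (?h a - ?h b) * (?p a - ?p b) * kern (a - b))"
 proof (rule Bochner_Integration.integrable_bound[OF i1])
  show "AE c in lborel \<Otimes>\<^sub>M lborel. norm (case c of (a, b) \<Rightarrow> (?h a - ?h b) * (?p a - ?p b) * kern (a - b))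
   \<le> norm (case c of (a, b) \<Rightarrow> (u a - u b) * (?p a - ?p b) * kern (a - b))"
   by (intro AE_I2) (auto simp: abs_mult split_paired_all intro!: mult_right_mono soft_abs_lipschitz)
 qed (unfold kern_def, measurable)
 have "t powr (- 2 * s) * (LBINT y. ?h y * ell ((y - x) /\<^sub>R t)) = (\<integral>(a, b). (?h a - ?h b) * (?p a - ?p b) * kern (a - b) \<partial>(lborel \<Otimes>\<^sub>M lborel))"
  by (rule form_sbump[OF h t(1) i3, symmetric])
 \<comment> \<open>Convexity at a, weighted by the bump at a, plus convexity at b, weighted by the
   bump at b; both weights are nonnegative.\<close>
 also have "\<dots> \<le> (\<integral>(a, b). (u a - u b) * (?v a - ?v b) * kern (a - b) \<partial>(lborel \<Otimes>\<^sub>M lborel))"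
 proof (rule integral_mono[OF i3 i2])
  fix c :: "'a \<times> 'a"
  obtain a b where c: "c = (a, b)" by fastforce
  have "(?h a - ?h b) * ?p a \<le> ((u a - u b) * soft_sgn (u a)) * ?p a"
   by (intro mult_right_mono soft_abs_convex sbump_nonneg)
  moreover have "(?h b - ?h a) * ?p b \<le> ((u b - u a) * soft_sgn (u b)) * ?p b"
   by (intro mult_right_mono soft_abs_convex sbump_nonneg)
  ultimately have "(?h a - ?h b) * (?p a - ?p b) \<le> (u a - u b) * (?v a - ?v b)"
   by (simp add: algebra_simps)
  then show "(case c of (a, b) \<Rightarrow> (?h a - ?h b) * (?p a - ?p b) * kern (a - b)) \<le> (case c of (a, b) \<Rightarrow> (u a - u b) * (?v a - ?v b) * kern (a - b))"
   by (simp add: c mult_right_mono kern_nonneg)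
 qed
 \<comment> \<open>By the equation this form equals a negative multiple of the integral of u times
   the test function times the potential, and r \<open>soft_sgn r\<close> is never negative.\<close>
 also have "\<dots> \<le> 0"
 proof -
  have "0 \<le> u y * ?v y * pot y" for y
  proof -
   have "0 \<le> u y * soft_sgn (u y)" by (simp add: soft_sgn_def)
   then have "0 \<le> (u y * soft_sgn (u y)) * (?p y * pot y)"
    by (rule mult_nonneg_nonneg[OF _ mult_nonneg_nonneg[OF sbump_nonneg pot_nonneg]])
   then show ?thesis by (simp only: mult_ac)
  qed
  then have "0 \<le> (\<integral>y. u y * ?v y * pot y \<partial>lebesgue)" by (rule Bochner_Integration.integral_nonneg)
  then have "(frac_const DIM('a) s / 2) * (\<integral>z. form u ?v z \<partial>(lebesgue \<Otimes>\<^sub>M lebesgue)) \<le> 0"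
   using interior_test[OF u(1) vW] z by force
  then show ?thesis unfolding f2[symmetric] using fc_pos by (simp only: mult_le_0_iff) linarith
 qed
 finally show ?thesis using t(1) by (simp add: mult_le_0_iff)
qed

lemma solution_locally_bounded:
 assumes u: "robin_solution s \<Omega> \<theta> q f u" "u \<in> borel_measurable borel" and x: "x \<in> \<Omega>"
 shows "\<exists>r>0. \<exists>B. AE y in lborel. y \<in> ball x r \<longrightarrow> \<bar>u y\<bar> \<le> B"
proof -
 note [measurable] = u(2)
 have uW: "u \<in> W" using u(1) by (simp add: robin_solution_iff)
 obtain R where R: "0 < R" "ball x R \<subseteq> \<Omega>" using open_dom x by (auto simp: open_contains_ball)
 have h: "square_integrable (\<lambda>y. soft_abs (u y))"
  by (rule square_integrable_soft_abs[OF square_integrable_W[OF uW u(2)]])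
 obtain B where "AE y in lborel. y \<in> ball x (R / 2) \<longrightarrow> soft_abs (u y) \<le> B"
 proof (rule subsolution_locally_bounded[OF h])
  show "0 < R / 2" using R by simp
  fix x' t assume "0 < t" "cball x' t \<subseteq> ball x (2 * (R / 2))"
  then show "(LBINT y. soft_abs (u y) * ell ((y - x') /\<^sub>R t)) \<le> 0"
   using R(2) by (intro soft_abs_subsolution[OF u]) auto
 qed (rule that)
 then have "AE y in lborel. y \<in> ball x (R / 2) \<longrightarrow> \<bar>u y\<bar> \<le> B + 1"
 proof eventually_elim
  fix y assume "y \<in> ball x (R / 2) \<longrightarrow> soft_abs (u y) \<le> B"
  then show "y \<in> ball x (R / 2) \<longrightarrow> \<bar>u y\<bar> \<le> B + 1" using abs_le_soft_abs[of "u y"] by linarith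
 qed
 then show ?thesis using R(1) by (intro exI[of _ "R / 2"]) auto
qed

text \<open>u is modified on null sets twice, first to a Borel function and then to the limit of its
  averages inside \<Omega>; weak solutions are insensitive to both changes.\<close>

lemma continuous_solution:
 assumes u: "robin_solution s \<Omega> \<theta> q f u"
 obtains w where "robin_solution s \<Omega> \<theta> q f w" "w \<in> borel_measurable borel" "AE x in lebesgue. w x = u x"
  "pointwise_solution s \<Omega> w (source w)"
proof -
 have uW: "u \<in> W" using u by (simp add: robin_solution_iff)
 obtain U where U: "U \<in> borel_measurable borel" "AE x in lebesgue. U x = u x"
  by (rule borel_representative[OF W_measurable[OF uW]])
 note [measurable] = U(1)
 have Ul: "U \<in> borel_measurable lebesgue" using U(1) by (intro measurable_completion) simp
 have solU: "robin_solution s \<Omega> \<theta> q f U" by (rule robin_solution_cong[OF u Ul U(2)])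
 have UW: "U \<in> W" using solU by (simp add: robin_solution_iff)
 obtain Q where Q: "0 \<le> Q" "\<And>x. \<bar>pot x\<bar> \<le> Q * indicator \<Omega> x" by (rule pot_bound) (rule that)
 have sm: "source U \<in> borel_measurable borel" unfolding source_def[abs_def] by measurable
 have loc: "\<exists>r>0. \<exists>B. AE y in lborel. y \<in> ball x r \<longrightarrow> \<bar>source U y\<bar> \<le> B" if x: "x \<in> \<Omega>" for x
 proof -
  obtain r B where r: "0 < r" "AE y in lborel. y \<in> ball x r \<longrightarrow> \<bar>U y\<bar> \<le> B"
   using solution_locally_bounded[OF solU U(1) x] by blast
  from r(2) have "AE y in lborel. y \<in> ball x r \<longrightarrow> \<bar>source U y\<bar> \<le> Q * B / (frac_const DIM('a) s / 2)"
  proof eventually_elim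
   fix y assume y: "y \<in> ball x r \<longrightarrow> \<bar>U y\<bar> \<le> B"
   show "y \<in> ball x r \<longrightarrow> \<bar>source U y\<bar> \<le> Q * B / (frac_const DIM('a) s / 2)"
   proof
    assume yb: "y \<in> ball x r"
    have "\<bar>pot y\<bar> \<le> Q" using Q(2)[of y] Q(1) by (cases "y \<in> \<Omega>") auto
    then have "\<bar>pot y\<bar> * \<bar>U y\<bar> \<le> Q * B" using y yb Q(1) by (intro mult_mono) auto
    then have "\<bar>pot y\<bar> * \<bar>U y\<bar> / (frac_const DIM('a) s / 2) \<le> Q * B / (frac_const DIM('a) s / 2)"
     using fc_pos by (intro divide_right_mono) auto
    moreover have "\<bar>source U y\<bar> = \<bar>pot y\<bar> * \<bar>U y\<bar> / (frac_const DIM('a) s / 2)"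
     using frac_const_pos[OF s0 s1, of "DIM('a)"] by (simp add: source_def abs_mult)
    ultimately show "\<bar>source U y\<bar> \<le> Q * B / (frac_const DIM('a) s / 2)" by simp
   qed
  qed
  then show ?thesis using r(1) by blast
 qed
 obtain w where w: "continuous_on \<Omega> w" "AE y in lborel. y \<in> \<Omega> \<longrightarrow> w y = U y"
  "\<And>x. x \<in> \<Omega> \<Longrightarrow> ((\<lambda>e. mean U e x) \<longlongrightarrow> mass TYPE('a) * w x) (at_right 0)"
  by (rule continuous_representative[OF square_integrable_W[OF UW U(1)] open_dom sm loc robin_weak_eq[OF solU U(1)]], assumption) (rule that)
 \<comment> \<open>The limit of averages is meaningful in \<Omega> only; outside, the Borel version
   is kept. V agrees with U almost everywhere, hence has the same averages, and
   \<open>mean_lim\<close> carries over.\<close>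
 define V where "V x = (if x \<in> \<Omega> then w x else U x)" for x
 have Vm [measurable]: "V \<in> borel_measurable borel"
 proof -
  have [measurable]: "(\<lambda>x. indicator \<Omega> x *\<^sub>R w x) \<in> borel_measurable borel"
   by (rule borel_measurable_continuous_on_indicator[OF _ w(1)]) simp
  have "V = (\<lambda>x. indicator \<Omega> x *\<^sub>R w x + indicator (- \<Omega>) x * U x)" by (auto simp: V_def indicator_def fun_eq_iff)
  also have "\<dots> \<in> borel_measurable borel" by measurable
  finally show ?thesis .
 qed
 have VU: "AE x in lborel. V x = U x" using w(2) by eventually_elim (simp add: V_def)
 have Vl: "V \<in> borel_measurable lebesgue" by (intro measurable_completion) simp
 have VU': "AE x in lebesgue. V x = U x" by (rule AE_completion[OF VU])
 have solV: "robin_solution s \<Omega> \<theta> q f V" by (rule robin_solution_cong[OF solU Vl VU'])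
 have VW: "V \<in> W" using solV by (simp add: robin_solution_iff)
 have Vw: "V x = w x" if "x \<in> \<Omega>" for x using that by (simp add: V_def)
 have Vc: "continuous_on \<Omega> V" using w(1) Vw by (simp cong: continuous_on_cong)
 have "pointwise_solution s \<Omega> V (source V)"
 proof
  show "square_integrable V" by (rule square_integrable_W[OF VW Vm])
  show "source V \<in> borel_measurable borel" unfolding source_def[abs_def] by measurable
  have "continuous_on \<Omega> (\<lambda>x. - (q x * V x / (frac_const DIM('a) s / 2)))"
   by (intro continuous_intros q_cont_dom Vc) (use fc_pos in auto)
  then show "continuous_on \<Omega> (source V)"
   by (rule continuous_on_eq) (simp add: source_def pot_def)
  show "weak_eq \<Omega> V (source V)" by (rule robin_weak_eq[OF solV Vm])
  fix x assume x: "x \<in> \<Omega>"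
  have "mean V e x = mean U e x" for e
   unfolding mean_def using VU by (intro integral_cong_AE) (auto elim: eventually_mono)
  then show "((\<lambda>e. mean V e x) \<longlongrightarrow> mass TYPE('a) * V x) (at_right 0)" using w(3)[OF x] Vw[OF x] by simp
 qed (rule open_dom, rule Vc)
 moreover have "AE x in lebesgue. V x = u x" using VU' U(2) by eventually_elim simp
 ultimately show ?thesis using solV Vm by (intro that)
qed

end

section \<open>The pointwise formula, unique continuation from the exterior, and
  reconstruction\<close>

lemma frac_laplacian_eq:
 assumes "has_frac_laplacian s u x l" shows "frac_laplacian s u x = l"
 unfolding frac_laplacian_def
proof (rule the_equality[of "has_frac_laplacian s u x", OF assms])
 fix l' assume "has_frac_laplacian s u x l'"
 with assms show "l' = l"
  unfolding has_frac_laplacian_def by (blast intro: tendsto_unique[OF trivial_limit_at_right_real])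
qed

context pointwise_solution
begin

lemma has_frac_laplacian:
 assumes x: "x \<in> \<Omega>"
 shows "has_frac_laplacian s w x (frac_const DIM('a) s * (g x / 2))"
proof -
 let ?F = "\<lambda>e z. (w x - w (x + z)) * (kern z * indicator {e..} (norm z))"
 let ?G = "\<lambda>e y. indicator (- ball x e) y *\<^sub>R ((w x - w y) / norm (x - y) powr (real DIM('a) + 2 * s))"
 have G: "?G e = (\<lambda>y. ?F e (y - x))" for e
 proof
  fix y
  have "norm (y - x) powr (- (real DIM('a) + 2 * s)) = inverse (norm (x - y) powr (real DIM('a) + 2 * s))"
   by (simp only: powr_minus norm_minus_commute)
  then show "?G e y = ?F e (y - x)"
   by (cases "y \<in> ball x e") (simp_all add: kern_def dist_norm norm_minus_commute divide_inverse)
 qed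
 have F: "integrable lborel (?F e)" if "0 < e" for e by (rule principal_value(1)[OF x that])
 have Fm: "?F e \<in> borel_measurable borel" if "0 < e" for e using F[OF that] by (simp add: borel_measurable_integrable)
 have Gm: "(\<lambda>y. ?F e (y - x)) \<in> borel_measurable lborel" if "0 < e" for e
  using measurable_compose[OF _ Fm[OF that], of "\<lambda>y. y - x" borel] by simp
 have i: "integrable lebesgue (?G e)" "(\<integral>y. ?G e y \<partial>lebesgue) = (LBINT z. ?F e z)" if "0 < e" for e
  unfolding G integrable_completion[OF Gm[OF that]] integral_completion[OF Gm[OF that]]
  using F[OF that] integrable_shift(2)[OF Fm[OF that], of x] integral_shift(2)[OF Fm[OF that], of x] by simp_all
 have "((\<lambda>e. frac_const DIM('a) s * (LBINT z. ?F e z)) \<longlongrightarrow> frac_const DIM('a) s * (g x / 2)) (at_right 0)"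
  by (rule tendsto_mult[OF tendsto_const principal_value(2)[OF x]])
 moreover have "eventually (\<lambda>e. frac_const DIM('a) s * (LBINT z. ?F e z) = frac_const DIM('a) s * (\<integral>y. ?G e y \<partial>lebesgue)) (at_right 0)"
  unfolding eventually_at_right_field by (intro exI[of _ 1] conjI allI impI) (simp_all only: i zero_less_one)
 ultimately have "((\<lambda>e. frac_const DIM('a) s * (\<integral>y. ?G e y \<partial>lebesgue)) \<longlongrightarrow> frac_const DIM('a) s * (g x / 2)) (at_right 0)"
  by (rule Lim_transform_eventually)
 then show ?thesis
  using i(1) unfolding has_frac_laplacian_def set_integrable_def set_lebesgue_integral_def by blast
qed

end

context robin_setting
begin

lemma lipschitz_W:
 assumes g: "L-lipschitz_on UNIV g" "\<And>x. 0 \<le> g x" "\<And>x. g x \<le> 1" "\<And>x. g x \<noteq> 0 \<Longrightarrow> norm x < R"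
 shows "g \<in> W" "g \<in> borel_measurable borel"
proof -
 have g1: "\<bar>g x\<bar> \<le> 1" for x using g(2,3)[of x] by simp
 show m: "g \<in> borel_measurable borel"
  using square_integrableD(1)[OF test_function_integrable(1)[OF g(1) g1 g(4)]] .
 have supp: "g x = 0" if "R \<le> dist 0 x" for x using g(4)[of x] that by (auto simp: not_less[symmetric])
 have lip: "\<bar>g x - g y\<bar> \<le> L * norm (x - y)" for x y
  using lipschitz_onD[OF g(1), of x y] by (simp add: dist_norm)
 show "g \<in> W"
 proof (rule W_I_borel[OF m g1, where R=R])
  show "g x = 0" if "R < norm x" for x using supp[of x] that by simp
  show "integrable (lborel \<Otimes>\<^sub>M lborel) (form g g)"
  proof (rule Bochner_Integration.integrable_bound[OF lipschitz_energy_integrable[where l=R and a=0, OF m lip g(2,3) supp]])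
   show "AE z in lborel \<Otimes>\<^sub>M lborel. norm (form g g z) \<le> norm (case z of (x, y) \<Rightarrow> (g x - g y)\<^sup>2 * kern (x - y))"
    by (intro AE_I2) (auto simp: form_def ker_cross_def indicator_def power2_eq_square)
  qed (assumption, rule form_measurable_borel[OF m m])
 qed
qed

text \<open>Because \<Omega> is bounded there is a ball outside it, and bumps supported there are
  admissible tests. On that ball both d and its tested fractional Laplacian vanish.\<close>

lemma exterior_unique_continuation:
 assumes d: "d \<in> W" "d \<in> borel_measurable borel" "\<And>x. x \<in> - \<Omega> \<Longrightarrow> d x = 0"
  and eq: "\<And>v. v \<in> W \<Longrightarrow> (\<And>x. x \<in> \<Omega> \<Longrightarrow> v x = 0) \<Longrightarrow> (\<integral>z. form d v z \<partial>(lebesgue \<Otimes>\<^sub>M lebesgue)) = 0"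
 shows "AE x in lborel. d x = 0"
proof -
 obtain R where R: "0 < R" "\<Omega> \<subseteq> ball 0 R" using bounded_subset_ballD[OF bounded_dom, of 0] by auto
 obtain b :: 'a where b: "b \<in> Basis" using nonempty_Basis by blast
 \<comment> \<open>At distance R + 1 from the origin the unit ball misses the ball of radius R that
   contains \<Omega>.\<close>
 define x0 where "x0 = (R + 1) *\<^sub>R b"
 have n0: "norm x0 = R + 1" using b R by (simp add: x0_def)
 have out: "y \<notin> \<Omega>" if "y \<in> ball x0 1" for y
 proof
  assume "y \<in> \<Omega>"
  then have "norm y < R" using R(2) by (auto simp: subset_eq)
  then show False using that n0 dist_triangle[of x0 0 y] by simp
 qed
 show ?thesis
 proof (rule weak_unique_continuation[OF square_integrable_W[OF d(1,2)] zero_less_one, of x0])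
  show "d y = 0" if "y \<in> ball x0 1" for y using out[OF that] d(3) by simp
  show "weak_eq (ball x0 1) d (\<lambda>_. 0)"
   unfolding weak_eq_def
  proof (intro allI impI)
   fix x :: 'a and t :: real assume t: "0 < t" "cball x t \<subseteq> ball x0 1"
   have "sbump x t y = 0" if "y \<in> \<Omega>" for y
   proof (rule sbump_zero[OF t(1)], rule ccontr)
    assume "\<not> t \<le> dist x y"
    then have "y \<in> cball x t" by simp
    with t(2) out[of y] that show False by blast
   qed
   then have "t powr (- 2 * s) * (LBINT y. d y * ell ((y - x) /\<^sub>R t)) = 0"
    using eq[OF sbump_W[OF t(1), of x]] weak_form_sbump[OF d(1,2) t(1), of x] d(3) by simp
   then show "(LBINT y. d y * ell ((y - x) /\<^sub>R t)) = t powr (2 * s) * (LBINT y. 0 * sbump x t y)"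
    using t(1) by simp
  qed
 qed
qed

end

context robin_problem
begin

lemma exterior_test:
 assumes u: "robin_solution s \<Omega> \<theta> q f u" and v: "v \<in> W" "\<And>x. x \<in> \<Omega> \<Longrightarrow> v x = 0"
 shows "(frac_const DIM('a) s / 2) * (\<integral>z. form u v z \<partial>(lebesgue \<Otimes>\<^sub>M lebesgue)) + (\<integral>x. u x * v x * ext_weight x \<partial>lebesgue)
  = (\<integral>x. v x * (f x * indicator (- \<Omega>) x) \<partial>lebesgue)"
proof -
 have 1: "u x * v x * pot x = 0" for x using v(2)[of x] by (cases "x \<in> \<Omega>") (simp_all add: pot_def)
 have "(frac_const DIM('a) s / 2) * (\<integral>z. form u v z \<partial>(lebesgue \<Otimes>\<^sub>M lebesgue)) + (\<integral>x. u x * v x * pot x \<partial>lebesgue)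
   + (\<integral>x. u x * v x * ext_weight x \<partial>lebesgue) = (\<integral>x. v x * (f x * indicator (- \<Omega>) x) \<partial>lebesgue)"
  using u v(1) by (simp add: robin_solution_iff)
 then show ?thesis unfolding 1 by simp
qed

text \<open>Where w vanishes so does q w, so the equation makes the tested fractional Laplacian
  vanish on the same ball and unique continuation gives w = 0. Then every term of the weak
  formulation except the one with f is zero, and Lipschitz test functions show f = 0.\<close>

lemma zero_data_if_zero_on_ball:
 assumes w: "robin_solution s \<Omega> \<theta> q f w" "w \<in> borel_measurable borel"
  and B: "0 < r" "ball x0 r \<subseteq> \<Omega>" "\<And>y. y \<in> ball x0 r \<Longrightarrow> w y = 0" and f: "L2_on (- \<Omega>) f"
 shows "AE x in lebesgue. x \<in> - \<Omega> \<longrightarrow> f x = 0"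
proof -
 have wW: "w \<in> W" using w(1) by (simp add: robin_solution_iff)
 have "weak_eq (ball x0 r) w (\<lambda>_. 0)"
  unfolding weak_eq_def
 proof (intro allI impI)
  fix x t assume t: "0 < t" "cball x t \<subseteq> ball x0 r"
  have z: "source w y * sbump x t y = 0" for y
  proof (cases "y \<in> ball x0 r")
   case False
   then have "sbump x t y = 0" using t by (intro sbump_zero[OF t(1)]) (auto simp: subset_eq not_le[symmetric])
   then show ?thesis by simp
  qed (simp add: source_def B(3))
  have "cball x t \<subseteq> \<Omega>" using t(2) B(2) by blast
  from weak_eqD[OF robin_weak_eq[OF w] t(1) this, unfolded z]
  show "(LBINT y. w y * ell ((y - x) /\<^sub>R t)) = t powr (2 * s) * (LBINT y. 0 * sbump x t y)" by simp
 qed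
 from weak_unique_continuation[OF square_integrable_W[OF wW w(2)] B(1,3) this]
 have w0: "AE x in lebesgue. w x = 0" by (intro AE_completion)
 let ?f = "\<lambda>x. f x * indicator (- \<Omega>) x"
 have zero: "(\<integral>x. v x * ?f x \<partial>lebesgue) = 0" if v: "v \<in> W" for v
 proof -
  have "AE z in lebesgue \<Otimes>\<^sub>M lebesgue. form w v z = 0"
   using AE_lebesgue_pair[OF w0] by eventually_elim (simp add: form_def)
  note 1 = integral_eq_zero_AE[OF this]
  have "AE x in lebesgue. w x * v x * k x = 0" for k using w0 by eventually_elim simp
  note 2 = integral_eq_zero_AE[OF this]
  from w(1)[unfolded robin_solution_iff, THEN conjunct2, rule_format, OF v, unfolded 1 2]
  show ?thesis by simp
 qed
 have fm: "?f \<in> borel_measurable lebesgue"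
  using f by (simp add: L2_on_def set_borel_measurable_def mult.commute)
 obtain h where h [measurable]: "h \<in> borel_measurable borel" and hf: "AE x in lebesgue. h x = ?f x"
  by (rule borel_representative[OF fm])
 have hl [measurable]: "h \<in> borel_measurable lebesgue" by (rule measurable_completion) simp
 note [measurable] = fm
 have "indicator (- \<Omega>) x *\<^sub>R (f x)\<^sup>2 = (?f x)\<^sup>2" for x by (simp add: indicator_def)
 then have "integrable lebesgue (\<lambda>x. (?f x)\<^sup>2)" using f by (simp add: L2_on_def set_integrable_def)
 then have "integrable lebesgue (\<lambda>x. (h x)\<^sup>2)"
  by (rule integrable_cong_AE_imp) (use hf in \<open>auto elim: eventually_mono\<close>)
 then have "square_integrable h" by (simp add: square_integrable_def integrable_completion)
 note loc = square_integrable_imp_loc[OF this, of 0]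
 have test: "(LBINT x. h x * g x) = 0"
  if "L-lipschitz_on UNIV g" "\<And>x. 0 \<le> g x" "\<And>x. g x \<le> 1" "\<And>x. g x \<noteq> 0 \<Longrightarrow> x \<in> UNIV \<and> norm x < R" for g L R
 proof -
  have gs: "norm x < R" if "g x \<noteq> 0" for x using \<open>\<And>x. g x \<noteq> 0 \<Longrightarrow> x \<in> UNIV \<and> norm x < R\<close> that by blast
  note g = lipschitz_W[OF that(1-3) gs]
  note [measurable] = g(2) W_measurable[OF g(1)]
  have "(LBINT x. h x * g x) = (\<integral>x. h x * g x \<partial>lebesgue)" by (rule integral_completion[symmetric]) measurable
  also have "\<dots> = (\<integral>x. g x * ?f x \<partial>lebesgue)"
   by (rule integral_cong_AE) (use hf in \<open>auto elim: eventually_mono\<close>)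
  finally show ?thesis using zero[OF g(1)] by simp
 qed
 have "AE x in lborel. x \<in> UNIV \<longrightarrow> h x \<le> 0"
  by (rule AE_nonpos_of_lipschitz_test[OF open_UNIV h loc]) (use test in \<open>blast intro: eq_refl\<close>)
 moreover have "AE x in lborel. x \<in> UNIV \<longrightarrow> - h x \<le> 0"
 proof (rule AE_nonpos_of_lipschitz_test[OF open_UNIV])
  show "integrable lborel (\<lambda>x. - h x * indicator (ball 0 R) x)" for R using loc[of R] by simp
  fix g :: "'a \<Rightarrow> real" and L R
  assume "L-lipschitz_on UNIV g" "\<And>x. 0 \<le> g x" "\<And>x. g x \<le> 1" "\<And>x. g x \<noteq> 0 \<Longrightarrow> x \<in> UNIV \<and> norm x < R"
  from test[OF this] show "(LBINT x. - h x * g x) \<le> 0" by simp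
 qed measurable
 ultimately have "AE x in lborel. h x = 0" by eventually_elim simp
 then have "AE x in lebesgue. h x = 0" by (rule AE_completion)
 with hf show ?thesis by eventually_elim (auto simp: indicator_def)
qed

text \<open>Off the zeros of w the quotient equals q, so its limit along such points is q(x) by
  continuity. That such points accumulate everywhere in \<Omega> is unique continuation: w vanishes
  on no ball unless f is zero.\<close>

lemma potential_formula:
 assumes u: "robin_solution s \<Omega> \<theta> q f u" and f: "L2_on (- \<Omega>) f"
 shows "potential_formula s \<Omega> q f u"
proof -
 obtain w where w: "robin_solution s \<Omega> \<theta> q f w" "w \<in> borel_measurable borel" "AE x in lebesgue. w x = u x"
  "pointwise_solution s \<Omega> w (source w)"
  by (rule continuous_solution[OF u])
 interpret p: pointwise_solution s \<Omega> w "source w" by (rule w(4))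
 have lap: "has_frac_laplacian s w x (- (q x * w x))" if x: "x \<in> \<Omega>" for x
 proof -
  have "frac_const DIM('a) s * (source w x / 2) = - (q x * w x)"
   using frac_const_pos[OF s0 s1, of "DIM('a)"] x by (simp add: source_def pot_def)
  then show ?thesis using p.has_frac_laplacian[OF x] by simp
 qed
 have formula: "q x = - frac_laplacian s w x / w x" if "x \<in> \<Omega>" "w x \<noteq> 0" for x
  using frac_laplacian_eq[OF lap[OF that(1)]] that(2) by simp
 let ?S = "{y \<in> \<Omega>. w y \<noteq> 0}"
 have "x islimpt ?S" if nz: "\<not> (AE x in lebesgue. x \<in> - \<Omega> \<longrightarrow> f x = 0)" and x: "x \<in> \<Omega>" for x
  unfolding islimpt_approachable
 proof (intro allI impI)
  fix e :: real assume e: "0 < e"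
  obtain r where r: "0 < r" "ball x r \<subseteq> \<Omega>" using open_dom x by (auto simp: open_contains_ball)
  \<comment> \<open>A ball of radius \<rho> around a point at distance 2 \<rho> from x: within e of
    x, inside \<Omega>, and not containing x, as a limit point demands.\<close>
  define \<rho> where "\<rho> = min e r / 4"
  have \<rho>: "0 < \<rho>" "4 * \<rho> \<le> e" "4 * \<rho> \<le> r" using e r by (auto simp: \<rho>_def)
  obtain b :: 'a where b: "b \<in> Basis" using nonempty_Basis by blast
  define z where "z = x + (2 * \<rho>) *\<^sub>R b"
  have dz: "dist x z = 2 * \<rho>" using b \<rho> by (simp add: z_def dist_norm)
  have near: "dist x y < 3 * \<rho>" "y \<noteq> x" if "y \<in> ball z \<rho>" for y
   using that dz dist_triangle[of x y z] \<rho>(1) by (auto simp: dist_commute)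
  have sub: "ball z \<rho> \<subseteq> \<Omega>"
  proof
   fix y assume "y \<in> ball z \<rho>"
   then have "y \<in> ball x r" using near(1)[of y] \<rho> by simp
   then show "y \<in> \<Omega>" using r(2) by blast
  qed
  obtain y where y: "y \<in> ball z \<rho>" "w y \<noteq> 0"
   using zero_data_if_zero_on_ball[OF w(1,2) \<rho>(1) sub _ f] nz by blast
  then have "y \<in> ?S" "y \<noteq> x" "dist y x < e" using near[OF y(1)] sub \<rho> by (auto simp: dist_commute)
  then show "\<exists>x'\<in>?S. x' \<noteq> x \<and> dist x' x < e" by blast
 qed
 moreover have "((\<lambda>y. - frac_laplacian s w y / w y) \<longlongrightarrow> q x) (at x within ?S)" if x: "x \<in> \<Omega>" for x
 proof (rule Lim_transform_eventually)
  have "(q \<longlongrightarrow> q x) (at x within \<Omega>)" using q_cont_dom x by (simp add: continuous_on_def)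
  then show "(q \<longlongrightarrow> q x) (at x within ?S)" by (rule tendsto_within_subset) auto
  show "eventually (\<lambda>y. q y = - frac_laplacian s w y / w y) (at x within ?S)"
   unfolding eventually_at_filter by (intro always_eventually) (use formula in blast)
 qed
 ultimately show ?thesis
  unfolding potential_formula_def using p.w_cont w(3) lap formula by (intro exI[of _ w]) blast
qed

end

text \<open>The two potentials may differ. Test functions vanishing in \<Omega> do not see them, and
  equal exterior values cancel the weight terms, so the difference of the solutions satisfies the
  homogeneous exterior equation.\<close>

lemma robin_interior_determined:
 fixes \<Omega> :: "'a::euclidean_space set"
 assumes "robin_problem s \<Omega> \<theta> q1 q01" "robin_problem s \<Omega> \<theta> q2 q02"
  and u1: "robin_solution s \<Omega> \<theta> q1 f u1" and u2: "robin_solution s \<Omega> \<theta> q2 f u2"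
  and ext: "AE x in lebesgue. x \<in> - \<Omega> \<longrightarrow> u1 x = u2 x"
 shows "AE x in lebesgue. u1 x = u2 x"
proof -
 interpret p1: robin_problem s \<Omega> \<theta> q1 q01 by fact
 interpret p2: robin_problem s \<Omega> \<theta> q2 q02 by fact
 let ?d = "\<lambda>x. u1 x - u2 x"
 have W: "u1 \<in> p1.W" "u2 \<in> p1.W" using u1 u2 p1.robin_solution_iff p2.robin_solution_iff by blast+
 have dW: "?d \<in> p1.W" by (rule p1.W_diff[OF W])
 note m = p1.W_measurable[OF W(1)] p1.W_measurable[OF W(2)]
 obtain D where D [measurable]: "D \<in> borel_measurable borel" and Dd: "AE x in lebesgue. D x = ?d x"
  by (rule borel_representative[OF p1.W_measurable[OF dW]])
 \<comment> \<open>The difference made Borel and exactly zero in the exterior, as the unique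
   continuation statement asks for values and not classes.\<close>
 define E where "E x = D x * indicator \<Omega> x" for x
 have Em: "E \<in> borel_measurable borel" unfolding E_def by measurable
 have El: "E \<in> borel_measurable lebesgue" by (rule measurable_completion) (use Em in simp)
 have Ed: "AE x in lebesgue. E x = ?d x"
  using Dd ext by eventually_elim (auto simp: E_def indicator_def)
 have EW: "E \<in> p1.W" by (rule p1.W_cong[OF dW El Ed])
 have "AE x in lborel. E x = 0"
 proof (rule p1.exterior_unique_continuation[OF EW Em])
  show "E x = 0" if "x \<in> - \<Omega>" for x using that by (simp add: E_def)
  fix v assume v: "v \<in> p1.W" "\<And>x. x \<in> \<Omega> \<Longrightarrow> v x = 0"
  note [measurable] = m p1.W_measurable[OF v(1)]
  have "(\<integral>z. p1.form E v z \<partial>(lebesgue \<Otimes>\<^sub>M lebesgue)) = (\<integral>z. p1.form ?d v z \<partial>(lebesgue \<Otimes>\<^sub>M lebesgue))"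
  proof (rule integral_cong_AE)
   show "AE z in lebesgue \<Otimes>\<^sub>M lebesgue. p1.form E v z = p1.form ?d v z"
    using AE_lebesgue_pair[OF Ed] by eventually_elim (simp add: p1.form_def)
  qed (rule p1.form_measurable; use El in measurable)+
  also have "\<dots> = (\<integral>z. p1.form u1 v z \<partial>(lebesgue \<Otimes>\<^sub>M lebesgue)) - (\<integral>z. p1.form u2 v z \<partial>(lebesgue \<Otimes>\<^sub>M lebesgue))"
   unfolding Bochner_Integration.integral_diff[OF p1.W_integrable(1)[OF W(1) v(1)] p1.W_integrable(1)[OF W(2) v(1)], symmetric]
   by (rule Bochner_Integration.integral_cong) (simp_all add: p1.form_def algebra_simps)
  also have "\<dots> = 0"
  proof -
   have "(\<integral>x. u1 x * v x * p1.ext_weight x \<partial>lebesgue) = (\<integral>x. u2 x * v x * p1.ext_weight x \<partial>lebesgue)"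
   proof (rule integral_cong_AE)
    show "AE x in lebesgue. u1 x * v x * p1.ext_weight x = u2 x * v x * p1.ext_weight x"
     using ext by eventually_elim (auto simp: p1.ext_weight_def indicator_def)
   qed measurable
   then have "(frac_const DIM('a) s / 2) * (\<integral>z. p1.form u1 v z \<partial>(lebesgue \<Otimes>\<^sub>M lebesgue))
    = (frac_const DIM('a) s / 2) * (\<integral>z. p1.form u2 v z \<partial>(lebesgue \<Otimes>\<^sub>M lebesgue))"
    using p1.exterior_test[OF u1 v] p2.exterior_test[OF u2 v] by linarith
   then show ?thesis using p1.fc_pos by simp
  qed
  finally show "(\<integral>z. p1.form E v z \<partial>(lebesgue \<Otimes>\<^sub>M lebesgue)) = 0" .
 qed
 then have "AE x in lebesgue. E x = 0" by (rule AE_completion)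
 with Ed show ?thesis by eventually_elim simp
qed

theorem theorem3p18:
  fixes \<Omega> :: "'a::euclidean_space set" and s :: real and \<theta> \<theta>' :: "'a \<Rightarrow> real"
  assumes s: "0 < s" "s < 1"
    and \<Omega>: "\<Omega> \<noteq> {}" "open \<Omega>" "bounded \<Omega>" "lipschitz_boundary \<Omega>"
    and \<theta>: "\<theta> \<in> Lambda1 \<Omega>" "\<theta>' \<in> Lambda1 \<Omega>"
    and diff_Linfty: "Linfty_on (- \<Omega>) (\<lambda>x. \<theta> x - \<theta>' x)"
    and diff_nonzero: "AE x in lebesgue. x \<in> - \<Omega> \<longrightarrow> \<theta> x - \<theta>' x \<noteq> 0"
  shows "\<exists>reconstruct :: ('a \<Rightarrow> real) \<Rightarrow> ('a \<Rightarrow> real) \<Rightarrow> ('a \<Rightarrow> real).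
    \<forall>q q0 f u Rf.
      continuous_on (closure \<Omega>) q \<and> 0 < q0 \<and> (\<forall>x\<in>\<Omega>. q0 \<le> q x) \<and>
      L2_on (- \<Omega>) f \<and> robin_solution s \<Omega> \<theta> q f u \<and>
      (AE x in lebesgue. x \<in> - \<Omega> \<longrightarrow> Rf x = robin_to_robin s \<Omega> \<theta> \<theta>' q f x) \<and>
      (s < 1 / 2 \<or> (1 / 2 \<le> s \<and> regular_data s \<Omega> \<theta> \<theta>' f Rf))
      \<longrightarrow> (AE x in lebesgue. x \<in> \<Omega> \<longrightarrow> u x = reconstruct f Rf x) \<and>
          potential_formula s \<Omega> q f u"
proof -
 \<comment> \<open>The potential is existentially quantified, so a function chosen from this
   relation depends on the pair (f, Rf) alone.\<close>
 define data_of where "data_of f Rf u \<longleftrightarrow> (\<exists>q q0. robin_problem s \<Omega> \<theta> q q0 \<and> robin_solution s \<Omega> \<theta> q f u \<and>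
  (AE x in lebesgue. x \<in> - \<Omega> \<longrightarrow> Rf x = robin_to_robin s \<Omega> \<theta> \<theta>' q f x))" for f Rf u :: "'a \<Rightarrow> real"
 have trace: "AE x in lebesgue. x \<in> - \<Omega> \<longrightarrow> Rf x = f x + (\<theta>' x - \<theta> x) * u x"
  if "robin_problem s \<Omega> \<theta> q q0" and u: "robin_solution s \<Omega> \<theta> q f u"
   and R: "AE x in lebesgue. x \<in> - \<Omega> \<longrightarrow> Rf x = robin_to_robin s \<Omega> \<theta> \<theta>' q f x" for q q0 f u Rf
 proof -
  interpret robin_problem s \<Omega> \<theta> q q0 by fact
  \<comment> \<open>The solution chosen inside \<open>robin_to_robin\<close> agrees with u almost
    everywhere by uniqueness, so the data really contain the exterior trace of u.\<close>
  have "robin_solution s \<Omega> \<theta> q f (SOME u. robin_solution s \<Omega> \<theta> q f u)" using u by (rule someI[of "robin_solution s \<Omega> \<theta> q f"])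
  from robin_solution_unique[OF u this] R show ?thesis
   by eventually_elim (simp add: robin_to_robin_def)
 qed
 have unique: "AE x in lebesgue. u1 x = u2 x" if a1: "data_of f Rf u1" and a2: "data_of f Rf u2" for f Rf u1 u2
 proof -
  obtain q1 q01 where 1: "robin_problem s \<Omega> \<theta> q1 q01" "robin_solution s \<Omega> \<theta> q1 f u1"
   "AE x in lebesgue. x \<in> - \<Omega> \<longrightarrow> Rf x = robin_to_robin s \<Omega> \<theta> \<theta>' q1 f x" using a1 by (auto simp: data_of_def)
  obtain q2 q02 where 2: "robin_problem s \<Omega> \<theta> q2 q02" "robin_solution s \<Omega> \<theta> q2 f u2"
   "AE x in lebesgue. x \<in> - \<Omega> \<longrightarrow> Rf x = robin_to_robin s \<Omega> \<theta> \<theta>' q2 f x" using a2 by (auto simp: data_of_def)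
  \<comment> \<open>Both traces satisfy Rf = f + (\<theta>' - \<theta>) u, and the factor \<theta>'
    - \<theta> can be cancelled almost everywhere.\<close>
  have "AE x in lebesgue. x \<in> - \<Omega> \<longrightarrow> u1 x = u2 x"
   using trace[OF 1] trace[OF 2] diff_nonzero by eventually_elim auto
  then show ?thesis by (rule robin_interior_determined[OF 1(1) 2(1) 1(2) 2(2)])
 qed
 show ?thesis
 \<comment> \<open>Any function compatible with the data will do, since two of them agree almost
   everywhere.\<close>
 proof (intro exI[of _ "\<lambda>f Rf. SOME u. data_of f Rf u"] allI impI)
  fix q q0 f u Rf
  assume a: "continuous_on (closure \<Omega>) q \<and> 0 < q0 \<and> (\<forall>x\<in>\<Omega>. q0 \<le> q x) \<and>
   L2_on (- \<Omega>) f \<and> robin_solution s \<Omega> \<theta> q f u \<and>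
   (AE x in lebesgue. x \<in> - \<Omega> \<longrightarrow> Rf x = robin_to_robin s \<Omega> \<theta> \<theta>' q f x) \<and>
   (s < 1 / 2 \<or> (1 / 2 \<le> s \<and> regular_data s \<Omega> \<theta> \<theta>' f Rf))"
  interpret robin_problem s \<Omega> \<theta> q q0 by unfold_locales (use a s \<Omega> \<theta> in auto)
  have adm: "data_of f Rf u" unfolding data_of_def using a robin_problem_axioms by blast
  have "AE x in lebesgue. u x = (SOME u. data_of f Rf u) x" by (rule unique[OF adm someI[of "data_of f Rf", OF adm]])
  then have "AE x in lebesgue. x \<in> \<Omega> \<longrightarrow> u x = (SOME u. data_of f Rf u) x" by eventually_elim simp
  then show "(AE x in lebesgue. x \<in> \<Omega> \<longrightarrow> u x = (SOME u. data_of f Rf u) x) \<and> potential_formula s \<Omega> q f u"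
   using potential_formula a by blast
 qed
qed

end
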